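(* Let $\mathcal M_\infty$ and $\mathcal F_\infty$ be as in the context. Then there exists $\hat\mu\in\mathcal M_\infty$ such that $$\mathcal F_\infty(\hat\mu)=\inf_{\mu\in\mathcal M_\infty}\mathcal F_\infty(\mu).$$ Moreover, every minimizer $\hat\mu$ satisfies the following properties: there exist a constant $C>0$ and a $(\pi_2)_\sharp\hat\mu$-measurable map $k\mapsto g_k$ with $g_k\in BV(0,1)$ for $(\pi_2)_\sharp\hat\mu$-a.e. $k\in\mathbb R$, such that $\big((\pi_2)_\sharp\hat\mu,(g_k)_{k\in\mathbb R}\big)$ is a disintegration of $\hat\mu$ in the $k$-variable, $$\int_0^1k^2g_k(x)\,dx=\int_0^1\frac1{4k^2}\Big(\frac{d\hat\mu_{,x}}{d\hat\mu}(x,k)\Big)^2g_k(x)\,dx\quad\text{for }(\pi_2)_\sharp\hat\mu\text{-a.e. }k\in\mathbb R,$$ and $$(\pi_2)_\sharp\hat\mu\big(\{|k|<C\}\big)=0.$$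
   Context: $\mathcal M_b(A)$ (resp. $\mathcal M_b^+(A)$) denotes the bounded (resp. positive bounded) Radon measures on $A$; for a measure $\mu$ on a product set with points $(x,k)$, $\mu_{,x}$ is its distributional derivative in $x$, $\langle\mu_{,x},\varphi\rangle=-\int\varphi_{,x}\,d\mu$ for $\varphi\in C_c^\infty$. $\mathcal M_\infty$ is the set of $\mu\in\mathcal M_b^+((-1,1)\times\mathbb R)$ such that $\mu((-1,0]\times\mathbb R)=0$, $\mu_{,x}\in\mathcal M_b((-1,1)\times\mathbb R)$, $\mu_{,x}\ll\mu$, and $\int_{(0,1)\times\mathbb R}\phi(x)\,d\mu(x,k)=\int_0^12x\phi(x)\,dx$ for all $\phi\in C_c^\infty(0,1)$. Elements of $\mathcal M_\infty$ are identified with their restrictions to $(0,1)\times\mathbb R$. The functional $\mathcal F_\infty:\mathcal M_\infty\to[0,+\infty]$ is $$\mathcal F_\infty(\mu)=\int_{(0,1)\times\mathbb R}\Big[k^2+\frac1{4k^2}\Big(\frac{d\mu_{,x}}{d\mu}\Big)^2\Big]d\mu,$$ where $\frac{d\mu_{,x}}{d\mu}$ is the Radon–Nikodym derivative; at $k=0$ the second term is read as $+\infty$ if $\frac{d\mu_{,x}}{d\mu}\neq0$ and $0$ if $\frac{d\mu_{,x}}{d\mu}=0$. $\pi_2:(0,1)\times\mathbb R\to\mathbb R$ is the projection $(x,k)\mapsto k$ and $(\pi_2)_\sharp\mu$ is the push-forward of $\mu$. Disintegration in the $k$-variable: for $\mu\in\mathcal M_b((0,1)\times\mathbb R)$, a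 pair $(\lambda,(g_k)_{k\in\mathbb R})$ with $\lambda\in\mathcal M_b(\mathbb R)$ and $g_k:(0,1)\to\mathbb R$ Lebesgue measurable for every $k$ is a disintegration of $\mu$ in the $k$-variable if $k\mapsto g_k$ is $\lambda$-measurable, $\int_0^1g_k\,dx=1$ for $\lambda$-a.e. $k\in\mathbb R$, and $$\int_{(0,1)\times\mathbb R}f(x,k)\,d\mu=\int_{\mathbb R}\int_0^1f(x,k)g_k(x)\,dx\,d\lambda(k)\quad\text{for every }f\in L^1((0,1)\times\mathbb R;|\mu|).$$ *)

theory Defs
  imports "HOL-Analysis.Analysis"
begin

subsection \<open>Test functions\<close>

primrec C_k :: "nat \<Rightarrow> ('a::real_normed_vector \<Rightarrow> real) \<Rightarrow> bool" where
  "C_k 0 f \<longleftrightarrow> continuous_on UNIV f"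
| "C_k (Suc n) f \<longleftrightarrow>
     (\<forall>x. f differentiable (at x)) \<and> (\<forall>v. C_k n (\<lambda>x. frechet_derivative f (at x) v))"

(* Elements of C_c^infinity(U), U open, are represented by their extension by zero. *)
definition test_fun :: "'a::real_normed_vector set \<Rightarrow> ('a \<Rightarrow> real) set" where
  "test_fun U =
     {\<phi>. (\<forall>n. C_k n \<phi>) \<and> compact (closure {x. \<phi> x \<noteq> 0}) \<and> closure {x. \<phi> x \<noteq> 0} \<subseteq> U}"

subsection \<open>Bounded signed measures\<close>

(* The measure M only provides the measurable space. A bounded signed measure is a real-valued
   countably additive set function; on an open subset of Euclidean space with its Borel sigma
   algebra these are exactly the bounded Radon measures. Values off the sets of M are irrelevant. *)
definition signed_measure_on :: "'a measure \<Rightarrow> ('a set \<Rightarrow> real) \<Rightarrow> bool" where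
  "signed_measure_on M \<nu> \<longleftrightarrow> \<nu> {} = 0 \<and>
     (\<forall>A. range A \<subseteq> sets M \<longrightarrow> disjoint_family A \<longrightarrow>
        (\<lambda>i::nat. \<nu> (A i)) sums \<nu> (\<Union>i. A i))"

(* Jordan decomposition; ennreal truncates negative values to 0, and B = {} is admissible. *)
definition pos_variation :: "'a measure \<Rightarrow> ('a set \<Rightarrow> real) \<Rightarrow> 'a measure" where
  "pos_variation M \<nu> =
     measure_of (space M) (sets M) (\<lambda>A. SUP B\<in>{B \<in> sets M. B \<subseteq> A}. ennreal (\<nu> B))"

definition neg_variation :: "'a measure \<Rightarrow> ('a set \<Rightarrow> real) \<Rightarrow> 'a measure" where
  "neg_variation M \<nu> = pos_variation M (\<lambda>A. - \<nu> A)"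

definition signed_integral :: "'a measure \<Rightarrow> ('a set \<Rightarrow> real) \<Rightarrow> ('a \<Rightarrow> real) \<Rightarrow> real" where
  "signed_integral M \<nu> f =
     (LINT x|pos_variation M \<nu>. f x) - (LINT x|neg_variation M \<nu>. f x)"

definition signed_abs_cont :: "'a measure \<Rightarrow> ('a set \<Rightarrow> real) \<Rightarrow> bool" where
  "signed_abs_cont M \<nu> \<longleftrightarrow> (\<forall>A\<in>null_sets M. \<nu> A = 0)"

definition signed_RN_deriv :: "'a measure \<Rightarrow> ('a set \<Rightarrow> real) \<Rightarrow> 'a \<Rightarrow> real" where
  "signed_RN_deriv M \<nu> x =
     enn2real (RN_deriv M (pos_variation M \<nu>) x) - enn2real (RN_deriv M (neg_variation M \<nu>) x)"

subsection \<open>The admissible class and the functional\<close>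

definition strip :: "(real \<times> real) set" where
  "strip = {-1<..<1} \<times> UNIV"

definition half_strip :: "(real \<times> real) set" where
  "half_strip = {0<..<1} \<times> UNIV"

definition is_x_derivative :: "(real \<times> real) measure \<Rightarrow> ((real \<times> real) set \<Rightarrow> real) \<Rightarrow> bool" where
  "is_x_derivative \<mu> \<nu> \<longleftrightarrow> signed_measure_on \<mu> \<nu> \<and>
     (\<forall>\<phi>\<in>test_fun strip.
        signed_integral \<mu> \<nu> \<phi> = - (LINT (x, k)|\<mu>. deriv (\<lambda>t. \<phi> (t, k)) x))"

(* Unique on the measurable sets whenever it exists. *)
definition x_derivative :: "(real \<times> real) measure \<Rightarrow> (real \<times> real) set \<Rightarrow> real" where
  "x_derivative \<mu> = (SOME \<nu>. is_x_derivative \<mu> \<nu>)"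

definition M_infty :: "(real \<times> real) measure set" where
  "M_infty = {\<mu>. space \<mu> = strip \<and> sets \<mu> = sets (restrict_space borel strip) \<and>
     finite_measure \<mu> \<and>
     emeasure \<mu> ({-1<..0} \<times> UNIV) = 0 \<and>
     (\<exists>\<nu>. is_x_derivative \<mu> \<nu>) \<and>
     signed_abs_cont \<mu> (x_derivative \<mu>) \<and>
     (\<forall>\<phi>\<in>test_fun {0<..<1::real}.
        (LINT p:half_strip|\<mu>. \<phi> (fst p)) = (LINT x:{0<..<1}|lebesgue. 2 * x * \<phi> x))}"

definition dx_density :: "(real \<times> real) measure \<Rightarrow> real \<times> real \<Rightarrow> real" where
  "dx_density \<mu> = signed_RN_deriv \<mu> (x_derivative \<mu>)"

definition slope_energy :: "real \<Rightarrow> real \<Rightarrow> ennreal" where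
  "slope_energy k h =
     (if k = 0 then (if h = 0 then 0 else \<infinity>) else ennreal (1 / (4 * k\<^sup>2) * h\<^sup>2))"

definition F_infty :: "(real \<times> real) measure \<Rightarrow> ennreal" where
  "F_infty \<mu> =
     (\<integral>\<^sup>+p\<in>half_strip. (ennreal ((snd p)\<^sup>2) + slope_energy (snd p) (dx_density \<mu> p)) \<partial>\<mu>)"

definition is_minimizer :: "(real \<times> real) measure \<Rightarrow> bool" where
  "is_minimizer \<mu> \<longleftrightarrow> \<mu> \<in> M_infty \<and> F_infty \<mu> = (INF \<nu>\<in>M_infty. F_infty \<nu>)"

subsection \<open>Disintegration in the second variable\<close>

definition restr :: "(real \<times> real) measure \<Rightarrow> (real \<times> real) measure" where
  "restr \<mu> = restrict_space \<mu> half_strip"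

definition k_marginal :: "(real \<times> real) measure \<Rightarrow> real measure" where
  "k_marginal \<mu> = distr (restr \<mu>) borel snd"

(* Measurability of k |-> g k is understood as for the measure-valued map k |-> g k dx:
   for every Borel set B, the mass of B is measurable for the completed sigma-algebra. *)
definition measurable_family :: "real measure \<Rightarrow> (real \<Rightarrow> real \<Rightarrow> real) \<Rightarrow> bool" where
  "measurable_family \<rho> g \<longleftrightarrow>
     (\<forall>B\<in>sets borel. B \<subseteq> {0<..<1} \<longrightarrow>
        (\<lambda>k. LINT x:B|lebesgue. g k x) \<in> borel_measurable (completion \<rho>))"

(* Here \<mu> is a positive bounded measure on half_strip, so that the variation of \<mu> is \<mu> itself.
   L^1 functions need only be measurable for the completion of \<mu>, and the existence of the
   iterated integral is part of the identity. *)
definition is_disintegration ::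
    "(real \<times> real) measure \<Rightarrow> real measure \<Rightarrow> (real \<Rightarrow> real \<Rightarrow> real) \<Rightarrow> bool" where
  "is_disintegration \<mu> \<rho> g \<longleftrightarrow>
     sets \<rho> = sets borel \<and> finite_measure \<rho> \<and>
     (\<forall>k. g k \<in> borel_measurable (lebesgue_on {0<..<1})) \<and>
     measurable_family \<rho> g \<and>
     (AE k in \<rho>. set_integrable lebesgue {0<..<1} (g k) \<and> (LINT x:{0<..<1}|lebesgue. g k x) = 1) \<and>
     (\<forall>f. integrable (completion \<mu>) f \<longrightarrow>
        (AE k in \<rho>. set_integrable lebesgue {0<..<1} (\<lambda>x. f (x, k) * g k x)) \<and>
        integrable (completion \<rho>) (\<lambda>k. LINT x:{0<..<1}|lebesgue. f (x, k) * g k x) \<and>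
        (LINT p|completion \<mu>. f p) =
          (LINT k|completion \<rho>. (LINT x:{0<..<1}|lebesgue. f (x, k) * g k x)))"

subsection \<open>Functions of bounded variation on the unit interval\<close>

definition BV01 :: "(real \<Rightarrow> real) set" where
  "BV01 = {u. set_integrable lebesgue {0<..<1} u \<and>
     (\<exists>\<nu>. signed_measure_on (restrict_space borel {0<..<1}) \<nu> \<and>
        (\<forall>\<phi>\<in>test_fun {0<..<1}. signed_integral (restrict_space borel {0<..<1}) \<nu> \<phi> =
           - (LINT x:{0<..<1}|lebesgue. u x * deriv \<phi> x)))}"

end

theory Submission
  imports Defs "HOL-Probability.Probability"
begin

text \<open>
  On the fibre of a fixed wave number k, an admissible measure \<mu> solves the equation \<mu>_{,x} = a \<mu> and
  vanishes for x \<le> 0. Hence it has an absolutely continuous density g on (0,1) that starts at 0 and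
  has the slope h = a g, and the functional becomes the integral over the wave numbers of

    \<integral>_0^1 k^2 g + h^2 / (4 k^2 g) dx.

  To make this rigorous one tests the equation with the ramps (t - x)^+ on {k < d}; the result is a formula for the mass of
  an arbitrary Borel set (sheet_mass_formula), from which the densities are read off (sheet_disintegration).
  Conversely, a random family of such profiles, with a wave number attached to each, can be superposed to an
  admissible measure (profile_family_imp_sheet). The integrand is convex and homogeneous of degree one in
  (g,h), so superposition does not increase the energy. Thus one may minimize over families of profiles. There the profiles
  and the wave numbers can be varied independently, and the only constraint, that the profiles add up to
  2x, is linear.

  Existence follows by the direct method. An explicit self-similar family has energy at most 120. Homogeneity
  allows to rescale the fibres of a minimizing sequence so that their slopes are bounded in a weighted L^2
  space while the laws of the wave numbers remain tight (normalized_profile_family). By Skorohod's theorem one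
  may assume that the wave numbers converge pointwise. Convex combinations of the slopes then converge almost
  everywhere (convex_combinations_converge), and because the integrand is convex in (g,h) and the wave numbers
  converge, the limit has no more energy (profile_family_limit).

  For a minimizer, change the wave numbers and keep the profiles. If k^2 and b are the two parts of the energy of
  a fibre, the optimal wave number has energy 2 |k| sqrt b, which is k^2 + b - (|k| - sqrt b)^2. Minimality forces
  b = k^2 on almost every fibre, which is the equipartition of the energy (optimal_family_equipartition). A profile of unit
  mass whose fibre energy is 2 k^2 is bounded by (8 k^4 + 1) / 2, and this must be at least 1; therefore
  |k| \<ge> 1/2 for almost every wave number. The profiles are primitives of integrable functions, hence of bounded variation.
\<close>

section \<open>Bounded signed measures\<close>

lemma signed_measure_on_empty: "signed_measure_on M \<nu> \<Longrightarrow> \<nu> {} = 0"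
  by (simp add: signed_measure_on_def)

lemma signed_measure_on_sums:
  "signed_measure_on M \<nu> \<Longrightarrow> range A \<subseteq> sets M \<Longrightarrow> disjoint_family A \<Longrightarrow>
    (\<lambda>i::nat. \<nu> (A i)) sums \<nu> (\<Union>i. A i)"
  by (simp add: signed_measure_on_def)

lemma signed_measure_on_Un:
  assumes \<nu>: "signed_measure_on M \<nu>" and A: "A \<in> sets M" and B: "B \<in> sets M" and disj: "A \<inter> B = {}"
  shows "\<nu> (A \<union> B) = \<nu> A + \<nu> B"
proof -
  have "(\<lambda>i. \<nu> (binaryset A B i)) sums \<nu> (\<Union>i. binaryset A B i)"
    by (rule signed_measure_on_sums[OF \<nu>])
       (use A B disj in \<open>auto simp: disjoint_family_on_def binaryset_def\<close>)
  moreover have "(\<lambda>i. \<nu> (binaryset A B i)) sums (\<nu> A + \<nu> B)"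
    by (rule binaryset_sums[of \<nu>, OF signed_measure_on_empty[OF \<nu>]])
  ultimately show ?thesis
    by (simp add: UN_binaryset_eq sums_unique2)
qed

lemma signed_measure_on_Diff:
  assumes \<nu>: "signed_measure_on M \<nu>" and A: "A \<in> sets M" and B: "B \<in> sets M" and sub: "B \<subseteq> A"
  shows "\<nu> (A - B) = \<nu> A - \<nu> B"
proof -
  have "\<nu> (B \<union> (A - B)) = \<nu> B + \<nu> (A - B)"
    using A B by (intro signed_measure_on_Un[OF \<nu>]) auto
  moreover have "B \<union> (A - B) = A" using sub by auto
  ultimately show ?thesis by simp
qed

lemma signed_measure_on_uminus:
  "signed_measure_on M \<nu> \<Longrightarrow> signed_measure_on M (\<lambda>A. - \<nu> A)"
  by (auto simp: signed_measure_on_def intro: sums_minus)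

text \<open>
  If \<nu> is unbounded on the subsets of A, choose B \<subseteq> A with |\<nu> B| > |\<nu> A| + 1; then both |\<nu> B|
  and |\<nu> (A - B)| exceed 1, and \<nu> is still unbounded on the subsets of B or of A - B. Iterating on that
  part splits off disjoint sets whose measures exceed 1 in absolute value, and the series of their measures
  cannot converge.
\<close>

lemma signed_measure_on_bounded:
  assumes \<nu>: "signed_measure_on M \<nu>"
  shows "\<exists>K. \<forall>A\<in>sets M. \<bar>\<nu> A\<bar> \<le> K"
proof (rule ccontr)
  assume contra: "\<not> ?thesis"
  define unb where "unb A \<longleftrightarrow> A \<in> sets M \<and> (\<forall>K. \<exists>B\<in>sets M. B \<subseteq> A \<and> \<bar>\<nu> B\<bar> > K)" for A
  have step: "\<exists>B. B \<in> sets M \<and> B \<subseteq> A \<and> \<bar>\<nu> B\<bar> > 1 \<and> unb (A - B)" if "unb A" for A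
  proof -
    have A: "A \<in> sets M" using that by (simp add: unb_def)
    obtain B where B: "B \<in> sets M" "B \<subseteq> A" "\<bar>\<nu> B\<bar> > \<bar>\<nu> A\<bar> + 1"
      using \<open>unb A\<close> unfolding unb_def by metis
    have AB: "A - B \<in> sets M" using A B by auto
    have "\<bar>\<nu> (A - B)\<bar> > 1"
      using signed_measure_on_Diff[OF \<nu> A B(1,2)] B(3) by linarith
    moreover have "unb B \<or> unb (A - B)"
    proof (rule ccontr)
      assume "\<not> (unb B \<or> unb (A - B))"
      then have nb: "\<not> unb B" "\<not> unb (A - B)" by auto
      obtain K1 where K1: "\<And>C. C \<in> sets M \<Longrightarrow> C \<subseteq> B \<Longrightarrow> \<bar>\<nu> C\<bar> \<le> K1"
        using nb(1) B(1) unfolding unb_def by (metis not_less)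
      obtain K2 where K2: "\<And>C. C \<in> sets M \<Longrightarrow> C \<subseteq> A - B \<Longrightarrow> \<bar>\<nu> C\<bar> \<le> K2"
        using nb(2) AB unfolding unb_def by (metis not_less)
      obtain C where C: "C \<in> sets M" "C \<subseteq> A" "\<bar>\<nu> C\<bar> > K1 + K2"
        using \<open>unb A\<close> unfolding unb_def by metis
      have "\<nu> ((C \<inter> B) \<union> (C - B)) = \<nu> (C \<inter> B) + \<nu> (C - B)"
        using C B by (intro signed_measure_on_Un[OF \<nu>]) auto
      moreover have "(C \<inter> B) \<union> (C - B) = C" by auto
      moreover have "\<bar>\<nu> (C \<inter> B)\<bar> \<le> K1" using C B by (intro K1) auto
      moreover have "\<bar>\<nu> (C - B)\<bar> \<le> K2" using C B by (intro K2) auto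
      ultimately show False using C(3) by simp
    qed
    moreover have "A - (A - B) = B" using B by auto
    ultimately show ?thesis using A B AB
      by (smt (verit) Diff_subset)
  qed
  then obtain f where f: "\<And>A. unb A \<Longrightarrow> f A \<in> sets M \<and> f A \<subseteq> A \<and> \<bar>\<nu> (f A)\<bar> > 1 \<and> unb (A - f A)"
    by metis
  define S where "S n = ((\<lambda>A. A - f A) ^^ n) (space M)" for n
  have S0: "unb (space M)"
  proof -
    have "\<exists>B\<in>sets M. B \<subseteq> space M \<and> \<bar>\<nu> B\<bar> > K" for K
      using contra sets.sets_into_space by (metis not_le)
    then show ?thesis by (simp add: unb_def)
  qed
  have SS: "S (Suc n) = S n - f (S n)" for n by (simp add: S_def)
  have unbS: "unb (S n)" for n
  proof (induction n)
    case 0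
    then show ?case using S0 by (simp add: S_def)
  next
    case (Suc n)
    then show ?case using f by (simp add: SS)
  qed
  have antiS: "n \<le> m \<Longrightarrow> S m \<subseteq> S n" for n m
    by (induction m rule: dec_induct) (auto simp: SS)
  have disj: "f (S m) \<inter> f (S n) = {}" if "n < m" for n m
  proof -
    have "f (S m) \<subseteq> S m" using f unbS by blast
    also have "S m \<subseteq> S (Suc n)" using that by (intro antiS) auto
    finally show ?thesis by (auto simp: SS)
  qed
  have "(\<lambda>n. \<nu> (f (S n))) sums \<nu> (\<Union>n. f (S n))"
  proof (rule signed_measure_on_sums[OF \<nu>])
    show "range (\<lambda>n. f (S n)) \<subseteq> sets M" using f unbS by auto
    show "disjoint_family (\<lambda>n. f (S n))"
      unfolding disjoint_family_on_def using disj by (metis Int_commute linorder_neqE_nat)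
  qed
  then have "(\<lambda>n. \<nu> (f (S n))) \<longlonglongrightarrow> 0"
    using sums_summable summable_LIMSEQ_zero by blast
  then obtain n where "\<bar>\<nu> (f (S n))\<bar> < 1"
    using LIMSEQ_D[of "\<lambda>n. \<nu> (f (S n))" 0 1] by auto
  moreover have "\<bar>\<nu> (f (S n))\<bar> > 1" using f unbS by blast
  ultimately show False by simp
qed

lemma space_pos_variation [simp]: "space (pos_variation M \<nu>) = space M"
  and sets_pos_variation [simp, measurable_cong]: "sets (pos_variation M \<nu>) = sets M"
  by (auto simp: pos_variation_def sets.sigma_sets_eq sets.space_closed)

lemma space_neg_variation [simp]: "space (neg_variation M \<nu>) = space M"
  and sets_neg_variation [simp, measurable_cong]: "sets (neg_variation M \<nu>) = sets M"
  by (auto simp: neg_variation_def)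

lemma emeasure_pos_variation:
  assumes \<nu>: "signed_measure_on M \<nu>" and A: "A \<in> sets M"
  shows "emeasure (pos_variation M \<nu>) A = (SUP B\<in>{B \<in> sets M. B \<subseteq> A}. ennreal (\<nu> B))"
proof -
  define p where "p A = (SUP B\<in>{B \<in> sets M. B \<subseteq> A}. ennreal (\<nu> B))" for A
  have p_upper: "ennreal (\<nu> B) \<le> p A" if "B \<in> sets M" "B \<subseteq> A" for A B
    unfolding p_def using that by (intro SUP_upper) auto
  have p_mono: "p A \<le> p B" if "A \<subseteq> B" for A B
    unfolding p_def using that by (intro SUP_subset_mono) auto
  have p_empty: "p {} = 0"
    by (auto simp: p_def signed_measure_on_empty[OF \<nu>] bot_ennreal cong: SUP_cong_simp
        intro!: antisym SUP_least)
  have super: "p A + p B \<le> p (A \<union> B)" if A: "A \<in> sets M" and B: "B \<in> sets M" and AB: "A \<inter> B = {}" for A B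
  proof -
    have ne: "{B' \<in> sets M. B' \<subseteq> B} \<noteq> {}" "{A' \<in> sets M. A' \<subseteq> A} \<noteq> {}" by auto
    have 1: "ennreal (\<nu> C) + ennreal (\<nu> D) \<le> p (A \<union> B)"
      if "C \<in> sets M" "C \<subseteq> A" "D \<in> sets M" "D \<subseteq> B" for C D
    proof -
      have "\<nu> (C \<union> D) = \<nu> C + \<nu> D"
        using that AB by (intro signed_measure_on_Un[OF \<nu>]) auto
      moreover have "ennreal (\<nu> (C \<union> D)) \<le> p (A \<union> B)" "ennreal (\<nu> C) \<le> p (A \<union> B)"
        "ennreal (\<nu> D) \<le> p (A \<union> B)"
        using that by (auto intro!: p_upper)
      ultimately show ?thesis
        by (cases "\<nu> C \<ge> 0"; cases "\<nu> D \<ge> 0") (auto simp: ennreal_plus ennreal_neg)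
    qed
    have 2: "ennreal (\<nu> C) + p B \<le> p (A \<union> B)" if "C \<in> sets M" "C \<subseteq> A" for C
    proof -
      have "ennreal (\<nu> C) + p B = (SUP D\<in>{B' \<in> sets M. B' \<subseteq> B}. ennreal (\<nu> C) + ennreal (\<nu> D))"
        unfolding p_def using ne by (simp add: ennreal_SUP_add_right)
      also have "\<dots> \<le> p (A \<union> B)" using that 1 by (intro SUP_least) auto
      finally show ?thesis .
    qed
    have "p A + p B = (SUP C\<in>{A' \<in> sets M. A' \<subseteq> A}. ennreal (\<nu> C) + p B)"
      unfolding p_def[of A] using ne by (simp add: ennreal_SUP_add_left)
    also have "\<dots> \<le> p (A \<union> B)" using 2 by (intro SUP_least) auto
    finally show ?thesis .
  qed
  have ca: "countably_additive (sets M) p"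
    unfolding countably_additive_def
  proof (intro allI impI)
    fix A :: "nat \<Rightarrow> _" assume A: "range A \<subseteq> sets M" "disjoint_family A" "(\<Union>i. A i) \<in> sets M"
    have sums_le: "(\<Sum>i<n. p (A i)) \<le> p (\<Union>i<n. A i)" for n
    proof (induction n)
      case (Suc n)
      have "(\<Sum>i<Suc n. p (A i)) \<le> p (\<Union>i<n. A i) + p (A n)" using add_right_mono[OF Suc] by simp
      also have "\<dots> \<le> p ((\<Union>i<n. A i) \<union> A n)"
      proof (rule super)
        have "A i \<inter> A n = {}" if "i < n" for i
          using A(2) that by (intro disjoint_family_onD) auto
        then show "(\<Union>i<n. A i) \<inter> A n = {}" by blast
      qed (use A in auto)
      also have "(\<Union>i<n. A i) \<union> A n = (\<Union>i<Suc n. A i)" by (auto simp: lessThan_Suc)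
      finally show ?case .
    qed (simp add: p_empty)
    show "(\<Sum>i. p (A i)) = p (\<Union>i. A i)"
    proof (rule antisym)
      show "(\<Sum>i. p (A i)) \<le> p (\<Union>i. A i)"
        by (rule suminf_le_const[OF summableI]) (rule order.trans[OF sums_le p_mono], auto)
      show "p (\<Union>i. A i) \<le> (\<Sum>i. p (A i))"
        unfolding p_def[of "\<Union>i. A i"]
      proof (rule SUP_least)
        fix B assume B: "B \<in> {B \<in> sets M. B \<subseteq> (\<Union>i. A i)}"
        have "(\<lambda>i. \<nu> (B \<inter> A i)) sums \<nu> (\<Union>i. B \<inter> A i)"
          using A B by (intro signed_measure_on_sums[OF \<nu>]) (auto simp: disjoint_family_on_def)
        moreover have "(\<Union>i. B \<inter> A i) = B" using B by auto
        ultimately have lim: "(\<lambda>n. ennreal (\<Sum>i<n. \<nu> (B \<inter> A i))) \<longlonglongrightarrow> ennreal (\<nu> B)"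
          by (auto simp: sums_def intro!: tendsto_ennrealI)
        have "ennreal (\<Sum>i<n. \<nu> (B \<inter> A i)) \<le> (\<Sum>i. p (A i))" for n
        proof -
          have "ennreal (\<Sum>i<n. \<nu> (B \<inter> A i)) \<le> ennreal (\<Sum>i<n. max 0 (\<nu> (B \<inter> A i)))"
            by (intro ennreal_leI sum_mono) auto
          also have "\<dots> = (\<Sum>i<n. ennreal (\<nu> (B \<inter> A i)))"
          proof -
            have "ennreal (max 0 x) = ennreal x" for x by (simp add: max_def ennreal_neg)
            then show ?thesis by (simp add: sum_ennreal[symmetric] del: sum_ennreal)
          qed
          also have "\<dots> \<le> (\<Sum>i<n. p (A i))" using A B by (intro sum_mono p_upper) auto
          also have "\<dots> \<le> (\<Sum>i. p (A i))" by (intro sum_le_suminf) auto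
          finally show ?thesis .
        qed
        with lim show "ennreal (\<nu> B) \<le> (\<Sum>i. p (A i))" by (intro LIMSEQ_le_const2) auto
      qed
    qed
  qed
  have "emeasure (pos_variation M \<nu>) A = p A"
  proof (rule emeasure_measure_of)
    show "pos_variation M \<nu> = measure_of (space M) (sets M) p"
      by (simp add: pos_variation_def p_def[abs_def])
    show "countably_additive (sets (pos_variation M \<nu>)) p" using ca by simp
    show "positive (sets (pos_variation M \<nu>)) p" by (simp add: positive_def p_empty)
  qed (use A sets.space_closed in auto)
  then show ?thesis by (simp add: p_def)
qed

lemma finite_measure_pos_variation:
  assumes \<nu>: "signed_measure_on M \<nu>"
  shows "finite_measure (pos_variation M \<nu>)"
proof (rule finite_measureI)
  obtain K where "\<And>A. A \<in> sets M \<Longrightarrow> \<bar>\<nu> A\<bar> \<le> K" using signed_measure_on_bounded[OF \<nu>] by auto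
  then have "emeasure (pos_variation M \<nu>) (space M) \<le> ennreal K"
    by (subst emeasure_pos_variation[OF \<nu>]) (auto intro!: SUP_least ennreal_leI simp: abs_le_iff)
  then show "emeasure (pos_variation M \<nu>) (space (pos_variation M \<nu>)) \<noteq> \<infinity>"
    by (auto simp: top_unique)
qed

lemma finite_measure_neg_variation:
  assumes \<nu>: "signed_measure_on M \<nu>"
  shows "finite_measure (neg_variation M \<nu>)"
  unfolding neg_variation_def
  by (rule finite_measure_pos_variation[OF signed_measure_on_uminus[OF \<nu>]])

text \<open>
  Replacing B \<subseteq> A by A - B changes \<nu> B into \<nu> A - \<nu> B. So the supremum of \<nu> over the subsets of A is
  \<nu> A plus the supremum of -\<nu>, and boundedness allows to subtract.
\<close>

lemma signed_measure_Jordan: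
  assumes \<nu>: "signed_measure_on M \<nu>" and A: "A \<in> sets M"
  shows "\<nu> A = measure (pos_variation M \<nu>) A - measure (neg_variation M \<nu>) A"
proof -
  interpret P: finite_measure "pos_variation M \<nu>" by (rule finite_measure_pos_variation[OF \<nu>])
  interpret N: finite_measure "neg_variation M \<nu>" by (rule finite_measure_neg_variation[OF \<nu>])
  note em = emeasure_pos_variation[OF \<nu> A]
    emeasure_pos_variation[OF signed_measure_on_uminus[OF \<nu>] A, folded neg_variation_def]
  have up: "\<nu> B \<le> measure (pos_variation M \<nu>) A" "- \<nu> B \<le> measure (neg_variation M \<nu>) A"
    if "B \<in> sets M" "B \<subseteq> A" for B
  proof -
    have "ennreal (\<nu> B) \<le> emeasure (pos_variation M \<nu>) A"
      "ennreal (- \<nu> B) \<le> emeasure (neg_variation M \<nu>) A"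
      unfolding em using that by (auto intro!: SUP_upper)
    then show "\<nu> B \<le> measure (pos_variation M \<nu>) A" "- \<nu> B \<le> measure (neg_variation M \<nu>) A"
      by (auto simp: P.emeasure_eq_measure N.emeasure_eq_measure ennreal_le_iff)
  qed
  have "emeasure (pos_variation M \<nu>) A \<le> ennreal (\<nu> A + measure (neg_variation M \<nu>) A)"
    unfolding em(1)
  proof (rule SUP_least)
    fix B assume "B \<in> {B \<in> sets M. B \<subseteq> A}"
    then show "ennreal (\<nu> B) \<le> ennreal (\<nu> A + measure (neg_variation M \<nu>) A)"
      using up(2)[of "A - B"] A signed_measure_on_Diff[OF \<nu> A, of B] by (intro ennreal_leI) auto
  qed
  moreover have "emeasure (neg_variation M \<nu>) A \<le> ennreal (measure (pos_variation M \<nu>) A - \<nu> A)"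
    unfolding em(2)
  proof (rule SUP_least)
    fix B assume "B \<in> {B \<in> sets M. B \<subseteq> A}"
    then show "ennreal (- \<nu> B) \<le> ennreal (measure (pos_variation M \<nu>) A - \<nu> A)"
      using up(1)[of "A - B"] A signed_measure_on_Diff[OF \<nu> A, of B] by (intro ennreal_leI) auto
  qed
  moreover have "0 \<le> \<nu> A + measure (neg_variation M \<nu>) A" "0 \<le> measure (pos_variation M \<nu>) A - \<nu> A"
    using up[of A] A by auto
  ultimately show ?thesis
    by (simp add: P.emeasure_eq_measure N.emeasure_eq_measure ennreal_le_iff)
qed

lemma signed_measure_on_density:
  fixes a :: "'a \<Rightarrow> real"
  assumes a: "integrable M a" and \<nu>: "\<And>A. A \<in> sets M \<Longrightarrow> \<nu> A = (LINT x:A|M. a x)"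
  shows "signed_measure_on M \<nu>"
  unfolding signed_measure_on_def
proof (intro conjI allI impI)
  show "\<nu> {} = 0" by (simp add: \<nu> set_lebesgue_integral_def)
  fix A :: "nat \<Rightarrow> 'a set" assume A: "range A \<subseteq> sets M" "disjoint_family A"
  have int: "set_integrable M (\<Union>i. A i) a"
    using a A unfolding set_integrable_def by (intro integrable_mult_indicator) auto
  have "(\<lambda>i. LINT x:A i|M. a x) sums (LINT x:(\<Union>i. A i)|M. a x)"
    unfolding sums_def
  proof -
    have "(LINT x:(\<Union>i. A i)|M. a x) = (\<Sum>i. LINT x:A i|M. a x)"
      using A int by (intro lebesgue_integral_countable_add) (auto simp: disjoint_family_on_def)
    moreover have "summable (\<lambda>i. LINT x:A i|M. a x)"
    proof (rule summable_comparison_test')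
      let ?B = "\<lambda>i. LINT x:A i|M. \<bar>a x\<bar>"
      show "norm (LINT x:A i|M. a x) \<le> ?B i" if "i \<ge> 0" for i
        unfolding set_lebesgue_integral_def
        by (rule order.trans[OF integral_norm_bound]) (auto simp: abs_mult)
      show "summable ?B"
      proof (rule bounded_imp_summable)
        show "0 \<le> ?B i" for i by (auto simp: set_lebesgue_integral_def)
        fix n
        have ia: "set_integrable M (A i) (\<lambda>x. \<bar>a x\<bar>)" for i
          using a A unfolding set_integrable_def by (intro integrable_mult_indicator) auto
        have "(\<Sum>i\<le>n. ?B i) = (LINT x|M. (\<Sum>i\<le>n. indicator (A i) x) * \<bar>a x\<bar>)"
          unfolding set_lebesgue_integral_def using ia
          by (subst Bochner_Integration.integral_sum[symmetric])
             (auto simp: set_integrable_def sum_distrib_right)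
        also have "\<dots> \<le> (LINT x|M. \<bar>a x\<bar>)"
        proof (rule integral_mono)
          show "integrable M (\<lambda>x. (\<Sum>i\<le>n. indicator (A i) x) * \<bar>a x\<bar>)"
            unfolding sum_distrib_right using ia[unfolded set_integrable_def real_scaleR_def]
            by (rule Bochner_Integration.integrable_sum)
          fix x
          have "(\<Sum>i\<le>n. indicator (A i) x) = (indicator (\<Union>i\<le>n. A i) x :: real)"
            by (rule indicator_UN_disjoint[symmetric])
               (use A in \<open>auto simp: disjoint_family_on_def\<close>)
          also have "\<dots> \<le> 1" by (simp add: indicator_def)
          finally show "(\<Sum>i\<le>n. indicator (A i) x) * \<bar>a x\<bar> \<le> \<bar>a x\<bar>"
            by (intro mult_left_le_one_le) (auto intro!: sum_nonneg)
        qed (use a in auto)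
        finally show "(\<Sum>i\<le>n. ?B i) \<le> (LINT x|M. \<bar>a x\<bar>)" .
      qed
    qed
    ultimately show "(\<lambda>n. \<Sum>i<n. LINT x:A i|M. a x) \<longlonglongrightarrow> (LINT x:(\<Union>i. A i)|M. a x)"
      using summable_LIMSEQ by metis
  qed
  moreover have "\<nu> (A i) = (LINT x:A i|M. a x)" for i using A by (intro \<nu>) auto
  moreover have "\<nu> (\<Union>i. A i) = (LINT x:(\<Union>i. A i)|M. a x)" using A by (intro \<nu>) auto
  ultimately show "(\<lambda>i. \<nu> (A i)) sums \<nu> (\<Union>i. A i)" by simp
qed

lemma integrable_bounded_mult:
  fixes a f :: "'a \<Rightarrow> real"
  assumes "integrable M a" "f \<in> borel_measurable M" "\<And>x. x \<in> space M \<Longrightarrow> \<bar>f x\<bar> \<le> K"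
  shows "integrable M (\<lambda>x. f x * a x)" "integrable M (\<lambda>x. a x * f x)"
proof -
  have [measurable]: "a \<in> borel_measurable M" "f \<in> borel_measurable M" using assms by auto
  show "integrable M (\<lambda>x. f x * a x)"
  proof (rule Bochner_Integration.integrable_bound)
    show "integrable M (\<lambda>x. K * a x)" using assms by auto
    show "AE x in M. norm (f x * a x) \<le> norm (K * a x)"
    proof (rule AE_I2)
      fix x assume "x \<in> space M"
      with assms(3)[of x] have "\<bar>f x\<bar> \<le> \<bar>K\<bar>" by linarith
      then show "norm (f x * a x) \<le> norm (K * a x)" by (simp add: abs_mult mult_right_mono)
    qed
  qed auto
  then show "integrable M (\<lambda>x. a x * f x)" by (simp add: mult.commute)
qed

text \<open>
  The supremum in the positive variation of A is attained at the part of A where the density is positive.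
\<close>

lemma pos_variation_density:
  fixes a :: "'a \<Rightarrow> real"
  assumes a: "integrable M a" and \<nu>: "\<And>A. A \<in> sets M \<Longrightarrow> \<nu> A = (LINT x:A|M. a x)"
  shows "pos_variation M \<nu> = density M (\<lambda>x. ennreal (a x))"
proof (rule measure_eqI)
  have sm: "signed_measure_on M \<nu>" by (rule signed_measure_on_density[OF assms])
  have meas [measurable]: "a \<in> borel_measurable M" using a by auto
  fix A assume "A \<in> sets (pos_variation M \<nu>)"
  then have A [measurable]: "A \<in> sets M" by simp
  have le: "ennreal (\<nu> B) \<le> emeasure (density M (\<lambda>x. ennreal (a x))) B" if [measurable]: "B \<in> sets M" for B
  proof -
    have i1: "integrable M (\<lambda>x. indicator B x * max 0 (a x))" "integrable M (\<lambda>x. indicator B x * a x)"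
      using a by (auto intro!: integrable_bounded_mult(1)[where K=1] simp: indicator_def)
    have "\<nu> B \<le> (LINT x|M. indicator B x * max 0 (a x))"
      unfolding \<nu>[OF that] set_lebesgue_integral_def real_scaleR_def using i1
      by (intro integral_mono) (auto simp: indicator_def)
    then have "ennreal (\<nu> B) \<le> ennreal (LINT x|M. indicator B x * max 0 (a x))"
      by (rule ennreal_leI)
    also have "\<dots> = (\<integral>\<^sup>+x. ennreal (indicator B x * max 0 (a x)) \<partial>M)"
      using i1 by (subst nn_integral_eq_integral) auto
    also have "\<dots> = (\<integral>\<^sup>+x. ennreal (a x) * indicator B x \<partial>M)"
      by (intro nn_integral_cong) (auto simp: indicator_def max_def ennreal_neg)
    also have "\<dots> = emeasure (density M (\<lambda>x. ennreal (a x))) B"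
      by (subst emeasure_density) auto
    finally show ?thesis .
  qed
  show "emeasure (pos_variation M \<nu>) A = emeasure (density M (\<lambda>x. ennreal (a x))) A"
    unfolding emeasure_pos_variation[OF sm A]
  proof (rule antisym)
    show "(SUP B\<in>{B \<in> sets M. B \<subseteq> A}. ennreal (\<nu> B)) \<le> emeasure (density M (\<lambda>x. ennreal (a x))) A"
      by (rule SUP_least) (auto intro!: order.trans[OF le] emeasure_mono)
    define B where "B = {x\<in>space M. x \<in> A \<and> a x > 0}"
    have B [measurable]: "B \<in> sets M" unfolding B_def by measurable
    have "emeasure (density M (\<lambda>x. ennreal (a x))) A = (\<integral>\<^sup>+x. ennreal (a x) * indicator A x \<partial>M)"
      by (subst emeasure_density) auto
    also have "\<dots> = (\<integral>\<^sup>+x. ennreal (indicator B x * a x) \<partial>M)"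
      by (intro nn_integral_cong) (auto simp: B_def indicator_def ennreal_neg)
    also have "\<dots> = ennreal (\<nu> B)"
      unfolding \<nu>[OF B] set_lebesgue_integral_def real_scaleR_def using a
      by (subst nn_integral_eq_integral)
         (auto intro!: integrable_bounded_mult(1)[where K=1], auto simp: B_def indicator_def)
    also have "\<dots> \<le> (SUP B\<in>{B \<in> sets M. B \<subseteq> A}. ennreal (\<nu> B))"
      using B by (intro SUP_upper) (auto simp: B_def)
    finally show "emeasure (density M (\<lambda>x. ennreal (a x))) A \<le> (SUP B\<in>{B \<in> sets M. B \<subseteq> A}. ennreal (\<nu> B))" .
  qed
qed simp

lemma neg_variation_density:
  fixes a :: "'a \<Rightarrow> real"
  assumes a: "integrable M a" and \<nu>: "\<And>A. A \<in> sets M \<Longrightarrow> \<nu> A = (LINT x:A|M. a x)"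
  shows "neg_variation M \<nu> = density M (\<lambda>x. ennreal (- a x))"
  unfolding neg_variation_def
  by (rule pos_variation_density) (use assms in \<open>auto simp: set_lebesgue_integral_def\<close>)

lemma signed_integral_density:
  fixes a f :: "'a \<Rightarrow> real"
  assumes a: "integrable M a" and \<nu>: "\<And>A. A \<in> sets M \<Longrightarrow> \<nu> A = (LINT x:A|M. a x)"
    and f: "f \<in> borel_measurable M" "\<And>x. x \<in> space M \<Longrightarrow> \<bar>f x\<bar> \<le> K"
  shows "signed_integral M \<nu> f = (LINT x|M. f x * a x)"
proof -
  have [measurable]: "a \<in> borel_measurable M" "f \<in> borel_measurable M" using assms by auto
  have i: "integrable M (\<lambda>x. max 0 (a x) * f x)" "integrable M (\<lambda>x. max 0 (- a x) * f x)"
    using a by (auto intro!: integrable_bounded_mult(2)[OF _ f])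
  have d: "density M (\<lambda>x. ennreal (a x)) = density M (\<lambda>x. ennreal (max 0 (a x)))"
    "density M (\<lambda>x. ennreal (- a x)) = density M (\<lambda>x. ennreal (max 0 (- a x)))"
    by (auto intro!: density_cong simp: max_def ennreal_neg)
  have "signed_integral M \<nu> f = (LINT x|M. max 0 (a x) * f x) - (LINT x|M. max 0 (- a x) * f x)"
    unfolding signed_integral_def pos_variation_density[OF a \<nu>, simplified]
      neg_variation_density[OF a \<nu>, simplified] d
    using integral_density[of f M "\<lambda>x. max 0 (a x)"] integral_density[of f M "\<lambda>x. max 0 (- a x)"]
    by (simp del: ennreal_max_0)
  also have "\<dots> = (LINT x|M. max 0 (a x) * f x - max 0 (- a x) * f x)"
    using i by simp
  also have "\<dots> = (LINT x|M. f x * a x)"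
    by (intro Bochner_Integration.integral_cong) (auto simp: max_def)
  finally show ?thesis .
qed

text \<open>
  Absolute continuity of \<nu> passes to both variations, because all measurable subsets of a null set are null.
  Each variation then has a finite density, and the Jordan decomposition recombines the two.
\<close>

lemma (in finite_measure) signed_Radon_Nikodym:
  assumes \<nu>: "signed_measure_on M \<nu>" and ac: "signed_abs_cont M \<nu>"
  shows "integrable M (signed_RN_deriv M \<nu>)"
    and "\<And>A. A \<in> sets M \<Longrightarrow> \<nu> A = (LINT x:A|M. signed_RN_deriv M \<nu> x)"
proof -
  have main: "integrable M (\<lambda>x. enn2real (RN_deriv M (pos_variation M \<nu>) x)) \<and>
     (\<forall>A\<in>sets M. measure (pos_variation M \<nu>) A = (LINT x:A|M. enn2real (RN_deriv M (pos_variation M \<nu>) x)))"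
    if \<nu>: "signed_measure_on M \<nu>" and ac: "signed_abs_cont M \<nu>" for \<nu>
  proof -
    let ?P = "pos_variation M \<nu>"
    interpret P: finite_measure ?P by (rule finite_measure_pos_variation[OF \<nu>])
    have "absolutely_continuous M ?P"
      unfolding absolutely_continuous_def
    proof
      fix A assume A: "A \<in> null_sets M"
      have "ennreal (\<nu> B) \<le> 0" if "B \<in> sets M" "B \<subseteq> A" for B
      proof -
        have "B \<in> null_sets M" using A that by (meson null_sets_subset)
        with ac show ?thesis by (simp add: signed_abs_cont_def)
      qed
      then have "emeasure ?P A = 0"
        using A by (subst emeasure_pos_variation[OF \<nu>]) (auto intro!: antisym SUP_least)
      with A show "A \<in> null_sets ?P" by (auto intro!: null_setsI)
    qed
    then have d: "density M (RN_deriv M ?P) = ?P"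
      by (intro density_RN_deriv) auto
    have fin: "AE x in M. RN_deriv M ?P x \<noteq> \<infinity>"
      by (rule RN_deriv_finite[OF P.sigma_finite_measure_axioms]) (simp_all add: d \<open>absolutely_continuous M ?P\<close>)
    have e: "(\<integral>\<^sup>+x. ennreal (indicator A x * enn2real (RN_deriv M ?P x)) \<partial>M) = emeasure ?P A" if [measurable]: "A \<in> sets M" for A
    proof -
      have "emeasure ?P A = (\<integral>\<^sup>+x. RN_deriv M ?P x * indicator A x \<partial>M)"
        by (subst d[symmetric], subst emeasure_density) auto
      also have "\<dots> = (\<integral>\<^sup>+x. ennreal (indicator A x * enn2real (RN_deriv M ?P x)) \<partial>M)"
        using fin by (intro nn_integral_cong_AE) (auto simp: indicator_def ennreal_enn2real_if)
      finally show ?thesis by simp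
    qed
    have "integrable M (\<lambda>x. enn2real (RN_deriv M ?P x))"
    proof (rule integrableI_nonneg)
      have "(\<integral>\<^sup>+x. ennreal (enn2real (RN_deriv M ?P x)) \<partial>M) = emeasure ?P (space M)"
        by (subst e[symmetric]) (auto intro!: nn_integral_cong)
      also have "\<dots> < \<infinity>" by (metis P.emeasure_finite infinity_ennreal_def less_top)
      finally show "(\<integral>\<^sup>+x. ennreal (enn2real (RN_deriv M ?P x)) \<partial>M) < \<infinity>" .
    qed auto
    moreover have "measure ?P A = (LINT x:A|M. enn2real (RN_deriv M ?P x))" if [measurable]: "A \<in> sets M" for A
    proof -
      have "(LINT x:A|M. enn2real (RN_deriv M ?P x)) = enn2real (\<integral>\<^sup>+x. ennreal (indicator A x * enn2real (RN_deriv M ?P x)) \<partial>M)"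
        unfolding set_lebesgue_integral_def real_scaleR_def
        by (rule integral_eq_nn_integral) auto
      also have "\<dots> = measure ?P A" unfolding e[OF that] by (simp add: measure_def)
      finally show ?thesis by simp
    qed
    ultimately show ?thesis by blast
  qed
  have ac': "signed_abs_cont M (\<lambda>A. - \<nu> A)" using ac by (simp add: signed_abs_cont_def)
  note m = main[OF \<nu> ac] main[OF signed_measure_on_uminus[OF \<nu>] ac', folded neg_variation_def]
  show "integrable M (signed_RN_deriv M \<nu>)"
    unfolding signed_RN_deriv_def using m by auto
  show "\<nu> A = (LINT x:A|M. signed_RN_deriv M \<nu> x)" if A: "A \<in> sets M" for A
  proof -
    have "set_integrable M A (\<lambda>x. enn2real (RN_deriv M (pos_variation M \<nu>) x))"
      "set_integrable M A (\<lambda>x. enn2real (RN_deriv M (neg_variation M \<nu>) x))"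
      using m A integrable_mult_indicator unfolding set_integrable_def by blast+
    then show ?thesis
      unfolding signed_RN_deriv_def
      using m A signed_measure_Jordan[OF \<nu> A] by (subst set_integral_diff) auto
  qed
qed

section \<open>Smooth functions with compact support\<close>

lemma C_k_SucI:
  assumes "\<And>x. (f has_derivative D x) (at x)" "\<And>v. C_k n (\<lambda>x. D x v)"
  shows "C_k (Suc n) f"
proof -
  have "frechet_derivative f (at x) = D x" for x
    using frechet_derivative_at[OF assms(1)] by simp
  with assms show ?thesis by (auto simp: differentiable_def)
qed

lemma C_k_SucD: "C_k (Suc n) f \<Longrightarrow> C_k n f"
proof (induction n arbitrary: f)
  case 0
  then show ?case
    by (auto intro!: differentiable_imp_continuous_on differentiable_at_imp_differentiable_on)
next
  case (Suc n)
  show ?case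
    unfolding C_k.simps(2)[of n f] using Suc.prems Suc.IH C_k.simps(2)[of "Suc n" f] by blast
qed

lemma C_k_has_derivative:
  "C_k (Suc n) f \<Longrightarrow> (f has_derivative frechet_derivative f (at x)) (at x)"
  by (simp add: frechet_derivative_works)

lemma C_k_const: "C_k n (\<lambda>x. c)"
  by (induction n arbitrary: c) (auto simp del: C_k.simps(2) intro!: C_k_SucI[where D="\<lambda>_ _. 0"])

lemma C_k_add: "C_k n f \<Longrightarrow> C_k n g \<Longrightarrow> C_k n (\<lambda>x. f x + g x)"
proof (induction n arbitrary: f g)
  case 0
  then show ?case by (auto intro: continuous_on_add)
next
  case (Suc n)
  show ?case
    by (rule C_k_SucI, rule has_derivative_add[OF C_k_has_derivative C_k_has_derivative, OF Suc.prems])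
       (use Suc in auto)
qed

lemma C_k_mult: "C_k n f \<Longrightarrow> C_k n g \<Longrightarrow> C_k n (\<lambda>x. f x * g x)"
proof (induction n arbitrary: f g)
  case 0
  then show ?case by (auto intro: continuous_on_mult)
next
  case (Suc n)
  have fg: "C_k n f" "C_k n g" using Suc.prems C_k_SucD by auto
  show ?case
    by (rule C_k_SucI, rule has_derivative_mult[OF C_k_has_derivative C_k_has_derivative, OF Suc.prems])
       (use Suc fg in \<open>auto intro!: C_k_add\<close>)
qed

lemma C_k_affine:
  fixes f :: "real \<Rightarrow> real" and L :: "'a::real_normed_vector \<Rightarrow> real"
  assumes L: "bounded_linear L"
  shows "C_k n f \<Longrightarrow> C_k n (\<lambda>x. f (L x + c))"
proof (induction n arbitrary: f)
  case 0
  have "continuous_on UNIV L" using L by (simp add: linear_continuous_on)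
  with 0 show ?case
    by (auto intro!: continuous_on_compose2[of UNIV f] continuous_intros)
next
  case (Suc n)
  have "((\<lambda>x. L x + c) has_derivative L) (at x)" for x
    using L by (auto intro!: derivative_eq_intros bounded_linear_imp_has_derivative)
  from has_derivative_compose[OF this C_k_has_derivative[OF Suc.prems]]
  show ?case
    by (rule C_k_SucI) (use Suc in auto)
qed

text \<open>
  The functions p(1/x) exp(-1/x) for x > 0, extended by 0, with p a polynomial. The family is closed under
  differentiation, which turns the smoothness of the classical cut-off function, the member p = 1, into an
  induction on the order.
\<close>

definition flat :: "real poly \<Rightarrow> real \<Rightarrow> real" where
  "flat p x = (if x \<le> 0 then 0 else poly p (1 / x) * exp (- (1 / x)))"

lemma poly_exp_decay: "((\<lambda>y. poly p y * exp (- y)) \<longlongrightarrow> (0::real)) at_top"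
proof -
  have "((\<lambda>y. \<Sum>i\<le>degree p. coeff p i * (y ^ i / exp y)) \<longlongrightarrow> (\<Sum>i\<le>degree p. coeff p i * 0)) at_top"
    by (intro tendsto_intros tendsto_power_div_exp_0)
  moreover have "(\<Sum>i\<le>degree p. coeff p i * (y ^ i / exp y)) = poly p y * exp (- y)" for y
    by (simp add: poly_altdef sum_distrib_right exp_minus divide_inverse mult.assoc)
  ultimately show ?thesis by simp
qed

lemma flat_has_derivative:
  "(flat p has_real_derivative flat ([:0,0,1:] * (p - pderiv p)) x) (at x)"
proof -
  consider "x < 0" | "x > 0" | "x = 0" by linarith
  then show ?thesis
  proof cases
    case 1
    have "((\<lambda>_. 0) has_real_derivative 0) (at x)" by simp
    from has_field_derivative_transform_within_open[OF this, of "{..<0}" "flat p"] 1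
    show ?thesis by (simp add: flat_def)
  next
    case 2
    have "((\<lambda>x. poly p (1 / x) * exp (- (1 / x))) has_real_derivative
        flat ([:0,0,1:] * (p - pderiv p)) x) (at x)"
      using 2 by (auto intro!: derivative_eq_intros poly_DERIV[THEN DERIV_chain2]
          simp: flat_def field_simps power2_eq_square)
    from has_field_derivative_transform_within_open[OF this, of "{0<..}" "flat p"] 2
    show ?thesis by (simp add: flat_def)
  next
    case 3
    have r: "((\<lambda>h. flat p h / h) \<longlongrightarrow> 0) (at_right 0)"
    proof (rule Lim_transform_eventually)
      show "((\<lambda>h. poly (pCons 0 p) (inverse h) * exp (- inverse h)) \<longlongrightarrow> 0) (at_right (0::real))"
        by (rule filterlim_compose[OF poly_exp_decay filterlim_inverse_at_top_right])
      show "\<forall>\<^sub>F h in at_right 0. poly (pCons 0 p) (inverse h) * exp (- inverse h) = flat p h / h"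
        by (auto simp: eventually_at_right_less flat_def field_simps
            intro!: eventually_mono[OF eventually_at_right_less])
    qed
    have l: "((\<lambda>h. flat p h / h) \<longlongrightarrow> 0) (at_left 0)"
    proof (rule Lim_transform_eventually[OF tendsto_const])
      show "\<forall>\<^sub>F h in at_left 0. 0 = flat p h / h"
        by (rule eventually_mono[of "\<lambda>h. h < 0"]) (auto simp: eventually_at_filter flat_def)
    qed
    have "((\<lambda>h. flat p h / h) \<longlongrightarrow> 0) (at 0)" by (rule filterlim_split_at[OF l r])
    moreover have "flat q 0 = 0" for q by (simp add: flat_def)
    ultimately show ?thesis by (simp add: 3 DERIV_def)
  qed
qed

lemma C_k_flat: "C_k n (flat p)"
proof (induction n arbitrary: p)
  case 0
  show ?case using flat_has_derivative DERIV_isCont by (auto simp: continuous_on_eq_continuous_at) blast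
next
  case (Suc n)
  show ?case
  proof (rule C_k_SucI)
    show "(flat p has_derivative (\<lambda>v. flat ([:0,0,1:] * (p - pderiv p)) x * v)) (at x)" for x
      using flat_has_derivative[of p x] by (simp add: has_field_derivative_def)
    show "C_k n (\<lambda>x. flat ([:0,0,1:] * (p - pderiv p)) x * v)" for v
      by (intro C_k_mult C_k_const Suc.IH)
  qed
qed

lemma continuous_on_flat [continuous_intros]: "continuous_on A f \<Longrightarrow> continuous_on A (\<lambda>x. flat p (f x))"
  using C_k_flat[of 0 p] by (auto intro: continuous_on_compose2[of UNIV "flat p"])

lemma borel_measurable_flat [measurable]: "flat p \<in> borel_measurable borel"
  using C_k_flat[of 0 p] by (auto intro: borel_measurable_continuous_onI)

abbreviation flat1 :: "real \<Rightarrow> real" where "flat1 \<equiv> flat 1"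

lemma flat1_eq: "flat1 x = (if x \<le> 0 then 0 else exp (- (1 / x)))"
  by (simp add: flat_def)

lemma flat1_bounds: "0 \<le> flat1 x" "flat1 x \<le> 1" "\<bar>flat1 x\<bar> \<le> 1"
  by (auto simp: flat1_eq)

lemma flat1_has_derivative: "(flat1 has_real_derivative flat [:0,0,1:] x) (at x)"
  using flat_has_derivative[of 1 x] by simp

text \<open>
  The derivative of x flat1(x) is flat [:1,1:] x. That it stays between 0 and 1 bounds the derivatives of
  the smoothed ramps below uniformly.
\<close>

lemma flat_11_bounds: "0 \<le> flat [:1,1:] x" "flat [:1,1:] x \<le> 1" "\<bar>flat [:1,1:] x\<bar> \<le> 1"
proof -
  have "(1 + 1 / x) * exp (- (1 / x)) \<le> 1" if "x > 0"
    using exp_ge_add_one_self[of "1 / x"] that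
    by (simp add: exp_minus field_simps)
  then show "0 \<le> flat [:1,1:] x" "flat [:1,1:] x \<le> 1"  "\<bar>flat [:1,1:] x\<bar> \<le> 1" by (auto simp: flat_def)
qed

lemma flat_001_bounds: "x > 0 \<Longrightarrow> 0 \<le> flat [:0,0,1:] x \<and> flat [:0,0,1:] x \<le> 1 / x\<^sup>2"
  by (auto simp: flat_def power2_eq_square divide_simps)

text \<open>
  Scaling by n + 1 produces smooth approximations of the indicator of the positive half line. The argument
  may drift with n, so that supports can be kept inside an open set; at the jump y = 0 the limit is 0
  because the arguments approach it from below.
\<close>

lemma flat_scale_tendsto:
  assumes "poly p 0 = 1" "(a \<longlongrightarrow> y) sequentially"
  assumes "y < 0 \<or> (\<forall>n. a n \<le> 0) \<or> y > 0"
  shows "(\<lambda>n. flat p (real (Suc n) * a n)) \<longlonglongrightarrow> (if y > 0 then 1 else 0)"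
proof -
  consider "y < 0" | "\<forall>n. a n \<le> 0" "\<not> y > 0" | "y > 0" using assms(3) by blast
  then show ?thesis
  proof cases
    case 1
    then have "\<forall>\<^sub>F n in sequentially. a n < 0" using assms(2) by (rule order_tendstoD(2)[rotated])
    then have "\<forall>\<^sub>F n in sequentially. 0 = flat p (real (Suc n) * a n)"
      by eventually_elim (simp add: flat_def mult_le_0_iff)
    from Lim_transform_eventually[OF tendsto_const this] 1 show ?thesis by simp
  next
    case 2
    then have "flat p (real (Suc n) * a n) = 0" for n
      using 2(1) by (simp add: flat_def mult_le_0_iff)
    with 2 show ?thesis by simp
  next
    case 3
    then have ev: "\<forall>\<^sub>F n in sequentially. a n > 0" using assms(2) by (rule order_tendstoD(1)[rotated])
    have "(\<lambda>n. inverse (real (Suc n)) * inverse (a n)) \<longlonglongrightarrow> 0 * inverse y"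
      using 3 by (intro tendsto_intros assms(2) LIMSEQ_inverse_real_of_nat) auto
    then have l: "(\<lambda>n. 1 / (real (Suc n) * a n)) \<longlonglongrightarrow> 0"
      by (simp add: divide_inverse mult.commute)
    have "(\<lambda>n. poly p (1 / (real (Suc n) * a n)) * exp (- (1 / (real (Suc n) * a n)))) \<longlonglongrightarrow> poly p 0 * exp (- 0)"
      by (intro tendsto_intros l)
    moreover have "\<forall>\<^sub>F n in sequentially. poly p (1 / (real (Suc n) * a n)) * exp (- (1 / (real (Suc n) * a n))) = flat p (real (Suc n) * a n)"
      using ev by eventually_elim (simp add: flat_def mult_le_0_iff)
    ultimately show ?thesis using 3 assms(1) by (auto intro: Lim_transform_eventually)
  qed
qed

lemma flat_scale_const_tendsto:
  "poly p 0 = 1 \<Longrightarrow> (\<lambda>n. flat p (real (Suc n) * y)) \<longlonglongrightarrow> (if y > 0 then 1 else 0)"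
  by (rule flat_scale_tendsto[where a="\<lambda>_. y"]) auto

lemma test_funI:
  assumes "\<And>n. C_k n \<phi>" "compact K" "K \<subseteq> U" "\<And>x. \<phi> x \<noteq> 0 \<Longrightarrow> x \<in> K"
  shows "\<phi> \<in> test_fun U"
proof -
  have "closure {x. \<phi> x \<noteq> 0} \<subseteq> K"
    using assms by (intro closure_minimal) (auto simp: compact_imp_closed)
  moreover from this have "compact (closure {x. \<phi> x \<noteq> 0})"
    using assms(2) by (metis closed_closure compact_Int_closed inf.absorb2)
  ultimately show ?thesis using assms by (auto simp: test_fun_def)
qed

lemma bounded_if_compact_support:
  fixes f :: "'a::real_normed_vector \<Rightarrow> real"
  assumes "continuous_on UNIV f" "compact K" "\<And>x. x \<notin> K \<Longrightarrow> f x = 0"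
  obtains B where "\<And>x. \<bar>f x\<bar> \<le> B"
proof -
  have "continuous_on K f" by (rule continuous_on_subset[OF assms(1)]) simp
  then have "bounded (f ` K)" using assms(2) by (intro compact_imp_bounded compact_continuous_image)
  then obtain B where B: "\<And>y. y \<in> f ` K \<Longrightarrow> \<bar>y\<bar> \<le> B"
    unfolding bounded_iff real_norm_def by metis
  have "\<bar>f x\<bar> \<le> max B 0" for x
    using B[of "f x"] assms(3)[of x] by (cases "x \<in> K") auto
  then show ?thesis using that by blast
qed

lemma test_fun_props:
  assumes "\<phi> \<in> test_fun U"
  shows "continuous_on UNIV \<phi>" "(\<phi> has_derivative frechet_derivative \<phi> (at x)) (at x)"
    "continuous_on UNIV (\<lambda>x. frechet_derivative \<phi> (at x) v)"
    "\<exists>B. \<forall>x. \<bar>\<phi> x\<bar> \<le> B" "\<exists>B. \<forall>x. \<bar>frechet_derivative \<phi> (at x) v\<bar> \<le> B"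
    "x \<notin> U \<Longrightarrow> \<phi> x = 0"
proof -
  let ?K = "closure {x. \<phi> x \<noteq> 0}"
  have sm: "\<And>n. C_k n \<phi>" and K: "compact ?K" "?K \<subseteq> U" using assms by (auto simp: test_fun_def)
  show c: "continuous_on UNIV \<phi>" using sm[of 0] by simp
  show "(\<phi> has_derivative frechet_derivative \<phi> (at x)) (at x)"
    using sm[of "Suc 0"] by (rule C_k_has_derivative)
  show c': "continuous_on UNIV (\<lambda>x. frechet_derivative \<phi> (at x) v)"
    using sm[of "Suc 0"] unfolding C_k.simps by blast
  have z: "\<phi> x = 0" if "x \<notin> ?K" for x using that closure_subset[of "{x. \<phi> x \<noteq> 0}"] by auto
  show "x \<notin> U \<Longrightarrow> \<phi> x = 0" using z[of x] K(2) by auto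
  show "\<exists>B. \<forall>x. \<bar>\<phi> x\<bar> \<le> B" using bounded_if_compact_support[OF c K(1) z] by metis
  have z': "frechet_derivative \<phi> (at x) v = 0" if "x \<notin> ?K" for x
  proof -
    have "((\<lambda>_. 0) has_derivative (\<lambda>_. 0)) (at x)" by simp
    then have "(\<phi> has_derivative (\<lambda>_. 0)) (at x)"
    proof (rule has_derivative_transform_within_open)
      show "open (- ?K)" by (intro open_Compl closed_closure)
      show "x \<in> - ?K" using that by (metis ComplI)
      show "0 = \<phi> y" if "y \<in> - ?K" for y using z[of y] that by (metis ComplD)
    qed
    from frechet_derivative_at[OF this] show ?thesis by metis
  qed
  show "\<exists>B. \<forall>x. \<bar>frechet_derivative \<phi> (at x) v\<bar> \<le> B"
    using bounded_if_compact_support[OF c' K(1) z'] by metis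
qed

lemma test_fun_strip_x_derivative:
  assumes "\<phi> \<in> test_fun strip"
  obtains D B where "continuous_on UNIV D" "\<And>p. \<bar>D p\<bar> \<le> B"
    "\<And>x k. ((\<lambda>t. \<phi> (t, k)) has_real_derivative D (x, k)) (at x)"
    "\<And>x k. deriv (\<lambda>t. \<phi> (t, k)) x = D (x, k)"
proof -
  define D where "D p = frechet_derivative \<phi> (at p) (1, 0)" for p
  obtain B where B: "\<And>p. \<bar>D p\<bar> \<le> B" using test_fun_props(5)[OF assms, of "(1,0)"] by (auto simp: D_def)
  have d: "((\<lambda>t. \<phi> (t, k)) has_real_derivative D (x, k)) (at x)" for x k
  proof -
    have "((\<lambda>t. (t, k)) has_derivative (\<lambda>h. (h, 0))) (at x)"
      by (auto intro!: derivative_eq_intros)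
    from has_derivative_compose[OF this test_fun_props(2)[OF assms]]
    have "((\<lambda>t. \<phi> (t, k)) has_derivative (\<lambda>h. frechet_derivative \<phi> (at (x, k)) (h, 0))) (at x)" by simp
    moreover have "frechet_derivative \<phi> (at (x, k)) (h, 0) = D (x, k) * h" for h
    proof -
      have "linear (frechet_derivative \<phi> (at (x, k)))"
        using test_fun_props(2)[OF assms] by (rule has_derivative_linear)
      from linear_scale[OF this, of h "(1, 0)"] show ?thesis by (simp add: D_def)
    qed
    ultimately show ?thesis by (simp add: has_field_derivative_def)
  qed
  show thesis
    by (rule that[of D B]) (use B d in \<open>auto simp: D_def test_fun_props(3)[OF assms] intro: DERIV_imp_deriv\<close>)
qed

lemma test_fun_real_derivative:
  fixes \<phi> :: "real \<Rightarrow> real"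
  assumes "\<phi> \<in> test_fun U"
  obtains B where "continuous_on UNIV (deriv \<phi>)" "\<And>x. \<bar>deriv \<phi> x\<bar> \<le> B"
    "\<And>x. (\<phi> has_real_derivative deriv \<phi> x) (at x)"
proof -
  have d: "(\<phi> has_real_derivative frechet_derivative \<phi> (at x) 1) (at x)" for x
  proof -
    have "linear (frechet_derivative \<phi> (at x))"
      using test_fun_props(2)[OF assms] by (rule has_derivative_linear)
    have "frechet_derivative \<phi> (at x) = (\<lambda>h. frechet_derivative \<phi> (at x) 1 * h)"
    proof
      fix h show "frechet_derivative \<phi> (at x) h = frechet_derivative \<phi> (at x) 1 * h"
        using linear_scale[OF \<open>linear _\<close>, of h 1] by simp
    qed
    with test_fun_props(2)[OF assms, of x] show ?thesis by (simp add: has_field_derivative_def)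
  qed
  have e: "deriv \<phi> = (\<lambda>x. frechet_derivative \<phi> (at x) 1)" by (rule ext) (rule DERIV_imp_deriv[OF d])
  obtain B where B: "\<And>x. \<bar>deriv \<phi> x\<bar> \<le> B" using test_fun_props(5)[OF assms, of 1] unfolding e by metis
  show thesis
    by (rule that[OF _ B]) (use d test_fun_props(3)[OF assms, of 1] in \<open>simp_all add: e\<close>)
qed

section \<open>Lebesgue measure on the unit interval\<close>

text \<open>
  Lebesgue measure on (0,1), carried by the whole line so that measurability of integrands is plain Borel
  measurability.
\<close>

definition U01 :: "real measure" where
  "U01 = density lborel (indicator {0<..<1})"

lemma sets_U01 [simp, measurable_cong]: "sets U01 = sets borel"
  by (simp add: U01_def)

lemma space_U01 [simp]: "space U01 = UNIV"
  by (simp add: U01_def)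

lemma prob_space_U01: "prob_space U01"
  by (rule prob_spaceI) (simp add: U01_def emeasure_density)

lemma AE_U01_iff: "(AE x in U01. P x) \<longleftrightarrow> (AE x in lborel. x \<in> {0<..<1} \<longrightarrow> P x)"
  unfolding U01_def by (subst AE_density) (auto simp: indicator_def)

lemma AE_U01: "AE x in U01. x \<in> {0<..<1}"
  by (simp add: AE_U01_iff)

lemma nn_integral_U01:
  assumes [measurable]: "f \<in> borel_measurable borel"
  shows "(\<integral>\<^sup>+x. f x \<partial>U01) = (\<integral>\<^sup>+x\<in>{0<..<1}. f x \<partial>lborel)"
  unfolding U01_def by (subst nn_integral_density) (auto simp: mult.commute)

lemma integral_U01:
  fixes f :: "real \<Rightarrow> real"
  assumes [measurable]: "f \<in> borel_measurable borel"
  shows "(LINT x|U01. f x) = (LINT x:{0<..<1}|lborel. f x)"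
proof -
  have "U01 = density lborel (\<lambda>x. ennreal (indicator {0<..<1} x))"
    by (simp add: U01_def ennreal_indicator)
  show ?thesis
    unfolding \<open>U01 = _\<close> by (subst integral_density) (auto simp: set_lebesgue_integral_def)
qed

lemma integrable_U01:
  fixes f :: "real \<Rightarrow> real"
  assumes [measurable]: "f \<in> borel_measurable borel"
  shows "integrable U01 f \<longleftrightarrow> set_integrable lborel {0<..<1} f"
proof -
  have "U01 = density lborel (\<lambda>x. ennreal (indicator {0<..<1} x))"
    by (simp add: U01_def ennreal_indicator)
  show ?thesis
    unfolding \<open>U01 = _\<close> by (subst integrable_density) (auto simp: set_integrable_def)
qed

lemma lebesgue_integral_eq_U01:
  fixes f :: "real \<Rightarrow> real"
  assumes [measurable]: "f \<in> borel_measurable borel"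
  shows "(LINT x:{0<..<1}|lebesgue. f x) = (LINT x|U01. f x)"
  unfolding integral_U01[OF assms] set_lebesgue_integral_def
  by (rule integral_completion) measurable

lemma lebesgue_nn_integral_eq_U01:
  assumes [measurable]: "f \<in> borel_measurable borel"
  shows "(\<integral>\<^sup>+x\<in>{0<..<1}. f x \<partial>lebesgue) = (\<integral>\<^sup>+x. f x \<partial>U01)"
  unfolding nn_integral_U01[OF assms] by (rule nn_integral_completion)

section \<open>Uniqueness of the x-derivative\<close>

definition quadrants :: "(real \<times> real) set set" where
  "quadrants = range (\<lambda>(t, d). {..<t} \<times> {..<d})"

lemma Pow_UNIV_quadrants: "quadrants \<subseteq> Pow UNIV"
  by simp

lemma Int_stable_quadrants: "Int_stable quadrants"
  unfolding Int_stable_def quadrants_def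
proof (clarsimp simp: image_iff)
  fix t d t' d' :: real
  have "{..<t} \<times> {..<d} \<inter> {..<t'} \<times> {..<d'} = {..<min t t'} \<times> {..<min d d'}" by auto
  then show "\<exists>a b. {..<t} \<times> {..<d} \<inter> {..<t'} \<times> {..<d'} = {..<a} \<times> {..<b}" by blast
qed

lemma borel_eq_quadrants: "sets (borel :: (real \<times> real) measure) = sigma_sets UNIV quadrants"
proof (rule antisym)
  let ?S = "sigma UNIV quadrants"
  have sS: "sets ?S = sigma_sets UNIV quadrants" by simp
  have q: "{..<t} \<times> {..<d} \<in> sets ?S" for t d
    unfolding sS by (rule sigma_sets.Basic) (auto simp: quadrants_def)
  have "fst \<in> borel_measurable ?S"
  proof (rule borel_measurableI_less)
    fix t :: real
    have "{x \<in> space ?S. fst x < t} = (\<Union>n::nat. {..<t} \<times> {..<real n})"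
      by (auto simp: reals_Archimedean2)
    then show "{x \<in> space ?S. fst x < t} \<in> sets ?S" using q by (auto simp del: sets_measure_of)
  qed
  moreover have "snd \<in> borel_measurable ?S"
  proof (rule borel_measurableI_less)
    fix t :: real
    have "{x \<in> space ?S. snd x < t} = (\<Union>n::nat. {..<real n} \<times> {..<t})"
      by (auto simp: reals_Archimedean2)
    then show "{x \<in> space ?S. snd x < t} \<in> sets ?S" using q by (auto simp del: sets_measure_of)
  qed
  ultimately have "(\<lambda>x. (fst x, snd x)) \<in> measurable ?S (borel \<Otimes>\<^sub>M borel)" by (rule measurable_Pair)
  then have m: "(\<lambda>x. x) \<in> measurable ?S borel" by (simp add: borel_prod)
  show "sets borel \<subseteq> sigma_sets UNIV quadrants"
  proof
    fix A :: "(real \<times> real) set" assume "A \<in> sets borel"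
    from measurable_sets[OF m this] show "A \<in> sigma_sets UNIV quadrants" by simp
  qed
  show "sigma_sets UNIV quadrants \<subseteq> sets (borel :: (real \<times> real) measure)"
  proof (rule sets.sigma_sets_subset[of _ borel, simplified])
    have "{..<t} \<times> {..<d} \<in> sets (borel :: (real \<times> real) measure)" for t d :: real
      unfolding borel_prod[symmetric] by auto
    then show "quadrants \<subseteq> sets borel" by (auto simp: quadrants_def)
  qed
qed

lemma signed_measure_on_incseq:
  assumes \<nu>: "signed_measure_on M \<nu>" and A: "range A \<subseteq> sets M" "incseq A"
  shows "(\<lambda>i::nat. \<nu> (A i)) \<longlonglongrightarrow> \<nu> (\<Union>i. A i)"
proof -
  interpret P: finite_measure "pos_variation M \<nu>" by (rule finite_measure_pos_variation[OF \<nu>])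
  interpret N: finite_measure "neg_variation M \<nu>" by (rule finite_measure_neg_variation[OF \<nu>])
  have s: "A i \<in> sets M" "(\<Union>i. A i) \<in> sets M" for i using A(1) by auto
  show ?thesis
    unfolding signed_measure_Jordan[OF \<nu> s(1)] signed_measure_Jordan[OF \<nu> s(2)]
    by (intro tendsto_diff P.finite_Lim_measure_incseq N.finite_Lim_measure_incseq) (use A in simp_all)
qed

text \<open>
  Uniqueness of measures from an intersection-stable generator, for signed measures. The step to complements
  needs the total masses to agree, which follows by exhausting the plane with quadrants.
\<close>

lemma signed_measure_eq_quadrants:
  fixes \<nu> \<nu>' :: "(real \<times> real) set \<Rightarrow> real"
  assumes \<nu>: "signed_measure_on borel \<nu>" and \<nu>': "signed_measure_on borel \<nu>'"
    and eq: "\<And>t d. \<nu> ({..<t} \<times> {..<d}) = \<nu>' ({..<t} \<times> {..<d})"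
    and A: "A \<in> sets borel"
  shows "\<nu> A = \<nu>' A"
proof -
  have q: "{..<t} \<times> {..<d} \<in> sets (borel :: (real \<times> real) measure)" for t d :: real
    unfolding borel_prod[symmetric] by auto
  have total: "\<nu> UNIV = \<nu>' UNIV"
  proof -
    let ?Q = "\<lambda>n::nat. {..<real n} \<times> {..<real n}"
    have Q: "range ?Q \<subseteq> sets borel" "incseq ?Q" using q by (auto simp: incseq_def)
    have "(\<Union>n. ?Q n) = UNIV"
    proof (intro set_eqI iffI UNIV_I)
      fix p :: "real \<times> real"
      obtain n where "max (fst p) (snd p) < real n" using reals_Archimedean2 by blast
      then show "p \<in> (\<Union>n. ?Q n)" by (cases p) auto
    qed
    with signed_measure_on_incseq[OF \<nu> Q] signed_measure_on_incseq[OF \<nu>' Q] show ?thesis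
      by (simp add: eq LIMSEQ_unique)
  qed
  from A have "A \<in> sigma_sets UNIV quadrants" by (simp add: borel_eq_quadrants)
  with Int_stable_quadrants Pow_UNIV_quadrants show ?thesis
  proof (induction rule: sigma_sets_induct_disjoint)
    case (basic A)
    then show ?case using eq by (auto simp: quadrants_def)
  next
    case empty
    show ?case using \<nu> \<nu>' by (simp add: signed_measure_on_empty)
  next
    case (compl A)
    have A: "A \<in> sets borel" using compl by (simp add: borel_eq_quadrants)
    have "\<nu> (UNIV - A) = \<nu> UNIV - \<nu> A" "\<nu>' (UNIV - A) = \<nu>' UNIV - \<nu>' A"
      using A by (auto intro!: signed_measure_on_Diff[OF \<nu>] signed_measure_on_Diff[OF \<nu>'])
    with total compl show ?case by simp
  next
    case (union A)
    have A: "range A \<subseteq> sets borel" using union(2) by (simp add: borel_eq_quadrants)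
    show ?case
      using signed_measure_on_sums[OF \<nu> A union(1)] signed_measure_on_sums[OF \<nu>' A union(1)] union(3)
      by (simp add: sums_unique2)
  qed
qed

lemma signed_integral_bounded_convergence:
  assumes \<nu>: "signed_measure_on M \<nu>"
    and [measurable]: "\<And>n. f n \<in> borel_measurable M" "g \<in> borel_measurable M"
    and bd: "\<And>n x. \<bar>f n x\<bar> \<le> K" and lim: "\<And>x. x \<in> space M \<Longrightarrow> (\<lambda>n. f n x) \<longlonglongrightarrow> g x"
  shows "(\<lambda>n. signed_integral M \<nu> (f n)) \<longlonglongrightarrow> signed_integral M \<nu> g"
  unfolding signed_integral_def
proof (intro tendsto_diff)
  interpret P: finite_measure "pos_variation M \<nu>" by (rule finite_measure_pos_variation[OF \<nu>])
  interpret N: finite_measure "neg_variation M \<nu>" by (rule finite_measure_neg_variation[OF \<nu>])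
  show "(\<lambda>n. LINT x|pos_variation M \<nu>. f n x) \<longlonglongrightarrow> (LINT x|pos_variation M \<nu>. g x)"
    by (rule integral_dominated_convergence[where w="\<lambda>_. K"]) (auto intro!: AE_I2 simp: bd lim)
  show "(\<lambda>n. LINT x|neg_variation M \<nu>. f n x) \<longlonglongrightarrow> (LINT x|neg_variation M \<nu>. g x)"
    by (rule integral_dominated_convergence[where w="\<lambda>_. K"]) (auto intro!: AE_I2 simp: bd lim)
qed

lemma signed_integral_indicator:
  assumes \<nu>: "signed_measure_on M \<nu>" and A: "A \<in> sets M"
  shows "signed_integral M \<nu> (indicator A) = \<nu> A"
  using A sets.sets_into_space[OF A]
  by (simp add: signed_integral_def signed_measure_Jordan[OF \<nu> A] Int_absorb2)

text \<open>
  A smooth version of the indicator of the quadrant. With N = n + 1, the four factors vanish for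
  x \<le> -1 + 1/N, x \<ge> t - 1/N, k \<ge> d and k \<le> -N; this makes the support compact in the strip if t \<le> 1.
\<close>

definition quadrant_bump :: "real \<Rightarrow> real \<Rightarrow> nat \<Rightarrow> real \<times> real \<Rightarrow> real" where
  "quadrant_bump t d n p = (let N = real (Suc n) in
     flat1 (N * fst p + (N - 1)) * flat1 (- N * fst p + (N * t - 1)) *
     (flat1 (- N * snd p + N * d) * flat1 (N * snd p + N * N)))"

lemma quadrant_bump_bounded: "\<bar>quadrant_bump t d n p\<bar> \<le> 1"
  using flat1_bounds by (auto simp: quadrant_bump_def Let_def abs_mult intro!: mult_le_one)

lemma quadrant_bump_measurable [measurable]: "quadrant_bump t d n \<in> borel_measurable borel"
  unfolding quadrant_bump_def[abs_def] Let_def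
  by (intro borel_measurable_continuous_onI continuous_intros)

lemma quadrant_bump_test_fun:
  assumes "t \<le> 1"
  shows "quadrant_bump t d n \<in> test_fun strip"
proof (rule test_funI)
  define N where "N = real (Suc n)"
  have N: "N > 0" by (simp add: N_def)
  have bl: "bounded_linear (\<lambda>p::real\<times>real. c * fst p)" "bounded_linear (\<lambda>p::real\<times>real. c * snd p)" for c
    by (auto intro!: bounded_linear_intros)
  show "C_k m (quadrant_bump t d n)" for m
    unfolding quadrant_bump_def[abs_def] Let_def
    by (intro C_k_mult C_k_affine[OF bl(1)] C_k_affine[OF bl(2)] C_k_flat)
  show "compact ({-1 + 1 / N..1 - 1 / N} \<times> {-N..d})" by (intro compact_Times) auto
  show "{-1 + 1 / N..1 - 1 / N} \<times> {-N..d} \<subseteq> strip"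
  proof -
    have "0 < 1 / N" using N by simp
    then have "{-1 + 1 / N..1 - 1 / N} \<subseteq> {-1<..<1}" by (intro subsetI) (simp only: atLeastAtMost_iff greaterThanLessThan_iff, linarith)
    then show ?thesis unfolding strip_def by (intro Sigma_mono) auto
  qed
  fix p assume "quadrant_bump t d n p \<noteq> 0"
  then have "N * fst p + (N - 1) > 0" "- N * fst p + (N * t - 1) > 0" "- N * snd p + N * d > 0"
    "N * snd p + N * N > 0"
    unfolding quadrant_bump_def Let_def N_def[symmetric] mult_eq_0_iff de_Morgan_disj flat1_eq
    by (meson not_le)+
  moreover have "N * t \<le> N * 1" using assms N by (intro mult_left_mono) auto
  ultimately have "N * (fst p + 1) > 1" "N * (1 - fst p) > 1" "N * (d - snd p) > 0" "N * (snd p + N) > 0"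
    by (simp_all add: algebra_simps)
  then have "fst p + 1 > 1 / N" "1 - fst p > 1 / N" "d - snd p > 0" "snd p + N > 0"
    using N by (simp_all add: pos_divide_less_eq mult.commute zero_less_mult_iff)
  then show "p \<in> {-1 + 1 / N..1 - 1 / N} \<times> {-N..d}" by (cases p) auto
qed

lemma quadrant_bump_tendsto:
  assumes "-1 < fst p"
  shows "(\<lambda>n. quadrant_bump t d n p) \<longlonglongrightarrow> indicator ({..<t} \<times> {..<d}) p"
proof -
  have inv: "(\<lambda>n. inverse (real (Suc n))) \<longlonglongrightarrow> 0" by (rule LIMSEQ_inverse_real_of_nat)
  have 1: "(\<lambda>n. flat1 (real (Suc n) * (fst p + 1 - inverse (real (Suc n))))) \<longlonglongrightarrow> (if fst p + 1 - 0 > 0 then 1 else 0)"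
    by (rule flat_scale_tendsto[OF _ tendsto_diff[OF tendsto_const inv]]) (use assms in auto)
  have 2: "(\<lambda>n. flat1 (real (Suc n) * (t - fst p - inverse (real (Suc n))))) \<longlonglongrightarrow> (if t - fst p - 0 > 0 then 1 else 0)"
  proof (rule flat_scale_tendsto[OF _ tendsto_diff[OF tendsto_const inv]])
    have "t - fst p - inverse (real (Suc n)) \<le> 0" if "t - fst p - 0 = 0" for n using that by simp
    then show "t - fst p - 0 < 0 \<or> (\<forall>n. t - fst p - inverse (real (Suc n)) \<le> 0) \<or> t - fst p - 0 > 0"
      by (metis linorder_neqE_linordered_idom)
  qed simp
  have 3: "(\<lambda>n. flat1 (real (Suc n) * (d - snd p))) \<longlonglongrightarrow> (if d - snd p > 0 then 1 else 0)"
    by (rule flat_scale_const_tendsto) simp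
  have 4: "(\<lambda>n. flat1 (real (Suc n) * (snd p + real (Suc n)))) \<longlonglongrightarrow> 1"
  proof (rule tendsto_sandwich[OF _ _ _ tendsto_const])
    obtain m where m: "real m > 1 - snd p" using reals_Archimedean2 by blast
    show "\<forall>\<^sub>F n in sequentially. flat1 (real (Suc n) * 1) \<le> flat1 (real (Suc n) * (snd p + real (Suc n)))"
      unfolding eventually_sequentially
    proof (intro exI allI impI)
      fix n assume "m \<le> n"
      then have "snd p + real (Suc n) \<ge> 1" using m by simp
      then have "real (Suc n) * 1 \<le> real (Suc n) * (snd p + real (Suc n))" by (intro mult_left_mono) auto
      moreover have "flat1 x \<le> flat1 y" if "x \<le> y" for x y
        using that by (auto simp: flat1_eq intro!: divide_left_mono)
      ultimately show "flat1 (real (Suc n) * 1) \<le> flat1 (real (Suc n) * (snd p + real (Suc n)))" by blast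
    qed
    show "(\<lambda>n. flat1 (real (Suc n) * 1)) \<longlonglongrightarrow> 1"
      using flat_scale_const_tendsto[of 1 1] by simp
  qed (simp_all add: flat1_bounds)
  have e: "quadrant_bump t d n p = flat1 (real (Suc n) * (fst p + 1 - inverse (real (Suc n)))) *
     flat1 (real (Suc n) * (t - fst p - inverse (real (Suc n)))) *
     (flat1 (real (Suc n) * (d - snd p)) * flat1 (real (Suc n) * (snd p + real (Suc n))))" for n
  proof -
    have "N * fst p + (N - 1) = N * (fst p + 1 - inverse N)" "- N * fst p + (N * t - 1) = N * (t - fst p - inverse N)"
      "- N * snd p + N * d = N * (d - snd p)" "N * snd p + N * N = N * (snd p + N)" if "N \<noteq> 0" for N
      using that by (simp_all add: algebra_simps)
    then show ?thesis unfolding quadrant_bump_def Let_def by (metis of_nat_neq_0)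
  qed
  have "(if fst p + 1 - 0 > 0 then 1 else 0) * (if t - fst p - 0 > 0 then 1 else 0) * ((if d - snd p > 0 then 1 else 0) * 1) =
      (indicator ({..<t} \<times> {..<d}) p :: real)"
    using assms by (cases p) (simp add: indicator_def)
  then show ?thesis
    using tendsto_mult[OF tendsto_mult[OF 1 2] tendsto_mult[OF 3 4]] unfolding e by (simp only:)
qed

text \<open>
  Test functions determine the values on quadrants, since the bumps above converge boundedly to indicators of
  quadrants; quadrants determine the signed measure.
\<close>

lemma x_derivative_unique:
  assumes sp: "space \<mu> = strip" and se: "sets \<mu> = sets (restrict_space borel strip)"
    and d: "is_x_derivative \<mu> \<nu>" "is_x_derivative \<mu> \<nu>'" and A: "A \<in> sets \<mu>"
  shows "\<nu> A = \<nu>' A"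
proof -
  have \<nu>: "signed_measure_on \<mu> \<nu>" and \<nu>': "signed_measure_on \<mu> \<nu>'" using d by (auto simp: is_x_derivative_def)
  have strip [measurable]: "strip \<in> sets borel" unfolding strip_def borel_prod[symmetric] by auto
  have sI: "B \<inter> strip \<in> sets \<mu>" if "B \<in> sets borel" for B
    using that unfolding se sets_restrict_space by blast
  have ext: "signed_measure_on borel (\<lambda>B. \<nu> (B \<inter> strip))" if \<nu>: "signed_measure_on \<mu> \<nu>" for \<nu>
    unfolding signed_measure_on_def
  proof (intro conjI allI impI)
    show "\<nu> ({} \<inter> strip) = 0" by (simp add: signed_measure_on_empty[OF \<nu>])
    fix B :: "nat \<Rightarrow> (real \<times> real) set" assume B: "range B \<subseteq> sets borel" "disjoint_family B"
    have "(\<lambda>i. \<nu> (B i \<inter> strip)) sums \<nu> (\<Union>i. B i \<inter> strip)"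
      using B sI by (intro signed_measure_on_sums[OF \<nu>]) (auto simp: disjoint_family_on_def)
    then show "(\<lambda>i. \<nu> (B i \<inter> strip)) sums \<nu> ((\<Union>i. B i) \<inter> strip)" by (simp add: Int_UN_distrib2)
  qed
  have "\<nu> (A \<inter> strip) = \<nu>' (A \<inter> strip)"
  proof (rule signed_measure_eq_quadrants[OF ext[OF \<nu>] ext[OF \<nu>']])
    show "A \<in> sets borel" using A strip unfolding se sets_restrict_space by auto
    fix t d :: real
    \<comment> \<open>The bump is supported in the strip only for t \<le> 1, and the strip does not see the difference.\<close>
    define t' where "t' = min t 1"
    let ?Q = "{..<t'} \<times> {..<d} \<inter> strip"
    have Q: "?Q \<in> sets \<mu>" by (rule sI) (auto simp: borel_prod[symmetric])
    have Qe: "{..<t} \<times> {..<d} \<inter> strip = ?Q" by (auto simp: t'_def strip_def)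
    have lim: "(\<lambda>n. signed_integral \<mu> \<nu> (quadrant_bump t' d n)) \<longlonglongrightarrow> \<nu> ?Q" if \<nu>: "signed_measure_on \<mu> \<nu>" for \<nu>
      unfolding signed_integral_indicator[OF \<nu> Q, symmetric]
    proof (rule signed_integral_bounded_convergence[OF \<nu>])
      show "quadrant_bump t' d n \<in> borel_measurable \<mu>" for n
        unfolding measurable_cong_sets[OF se refl] by (rule measurable_restrict_space1) measurable
      show "indicator ?Q \<in> borel_measurable \<mu>" using Q by measurable
      show "\<bar>quadrant_bump t' d n x\<bar> \<le> 1" for n x by (rule quadrant_bump_bounded)
      fix x assume x: "x \<in> space \<mu>"
      then have "(indicator ?Q x :: real) = indicator ({..<t'} \<times> {..<d}) x" by (auto simp: indicator_def sp)
      moreover have "-1 < fst x" using x by (auto simp: sp strip_def)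
      ultimately show "(\<lambda>n. quadrant_bump t' d n x) \<longlonglongrightarrow> indicator ?Q x"
        using quadrant_bump_tendsto by simp
    qed
    have "signed_integral \<mu> \<nu> (quadrant_bump t' d n) = signed_integral \<mu> \<nu>' (quadrant_bump t' d n)" for n
      using d quadrant_bump_test_fun[of t' d n] by (simp add: is_x_derivative_def t'_def)
    then show "\<nu> ({..<t} \<times> {..<d} \<inter> strip) = \<nu>' ({..<t} \<times> {..<d} \<inter> strip)"
      unfolding Qe using LIMSEQ_unique[OF lim[OF \<nu>]] lim[OF \<nu>'] by simp
  qed
  moreover have "A \<inter> strip = A" using sets.sets_into_space[OF A] sp by auto
  ultimately show ?thesis by simp
qed

section \<open>Admissible measures with an explicit density\<close>

text \<open>
  Admissibility stated on the whole plane, with an explicit density a of the x-derivative of m with respect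
  to m. Working with the pair (m, a) avoids the choices made by the Radon-Nikodym derivative and by the
  distributional derivative, and the constraint on the x-marginal becomes an equation between measures.
\<close>

definition sheet :: "(real \<times> real) measure \<Rightarrow> (real \<times> real \<Rightarrow> real) \<Rightarrow> bool" where
  "sheet m a \<longleftrightarrow> sets m = sets borel \<and> finite_measure m \<and> emeasure m (- half_strip) = 0 \<and>
     a \<in> borel_measurable borel \<and> integrable m a \<and>
     (\<forall>\<phi>\<in>test_fun strip. (LINT p|m. \<phi> p * a p) = - (LINT p|m. deriv (\<lambda>t. \<phi> (t, snd p)) (fst p))) \<and>
     distr m borel fst = density U01 (\<lambda>x. ennreal (2 * x))"

definition sheet_energy :: "(real \<times> real) measure \<Rightarrow> (real \<times> real \<Rightarrow> real) \<Rightarrow> ennreal" where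
  "sheet_energy m a = (\<integral>\<^sup>+p. ennreal ((snd p)\<^sup>2) + slope_energy (snd p) (a p) \<partial>m)"

lemma borel_strip [measurable]: "strip \<in> sets borel" "half_strip \<in> sets borel"
  unfolding strip_def half_strip_def borel_prod[symmetric] by auto

lemma half_strip_subset: "half_strip \<subseteq> strip"
  by (auto simp: half_strip_def strip_def)

lemma slope_energy_measurable [measurable]:
  assumes [measurable]: "f \<in> borel_measurable M" "g \<in> borel_measurable M"
  shows "(\<lambda>x. slope_energy (f x) (g x)) \<in> borel_measurable M"
  unfolding slope_energy_def by measurable

lemma measurable_fst_borel [measurable]: "fst \<in> borel_measurable (borel :: (real \<times> real) measure)"
  and measurable_snd_borel [measurable]: "snd \<in> borel_measurable (borel :: (real \<times> real) measure)"
  unfolding borel_prod[symmetric] by measurable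

lemma emeasure_0_AE:
  assumes "sets m = sets borel" "A \<in> sets borel" "emeasure m (- A) = 0"
  shows "AE p in m. p \<in> A"
  by (rule AE_I[where N="- A"]) (use assms in auto)

lemma sheetD:
  assumes "sheet m a"
  shows "sets m = sets borel" "space m = UNIV" "finite_measure m" "AE p in m. p \<in> half_strip"
    "a \<in> borel_measurable borel" "integrable m a"
    "\<And>\<phi>. \<phi> \<in> test_fun strip \<Longrightarrow> (LINT p|m. \<phi> p * a p) = - (LINT p|m. deriv (\<lambda>t. \<phi> (t, snd p)) (fst p))"
    "distr m borel fst = density U01 (\<lambda>x. ennreal (2 * x))"
proof -
  show "AE p in m. p \<in> half_strip"
    by (rule emeasure_0_AE) (use assms in \<open>auto simp: sheet_def\<close>)
  show "space m = UNIV" using assms sets_eq_imp_space_eq[of m borel] by (simp add: sheet_def)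
qed (use assms in \<open>auto simp: sheet_def\<close>)

lemma identity_measurable_strip:
  assumes "sets \<mu> = sets (restrict_space borel strip)"
  shows "(\<lambda>p. p) \<in> measurable \<mu> borel"
  unfolding measurable_cong_sets[OF assms refl] by (rule measurable_restrict_space1) measurable

lemma F_infty_eq_extension:
  assumes se: "sets \<mu> = sets (restrict_space borel strip)" and sp: "space \<mu> = strip"
    and null: "emeasure \<mu> ({-1<..0} \<times> UNIV) = 0"
    and a: "a \<in> borel_measurable borel" "AE p in \<mu>. a p = dx_density \<mu> p"
  shows "F_infty \<mu> = sheet_energy (distr \<mu> borel (\<lambda>p. p)) a"
proof -
  note id [measurable] = identity_measurable_strip[OF se]
  have [measurable]: "a \<in> borel_measurable borel" by fact
  have "{-1<..0} \<times> UNIV \<in> sets \<mu>"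
  proof -
    have "{-1<..0} \<times> UNIV = (strip - half_strip)" by (auto simp: strip_def half_strip_def)
    also have "\<dots> \<in> sets \<mu>" unfolding se sets_restrict_space by (auto intro!: image_eqI[of _ _ "- half_strip"])
    finally show ?thesis .
  qed
  then have ae: "AE p in \<mu>. p \<in> half_strip"
    using null by (intro AE_I[where N="{-1<..0} \<times> UNIV"]) (auto simp: sp strip_def half_strip_def)
  have "F_infty \<mu> = (\<integral>\<^sup>+p. ennreal ((snd p)\<^sup>2) + slope_energy (snd p) (a p) \<partial>\<mu>)"
    unfolding F_infty_def
  proof (rule nn_integral_cong_AE)
    show "AE p in \<mu>. (ennreal ((snd p)\<^sup>2) + slope_energy (snd p) (dx_density \<mu> p)) * indicator half_strip p =
        ennreal ((snd p)\<^sup>2) + slope_energy (snd p) (a p)"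
      using ae a(2) by eventually_elim simp
  qed
  also have "\<dots> = sheet_energy (distr \<mu> borel (\<lambda>p. p)) a"
    unfolding sheet_energy_def by (subst nn_integral_distr) auto
  finally show ?thesis .
qed

lemma test_fun_measurable:
  "\<phi> \<in> test_fun U \<Longrightarrow> \<phi> \<in> borel_measurable borel"
  using test_fun_props(1) borel_measurable_continuous_onI by blast

definition interval_bump :: "real \<Rightarrow> nat \<Rightarrow> real \<Rightarrow> real" where
  "interval_bump s n x = (let N = real (Suc n) in flat1 (N * x + (- N * s - 1)) * flat1 (- N * x + (N - 1)))"

lemma interval_bump_test_fun:
  assumes "0 \<le> s"
  shows "interval_bump s n \<in> test_fun {0<..<1}"
proof (rule test_funI)
  define N where "N = real (Suc n)"
  have N: "N > 0" by (simp add: N_def)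
  have bl: "bounded_linear (\<lambda>p::real. c * p)" for c by (rule bounded_linear_mult_right)
  show "C_k m (interval_bump s n)" for m
    unfolding interval_bump_def[abs_def] Let_def by (intro C_k_mult C_k_affine[OF bl] C_k_flat)
  show "compact {1 / N..1 - 1 / N}" by simp
  have "0 < 1 / N" using N by simp
  then show "{1 / N..1 - 1 / N} \<subseteq> {0<..<1}"
    by (intro subsetI) (simp only: atLeastAtMost_iff greaterThanLessThan_iff, linarith)
  fix x assume "interval_bump s n x \<noteq> 0"
  then have "N * x + (- N * s - 1) > 0" "- N * x + (N - 1) > 0"
    unfolding interval_bump_def Let_def N_def[symmetric] mult_eq_0_iff de_Morgan_disj flat1_eq
    by (meson not_le)+
  moreover have "N * s \<ge> 0" using assms N by simp
  ultimately have "N * x > 1" "N * (1 - x) > 1" by (simp_all add: algebra_simps)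
  then have "x > 1 / N" "1 - x > 1 / N" using N by (simp_all add: pos_divide_less_eq mult.commute)
  then show "x \<in> {1 / N..1 - 1 / N}" by simp
qed

lemma interval_bump_bounded: "\<bar>interval_bump s n x\<bar> \<le> 1"
  using flat1_bounds by (auto simp: interval_bump_def Let_def abs_mult intro!: mult_le_one)

lemma interval_bump_tendsto: "(\<lambda>n. interval_bump s n x) \<longlonglongrightarrow> indicator {s<..<1} x"
proof -
  have inv: "(\<lambda>n. inverse (real (Suc n))) \<longlonglongrightarrow> 0" by (rule LIMSEQ_inverse_real_of_nat)
  have 1: "(\<lambda>n. flat1 (real (Suc n) * (c - inverse (real (Suc n))))) \<longlonglongrightarrow> (if c - 0 > 0 then 1 else 0)" for c
  proof (rule flat_scale_tendsto[OF _ tendsto_diff[OF tendsto_const inv]])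
    have "c - inverse (real (Suc n)) \<le> 0" if "c - 0 = 0" for n using that by simp
    then show "c - 0 < 0 \<or> (\<forall>n. c - inverse (real (Suc n)) \<le> 0) \<or> c - 0 > 0"
      by (metis linorder_neqE_linordered_idom)
  qed simp
  have e: "interval_bump s n x = flat1 (real (Suc n) * ((x - s) - inverse (real (Suc n)))) *
     flat1 (real (Suc n) * ((1 - x) - inverse (real (Suc n))))" for n
  proof -
    have "N * x + (- N * s - 1) = N * (x - s - inverse N)" "- N * x + (N - 1) = N * ((1 - x) - inverse N)" if "N \<noteq> 0" for N
      using that by (simp_all add: algebra_simps)
    then show ?thesis unfolding interval_bump_def Let_def by (metis of_nat_neq_0)
  qed
  have "(if x - s - 0 > 0 then 1 else 0) * (if 1 - x - 0 > 0 then 1 else 0) = (indicator {s<..<1} x :: real)"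
    by (simp add: indicator_def)
  then show ?thesis using tendsto_mult[OF 1 1, of "x - s" "1 - x"] unfolding e by (simp only:)
qed

text \<open>
  The bumps converge to the indicators of the intervals (s,1), and these determine a measure carried
  by (0,1).
\<close>

lemma marginal_from_test_functions:
  assumes se: "sets m = sets borel" and fin: "finite_measure m" and ae: "AE p in m. p \<in> half_strip"
    and marg: "\<And>\<phi>. \<phi> \<in> test_fun {0<..<1::real} \<Longrightarrow> (LINT p|m. \<phi> (fst p)) = (LINT x|U01. 2 * x * \<phi> x)"
  shows "distr m borel fst = density U01 (\<lambda>x. ennreal (2 * x))"
proof (rule measure_eqI_lessThan)
  interpret finite_measure m by fact
  interpret U: prob_space U01 by (rule prob_space_U01)
  note [measurable_cong] = se
  have spm: "space m = UNIV" using sets_eq_imp_space_eq[OF se] by simp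
  have [measurable]: "fst \<in> borel_measurable m" by measurable
  show "emeasure (distr m borel fst) {x<..} < \<infinity>" for x
    by (subst emeasure_distr) (auto simp: less_top[symmetric])
  fix s0 :: real
  define s where "s = max s0 0"
  let ?A = "{p::real\<times>real. fst p \<in> {s<..<1}}"
  have A [measurable]: "?A \<in> sets borel" by measurable
  have u: "integrable U01 (\<lambda>x. 2 * x)"
  proof (rule U.integrable_const_bound[where B=2])
    show "AE x in U01. norm (2 * x) \<le> 2" using AE_U01 by eventually_elim auto
  qed simp
  have "(\<lambda>n. LINT p|m. interval_bump s n (fst p)) \<longlonglongrightarrow> (LINT p|m. indicator {s<..<1} (fst p))"
    by (rule integral_dominated_convergence[where w="\<lambda>_. 1"])
       (auto intro!: AE_I2 interval_bump_tendsto simp: interval_bump_bounded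
          intro: measurable_compose[OF _ test_fun_measurable[OF interval_bump_test_fun]] simp: s_def)
  moreover have "(\<lambda>n. LINT x|U01. 2 * x * interval_bump s n x) \<longlonglongrightarrow> (LINT x|U01. 2 * x * indicator {s<..<1} x)"
  proof (rule integral_dominated_convergence[where w="\<lambda>x. \<bar>2 * x\<bar>"])
    show "(\<lambda>x. 2 * x * interval_bump s n x) \<in> borel_measurable U01" for n
      using test_fun_measurable[OF interval_bump_test_fun, of s n] by (simp add: s_def)
    show "integrable U01 (\<lambda>x. \<bar>2 * x\<bar>)" using u by (rule integrable_abs)
    show "AE x in U01. (\<lambda>n. 2 * x * interval_bump s n x) \<longlonglongrightarrow> 2 * x * indicator {s<..<1} x"
      by (intro AE_I2 tendsto_mult tendsto_const interval_bump_tendsto)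
    show "AE x in U01. norm (2 * x * interval_bump s n x) \<le> \<bar>2 * x\<bar>" for n
    proof (rule AE_I2)
      fix x show "norm (2 * x * interval_bump s n x) \<le> \<bar>2 * x\<bar>"
        using mult_left_mono[OF interval_bump_bounded[of s n x], of "\<bar>2 * x\<bar>"] by (simp add: abs_mult)
    qed
  qed simp
  moreover have "(LINT p|m. interval_bump s n (fst p)) = (LINT x|U01. 2 * x * interval_bump s n x)" for n
    by (rule marg, rule interval_bump_test_fun) (simp add: s_def)
  ultimately have "(LINT p|m. indicator {s<..<1} (fst p)) = (LINT x|U01. 2 * x * indicator {s<..<1} x)"
    by (simp add: LIMSEQ_unique)
  moreover have "(LINT p|m. indicator {s<..<1} (fst p)) = measure m ?A"
  proof -
    have "(\<lambda>p. indicator {s<..<1} (fst p) :: real) = indicator ?A" by (auto simp: indicator_def fun_eq_iff)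
    then show ?thesis by (simp add: spm)
  qed
  ultimately have eq: "measure m ?A = (LINT x|U01. 2 * x * indicator {s<..<1} x)" by simp
  have "emeasure (distr m borel fst) {s0<..} = emeasure m ?A"
  proof (subst emeasure_distr)
    show "emeasure m (fst -` {s0<..} \<inter> space m) = emeasure m ?A"
      by (rule emeasure_eq_AE) (use ae in \<open>auto simp: s_def half_strip_def elim!: eventually_mono\<close>)
  qed auto
  also have "\<dots> = ennreal (LINT x|U01. 2 * x * indicator {s<..<1} x)"
    unfolding emeasure_eq_measure eq ..
  also have "\<dots> = (\<integral>\<^sup>+x. ennreal (2 * x * indicator {s<..<1} x) \<partial>U01)"
  proof (rule nn_integral_eq_integral[symmetric])
    show "integrable U01 (\<lambda>x. 2 * x * indicator {s<..<1} x)"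
      by (rule integrable_bounded_mult(2)[OF u, where K=1]) (auto simp: indicator_def)
    show "AE x in U01. 0 \<le> 2 * x * indicator {s<..<1} x"
      using AE_U01 by eventually_elim auto
  qed
  also have "\<dots> = (\<integral>\<^sup>+x. ennreal (2 * x) * indicator {s0<..} x \<partial>U01)"
    by (rule nn_integral_cong_AE) (use AE_U01 in \<open>eventually_elim, auto simp: s_def indicator_def\<close>)
  also have "\<dots> = emeasure (density U01 (\<lambda>x. ennreal (2 * x))) {s0<..}"
    by (subst emeasure_density) auto
  finally show "emeasure (distr m borel fst) {s0<..} = emeasure (density U01 (\<lambda>x. ennreal (2 * x))) {s0<..}" .
qed auto

lemma test_fun_strip_deriv_measurable:
  assumes "\<phi> \<in> test_fun strip"
  shows "(\<lambda>p. deriv (\<lambda>t. \<phi> (t, snd p)) (fst p)) \<in> borel_measurable borel"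
proof -
  obtain D B where D: "continuous_on UNIV D" "\<And>x k. deriv (\<lambda>t. \<phi> (t, k)) x = D (x, k)"
    using test_fun_strip_x_derivative[OF assms] by metis
  then have "(\<lambda>p. deriv (\<lambda>t. \<phi> (t, snd p)) (fst p)) = D" by auto
  with D(1) show ?thesis by (simp add: borel_measurable_continuous_onI)
qed

text \<open>
  The density a is the Radon-Nikodym derivative of the x-derivative, so that integrating a test function
  against the signed measure is integrating it against a m.
\<close>

lemma M_infty_imp_sheet:
  assumes \<mu>: "\<mu> \<in> M_infty"
  defines "a \<equiv> \<lambda>p. indicator strip p *\<^sub>R dx_density \<mu> p"
  shows "sheet (distr \<mu> borel (\<lambda>p. p)) a" "F_infty \<mu> = sheet_energy (distr \<mu> borel (\<lambda>p. p)) a"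
proof -
  let ?m = "distr \<mu> borel (\<lambda>p. p)"
  have sp: "space \<mu> = strip" and se: "sets \<mu> = sets (restrict_space borel strip)" and fin: "finite_measure \<mu>"
    and null: "emeasure \<mu> ({-1<..0} \<times> UNIV) = 0" and ex: "\<exists>\<nu>. is_x_derivative \<mu> \<nu>"
    and ac: "signed_abs_cont \<mu> (x_derivative \<mu>)"
    and marg: "\<And>\<phi>. \<phi> \<in> test_fun {0<..<1::real} \<Longrightarrow>
        (LINT p:half_strip|\<mu>. \<phi> (fst p)) = (LINT x:{0<..<1}|lebesgue. 2 * x * \<phi> x)"
    using \<mu> by (auto simp: M_infty_def)
  interpret \<mu>: finite_measure \<mu> by fact
  note id [measurable] = identity_measurable_strip[OF se]
  have d: "is_x_derivative \<mu> (x_derivative \<mu>)" unfolding x_derivative_def using ex by (rule someI_ex)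
  then have sm: "signed_measure_on \<mu> (x_derivative \<mu>)" by (simp add: is_x_derivative_def)
  note RN = \<mu>.signed_Radon_Nikodym[OF sm ac, folded dx_density_def]
  have am: "a \<in> borel_measurable borel"
  proof -
    have "dx_density \<mu> \<in> borel_measurable (restrict_space borel strip)"
      using RN(1) unfolding measurable_cong_sets[OF se[symmetric] refl] by simp
    then show ?thesis unfolding a_def by (subst (asm) borel_measurable_restrict_space_iff) auto
  qed
  note [measurable] = am
  have aeq: "a p = dx_density \<mu> p" if "p \<in> space \<mu>" for p using that by (simp add: a_def sp)
  show "F_infty \<mu> = sheet_energy ?m a"
    by (rule F_infty_eq_extension[OF se sp null am]) (simp add: aeq)
  have ai: "integrable \<mu> a" using RN(1) by (subst Bochner_Integration.integrable_cong[OF refl aeq]) auto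
  have finm: "finite_measure ?m" by (rule \<mu>.finite_measure_distr) measurable
  have null': "emeasure ?m (- half_strip) = 0"
  proof -
    have "(\<lambda>p. p) -` (- half_strip) \<inter> space \<mu> = {-1<..0} \<times> UNIV" by (auto simp: sp strip_def half_strip_def)
    then show ?thesis using null by (subst emeasure_distr) auto
  qed
  have aem: "AE p in ?m. p \<in> half_strip" by (rule emeasure_0_AE) (use null' in auto)
  show "sheet ?m a"
    unfolding sheet_def
  proof (intro conjI ballI)
    show "finite_measure ?m" "emeasure ?m (- half_strip) = 0" by fact+
    show "integrable ?m a" using ai by (subst integrable_distr_eq) auto
    show "(LINT p|?m. \<phi> p * a p) = - (LINT p|?m. deriv (\<lambda>t. \<phi> (t, snd p)) (fst p))"
      if \<phi>: "\<phi> \<in> test_fun strip" for \<phi>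
    proof -
      note [measurable] = test_fun_measurable[OF \<phi>] test_fun_strip_deriv_measurable[OF \<phi>]
      obtain B where B: "\<And>p. \<bar>\<phi> p\<bar> \<le> B" using test_fun_props(4)[OF \<phi>] by metis
      have "(LINT p|?m. \<phi> p * a p) = (LINT p|\<mu>. \<phi> p * a p)"
        by (subst integral_distr) auto
      also have "\<dots> = (LINT p|\<mu>. \<phi> p * dx_density \<mu> p)"
        by (rule Bochner_Integration.integral_cong) (auto simp: aeq)
      also have "\<dots> = signed_integral \<mu> (x_derivative \<mu>) \<phi>"
        by (rule signed_integral_density[OF RN, symmetric, where K=B]) (simp_all add: B)
      also have "\<dots> = - (LINT (x, k)|\<mu>. deriv (\<lambda>t. \<phi> (t, k)) x)"
        using d \<phi> by (simp add: is_x_derivative_def)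
      also have "(LINT (x, k)|\<mu>. deriv (\<lambda>t. \<phi> (t, k)) x) = (LINT p|\<mu>. deriv (\<lambda>t. \<phi> (t, snd p)) (fst p))"
        by (simp add: case_prod_beta')
      also have "\<dots> = (LINT p|?m. deriv (\<lambda>t. \<phi> (t, snd p)) (fst p))"
        by (subst integral_distr) auto
      finally show ?thesis .
    qed
    show "distr ?m borel fst = density U01 (\<lambda>x. ennreal (2 * x))"
    proof (rule marginal_from_test_functions[OF _ finm aem])
      fix \<phi> :: "real \<Rightarrow> real" assume \<phi>: "\<phi> \<in> test_fun {0<..<1}"
      note [measurable] = test_fun_measurable[OF \<phi>]
      have \<phi>0: "\<phi> x \<noteq> 0 \<Longrightarrow> 0 < x \<and> x < 1" for x using test_fun_props(6)[OF \<phi>, of x] by auto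
      have "(LINT p|?m. \<phi> (fst p)) = (LINT p|\<mu>. \<phi> (fst p))"
        by (subst integral_distr) auto
      also have "\<dots> = (LINT p:half_strip|\<mu>. \<phi> (fst p))"
        unfolding set_lebesgue_integral_def
        by (rule Bochner_Integration.integral_cong) (auto simp: half_strip_def indicator_def \<phi>0)
      also have "\<dots> = (LINT x:{0<..<1}|lebesgue. 2 * x * \<phi> x)" by (rule marg[OF \<phi>])
      also have "\<dots> = (LINT x|U01. 2 * x * \<phi> x)" by (rule lebesgue_integral_eq_U01) simp
      finally show "(LINT p|?m. \<phi> (fst p)) = (LINT x|U01. 2 * x * \<phi> x)" .
    qed simp
  qed (simp_all add: am)
qed

text \<open>
  The signed measure a m is an x-derivative of the restriction of m. By uniqueness it is the one that enters the
  functional, and a agrees almost everywhere with its Radon-Nikodym density.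
\<close>

lemma sheet_imp_M_infty:
  assumes s: "sheet m a"
  shows "restrict_space m strip \<in> M_infty" "F_infty (restrict_space m strip) = sheet_energy m a"
proof -
  define \<mu> where "\<mu> = restrict_space m strip"
  note sh = sheetD[OF s]
  interpret m: finite_measure m by (rule sh)
  note [measurable] = sh(5)
  note [measurable_cong] = sh(1)
  have [measurable]: "fst \<in> borel_measurable m" by (simp add: measurable_cong_sets[OF sh(1) refl])
  have sp: "space \<mu> = strip" by (simp add: \<mu>_def space_restrict_space sh(2))
  have se: "sets \<mu> = sets (restrict_space borel strip)"
    unfolding \<mu>_def by (rule sets_restrict_space_cong[OF sh(1)])
  note id [measurable] = identity_measurable_strip[OF se]
  have fin: "finite_measure \<mu>" unfolding \<mu>_def by (rule finite_measure_restrict_space) (auto simp: sh m.finite_measure_axioms)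
  interpret \<mu>: finite_measure \<mu> by fact
  have em: "emeasure \<mu> A = emeasure m A" if "A \<subseteq> strip" for A
    unfolding \<mu>_def by (rule emeasure_restrict_space) (auto simp: sh that)
  have dm: "distr \<mu> borel (\<lambda>p. p) = m"
  proof (rule measure_eqI)
    fix A assume "A \<in> sets (distr \<mu> borel (\<lambda>p. p))"
    then have A [measurable]: "A \<in> sets borel" by simp
    have "emeasure (distr \<mu> borel (\<lambda>p. p)) A = emeasure \<mu> (A \<inter> strip)"
      by (subst emeasure_distr) (auto simp: sp)
    also have "\<dots> = emeasure m (A \<inter> strip)" by (rule em) auto
    also have "\<dots> = emeasure m A"
      by (rule emeasure_eq_AE) (use sh(4) half_strip_subset in \<open>auto elim!: eventually_mono simp: sh(1)\<close>)
    finally show "emeasure (distr \<mu> borel (\<lambda>p. p)) A = emeasure m A" .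
  qed (simp add: sh)
  have null: "emeasure \<mu> ({-1<..0} \<times> UNIV) = 0"
  proof -
    have "{-1<..0} \<times> UNIV \<subseteq> strip" by (auto simp: strip_def)
    from em[OF this] have "emeasure \<mu> ({-1<..0} \<times> UNIV) = emeasure m ({-1<..0} \<times> UNIV)" .
    also have "\<dots> \<le> emeasure m (- half_strip)"
    proof (rule emeasure_mono)
      show "- half_strip \<in> sets m" unfolding sh(1) by measurable
    qed (auto simp: half_strip_def)
    finally show ?thesis using s by (simp add: sheet_def)
  qed
  have ai: "integrable \<mu> a"
    using sh(6) unfolding dm[symmetric] by (subst (asm) integrable_distr_eq) auto
  define \<nu> where "\<nu> A = (LINT p:A|\<mu>. a p)" for A
  have \<nu>: "is_x_derivative \<mu> \<nu>"
    unfolding is_x_derivative_def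
  proof (intro conjI ballI)
    show "signed_measure_on \<mu> \<nu>" by (rule signed_measure_on_density[OF ai]) (simp add: \<nu>_def)
    fix \<phi> assume \<phi>: "\<phi> \<in> test_fun strip"
    note [measurable] = test_fun_measurable[OF \<phi>] test_fun_strip_deriv_measurable[OF \<phi>]
    obtain B where B: "\<And>p. \<bar>\<phi> p\<bar> \<le> B" using test_fun_props(4)[OF \<phi>] by metis
    have "signed_integral \<mu> \<nu> \<phi> = (LINT p|\<mu>. \<phi> p * a p)"
      by (rule signed_integral_density[OF ai, where K=B]) (simp_all add: B \<nu>_def)
    also have "\<dots> = (LINT p|m. \<phi> p * a p)" unfolding dm[symmetric] by (subst integral_distr) auto
    also have "\<dots> = - (LINT p|m. deriv (\<lambda>t. \<phi> (t, snd p)) (fst p))" by (rule sh(7)[OF \<phi>])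
    also have "(LINT p|m. deriv (\<lambda>t. \<phi> (t, snd p)) (fst p)) = (LINT p|\<mu>. deriv (\<lambda>t. \<phi> (t, snd p)) (fst p))"
      unfolding dm[symmetric] by (subst integral_distr) auto
    finally show "signed_integral \<mu> \<nu> \<phi> = - (LINT (x, k)|\<mu>. deriv (\<lambda>t. \<phi> (t, k)) x)"
      by (simp add: case_prod_beta')
  qed
  then have d: "is_x_derivative \<mu> (x_derivative \<mu>)" unfolding x_derivative_def by (metis someI)
  then have sm: "signed_measure_on \<mu> (x_derivative \<mu>)" by (simp add: is_x_derivative_def)
  have eq: "x_derivative \<mu> A = (LINT p:A|\<mu>. a p)" if "A \<in> sets \<mu>" for A
    using x_derivative_unique[OF sp se d \<nu> that] by (simp add: \<nu>_def)
  have ac: "signed_abs_cont \<mu> (x_derivative \<mu>)"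
    unfolding signed_abs_cont_def
  proof
    fix A assume A: "A \<in> null_sets \<mu>"
    have "(LINT p:A|\<mu>. a p) = (LINT p|\<mu>. 0)"
      unfolding set_lebesgue_integral_def using AE_not_in[OF A] A ai
      by (intro integral_cong_AE) (auto elim!: eventually_mono)
    then show "x_derivative \<mu> A = 0" using A by (simp add: eq null_setsD2)
  qed
  note RN = \<mu>.signed_Radon_Nikodym[OF sm ac, folded dx_density_def]
  have ad: "AE p in \<mu>. a p = dx_density \<mu> p"
    by (rule density_unique_real[OF ai RN(1)]) (use RN(2) eq in simp)
  show "\<mu> \<in> M_infty"
    unfolding M_infty_def
  proof (intro CollectI conjI ballI)
    show "\<exists>\<nu>. is_x_derivative \<mu> \<nu>" using \<nu> by blast
    fix \<phi> :: "real \<Rightarrow> real" assume \<phi>: "\<phi> \<in> test_fun {0<..<1}"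
    note [measurable] = test_fun_measurable[OF \<phi>]
    have \<phi>0: "\<phi> x \<noteq> 0 \<Longrightarrow> 0 < x \<and> x < 1" for x using test_fun_props(6)[OF \<phi>, of x] by auto
    have "(LINT p:half_strip|\<mu>. \<phi> (fst p)) = (LINT p|\<mu>. \<phi> (fst p))"
      unfolding set_lebesgue_integral_def
      by (rule Bochner_Integration.integral_cong) (auto simp: half_strip_def indicator_def \<phi>0)
    also have "\<dots> = (LINT p|m. \<phi> (fst p))" unfolding dm[symmetric] by (subst integral_distr) auto
    also have "\<dots> = (LINT x|distr m borel fst. \<phi> x)" by (subst integral_distr) auto
    also have "\<dots> = (LINT x|U01. 2 * x * \<phi> x)" unfolding sh(8)
    proof (subst integral_density)
      show "AE x in U01. 0 \<le> 2 * x" using AE_U01 by eventually_elim auto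
    qed auto
    also have "\<dots> = (LINT x:{0<..<1}|lebesgue. 2 * x * \<phi> x)"
      by (rule lebesgue_integral_eq_U01[symmetric]) simp
    finally show "(LINT p:half_strip|\<mu>. \<phi> (fst p)) = (LINT x:{0<..<1}|lebesgue. 2 * x * \<phi> x)" .
  qed (fact sp se fin null ac)+
  show "F_infty \<mu> = sheet_energy m a"
    using F_infty_eq_extension[OF se sp null sh(5) ad] by (simp add: dm)
qed

section \<open>Primitives on the unit interval\<close>

interpretation U: prob_space U01 by (rule prob_space_U01)

text \<open>
  For 0 < t < 1 this is the integral of h over (0,t), the primitive that vanishes at 0. Written as an
  integral against U01, it is subject to Fubini's theorem.
\<close>

definition prim :: "(real \<Rightarrow> real) \<Rightarrow> real \<Rightarrow> real" where
  "prim h t = (LINT x|U01. indicator {..<t} x * h x)"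

lemma prim_measurable:
  assumes [measurable]: "(\<lambda>(w, x). h w x) \<in> borel_measurable (N \<Otimes>\<^sub>M U01)" "f \<in> borel_measurable N"
  shows "(\<lambda>w. prim (h w) (f w)) \<in> borel_measurable N"
  unfolding prim_def
proof (rule U.borel_measurable_lebesgue_integral)
  have [measurable]: "(\<lambda>p. indicator {..<f (fst p)} (snd p) :: real) \<in> borel_measurable (N \<Otimes>\<^sub>M U01)"
  proof -
    have "(\<lambda>p. indicator {..<f (fst p)} (snd p) :: real) = (\<lambda>p. if snd p < f (fst p) then 1 else 0)"
      by (auto simp: indicator_def fun_eq_iff)
    also have "\<dots> \<in> borel_measurable (N \<Otimes>\<^sub>M U01)" by measurable
    finally show ?thesis .
  qed
  show "(\<lambda>(w, x). indicator {..<f w} x * h w x) \<in> borel_measurable (N \<Otimes>\<^sub>M U01)"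
    unfolding split_beta' by measurable
qed

lemma prim_measurable_pair:
  assumes [measurable]: "(\<lambda>(w, x). h w x) \<in> borel_measurable (N \<Otimes>\<^sub>M U01)"
  shows "(\<lambda>(w, t). prim (h w) t) \<in> borel_measurable (N \<Otimes>\<^sub>M U01)"
  unfolding split_beta'
proof (rule prim_measurable)
  have "(\<lambda>q. (fst (fst q), snd q)) \<in> measurable ((N \<Otimes>\<^sub>M U01) \<Otimes>\<^sub>M U01) (N \<Otimes>\<^sub>M U01)"
    by measurable
  from measurable_compose[OF this assms]
  show "(\<lambda>(p, x). h (fst p) x) \<in> borel_measurable ((N \<Otimes>\<^sub>M U01) \<Otimes>\<^sub>M U01)"
    by (simp add: split_beta')
  show "snd \<in> borel_measurable (N \<Otimes>\<^sub>M U01)"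
    using measurable_snd[of N U01] measurable_cong_sets[OF refl sets_U01, of "N \<Otimes>\<^sub>M U01"] by (rule back_subst)
qed

lemma prim_measurable_fiber [measurable]:
  assumes "h \<in> borel_measurable borel"
  shows "prim h \<in> borel_measurable borel"
proof (rule prim_measurable[of "\<lambda>_. h" borel "\<lambda>t. t"])
  have "h \<in> borel_measurable U01" using assms by simp
  then show "(\<lambda>(w::real, x). h x) \<in> borel_measurable (borel \<Otimes>\<^sub>M U01)"
    unfolding split_beta' by (rule measurable_compose[OF measurable_snd])
qed simp

lemma norm_integral_le_nn_integral:
  fixes f :: "'a \<Rightarrow> real"
  shows "ennreal \<bar>LINT x|M. f x\<bar> \<le> (\<integral>\<^sup>+x. ennreal \<bar>f x\<bar> \<partial>M)"
proof (cases "integrable M f")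
  case True
  from integral_norm_bound_ennreal[OF this] show ?thesis by simp
qed (simp add: not_integrable_integral_eq)

lemma prim_le_nn_integral: "ennreal \<bar>prim h t\<bar> \<le> (\<integral>\<^sup>+x. ennreal \<bar>h x\<bar> \<partial>U01)"
  unfolding prim_def
  by (rule order.trans[OF norm_integral_le_nn_integral])
     (auto intro!: nn_integral_mono ennreal_leI simp: indicator_def)

lemma fiber_Fubini:
  fixes h :: "real \<Rightarrow> real" and w :: "real \<Rightarrow> real \<Rightarrow> real"
  assumes h: "integrable U01 h" and w [measurable]: "(\<lambda>(x, t). w x t) \<in> borel_measurable (U01 \<Otimes>\<^sub>M U01)"
    and bd: "\<And>x t. \<bar>w x t\<bar> \<le> K"
  shows "(LINT x|U01. h x * (LINT t|U01. w x t)) = (LINT t|U01. LINT x|U01. w x t * h x)"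
proof -
  interpret P: pair_sigma_finite U01 U01 ..
  have [measurable]: "h \<in> borel_measurable U01" using h by auto
  have int: "integrable (U01 \<Otimes>\<^sub>M U01) (\<lambda>(x, t). w x t * h x)"
  proof (rule P.Fubini_integrable)
    show "AE x in U01. integrable U01 (\<lambda>t. case (x, t) of (x, t) \<Rightarrow> w x t * h x)"
    proof (rule AE_I2)
      fix x
      have "integrable U01 (w x)"
        by (rule U.integrable_const_bound[where B=K]) (auto simp: bd)
      then show "integrable U01 (\<lambda>t. case (x, t) of (x, t) \<Rightarrow> w x t * h x)" by simp
    qed
    have eq: "(LINT t|U01. norm (case (x, t) of (x, t) \<Rightarrow> w x t * h x)) = (LINT t|U01. \<bar>w x t\<bar>) * \<bar>h x\<bar>" for x
      by (simp add: abs_mult)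
    show "integrable U01 (\<lambda>x. LINT t|U01. norm (case (x, t) of (x, t) \<Rightarrow> w x t * h x))"
      unfolding eq
    proof (rule integrable_bounded_mult(1)[where K=K])
      show "integrable U01 (\<lambda>x. \<bar>h x\<bar>)" using h by auto
      show "(\<lambda>x. LINT t|U01. \<bar>w x t\<bar>) \<in> borel_measurable U01" by measurable
      have "(LINT t|U01. \<bar>w x t\<bar>) \<le> (LINT t|U01. K)" for x
        by (rule integral_mono) (auto intro!: U.integrable_const_bound[where B=K] simp: bd)
      then show "\<bar>LINT t|U01. \<bar>w x t\<bar>\<bar> \<le> K" for x
        by (simp add: U.prob_space[simplified] abs_of_nonneg[OF integral_nonneg])
    qed
  qed (auto simp: split_beta')
  have "(LINT x|U01. h x * (LINT t|U01. w x t)) = (LINT x|U01. LINT t|U01. w x t * h x)"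
    by (simp add: mult.commute)
  also have "\<dots> = (LINT t|U01. LINT x|U01. w x t * h x)"
    by (rule P.Fubini_integral[symmetric]) (use int in simp)
  finally show ?thesis .
qed

lemma indicator_less_measurable [measurable (raw)]:
  assumes [measurable]: "f \<in> borel_measurable N" "g \<in> borel_measurable N"
  shows "(\<lambda>w. indicator {..<f w} (g w :: real) :: real) \<in> borel_measurable N"
proof -
  have "(\<lambda>w. indicator {..<f w} (g w) :: real) = (\<lambda>w. if g w < f w then 1 else 0)"
    by (auto simp: indicator_def fun_eq_iff)
  also have "\<dots> \<in> borel_measurable N" by measurable
  finally show ?thesis .
qed

text \<open>
  Write \<phi>(x) as the integral of -D over (x,1), and exchange the order of integration. No boundary term
  appears: the primitive vanishes at 0 and \<phi> vanishes at 1.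
\<close>

lemma fiber_integration_by_parts:
  assumes h: "integrable U01 h"
    and D: "continuous_on UNIV D" "\<And>x. \<bar>D x\<bar> \<le> B" "\<And>x. (\<phi> has_real_derivative D x) (at x)" and \<phi>1: "\<phi> 1 = 0"
  shows "(LINT t|U01. D t * prim h t) = - (LINT x|U01. \<phi> x * h x)"
proof -
  have [measurable]: "D \<in> borel_measurable borel" "h \<in> borel_measurable borel"
    using borel_measurable_continuous_onI[OF D(1)] h by auto
  have FTC: "(LINT t|U01. indicator {..<t} x * D t) = - \<phi> x" if "x \<in> {0<..<1}" for x
  proof -
    have "(LINT t|U01. indicator {..<t} x * D t) = (LINT t|lborel. D t * indicator {x .. 1} t)"
    proof (subst integral_U01, measurable, unfold set_lebesgue_integral_def, rule integral_cong_AE)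
      show "AE t in lborel. indicator {0<..<1} t *\<^sub>R (indicator {..<t} x * D t) = D t * indicator {x..1} t"
        using AE_lborel_singleton[of x] AE_lborel_singleton[of 1]
        by eventually_elim (use that in \<open>auto simp: indicator_def\<close>)
    qed measurable
    also have "\<dots> = \<phi> 1 - \<phi> x"
    proof (rule integral_FTC_Icc_real)
      show "isCont D t" for t using D(1) by (simp add: continuous_on_eq_continuous_at)
    qed (use that D(3) in auto)
    finally show ?thesis using \<phi>1 by simp
  qed
  have "(LINT t|U01. D t * prim h t) = (LINT t|U01. LINT x|U01. (indicator {..<t} x * D t) * h x)"
    unfolding prim_def by (simp add: ac_simps flip: Bochner_Integration.integral_mult_right_zero)
  also have "\<dots> = (LINT x|U01. h x * (LINT t|U01. indicator {..<t} x * D t))"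
    by (rule fiber_Fubini[OF h, symmetric, where K=B])
       (auto simp: split_beta' indicator_def D(2) intro: order.trans[OF abs_ge_zero D(2)])
  also have "\<dots> = (LINT x|U01. - (\<phi> x * h x))"
  proof (rule integral_cong_AE)
    show "AE x in U01. h x * (LINT t|U01. indicator {..<t} x * D t) = - (\<phi> x * h x)"
      using AE_U01 by eventually_elim (simp add: FTC)
    have "continuous_on UNIV \<phi>" using D(3) DERIV_isCont by (auto simp: continuous_on_eq_continuous_at)
    then have [measurable]: "\<phi> \<in> borel_measurable borel" by (rule borel_measurable_continuous_onI)
    show "(\<lambda>x. - (\<phi> x * h x)) \<in> borel_measurable U01" by measurable
  qed measurable
  finally show ?thesis by simp
qed

section \<open>Testing with ramps\<close>

lemma integral_indicator_greater_less:
  assumes "0 < x" "t \<le> 1"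
  shows "(LINT \<tau>|U01. indicator {..<\<tau>} x * indicator {..<t} \<tau>) = (max 0 (t - x) :: real)"
proof -
  have "(LINT \<tau>|U01. indicator {..<\<tau>} x * indicator {..<t} \<tau>) = (LINT \<tau>|lborel. indicator {x..t} \<tau> :: real)"
  proof (subst integral_U01, (unfold set_lebesgue_integral_def)?)
    have m1: "(\<lambda>\<tau>. indicator {..<\<tau>} x :: real) \<in> borel_measurable borel" by (rule indicator_less_measurable) auto
    have m2: "(indicator {..<t} :: real \<Rightarrow> real) \<in> borel_measurable borel" by auto
    show m: "(\<lambda>\<tau>. indicator {..<\<tau>} x * indicator {..<t} \<tau> :: real) \<in> borel_measurable borel"
      by (rule borel_measurable_times[OF m1 m2])
    show "(LINT \<tau>|lborel. indicator {0<..<1} \<tau> *\<^sub>R (indicator {..<\<tau>} x * indicator {..<t} \<tau>)) =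
        (LINT \<tau>|lborel. indicator {x..t} \<tau> :: real)"
    proof (rule integral_cong_AE)
      show "AE \<tau> in lborel. indicator {0<..<1} \<tau> *\<^sub>R (indicator {..<\<tau>} x * indicator {..<t} \<tau>) = (indicator {x..t} \<tau> :: real)"
        using AE_lborel_singleton[of x] AE_lborel_singleton[of t]
        by eventually_elim (use assms in \<open>auto simp: indicator_def\<close>)
      show "(\<lambda>\<tau>. indicator {0<..<1} \<tau> *\<^sub>R (indicator {..<\<tau>} x * indicator {..<t} \<tau>) :: real) \<in> borel_measurable lborel"
        using m by (intro borel_measurable_scaleR) auto
    qed auto
  qed
  then show ?thesis by (cases "x \<le> t") auto
qed

lemma signed_measure_on_push:
  fixes h :: "'a \<Rightarrow> real"
  assumes h: "integrable Q h" and T [measurable]: "T \<in> measurable Q N"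
  shows "signed_measure_on N (\<lambda>E. LINT q|Q. indicator E (T q) * h q)"
proof -
  have s: "signed_measure_on Q (\<lambda>A. LINT q:A|Q. h q)" by (rule signed_measure_on_density[OF h]) simp
  have e: "(LINT q|Q. indicator E (T q) * h q) = (LINT q:(T -` E \<inter> space Q)|Q. h q)" for E
    unfolding set_lebesgue_integral_def by (rule Bochner_Integration.integral_cong) (auto simp: indicator_def)
  show ?thesis
    unfolding signed_measure_on_def e
  proof (intro conjI allI impI)
    show "(LINT q:(T -` {} \<inter> space Q)|Q. h q) = 0" by (simp add: set_lebesgue_integral_def)
    fix A :: "nat \<Rightarrow> _" assume A: "range A \<subseteq> sets N" "disjoint_family A"
    have "(\<lambda>i. LINT q:(T -` A i \<inter> space Q)|Q. h q) sums (LINT q:(\<Union>i. T -` A i \<inter> space Q)|Q. h q)"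
      using A by (intro signed_measure_on_sums[OF s]) (auto simp: disjoint_family_on_def intro!: measurable_sets[OF T])
    then show "(\<lambda>i. LINT q:(T -` A i \<inter> space Q)|Q. h q) sums (LINT q:(T -` (\<Union>i. A i) \<inter> space Q)|Q. h q)"
      by (simp add: vimage_UN Int_UN_distrib2)
  qed
qed

lemma (in finite_measure) signed_measure_on_measure: "signed_measure_on M (measure M)"
  unfolding signed_measure_on_def by (auto intro!: finite_measure_UNION)

text \<open>
  A smooth version of (t - x)^+ on {k < d}. With N = n + 1, the linear factor t - 1/N - x is cut off by a
  flat function of N (t - 1/N - x), that is, where it vanishes; the factor flat1(N x + N/2) vanishes for
  x \<le> -1/2, and the last two factors cut off in k.
\<close>

definition ramp_bump :: "real \<Rightarrow> real \<Rightarrow> nat \<Rightarrow> real \<times> real \<Rightarrow> real" where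
  "ramp_bump t d n p = (let N = real (Suc n) in
     ((t - 1 / N - fst p) * flat1 (- N * fst p + (N * t - 1))) * flat1 (N * fst p + N / 2) *
     (flat1 (- N * snd p + N * d) * flat1 (N * snd p + N * N)))"

lemma C_k_id: "C_k n (\<lambda>x::real. x)"
proof (cases n)
  case (Suc m)
  then show ?thesis by (auto simp del: C_k.simps intro!: C_k_SucI[where D="\<lambda>_ v. v"] C_k_const)
qed simp

lemma ramp_bump_test_fun:
  assumes "t \<le> 1"
  shows "ramp_bump t d n \<in> test_fun strip"
proof (rule test_funI)
  define N where "N = real (Suc n)"
  have N: "N > 0" by (simp add: N_def)
  have bl: "bounded_linear (\<lambda>p::real\<times>real. c * fst p)" "bounded_linear (\<lambda>p::real\<times>real. c * snd p)" for c
    by (auto intro!: bounded_linear_intros)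
  have l: "C_k m (\<lambda>p::real\<times>real. t - 1 / real (Suc n) - fst p)" for m
    using C_k_affine[OF bl(1) C_k_id, of m "-1" "t - 1 / real (Suc n)"] by simp
  show "C_k m (ramp_bump t d n)" for m
    unfolding ramp_bump_def[abs_def] Let_def
    by (intro C_k_mult l C_k_affine[OF bl(1)] C_k_affine[OF bl(2)] C_k_flat)
  show "compact ({-1/2..1 - 1 / N} \<times> {-N..d})" by (intro compact_Times) auto
  have "0 < 1 / N" using N by simp
  then have "{-1/2..1 - 1 / N} \<subseteq> {-1<..<1}" by (intro subsetI) (simp only: atLeastAtMost_iff greaterThanLessThan_iff, linarith)
  then show "{-1/2..1 - 1 / N} \<times> {-N..d} \<subseteq> strip" unfolding strip_def by (intro Sigma_mono) auto
  fix p assume "ramp_bump t d n p \<noteq> 0"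
  then have "- N * fst p + (N * t - 1) > 0" "N * fst p + N / 2 > 0" "- N * snd p + N * d > 0"
    "N * snd p + N * N > 0"
    unfolding ramp_bump_def Let_def N_def[symmetric] mult_eq_0_iff de_Morgan_disj flat1_eq
    by (meson not_le)+
  moreover have "N * t \<le> N * 1" using assms N by (intro mult_left_mono) auto
  ultimately have "N * (1 - fst p) > 1" "N * (fst p + 1 / 2) > 0" "N * (d - snd p) > 0" "N * (snd p + N) > 0"
    by (simp_all add: algebra_simps)
  then have "1 - fst p > 1 / N" "fst p + 1 / 2 > 0" "d - snd p > 0" "snd p + N > 0"
    using N by (simp_all only: pos_divide_less_eq mult.commute zero_less_mult_iff) auto
  then show "p \<in> {-1/2..1 - 1 / N} \<times> {-N..d}" by (cases p) auto
qed

lemma snd_bump_tendsto: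
  fixes k d :: real
  shows "(\<lambda>n. flat1 (- real (Suc n) * k + real (Suc n) * d) * flat1 (real (Suc n) * k + real (Suc n) * real (Suc n)))
    \<longlonglongrightarrow> indicator {..<d} k"
proof -
  have 3: "(\<lambda>n. flat1 (real (Suc n) * (d - k))) \<longlonglongrightarrow> (if d - k > 0 then 1 else 0)"
    by (rule flat_scale_const_tendsto) simp
  have 4: "(\<lambda>n. flat1 (real (Suc n) * (k + real (Suc n)))) \<longlonglongrightarrow> 1"
  proof (rule tendsto_sandwich[OF _ _ _ tendsto_const])
    obtain m where m: "real m > 1 - k" using reals_Archimedean2 by blast
    show "\<forall>\<^sub>F n in sequentially. flat1 (real (Suc n) * 1) \<le> flat1 (real (Suc n) * (k + real (Suc n)))"
      unfolding eventually_sequentially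
    proof (intro exI allI impI)
      fix n assume "m \<le> n"
      then have "k + real (Suc n) \<ge> 1" using m by simp
      then have "real (Suc n) * 1 \<le> real (Suc n) * (k + real (Suc n))" by (intro mult_left_mono) auto
      moreover have "flat1 x \<le> flat1 y" if "x \<le> y" for x y
        using that by (auto simp: flat1_eq intro!: divide_left_mono)
      ultimately show "flat1 (real (Suc n) * 1) \<le> flat1 (real (Suc n) * (k + real (Suc n)))" by blast
    qed
    show "(\<lambda>n. flat1 (real (Suc n) * 1)) \<longlonglongrightarrow> 1"
      using flat_scale_const_tendsto[of 1 1] by simp
  qed (simp_all add: flat1_bounds)
  have e: "- N * k + N * d = N * (d - k)" "N * k + N * N = N * (k + N)" for N :: real
    by (simp_all add: algebra_simps)
  have "(if d - k > 0 then 1 else 0) * 1 = (indicator {..<d} k :: real)" by simp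
  then show ?thesis using tendsto_mult[OF 3 4] unfolding e by (simp only:)
qed

text \<open>
  The cut-off of the ramp has argument z = N (t - 1/N - x), so the ramp part is z flat1(z) / N, whose
  x-derivative - flat [:1,1:] z is bounded independently of N. The factor near x = -1/2 contributes a derivative of order
  1/N at the points with x > 0.
\<close>

lemma ramp_bump_limits:
  assumes t: "t \<le> 1" and p: "0 < fst p" "fst p < 1"
  shows "\<bar>ramp_bump t d n p\<bar> \<le> 1"
    and "(\<lambda>n. ramp_bump t d n p) \<longlonglongrightarrow> max 0 (t - fst p) * indicator {..<d} (snd p)"
    and "\<bar>deriv (\<lambda>x. ramp_bump t d n (x, snd p)) (fst p)\<bar> \<le> 5"
    and "(\<lambda>n. deriv (\<lambda>x. ramp_bump t d n (x, snd p)) (fst p)) \<longlonglongrightarrow> - (indicator ({..<t} \<times> {..<d}) p)"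
proof -
  obtain x k where pe: "p = (x, k)" by (cases p)
  have x: "0 < x" "x < 1" using p by (auto simp: pe)
  define g where "g n = flat1 (- real (Suc n) * k + real (Suc n) * d) * flat1 (real (Suc n) * k + real (Suc n) * real (Suc n))" for n
  have g: "g \<longlonglongrightarrow> indicator {..<d} k" unfolding g_def by (rule snd_bump_tendsto)
  have gb: "\<bar>g n\<bar> \<le> 1" for n using flat1_bounds by (auto simp: g_def abs_mult intro!: mult_le_one)
  define R where "R n = (t - 1 / real (Suc n) - x) * flat1 (- real (Suc n) * x + (real (Suc n) * t - 1))" for n
  define C where "C n = flat1 (real (Suc n) * x + real (Suc n) / 2)" for n
  define E where "E n = real (Suc n) * flat [:0,0,1:] (real (Suc n) * x + real (Suc n) / 2)" for n
  define S where "S n = flat [:1,1:] (- real (Suc n) * x + (real (Suc n) * t - 1))" for n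
  have inv: "(\<lambda>n. inverse (real (Suc n))) \<longlonglongrightarrow> 0" by (rule LIMSEQ_inverse_real_of_nat)
  have arg: "- N * x + (N * t - 1) = N * (t - x - inverse N)" if "N > 0" for N
    using that by (simp add: algebra_simps)
  have arg2: "N * x + N / 2 = N * (x + 1 / 2)" for N by (simp add: algebra_simps)
  have step: "(\<lambda>n. flat q (- real (Suc n) * x + (real (Suc n) * t - 1))) \<longlonglongrightarrow> (if t - x - 0 > 0 then 1 else 0)"
    if "poly q 0 = 1" for q
    unfolding arg[OF of_nat_0_less_iff[THEN iffD2, OF zero_less_Suc]]
  proof (rule flat_scale_tendsto[OF that tendsto_diff[OF tendsto_const inv]])
    have "t - x - inverse (real (Suc n)) \<le> 0" if "t - x - 0 = 0" for n using that by simp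
    then show "t - x - 0 < 0 \<or> (\<forall>n. t - x - inverse (real (Suc n)) \<le> 0) \<or> t - x - 0 > 0"
      by (metis linorder_neqE_linordered_idom)
  qed
  have Sb: "\<bar>S n\<bar> \<le> 1" for n unfolding S_def by (rule flat_11_bounds)
  have S: "S \<longlonglongrightarrow> (if t - x - 0 > 0 then 1 else 0)" unfolding S_def by (rule step) simp
  have Rb: "\<bar>R n\<bar> \<le> 1" for n
  proof (cases "- real (Suc n) * x + (real (Suc n) * t - 1) \<le> 0")
    case False
    then have "real (Suc n) * (t - x - inverse (real (Suc n))) > 0"
      using arg[of "real (Suc n)"] by simp
    then have "t - x - 1 / real (Suc n) > 0" by (simp add: zero_less_mult_iff inverse_eq_divide del: of_nat_Suc)
    moreover have "1 / real (Suc n) > 0" by simp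
    ultimately have "\<bar>t - 1 / real (Suc n) - x\<bar> \<le> 1" using t x by linarith
    then show ?thesis unfolding R_def abs_mult using flat1_bounds by (intro mult_le_one) auto
  qed (simp add: R_def flat1_eq del: of_nat_Suc)
  have R: "R \<longlonglongrightarrow> max 0 (t - x)"
  proof -
    have "(\<lambda>n. (t - inverse (real (Suc n)) - x) * flat1 (- real (Suc n) * x + (real (Suc n) * t - 1)))
       \<longlonglongrightarrow> (t - 0 - x) * (if t - x - 0 > 0 then 1 else 0)"
      by (intro tendsto_mult tendsto_diff tendsto_const inv step) simp
    moreover have "(t - 0 - x) * (if t - x - 0 > 0 then 1 else 0) = max 0 (t - x)" by (simp add: max_def)
    ultimately show ?thesis unfolding R_def by (simp only: inverse_eq_divide)
  qed
  have Cb: "\<bar>C n\<bar> \<le> 1" for n unfolding C_def by (rule flat1_bounds)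
  have C: "C \<longlonglongrightarrow> 1"
    using flat_scale_const_tendsto[of 1 "x + 1/2"] x unfolding C_def arg2 by simp
  have Eb: "0 \<le> E n \<and> E n \<le> 4 * inverse (real (Suc n))" for n
  proof -
    define N where "N = real (Suc n)"
    have N: "N > 0" by (simp add: N_def)
    have z: "N * x + N / 2 > 0" using N x by (simp add: add_pos_pos)
    have "(N / 2)\<^sup>2 \<le> (N * x + N / 2)\<^sup>2" using N x by (intro power_mono) auto
    moreover have "0 < (N / 2)\<^sup>2" using N by simp
    ultimately have "1 / (N * x + N / 2)\<^sup>2 \<le> 1 / (N / 2)\<^sup>2" by (intro divide_left_mono mult_pos_pos) linarith+
    then have "flat [:0,0,1:] (N * x + N / 2) \<le> 1 / (N / 2)\<^sup>2" using flat_001_bounds[OF z] by linarith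
    then have "N * flat [:0,0,1:] (N * x + N / 2) \<le> N * (1 / (N / 2)\<^sup>2)" using N by (intro mult_left_mono) auto
    also have "\<dots> = 4 * inverse N" using N by (simp add: power2_eq_square field_simps)
    finally show ?thesis using flat_001_bounds[OF z] N unfolding E_def N_def[symmetric] by simp
  qed
  have E: "E \<longlonglongrightarrow> 0"
  proof (rule tendsto_sandwich[OF _ _ tendsto_const])
    show "(\<lambda>n. 4 * inverse (real (Suc n))) \<longlonglongrightarrow> 0" using tendsto_mult[OF tendsto_const[of 4] inv] by simp
  qed (use Eb in simp_all)
  have Eb': "\<bar>E n\<bar> \<le> 4" for n
  proof -
    have "inverse (real (Suc n)) \<le> 1" by (simp add: inverse_eq_divide)
    then show ?thesis using Eb[of n] by linarith
  qed
  have val: "ramp_bump t d n p = R n * C n * g n" for n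
    unfolding ramp_bump_def Let_def R_def C_def g_def pe fst_conv snd_conv ..
  show "\<bar>ramp_bump t d n p\<bar> \<le> 1"
    unfolding val abs_mult using Rb[of n] Cb[of n] gb[of n] by (intro mult_le_one) auto
  show "(\<lambda>n. ramp_bump t d n p) \<longlonglongrightarrow> max 0 (t - fst p) * indicator {..<d} (snd p)"
    unfolding val using tendsto_mult[OF tendsto_mult[OF R C] g] by (simp add: pe)
  have der: "deriv (\<lambda>x. ramp_bump t d n (x, snd p)) (fst p) = (- S n * C n + R n * E n) * g n" for n
  proof (rule DERIV_imp_deriv)
    define N where "N = real (Suc n)"
    have N: "N > 0" by (simp add: N_def)
    define z where "z y = - N * y + (N * t - 1)" for y
    have lin: "(z has_real_derivative - N) (at y)" for y
      unfolding z_def by (auto intro!: derivative_eq_intros)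
    have lin2: "((\<lambda>y. N * y + N / 2) has_real_derivative N) (at y)" for y
      by (auto intro!: derivative_eq_intros)
    have zN: "t - 1 / N - y = z y / N" for y using N by (simp add: z_def field_simps)
    have f11: "w * flat [:0,0,1:] w + flat1 w = flat [:1,1:] w" for w :: real
      by (simp add: flat_def field_simps)
    have dR: "((\<lambda>y. (t - 1 / N - y) * flat1 (z y)) has_real_derivative - flat [:1,1:] (z x)) (at x)"
    proof -
      have "((\<lambda>y. (t - 1 / N - y) * flat1 (z y)) has_real_derivative
          (-1) * flat1 (z x) + (flat [:0,0,1:] (z x) * (- N)) * (t - 1 / N - x)) (at x)"
        by (intro DERIV_mult DERIV_chain2[OF flat1_has_derivative lin]) (auto intro!: derivative_eq_intros)
      moreover have "(-1) * flat1 (z x) + (flat [:0,0,1:] (z x) * (- N)) * (t - 1 / N - x) = - flat [:1,1:] (z x)"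
        unfolding zN f11[symmetric] using N by simp
      ultimately show ?thesis by simp
    qed
    have "((\<lambda>y. (t - 1 / N - y) * flat1 (z y) * flat1 (N * y + N / 2)) has_real_derivative
        (- flat [:1,1:] (z x)) * flat1 (N * x + N / 2) + (flat [:0,0,1:] (N * x + N / 2) * N) * ((t - 1 / N - x) * flat1 (z x))) (at x)"
      by (intro DERIV_mult dR DERIV_chain2[OF flat1_has_derivative lin2])
    from DERIV_cmult_right[OF this, of "g n"]
    show "((\<lambda>x. ramp_bump t d n (x, snd p)) has_real_derivative (- S n * C n + R n * E n) * g n) (at (fst p))"
      unfolding ramp_bump_def Let_def pe fst_conv snd_conv N_def[symmetric]
      by (simp only: z_def S_def C_def R_def E_def g_def N_def ac_simps)
  qed
  show "\<bar>deriv (\<lambda>x. ramp_bump t d n (x, snd p)) (fst p)\<bar> \<le> 5"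
  proof -
    have "\<bar>S n * C n\<bar> \<le> 1" unfolding abs_mult using Sb[of n] Cb[of n] by (intro mult_le_one) auto
    moreover have "\<bar>R n * E n\<bar> \<le> 1 * 4" unfolding abs_mult using Rb[of n] Eb'[of n] by (intro mult_mono) auto
    ultimately have "\<bar>- S n * C n + R n * E n\<bar> \<le> 5" by linarith
    then have "\<bar>- S n * C n + R n * E n\<bar> * \<bar>g n\<bar> \<le> 5 * 1" using gb[of n] by (intro mult_mono) auto
    then show ?thesis unfolding der abs_mult by simp
  qed
  have "(\<lambda>n. (- S n * C n + R n * E n) * g n) \<longlonglongrightarrow>
     (- (if t - x - 0 > 0 then 1 else 0) * 1 + max 0 (t - x) * 0) * indicator {..<d} k"
    by (intro tendsto_intros S C R E g)
  moreover have "(- (if t - x - 0 > 0 then 1 else 0) * 1 + max 0 (t - x) * 0) * indicator {..<d} k =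
     - (indicator ({..<t} \<times> {..<d}) p :: real)"
    by (simp add: pe indicator_def)
  ultimately show "(\<lambda>n. deriv (\<lambda>x. ramp_bump t d n (x, snd p)) (fst p)) \<longlonglongrightarrow> - (indicator ({..<t} \<times> {..<d}) p)"
    unfolding der by (simp only:)
qed

section \<open>Families of profiles\<close>

text \<open>
  A random profile: w selects a wave number Y w and the density prim (\<eta> w) on (0,1) with slope \<eta> w; the last
  clause is the constraint on the x-marginal. The parameter w need not be the wave number: several profiles
  may share the same one, the wave numbers may be changed while the profiles are kept, and sequences of
  families may be coupled on a common probability space.
\<close>

definition profile_family :: "'w measure \<Rightarrow> ('w \<Rightarrow> real) \<Rightarrow> ('w \<Rightarrow> real \<Rightarrow> real) \<Rightarrow> bool" where
  "profile_family \<Omega> Y \<eta> \<longleftrightarrow> prob_space \<Omega> \<and> Y \<in> borel_measurable \<Omega> \<and>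
     (\<lambda>(w, x). \<eta> w x) \<in> borel_measurable (\<Omega> \<Otimes>\<^sub>M U01) \<and>
     (AE w in \<Omega>. integrable U01 (\<eta> w)) \<and>
     (AE w in \<Omega>. AE t in U01. 0 \<le> prim (\<eta> w) t \<and> (prim (\<eta> w) t = 0 \<longrightarrow> \<eta> w t = 0)) \<and>
     (\<forall>A\<in>sets borel. (\<integral>\<^sup>+w. \<integral>\<^sup>+t. ennreal (prim (\<eta> w) t) * indicator A t \<partial>U01 \<partial>\<Omega>) =
        (\<integral>\<^sup>+t. ennreal (2 * t) * indicator A t \<partial>U01))"

text \<open>
  The integrand at a point with wave number k, density g and slope h. For g > 0 it is
  k^2 g + h^2 / (4 k^2 g), which is jointly convex and homogeneous of degree one in (g,h).
\<close>

definition cell_energy :: "real \<Rightarrow> real \<Rightarrow> real \<Rightarrow> ennreal" where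
  "cell_energy k g h = (ennreal (k\<^sup>2) + slope_energy k (h / g)) * ennreal g"

definition fiber_energy :: "real \<Rightarrow> (real \<Rightarrow> real) \<Rightarrow> ennreal" where
  "fiber_energy k h = (\<integral>\<^sup>+t. cell_energy k (prim h t) (h t) \<partial>U01)"

definition profile_energy :: "'w measure \<Rightarrow> ('w \<Rightarrow> real) \<Rightarrow> ('w \<Rightarrow> real \<Rightarrow> real) \<Rightarrow> ennreal" where
  "profile_energy \<Omega> Y \<eta> = (\<integral>\<^sup>+w. fiber_energy (Y w) (\<eta> w) \<partial>\<Omega>)"

section \<open>Disintegration of admissible measures\<close>

lemma integrable_pair_U01:
  fixes a :: "'a \<Rightarrow> real"
  assumes "sigma_finite_measure M" and a: "integrable M a"
    and w: "(\<lambda>(p, t). w p t) \<in> borel_measurable (M \<Otimes>\<^sub>M U01)" and bd: "\<And>p t. \<bar>w p t\<bar> \<le> K"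
  shows "integrable (M \<Otimes>\<^sub>M U01) (\<lambda>(p, t). w p t * a p)"
proof -
  interpret M: sigma_finite_measure M by fact
  interpret P: pair_sigma_finite M U01 ..
  have [measurable]: "a \<in> borel_measurable M" using a by auto
  have "integrable (M \<Otimes>\<^sub>M U01) (\<lambda>q. a (fst q))"
  proof (rule P.Fubini_integrable)
    show "integrable M (\<lambda>x. LINT y|U01. norm (a (fst (x, y))))"
      using a by (simp add: U.prob_space[simplified])
  qed auto
  from integrable_bounded_mult(1)[OF this w, of K] show ?thesis
    using bd by (simp add: split_beta')
qed

lemma integral_id_U01: "(\<integral>\<^sup>+t. ennreal (2 * t) \<partial>U01) = 1"
proof -
  have "(\<integral>\<^sup>+t. ennreal (2 * t) \<partial>U01) = (\<integral>\<^sup>+t. ennreal (2 * t) * indicator {0..1} t \<partial>lborel)"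
  proof (subst nn_integral_U01, simp, rule nn_integral_cong_AE)
    show "AE t in lborel. ennreal (2 * t) * indicator {0<..<1} t = ennreal (2 * t) * indicator {0..1} t"
      using AE_lborel_singleton[of 0] AE_lborel_singleton[of 1]
      by eventually_elim (auto simp: indicator_def)
  qed
  also have "\<dots> = ennreal (1\<^sup>2 - 0\<^sup>2)"
    by (rule nn_integral_FTC_Icc[where F="\<lambda>t. t\<^sup>2"]) (auto intro!: derivative_eq_intros)
  finally show ?thesis by simp
qed

text \<open>
  Test with ramps: the x-derivative of (t - x)^+ on {k < d} is minus the indicator of the quadrant
  {x < t, k < d}, so the mass of the quadrant is the integral of (t - x)^+ against a m over {k < d}. As
  (t - x)^+ is the length of (x,t), this is the formula for quadrants. Both sides are signed measures in E,
  hence agree on all Borel sets. Informally: the density at (\<tau>, k) is the integral of a m over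
  {x < \<tau>} in the fibre of k.
\<close>

lemma sheet_mass_formula:
  assumes s: "sheet m a" and E: "E \<in> sets borel"
  shows "measure m E = (LINT p|m. a p * (LINT \<tau>|U01. indicator {..<\<tau>} (fst p) * indicator E (\<tau>, snd p)))"
proof -
  note sh = sheetD[OF s]
  interpret m: finite_measure m by (rule sh)
  interpret P: pair_sigma_finite m U01 ..
  note [measurable] = sh(5)
  note [measurable_cong] = sh(1)
  have [measurable]: "fst \<in> borel_measurable m" "snd \<in> borel_measurable m"
    by (simp_all add: measurable_cong_sets[OF sh(1) refl])
  let ?h = "\<lambda>(p, \<tau>). indicator {..<\<tau>} (fst p) * a p"
  let ?T = "\<lambda>q. (snd q, snd (fst q))"
  let ?Q = "m \<Otimes>\<^sub>M U01"
  have sndQ [measurable]: "snd \<in> borel_measurable ?Q"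
    using measurable_snd[of m U01] measurable_cong_sets[OF refl sets_U01, of ?Q] by (rule back_subst)
  have T [measurable]: "?T \<in> measurable ?Q borel"
    unfolding borel_prod[symmetric] by measurable
  have ih: "integrable ?Q ?h"
  proof (rule integrable_pair_U01[where K=1])
    show "(\<lambda>(p, t). indicator {..<t} (fst p) :: real) \<in> borel_measurable ?Q"
      unfolding split_beta' by (rule indicator_less_measurable) measurable
  qed (auto simp: sh m.sigma_finite_measure_axioms indicator_def)
  define \<nu> where "\<nu> E = (LINT q|?Q. indicator E (?T q) * ?h q)" for E
  have sm: "signed_measure_on borel \<nu>" unfolding \<nu>_def by (rule signed_measure_on_push[OF ih T])
  have \<nu>: "\<nu> E = (LINT p|m. a p * (LINT \<tau>|U01. indicator {..<\<tau>} (fst p) * indicator E (\<tau>, snd p)))"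
    if [measurable]: "E \<in> sets borel" for E
  proof -
    have "integrable ?Q (\<lambda>q. indicator E (?T q) * ?h q)"
      by (rule integrable_bounded_mult(1)[OF ih, where K=1]) (auto simp: indicator_def)
    from P.integral_fst'[OF this] have "\<nu> E = (LINT p|m. LINT \<tau>|U01. indicator E (\<tau>, snd p) * (indicator {..<\<tau>} (fst p) * a p))"
      by (simp add: \<nu>_def)
    also have "\<dots> = (LINT p|m. a p * (LINT \<tau>|U01. indicator {..<\<tau>} (fst p) * indicator E (\<tau>, snd p)))"
      by (intro Bochner_Integration.integral_cong refl)
         (simp add: ac_simps flip: Bochner_Integration.integral_mult_right_zero)
    finally show ?thesis .
  qed
  have mm: "signed_measure_on borel (measure m)"
    using m.signed_measure_on_measure by (simp add: signed_measure_on_def sh(1))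
  have quad: "measure m ({..<t0} \<times> {..<d}) = \<nu> ({..<t0} \<times> {..<d})" for t0 d :: real
  proof -
    \<comment> \<open>The ramp is a test function only for t \<le> 1, and m is carried by x < 1.\<close>
    define t where "t = min t0 1"
    have t: "t \<le> 1" by (simp add: t_def)
    have Qb [measurable]: "{..<t} \<times> {..<d} \<in> sets borel" for t d :: real
      unfolding borel_prod[symmetric] by auto
    have "(\<lambda>n. LINT p|m. ramp_bump t d n p * a p) \<longlonglongrightarrow> (LINT p|m. max 0 (t - fst p) * indicator {..<d} (snd p) * a p)"
    proof (rule integral_dominated_convergence[where w="\<lambda>p. \<bar>a p\<bar>"])
      show "(\<lambda>p. ramp_bump t d n p * a p) \<in> borel_measurable m" for n
        using test_fun_measurable[OF ramp_bump_test_fun[OF t]] by measurable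
      show "AE p in m. norm (ramp_bump t d n p * a p) \<le> \<bar>a p\<bar>" for n
        using sh(4)
      proof eventually_elim
        case (elim p)
        then have "\<bar>ramp_bump t d n p\<bar> \<le> 1" using ramp_bump_limits(1)[OF t] by (auto simp: half_strip_def)
        then show ?case by (simp add: abs_mult mult_left_le_one_le)
      qed
      show "AE p in m. (\<lambda>n. ramp_bump t d n p * a p) \<longlonglongrightarrow> max 0 (t - fst p) * indicator {..<d} (snd p) * a p"
        using sh(4)
      proof eventually_elim
        case (elim p)
        then show ?case using ramp_bump_limits(2)[OF t] by (intro tendsto_mult tendsto_const) (auto simp: half_strip_def)
      qed
    qed (use sh in auto)
    moreover have "(\<lambda>n. LINT p|m. deriv (\<lambda>x. ramp_bump t d n (x, snd p)) (fst p)) \<longlonglongrightarrow>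
        (LINT p|m. - indicator ({..<t} \<times> {..<d}) p)"
    proof (rule integral_dominated_convergence[where w="\<lambda>p. 5"])
      show "(\<lambda>p. deriv (\<lambda>x. ramp_bump t d n (x, snd p)) (fst p)) \<in> borel_measurable m" for n
        using test_fun_strip_deriv_measurable[OF ramp_bump_test_fun[OF t, of d n]] by simp
      show "AE p in m. norm (deriv (\<lambda>x. ramp_bump t d n (x, snd p)) (fst p)) \<le> 5" for n
        using sh(4)
      proof eventually_elim
        case (elim p)
        then show ?case using ramp_bump_limits(3)[OF t, of p] by (auto simp: half_strip_def)
      qed
      show "AE p in m. (\<lambda>n. deriv (\<lambda>x. ramp_bump t d n (x, snd p)) (fst p)) \<longlonglongrightarrow> - indicator ({..<t} \<times> {..<d}) p"
        using sh(4)
      proof eventually_elim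
        case (elim p)
        then show ?case using ramp_bump_limits(4)[OF t, of p] by (auto simp: half_strip_def)
      qed
    qed auto
    ultimately have "(LINT p|m. max 0 (t - fst p) * indicator {..<d} (snd p) * a p) = - (LINT p|m. - indicator ({..<t} \<times> {..<d}) p)"
      using sh(7)[OF ramp_bump_test_fun[OF t]] by (simp add: LIMSEQ_unique tendsto_minus_cancel_left)
    also have "\<dots> = measure m ({..<t} \<times> {..<d})" by (simp add: sh(2))
    also have "\<dots> = measure m ({..<t0} \<times> {..<d})"
    proof (rule m.finite_measure_eq_AE)
      show "AE p in m. (p \<in> {..<t} \<times> {..<d}) = (p \<in> {..<t0} \<times> {..<d})"
        using sh(4) by eventually_elim (auto simp: half_strip_def t_def)
    qed (auto simp: sh(1))
    finally have 1: "measure m ({..<t0} \<times> {..<d}) = (LINT p|m. max 0 (t - fst p) * indicator {..<d} (snd p) * a p)" by simp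
    have "(LINT p|m. max 0 (t - fst p) * indicator {..<d} (snd p) * a p) =
       (LINT p|m. a p * (LINT \<tau>|U01. indicator {..<\<tau>} (fst p) * indicator ({..<t0} \<times> {..<d}) (\<tau>, snd p)))"
    proof (rule integral_cong_AE)
      show "AE p in m. max 0 (t - fst p) * indicator {..<d} (snd p) * a p =
          a p * (LINT \<tau>|U01. indicator {..<\<tau>} (fst p) * indicator ({..<t0} \<times> {..<d}) (\<tau>, snd p))"
        using sh(4)
      proof eventually_elim
        case (elim p)
        have m1: "(\<lambda>\<tau>. indicator {..<\<tau>} x :: real) \<in> borel_measurable U01" for x :: real
          by (rule indicator_less_measurable) auto
        have "(LINT \<tau>|U01. indicator {..<\<tau>} (fst p) * indicator ({..<t0} \<times> {..<d}) (\<tau>, snd p)) =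
           (LINT \<tau>|U01. (indicator {..<\<tau>} (fst p) * indicator {..<t} \<tau>) * indicator {..<d} (snd p) :: real)"
        proof (rule integral_cong_AE)
          show "AE \<tau> in U01. indicator {..<\<tau>} (fst p) * indicator ({..<t0} \<times> {..<d}) (\<tau>, snd p) =
             (indicator {..<\<tau>} (fst p) * indicator {..<t} \<tau>) * (indicator {..<d} (snd p) :: real)"
            using AE_U01 by eventually_elim (auto simp: t_def indicator_def)
          have "(\<lambda>\<tau>. indicator ({..<t0} \<times> {..<d}) (\<tau>, snd p) :: real) = (\<lambda>\<tau>. indicator {..<t0} \<tau> * indicator {..<d} (snd p))"
            by (auto simp: indicator_def)
          then show "(\<lambda>\<tau>. indicator {..<\<tau>} (fst p) * indicator ({..<t0} \<times> {..<d}) (\<tau>, snd p) :: real) \<in> borel_measurable U01"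
            by (intro borel_measurable_times m1) auto
        qed (auto intro!: borel_measurable_times m1)
        also have "\<dots> = max 0 (t - fst p) * indicator {..<d} (snd p)"
          using integral_indicator_greater_less[of "fst p" t] elim t by (auto simp: half_strip_def)
        finally show ?case by (simp add: ac_simps)
      qed
      have "(\<lambda>(p, \<tau>). indicator {..<\<tau>} (fst p) * indicator ({..<t0} \<times> {..<d}) (\<tau>, snd p) :: real) \<in> borel_measurable ?Q"
        unfolding split_beta'
        by (intro borel_measurable_times indicator_less_measurable measurable_compose[OF T borel_measurable_indicator]) measurable
      from U.borel_measurable_lebesgue_integral[OF this]
      show "(\<lambda>p. a p * (LINT \<tau>|U01. indicator {..<\<tau>} (fst p) * indicator ({..<t0} \<times> {..<d}) (\<tau>, snd p))) \<in> borel_measurable m"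
        by measurable
    qed measurable
    also have "\<dots> = \<nu> ({..<t0} \<times> {..<d})" by (simp add: \<nu>)
    finally show "measure m ({..<t0} \<times> {..<d}) = \<nu> ({..<t0} \<times> {..<d})" using 1 by simp
  qed
  show ?thesis
    using signed_measure_eq_quadrants[OF mm sm quad E] \<nu>[OF E] by simp
qed

text \<open>
  The right-hand side of the mass formula vanishes if almost every fibre of E is Lebesgue null, so m has a
  density G with respect to the product of its k-marginal and Lebesgue measure. With \<eta> = G a, Fubini's theorem
  turns the mass formula into the statement that G(k,t) is the primitive of \<eta> k at t. Hence almost every fibre of
  m has an absolutely continuous density that starts at 0 and has the derivative a G. Integrating functions of k
  alone shows that the fibre densities have unit mass.
\<close>

lemma sheet_disintegration:
  assumes s: "sheet m a"
  defines "lam \<equiv> distr m borel snd"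
  obtains \<eta> where "(\<lambda>(k, x). \<eta> k x) \<in> borel_measurable (borel \<Otimes>\<^sub>M borel)"
    and "profile_family lam (\<lambda>k. k) \<eta>"
    and "profile_energy lam (\<lambda>k. k) \<eta> = sheet_energy m a"
    and "\<And>f. f \<in> borel_measurable borel \<Longrightarrow>
       (\<integral>\<^sup>+p. f p \<partial>m) = (\<integral>\<^sup>+k. \<integral>\<^sup>+t. f (t, k) * ennreal (prim (\<eta> k) t) \<partial>U01 \<partial>lam)"
    and "AE k in lam. (\<integral>\<^sup>+t. ennreal (prim (\<eta> k) t) \<partial>U01) = 1"
    and "AE k in lam. AE t in U01. \<eta> k t = a (t, k) * prim (\<eta> k) t"
proof -
  note sh = sheetD[OF s]
  interpret m: finite_measure m by (rule sh)
  note a_borel [measurable] = sh(5)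
  note [measurable_cong] = sh(1)
  have a_pair [measurable]: "a \<in> borel_measurable (borel \<Otimes>\<^sub>M borel)" by (simp add: borel_prod)
  have sets_lam [simp, measurable_cong]: "sets lam = sets borel" and space_lam [simp]: "space lam = UNIV"
    by (simp_all add: lam_def)
  have fs [measurable]: "fst \<in> borel_measurable m" "snd \<in> borel_measurable m"
    by (simp_all add: measurable_cong_sets[OF sh(1) refl])
  have "emeasure lam UNIV = emeasure (distr m borel fst) UNIV"
    by (simp add: lam_def emeasure_distr)
  also have "\<dots> = 1"
    unfolding sh(8) by (subst emeasure_density) (auto simp: integral_id_U01)
  finally have prob: "prob_space lam" by (intro prob_spaceI) simp
  interpret L: prob_space lam by fact
  interpret P: pair_sigma_finite lam U01 ..
  have sfQ: "sigma_finite_measure (lam \<Otimes>\<^sub>M U01)"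
    by (rule finite_measure.axioms(1), rule finite_measure_pair_measure) (auto intro: L.finite_measure_axioms U.finite_measure_axioms)
  let ?Q = "lam \<Otimes>\<^sub>M U01"
  let ?s = "\<lambda>p. (snd p, fst p)"
  have setsQ: "sets ?Q = sets (borel \<Otimes>\<^sub>M borel)" by (rule sets_pair_measure_cong) auto
  have sw [measurable]: "?s \<in> measurable m ?Q"
    unfolding measurable_cong_sets[OF refl setsQ] by measurable
  have sw2 [measurable]: "(\<lambda>q. (snd q, fst q)) \<in> measurable ?Q borel"
    unfolding measurable_cong_sets[OF setsQ refl] borel_prod[symmetric] by measurable
  define m' where "m' = distr m ?Q ?s"
  have setsm' [measurable_cong]: "sets m' = sets ?Q" by (simp add: m'_def)
  have spQ: "space ?Q = UNIV" by (simp add: space_pair_measure)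
  have finm': "finite_measure m'" unfolding m'_def by (rule m.finite_measure_distr) measurable
  have mass: "measure m' E = (LINT p|m. a p * (LINT \<tau>|U01. indicator {..<\<tau>} (fst p) * indicator E (snd p, \<tau>)))"
    if E: "E \<in> sets ?Q" for E
  proof -
    let ?E = "(\<lambda>q. (snd q, fst q)) -` E"
    have "?s \<in> measurable borel ?Q" unfolding measurable_cong_sets[OF sh(1)[symmetric] refl] by (rule sw)
    from measurable_sets[OF this E] have E': "?E \<in> sets borel" by simp
    have "measure m' E = measure m ?E"
      unfolding m'_def using E by (subst measure_distr) (auto simp: sh(2))
    also note sheet_mass_formula[OF s E']
    finally show ?thesis by (simp add: indicator_def)
  qed
  have ac: "absolutely_continuous ?Q m'"
    unfolding absolutely_continuous_def
  proof
    fix E assume E: "E \<in> null_sets ?Q"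
    have "AE k in lam. AE \<tau> in U01. (k, \<tau>) \<notin> E" using P.AE_pair[OF AE_not_in[OF E]] .
    then have "AE p in m. AE \<tau> in U01. (snd p, \<tau>) \<notin> E"
      unfolding lam_def by (rule AE_distrD[rotated]) measurable
    then have ae: "AE p in m. a p * (LINT \<tau>|U01. indicator {..<\<tau>} (fst p) * indicator E (snd p, \<tau>)) = 0"
    proof eventually_elim
      case (elim p)
      have "(LINT \<tau>|U01. indicator {..<\<tau>} (fst p) * indicator E (snd p, \<tau>)) = (0::real)"
        by (rule integral_eq_zero_AE) (use elim in \<open>eventually_elim, simp\<close>)
      then show ?case by simp
    qed
    have "measure m' E = 0"
      unfolding mass[OF null_setsD2[OF E]] by (rule integral_eq_zero_AE[OF ae])
    then have "emeasure m' E = 0" using finm' by (simp add: finite_measure.emeasure_eq_measure)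
    then show "E \<in> null_sets m'" using E by (auto simp: null_sets_def setsm')
  qed
  obtain G where G [measurable]: "G \<in> borel_measurable ?Q" and GRN: "AE q in ?Q. RN_deriv ?Q m' q = ennreal (G q)"
    and G0: "\<And>q. 0 \<le> G q"
    using sigma_finite_measure.real_RN_deriv[OF sfQ finm' ac setsm'] by metis
  have dens: "density ?Q (\<lambda>q. ennreal (G q)) = m'"
  proof -
    have "density ?Q (\<lambda>q. ennreal (G q)) = density ?Q (RN_deriv ?Q m')"
      by (rule density_cong) (use GRN in auto)
    then show ?thesis using sigma_finite_measure.density_RN_deriv[OF sfQ ac setsm'] by simp
  qed
  have nn: "(\<integral>\<^sup>+p. f p \<partial>m) = (\<integral>\<^sup>+k. \<integral>\<^sup>+t. f (t, k) * ennreal (G (k, t)) \<partial>U01 \<partial>lam)"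
    if [measurable]: "f \<in> borel_measurable borel" for f
  proof -
    have "(\<integral>\<^sup>+p. f p \<partial>m) = (\<integral>\<^sup>+q. f (snd q, fst q) \<partial>m')"
      unfolding m'_def by (subst nn_integral_distr) auto
    also have "\<dots> = (\<integral>\<^sup>+q. ennreal (G q) * f (snd q, fst q) \<partial>?Q)"
      unfolding dens[symmetric] by (subst nn_integral_density) auto
    also have "\<dots> = (\<integral>\<^sup>+k. \<integral>\<^sup>+t. ennreal (G (k, t)) * f (snd (k, t), fst (k, t)) \<partial>U01 \<partial>lam)"
      by (rule U.nn_integral_fst[symmetric]) measurable
    finally show ?thesis by (simp add: mult.commute)
  qed
  have lint: "(LINT p|m. f p) = (LINT q|?Q. G q * f (snd q, fst q))"
    and inteq: "integrable m f \<longleftrightarrow> integrable ?Q (\<lambda>q. G q * f (snd q, fst q))"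
    if [measurable]: "f \<in> borel_measurable borel" for f :: "_ \<Rightarrow> real"
  proof -
    have "(LINT p|m. f p) = (LINT q|m'. f (snd q, fst q))"
      unfolding m'_def by (subst integral_distr) auto
    also have "\<dots> = (LINT q|?Q. G q * f (snd q, fst q))"
      unfolding dens[symmetric] by (subst integral_density) (auto simp: G0)
    finally show "(LINT p|m. f p) = (LINT q|?Q. G q * f (snd q, fst q))" .
    have "integrable m f \<longleftrightarrow> integrable m' (\<lambda>q. f (snd q, fst q))"
      unfolding m'_def by (subst integrable_distr_eq) auto
    also have "\<dots> \<longleftrightarrow> integrable ?Q (\<lambda>q. G q * f (snd q, fst q))"
      unfolding dens[symmetric] by (subst integrable_density) (auto simp: G0)
    finally show "integrable m f \<longleftrightarrow> integrable ?Q (\<lambda>q. G q * f (snd q, fst q))" .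
  qed
  have [measurable]: "(\<lambda>q. a (snd q, fst q)) \<in> borel_measurable ?Q"
    by (rule measurable_compose[OF sw2 a_borel])
  have G_pair [measurable]: "G \<in> borel_measurable (borel \<Otimes>\<^sub>M borel)"
    using G unfolding measurable_cong_sets[OF setsQ refl] .
  define \<eta> where "\<eta> k x = G (k, x) * a (x, k)" for k x
  have \<eta>B: "(\<lambda>(k, x). \<eta> k x) \<in> borel_measurable (borel \<Otimes>\<^sub>M borel)"
    unfolding \<eta>_def split_beta' by measurable
  then have \<eta>Q [measurable]: "(\<lambda>(k, x). \<eta> k x) \<in> borel_measurable ?Q"
    unfolding measurable_cong_sets[OF setsQ refl] .
  have \<eta>fib [measurable]: "\<eta> k \<in> borel_measurable borel" for k
    using measurable_compose[OF measurable_Pair1'[of k borel borel] \<eta>B] by simp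
  have \<eta>int: "integrable ?Q (\<lambda>(k, x). \<eta> k x)"
    using sh(6) unfolding inteq[OF a_borel] by (simp add: \<eta>_def split_beta')
  have \<eta>fibint: "AE k in lam. integrable U01 (\<eta> k)"
    using P.AE_integrable_fst'[OF \<eta>int] by simp
  define \<gamma> where "\<gamma> q = prim (\<eta> (fst q)) (snd q)" for q
  have \<gamma> [measurable]: "\<gamma> \<in> borel_measurable ?Q"
    using prim_measurable_pair[OF \<eta>Q] by (simp add: \<gamma>_def[abs_def] split_beta')
  have \<gamma>int: "integrable ?Q \<gamma>"
  proof (rule integrableI_bounded)
    have "(\<integral>\<^sup>+q. ennreal (norm (\<gamma> q)) \<partial>?Q) = (\<integral>\<^sup>+k. \<integral>\<^sup>+t. ennreal \<bar>prim (\<eta> k) t\<bar> \<partial>U01 \<partial>lam)"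
    proof -
      have "(\<lambda>q. ennreal (norm (\<gamma> q))) \<in> borel_measurable ?Q" by measurable
      from U.nn_integral_fst[OF this] show ?thesis by (simp add: \<gamma>_def)
    qed
    also have "\<dots> \<le> (\<integral>\<^sup>+k. \<integral>\<^sup>+t. (\<integral>\<^sup>+x. ennreal \<bar>\<eta> k x\<bar> \<partial>U01) \<partial>U01 \<partial>lam)"
      by (intro nn_integral_mono prim_le_nn_integral)
    also have "\<dots> = (\<integral>\<^sup>+k. \<integral>\<^sup>+x. ennreal \<bar>\<eta> k x\<bar> \<partial>U01 \<partial>lam)"
      using U.emeasure_space_1 by simp
    also have "\<dots> = (\<integral>\<^sup>+q. ennreal (norm (case q of (k, x) \<Rightarrow> \<eta> k x)) \<partial>?Q)"
      by (subst U.nn_integral_fst[symmetric]) (auto simp: split_beta')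
    also have "\<dots> < \<infinity>" using \<eta>int unfolding integrable_iff_bounded by blast
    finally show "(\<integral>\<^sup>+q. ennreal (norm (\<gamma> q)) \<partial>?Q) < \<infinity>" .
  qed simp
  have Gint: "integrable ?Q G"
    using inteq[of "\<lambda>_. 1"] by simp
  have \<gamma>G: "AE q in ?Q. \<gamma> q = G q"
  proof (rule density_unique_real[OF \<gamma>int Gint])
    fix E assume E [measurable]: "E \<in> sets ?Q"
    have E' [measurable]: "E \<in> sets (borel \<Otimes>\<^sub>M borel)" using E by (simp add: setsQ)
    define W where "W k x = (LINT \<tau>|U01. indicator {..<\<tau>} x * indicator E (k, \<tau>) :: real)" for k x
    have Wm: "(\<lambda>p. W (snd p) (fst p)) \<in> borel_measurable borel"
    proof -
      have "(\<lambda>(p, \<tau>). indicator {..<\<tau>} (fst p) * indicator E (snd p, \<tau>) :: real) \<in> borel_measurable ((borel \<Otimes>\<^sub>M borel) \<Otimes>\<^sub>M U01)"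
        unfolding split_beta' by (intro borel_measurable_times indicator_less_measurable borel_measurable_indicator) measurable
      from U.borel_measurable_lebesgue_integral[OF this] show ?thesis by (simp add: W_def[abs_def] borel_prod)
    qed
    have Wb: "\<bar>W k x\<bar> \<le> 1" for k x
    proof -
      have "ennreal \<bar>W k x\<bar> \<le> (\<integral>\<^sup>+\<tau>. 1 \<partial>U01)"
        unfolding W_def
        by (rule order.trans[OF norm_integral_le_nn_integral], rule nn_integral_mono) (simp add: indicator_def)
      then show ?thesis using U.emeasure_space_1 by simp
    qed
    have "(LINT q:E|?Q. G q) = (LINT p|m. indicator E (snd p, fst p))"
      by (subst lint) (auto simp: set_lebesgue_integral_def mult.commute)
    also have "\<dots> = (LINT q|m'. indicator E q)"
      unfolding m'_def by (subst integral_distr) auto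
    also have "\<dots> = measure m' E" using sets.sets_into_space[OF E] by (simp add: m'_def Int_absorb2)
    also have "\<dots> = (LINT p|m. a p * W (snd p) (fst p))" unfolding mass[OF E] W_def ..
    also have "\<dots> = (LINT q|?Q. G q * (a (snd q, fst q) * W (fst q) (snd q)))"
      by (subst lint) (auto intro!: borel_measurable_times Wm)
    also have "\<dots> = (LINT k|lam. LINT x|U01. \<eta> k x * W k x)"
    proof -
      have "integrable ?Q (\<lambda>q. \<eta> (fst q) (snd q) * W (fst q) (snd q))"
        using measurable_compose[OF sw2 Wm] \<eta>int Wb
        by (intro integrable_bounded_mult(2)[where K=1]) (auto simp: split_beta')
      from P.integral_fst'[OF this] show ?thesis by (simp add: \<eta>_def mult.assoc)
    qed
    also have "\<dots> = (LINT k|lam. LINT t|U01. indicator E (k, t) * \<gamma> (k, t))"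
    proof (rule integral_cong_AE)
      show "AE k in lam. (LINT x|U01. \<eta> k x * W k x) = (LINT t|U01. indicator E (k, t) * \<gamma> (k, t))"
        using \<eta>fibint
      proof eventually_elim
        case (elim k)
        have Ek: "(\<lambda>(x::real, t). indicator E (k, t) :: real) \<in> borel_measurable (U01 \<Otimes>\<^sub>M U01)"
        proof -
          have "(\<lambda>q :: real \<times> real. (k, snd q)) \<in> measurable (U01 \<Otimes>\<^sub>M U01) (borel \<Otimes>\<^sub>M borel)" by measurable
          from measurable_compose[OF this borel_measurable_indicator[OF E']] show ?thesis by (simp add: split_beta')
        qed
        have "(LINT x|U01. \<eta> k x * W k x) = (LINT t|U01. LINT x|U01. (indicator {..<t} x * indicator E (k, t)) * \<eta> k x)"
          unfolding W_def
        proof (rule fiber_Fubini[OF elim, where K=1])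
          show "(\<lambda>(x, t). indicator {..<t} x * indicator E (k, t) :: real) \<in> borel_measurable (U01 \<Otimes>\<^sub>M U01)"
            using Ek unfolding split_beta' by (intro borel_measurable_times indicator_less_measurable) measurable
        qed (simp add: indicator_def)
        also have "\<dots> = (LINT t|U01. indicator E (k, t) * \<gamma> (k, t))"
          by (simp add: \<gamma>_def prim_def ac_simps flip: Bochner_Integration.integral_mult_right_zero)
        finally show ?case .
      qed
      have "(\<lambda>(k, x). \<eta> k x * W k x) \<in> borel_measurable ?Q"
        using borel_measurable_times[OF \<eta>Q measurable_compose[OF sw2 Wm]] by (simp add: split_beta')
      from U.borel_measurable_lebesgue_integral[OF this]
      show "(\<lambda>k. LINT x|U01. \<eta> k x * W k x) \<in> borel_measurable lam" .
      show "(\<lambda>k. LINT t|U01. indicator E (k, t) * \<gamma> (k, t)) \<in> borel_measurable lam"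
        by (rule U.borel_measurable_lebesgue_integral) (simp add: split_beta')
    qed
    also have "\<dots> = (LINT q:E|?Q. \<gamma> q)"
    proof -
      have "integrable ?Q (\<lambda>q. indicator E q * \<gamma> q)"
        using \<gamma>int by (rule integrable_bounded_mult(1)[where K=1]) (auto simp: indicator_def)
      from P.integral_fst'[OF this] show ?thesis by (simp add: set_lebesgue_integral_def)
    qed
    finally show "(LINT q:E|?Q. \<gamma> q) = (LINT q:E|?Q. G q)" ..
  qed
  have aeG: "AE k in lam. AE t in U01. prim (\<eta> k) t = G (k, t)"
    using P.AE_pair[OF \<gamma>G] by (simp add: \<gamma>_def)
  have nn': "(\<integral>\<^sup>+p. f p \<partial>m) = (\<integral>\<^sup>+k. \<integral>\<^sup>+t. f (t, k) * ennreal (prim (\<eta> k) t) \<partial>U01 \<partial>lam)"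
    if "f \<in> borel_measurable borel" for f
    unfolding nn[OF that]
  proof (rule nn_integral_cong_AE)
    show "AE k in lam. (\<integral>\<^sup>+t. f (t, k) * ennreal (G (k, t)) \<partial>U01) = (\<integral>\<^sup>+t. f (t, k) * ennreal (prim (\<eta> k) t) \<partial>U01)"
      using aeG
    proof eventually_elim
      case (elim k)
      show ?case by (rule nn_integral_cong_AE) (use elim in \<open>eventually_elim, simp\<close>)
    qed
  qed
  have \<eta>a: "AE k in lam. AE t in U01. \<eta> k t = a (t, k) * prim (\<eta> k) t"
    using aeG
  proof eventually_elim
    case (elim k)
    then show ?case
    proof eventually_elim
      case (elim t)
      have "\<eta> k t = G (k, t) * a (t, k)" by (simp add: \<eta>_def)
      with elim show ?case by simp
    qed
  qed
  have fam: "profile_family lam (\<lambda>k. k) \<eta>"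
    unfolding profile_family_def
  proof (intro conjI ballI)
    show "AE k in lam. AE t in U01. 0 \<le> prim (\<eta> k) t \<and> (prim (\<eta> k) t = 0 \<longrightarrow> \<eta> k t = 0)"
      using aeG
    proof eventually_elim
      case (elim k)
      then show ?case
      proof eventually_elim
        case (elim t)
        have "\<eta> k t = G (k, t) * a (t, k)" by (simp add: \<eta>_def)
        with elim G0 show ?case by simp
      qed
    qed
    fix A :: "real set" assume A [measurable]: "A \<in> sets borel"
    have "(\<integral>\<^sup>+k. \<integral>\<^sup>+t. ennreal (prim (\<eta> k) t) * indicator A t \<partial>U01 \<partial>lam) = (\<integral>\<^sup>+p. indicator A (fst p) \<partial>m)"
      by (subst nn') (auto simp: mult.commute)
    also have "\<dots> = emeasure (distr m borel fst) A"
      by (subst nn_integral_indicator[symmetric], simp, subst nn_integral_distr) auto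
    also have "\<dots> = (\<integral>\<^sup>+t. ennreal (2 * t) * indicator A t \<partial>U01)"
      unfolding sh(8) by (subst emeasure_density) auto
    finally show "(\<integral>\<^sup>+k. \<integral>\<^sup>+t. ennreal (prim (\<eta> k) t) * indicator A t \<partial>U01 \<partial>lam) = (\<integral>\<^sup>+t. ennreal (2 * t) * indicator A t \<partial>U01)" .
  qed (auto intro: prob \<eta>fibint)
  have en: "profile_energy lam (\<lambda>k. k) \<eta> = sheet_energy m a"
  proof -
    have "sheet_energy m a = (\<integral>\<^sup>+k. \<integral>\<^sup>+t. (ennreal (k\<^sup>2) + slope_energy k (a (t, k))) * ennreal (prim (\<eta> k) t) \<partial>U01 \<partial>lam)"
      unfolding sheet_energy_def by (subst nn') auto
    also have "\<dots> = profile_energy lam (\<lambda>k. k) \<eta>"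
      unfolding profile_energy_def fiber_energy_def cell_energy_def
    proof (rule nn_integral_cong_AE)
      show "AE k in lam. (\<integral>\<^sup>+t. (ennreal (k\<^sup>2) + slope_energy k (a (t, k))) * ennreal (prim (\<eta> k) t) \<partial>U01) =
         (\<integral>\<^sup>+t. (ennreal (k\<^sup>2) + slope_energy k (\<eta> k t / prim (\<eta> k) t)) * ennreal (prim (\<eta> k) t) \<partial>U01)"
        using \<eta>a
      proof eventually_elim
        case (elim k)
        show ?case
        proof (rule nn_integral_cong_AE)
          show "AE t in U01. (ennreal (k\<^sup>2) + slope_energy k (a (t, k))) * ennreal (prim (\<eta> k) t) =
             (ennreal (k\<^sup>2) + slope_energy k (\<eta> k t / prim (\<eta> k) t)) * ennreal (prim (\<eta> k) t)"
            using elim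
          proof eventually_elim
            case (elim t)
            then show ?case by (cases "prim (\<eta> k) t = 0") auto
          qed
        qed
      qed
    qed
    finally show ?thesis ..
  qed
  have unit: "AE k in lam. (\<integral>\<^sup>+t. ennreal (prim (\<eta> k) t) \<partial>U01) = 1"
  proof (rule L.density_unique_iff[THEN iffD1])
    have "(\<lambda>(k, t). ennreal (prim (\<eta> k) t)) \<in> borel_measurable ?Q"
      using prim_measurable_pair[OF \<eta>Q] by (auto simp: split_beta')
    from U.borel_measurable_nn_integral[OF this]
    show im [measurable]: "(\<lambda>k. \<integral>\<^sup>+t. ennreal (prim (\<eta> k) t) \<partial>U01) \<in> borel_measurable lam" .
    show "density lam (\<lambda>k. \<integral>\<^sup>+t. ennreal (prim (\<eta> k) t) \<partial>U01) = density lam (\<lambda>k. 1)"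
    proof (rule measure_eqI)
      fix B assume "B \<in> sets (density lam (\<lambda>k. \<integral>\<^sup>+t. ennreal (prim (\<eta> k) t) \<partial>U01))"
      then have B [measurable]: "B \<in> sets borel" by simp
      have pm: "(\<lambda>t. ennreal (prim (\<eta> k) t)) \<in> borel_measurable U01" for k by measurable
      have "emeasure (density lam (\<lambda>k. \<integral>\<^sup>+t. ennreal (prim (\<eta> k) t) \<partial>U01)) B =
          (\<integral>\<^sup>+k. (\<integral>\<^sup>+t. ennreal (prim (\<eta> k) t) \<partial>U01) * indicator B k \<partial>lam)"
        by (subst emeasure_density) auto
      also have "\<dots> = (\<integral>\<^sup>+k. \<integral>\<^sup>+t. indicator B (snd (t, k)) * ennreal (prim (\<eta> k) t) \<partial>U01 \<partial>lam)"
        by (intro nn_integral_cong) (simp add: nn_integral_cmult mult.commute)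
      also have "\<dots> = (\<integral>\<^sup>+p. indicator B (snd p) \<partial>m)"
        by (rule nn'[symmetric]) measurable
      also have "\<dots> = emeasure lam B"
        unfolding lam_def by (subst nn_integral_indicator[symmetric], simp, subst nn_integral_distr) auto
      also have "\<dots> = emeasure (density lam (\<lambda>k. 1)) B"
        by (subst emeasure_density) auto
      finally show "emeasure (density lam (\<lambda>k. \<integral>\<^sup>+t. ennreal (prim (\<eta> k) t) \<partial>U01)) B = emeasure (density lam (\<lambda>k. 1)) B" .
    qed simp
  qed simp
  show thesis
    by (rule that[OF \<eta>B fam en nn' unit \<eta>a])
qed

section \<open>Convex duality and superposition of profiles\<close>

text \<open>
  Completing the square: for k \<noteq> 0 and g > 0 the difference is (h - 4 k^2 c g)^2 / (4 k^2 g). These minorants, linear in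
  (g,h), replace Jensen's inequality and lower semicontinuity in what follows.
\<close>

lemma cell_energy_ge_dual:
  assumes g: "0 \<le> g" and h: "g = 0 \<longrightarrow> h = 0"
  shows "ennreal (k\<^sup>2 * g + 2 * c * h - 4 * k\<^sup>2 * c\<^sup>2 * g) \<le> cell_energy k g h"
proof -
  consider "g = 0" | "g > 0" "k = 0" "h \<noteq> 0" | "g > 0" "k = 0" "h = 0" | "g > 0" "k \<noteq> 0" using g by linarith
  then show ?thesis
  proof cases
    case 1
    then show ?thesis using h by simp
  next
    case 2
    then show ?thesis by (simp add: cell_energy_def slope_energy_def ennreal_top_mult)
  next
    case 3
    then show ?thesis by simp
  next
    case 4
    have "2 * c * h - 4 * k\<^sup>2 * c\<^sup>2 * g \<le> 1 / (4 * k\<^sup>2) * (h / g)\<^sup>2 * g"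
    proof -
      have "0 \<le> (h - 4 * k\<^sup>2 * c * g)\<^sup>2 / (4 * k\<^sup>2 * g)" using 4 by simp
      also have "\<dots> = 1 / (4 * k\<^sup>2) * (h / g)\<^sup>2 * g - (2 * c * h - 4 * k\<^sup>2 * c\<^sup>2 * g)"
        using 4 by (simp add: field_simps power2_eq_square)
      finally show ?thesis by simp
    qed
    then have "ennreal (k\<^sup>2 * g + 2 * c * h - 4 * k\<^sup>2 * c\<^sup>2 * g) \<le> ennreal ((k\<^sup>2 + 1 / (4 * k\<^sup>2) * (h / g)\<^sup>2) * g)"
      by (intro ennreal_leI) (simp add: algebra_simps)
    also have "\<dots> = cell_energy k g h"
      using 4 by (simp add: cell_energy_def slope_energy_def ennreal_mult ennreal_plus)
    finally show ?thesis .
  qed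
qed

text \<open>
  The minorant with c = sgn h / 2 has the terms k^2 g cancel. So the energy controls the total variation of
  the profiles for every wave number.
\<close>

lemma cell_energy_ge_abs:
  assumes "0 \<le> g" "g = 0 \<longrightarrow> h = 0"
  shows "ennreal \<bar>h\<bar> \<le> cell_energy k g h"
proof (cases "h = 0")
  case False
  then have "(sgn h)\<^sup>2 = 1" by (auto simp: sgn_if)
  then have "k\<^sup>2 * g + 2 * (sgn h / 2) * h - 4 * k\<^sup>2 * (sgn h / 2)\<^sup>2 * g = \<bar>h\<bar>"
    by (simp add: power_divide abs_sgn mult.commute)
  with cell_energy_ge_dual[OF assms, of k "sgn h / 2"] show ?thesis by (simp only:)
qed simp

lemma cell_energy_measurable [measurable]:
  assumes [measurable]: "f \<in> borel_measurable M" "g \<in> borel_measurable M" "h \<in> borel_measurable M"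
  shows "(\<lambda>x. cell_energy (f x) (g x) (h x)) \<in> borel_measurable M"
  unfolding cell_energy_def by measurable

lemma profile_familyD:
  assumes "profile_family \<Omega> Y \<eta>"
  shows "prob_space \<Omega>" "Y \<in> borel_measurable \<Omega>" "(\<lambda>(w, x). \<eta> w x) \<in> borel_measurable (\<Omega> \<Otimes>\<^sub>M U01)"
    "(\<lambda>q. \<eta> (fst q) (snd q)) \<in> borel_measurable (\<Omega> \<Otimes>\<^sub>M U01)"
    "(\<lambda>q. prim (\<eta> (fst q)) (snd q)) \<in> borel_measurable (\<Omega> \<Otimes>\<^sub>M U01)"
    "AE w in \<Omega>. integrable U01 (\<eta> w)"
    "AE w in \<Omega>. AE t in U01. 0 \<le> prim (\<eta> w) t \<and> (prim (\<eta> w) t = 0 \<longrightarrow> \<eta> w t = 0)"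
    "A \<in> sets borel \<Longrightarrow> (\<integral>\<^sup>+w. \<integral>\<^sup>+t. ennreal (prim (\<eta> w) t) * indicator A t \<partial>U01 \<partial>\<Omega>) =
        (\<integral>\<^sup>+t. ennreal (2 * t) * indicator A t \<partial>U01)"
    "AE q in \<Omega> \<Otimes>\<^sub>M U01. 0 \<le> prim (\<eta> (fst q)) (snd q) \<and> (prim (\<eta> (fst q)) (snd q) = 0 \<longrightarrow> \<eta> (fst q) (snd q) = 0)"
proof -
  show m: "(\<lambda>(w, x). \<eta> w x) \<in> borel_measurable (\<Omega> \<Otimes>\<^sub>M U01)" and p: "prob_space \<Omega>"
    and ae: "AE w in \<Omega>. AE t in U01. 0 \<le> prim (\<eta> w) t \<and> (prim (\<eta> w) t = 0 \<longrightarrow> \<eta> w t = 0)"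
    using assms by (auto simp: profile_family_def)
  show 1 [measurable]: "(\<lambda>q. \<eta> (fst q) (snd q)) \<in> borel_measurable (\<Omega> \<Otimes>\<^sub>M U01)" using m by (simp add: split_beta')
  show 2 [measurable]: "(\<lambda>q. prim (\<eta> (fst q)) (snd q)) \<in> borel_measurable (\<Omega> \<Otimes>\<^sub>M U01)"
    using prim_measurable_pair[OF m] by (simp add: split_beta')
  interpret prob_space \<Omega> by fact
  interpret P: pair_sigma_finite \<Omega> U01 ..
  show "AE q in \<Omega> \<Otimes>\<^sub>M U01. 0 \<le> prim (\<eta> (fst q)) (snd q) \<and> (prim (\<eta> (fst q)) (snd q) = 0 \<longrightarrow> \<eta> (fst q) (snd q) = 0)"
    by (rule P.AE_pair_measure) (measurable, use ae in simp)
qed (use assms in \<open>auto simp: profile_family_def\<close>)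

lemma profile_energy_pair:
  assumes "profile_family \<Omega> Y \<eta>"
  shows "profile_energy \<Omega> Y \<eta> =
    (\<integral>\<^sup>+q. cell_energy (Y (fst q)) (prim (\<eta> (fst q)) (snd q)) (\<eta> (fst q) (snd q)) \<partial>(\<Omega> \<Otimes>\<^sub>M U01))"
proof -
  note [measurable] = profile_familyD(2,4,5)[OF assms]
  have "(\<lambda>q. cell_energy (Y (fst q)) (prim (\<eta> (fst q)) (snd q)) (\<eta> (fst q) (snd q))) \<in> borel_measurable (\<Omega> \<Otimes>\<^sub>M U01)"
    by measurable
  from U.nn_integral_fst[OF this] show ?thesis by (simp add: profile_energy_def fiber_energy_def)
qed

text \<open>
  Since e vanishes where g does, the image of the signed measure e Q under T is absolutely continuous with
  respect to the image m of g Q; its density is built separately for the positive and the negative part.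
\<close>

lemma push_forward_density:
  fixes g e :: "'a \<Rightarrow> real"
  assumes T: "T \<in> measurable Q (N :: 'b measure)"
    and g: "integrable Q g" "AE q in Q. 0 \<le> g q" and e: "integrable Q e" "AE q in Q. g q = 0 \<longrightarrow> e q = 0"
  defines "m \<equiv> distr (density Q (\<lambda>q. ennreal (g q))) N T"
  obtains a :: "'b \<Rightarrow> real" where "a \<in> borel_measurable N" "integrable m a"
    "\<forall>f\<in>borel_measurable N. (\<exists>K. \<forall>p\<in>space N. \<bar>f p\<bar> \<le> K) \<longrightarrow>
       (LINT p|m. f p * a p) = (LINT q|Q. f (T q) * e q)"
proof -
  note [measurable] = T
  have [measurable]: "g \<in> borel_measurable Q" "e \<in> borel_measurable Q" using g e by auto
  have finm: "finite_measure (distr (density Q (\<lambda>q. ennreal (u q))) N T)" if u: "integrable Q u" for u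
  proof (rule finite_measure.finite_measure_distr)
    have [measurable]: "u \<in> borel_measurable Q" using u by auto
    have "(\<integral>\<^sup>+q. ennreal (u q) \<partial>Q) \<le> (\<integral>\<^sup>+q. ennreal (norm (u q)) \<partial>Q)"
      by (intro nn_integral_mono ennreal_leI) simp
    also have "\<dots> < \<infinity>" using u unfolding integrable_iff_bounded by blast
    finally show "finite_measure (density Q (\<lambda>q. ennreal (u q)))"
      by (intro finite_measureI) (simp add: emeasure_density cong: nn_integral_cong_simp)
  qed measurable
  have [simp, measurable_cong]: "sets m = sets N" by (simp add: m_def)
  have [simp]: "space m = space N" by (simp add: m_def)
  interpret m: finite_measure m unfolding m_def by (rule finm[OF g(1)])
  have part: "\<exists>D. D \<in> borel_measurable N \<and> (\<forall>x. 0 \<le> D x) \<and> density m (\<lambda>p. ennreal (D p)) = distr (density Q (\<lambda>q. ennreal (u q))) N T"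
    if u: "integrable Q u" "AE q in Q. g q = 0 \<longrightarrow> u q = 0" for u
  proof -
    let ?n = "distr (density Q (\<lambda>q. ennreal (u q))) N T"
    have [measurable]: "u \<in> borel_measurable Q" using u by auto
    have ac: "absolutely_continuous m ?n"
      unfolding absolutely_continuous_def
    proof
      fix A assume A: "A \<in> null_sets m"
      then have A' [measurable]: "A \<in> sets N" by (simp add: null_sets_def)
      have "0 = emeasure m A" using A by (simp add: null_sets_def)
      also have "\<dots> = (\<integral>\<^sup>+q. ennreal (g q) * indicator (T -` A \<inter> space Q) q \<partial>Q)"
        unfolding m_def by (subst emeasure_distr, measurable, subst emeasure_density) (auto simp: measurable_sets[OF T])
      finally have "AE q in Q. ennreal (g q) * indicator (T -` A \<inter> space Q) q = 0"
        by (subst (asm) eq_commute, subst (asm) nn_integral_0_iff_AE) (auto simp: measurable_sets[OF T])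
      then have "AE q in Q. ennreal (u q) * indicator (T -` A \<inter> space Q) q = 0"
        using u(2) g(2)
      proof eventually_elim
        case (elim q)
        then show ?case by (cases "g q = 0") (auto simp: indicator_def ennreal_eq_0_iff)
      qed
      then have "(\<integral>\<^sup>+q. ennreal (u q) * indicator (T -` A \<inter> space Q) q \<partial>Q) = 0"
        by (subst nn_integral_0_iff_AE) (auto simp: measurable_sets[OF T])
      then have "emeasure ?n A = 0"
        by (subst emeasure_distr, measurable, subst emeasure_density) (auto simp: measurable_sets[OF T])
      with A' show "A \<in> null_sets ?n" by (auto simp: null_sets_def)
    qed
    have sn: "sets ?n = sets m" by simp
    obtain D where D: "D \<in> borel_measurable m" "AE x in m. RN_deriv m ?n x = ennreal (D x)" "\<And>x. 0 \<le> D x"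
      using m.real_RN_deriv[OF finm[OF u(1)] ac sn] by metis
    have "density m (\<lambda>p. ennreal (D p)) = density m (RN_deriv m ?n)"
      by (rule density_cong) (use D in auto)
    also have "\<dots> = ?n" by (rule m.density_RN_deriv[OF ac sn])
    finally have "density m (\<lambda>p. ennreal (D p)) = ?n" .
    moreover have "D \<in> borel_measurable N" using D(1) by simp
    ultimately show ?thesis using D(3) by blast
  qed
  have ei: "integrable Q (\<lambda>q. max 0 (e q))" "integrable Q (\<lambda>q. max 0 (- e q))"
    by (intro Bochner_Integration.integrable_max integrable_zero integrable_minus e(1))+
  have ez: "AE q in Q. g q = 0 \<longrightarrow> max 0 (e q) = 0" "AE q in Q. g q = 0 \<longrightarrow> max 0 (- e q) = 0"
    using e(2) by (auto elim!: eventually_mono)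
  obtain D1 where D1 [measurable]: "D1 \<in> borel_measurable N" and D1p: "\<And>x. 0 \<le> D1 x"
    and D1d: "density m (\<lambda>p. ennreal (D1 p)) = distr (density Q (\<lambda>q. ennreal (max 0 (e q)))) N T"
    using part[OF ei(1) ez(1)] by metis
  obtain D2 where D2 [measurable]: "D2 \<in> borel_measurable N" and D2p: "\<And>x. 0 \<le> D2 x"
    and D2d: "density m (\<lambda>p. ennreal (D2 p)) = distr (density Q (\<lambda>q. ennreal (max 0 (- e q)))) N T"
    using part[OF ei(2) ez(2)] by metis
  have key: "integrable m (\<lambda>p. f p * D p)" "(LINT p|m. f p * D p) = (LINT q|Q. f (T q) * u q)"
    if f [measurable]: "f \<in> borel_measurable N" and K: "\<And>x. x \<in> space N \<Longrightarrow> \<bar>f x\<bar> \<le> (K::real)"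
      and D [measurable]: "D \<in> borel_measurable N" and Dp: "\<And>x. 0 \<le> D x"
      and Dd: "density m (\<lambda>p. ennreal (D p)) = distr (density Q (\<lambda>q. ennreal (u q))) N T"
      and u: "integrable Q u" "\<And>q. 0 \<le> u q" for f :: "'b \<Rightarrow> real" and D u K
  proof -
    have [measurable]: "u \<in> borel_measurable Q" using u by auto
    have i: "integrable Q (\<lambda>q. u q * f (T q))"
      by (rule integrable_bounded_mult(2)[OF u(1), where K=K]) (use measurable_space[OF T] K in auto)
    have "integrable (density Q (\<lambda>q. ennreal (u q))) (\<lambda>q. f (T q))"
      by (subst integrable_density) (use i u in auto)
    then have "integrable (density m (\<lambda>p. ennreal (D p))) f"
      unfolding Dd by (subst integrable_distr_eq) auto
    then show "integrable m (\<lambda>p. f p * D p)"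
      by (subst (asm) integrable_density) (auto simp: Dp mult.commute)
    have "(LINT p|m. f p * D p) = (LINT p|density m (\<lambda>p. ennreal (D p)). f p)"
      by (subst integral_density) (auto simp: Dp mult.commute)
    also have "\<dots> = (LINT q|density Q (\<lambda>q. ennreal (u q)). f (T q))"
      unfolding Dd by (subst integral_distr) auto
    also have "\<dots> = (LINT q|Q. f (T q) * u q)"
      by (subst integral_density) (auto simp: u mult.commute)
    finally show "(LINT p|m. f p * D p) = (LINT q|Q. f (T q) * u q)" .
  qed
  note k1 = key[OF _ _ D1 D1p D1d ei(1)] and k2 = key[OF _ _ D2 D2p D2d ei(2)]
  show thesis
  proof (rule that[of "\<lambda>p. D1 p - D2 p"])
    show "integrable m (\<lambda>p. D1 p - D2 p)"
      using k1(1)[of "\<lambda>_. 1" 1] k2(1)[of "\<lambda>_. 1" 1] by simp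
    show "\<forall>f\<in>borel_measurable N. (\<exists>K. \<forall>p\<in>space N. \<bar>f p\<bar> \<le> K) \<longrightarrow>
       (LINT p|m. f p * (D1 p - D2 p)) = (LINT q|Q. f (T q) * e q)"
    proof (intro ballI impI, elim exE)
    fix f K assume f [measurable]: "f \<in> borel_measurable N" and K': "\<forall>x\<in>space N. \<bar>f x\<bar> \<le> (K::real)"
    have K: "\<bar>f x\<bar> \<le> K" if "x \<in> space N" for x using K' that by blast
    have b: "integrable Q (\<lambda>q. f (T q) * max 0 (e q))" "integrable Q (\<lambda>q. f (T q) * max 0 (- e q))"
      using measurable_space[OF T] K by (auto intro!: integrable_bounded_mult(1)[OF ei(1), where K=K] integrable_bounded_mult(1)[OF ei(2), where K=K])
    have "(LINT p|m. f p * (D1 p - D2 p)) = (LINT p|m. f p * D1 p) - (LINT p|m. f p * D2 p)"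
      using k1(1)[OF f K] k2(1)[OF f K] by (simp add: right_diff_distrib)
    also have "\<dots> = (LINT q|Q. f (T q) * max 0 (e q) - f (T q) * max 0 (- e q))"
      using k1(2)[OF f K] k2(2)[OF f K] b by simp
    also have "\<dots> = (LINT q|Q. f (T q) * e q)"
      by (rule Bochner_Integration.integral_cong) (auto simp: max_def)
    finally show "(LINT p|m. f p * (D1 p - D2 p)) = (LINT q|Q. f (T q) * e q)" .
    qed
  qed measurable
qed

lemma ennreal_integral_le_nn_integral:
  fixes f :: "'a \<Rightarrow> real"
  assumes f: "integrable M f"
  shows "ennreal (LINT x|M. f x) \<le> (\<integral>\<^sup>+x. ennreal (f x) \<partial>M)"
proof -
  have i: "integrable M (\<lambda>x. max 0 (f x))" using f by auto
  have "(LINT x|M. f x) \<le> (LINT x|M. max 0 (f x))" using f i by (rule integral_mono) simp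
  then have "ennreal (LINT x|M. f x) \<le> ennreal (LINT x|M. max 0 (f x))" by (rule ennreal_leI)
  also have "\<dots> = (\<integral>\<^sup>+x. ennreal (max 0 (f x)) \<partial>M)"
    by (rule nn_integral_eq_integral[OF i, symmetric]) simp
  also have "\<dots> = (\<integral>\<^sup>+x. ennreal (f x) \<partial>M)"
    by (intro nn_integral_cong) (simp add: max_def ennreal_neg)
  finally show ?thesis .
qed

text \<open>
  The value of the linear minorant at density one, for the multiplier defined next: an increasingly good lower
  bound for the slope energy that comes from a bounded multiplier.
\<close>

definition slope_truncation :: "nat \<Rightarrow> real \<Rightarrow> real \<Rightarrow> real" where
  "slope_truncation n k h = (if k = 0 then 2 * real n * \<bar>h\<bar>
     else if \<bar>h\<bar> \<le> real n \<and> 1 \<le> real n * \<bar>k\<bar> then 1 / (4 * k\<^sup>2) * h\<^sup>2 else 0)"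

text \<open>
  The optimal multiplier is h / (4 k^2); it is cut off for large slopes and small wave numbers, and
  replaced at k = 0 by a multiplier that forces the energy to infinity.
\<close>

definition slope_multiplier :: "nat \<Rightarrow> real \<Rightarrow> real \<Rightarrow> real" where
  "slope_multiplier n k h = (if k = 0 then real n * sgn h
     else if \<bar>h\<bar> \<le> real n \<and> 1 \<le> real n * \<bar>k\<bar> then h / (4 * k\<^sup>2) else 0)"

lemma slope_truncation_eq:
  "2 * slope_multiplier n k h * h - 4 * k\<^sup>2 * (slope_multiplier n k h)\<^sup>2 = slope_truncation n k h"
  by (auto simp: slope_multiplier_def slope_truncation_def field_simps power2_eq_square abs_sgn)

lemma slope_truncation_nonneg: "0 \<le> slope_truncation n k h"
  by (auto simp: slope_truncation_def)

lemma slope_multiplier_bounds: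
  "\<bar>slope_multiplier n k h\<bar> \<le> real n + real n ^ 3"
  "\<bar>4 * k\<^sup>2 * (slope_multiplier n k h)\<^sup>2\<bar> \<le> real n ^ 4"
proof -
  have *: "\<bar>h\<bar> \<le> real n \<Longrightarrow> 1 \<le> real n * \<bar>k\<bar> \<Longrightarrow> k \<noteq> 0 \<Longrightarrow> 1 / k\<^sup>2 \<le> (real n)\<^sup>2"
  proof -
    assume "1 \<le> real n * \<bar>k\<bar>" "k \<noteq> 0"
    then have "1\<^sup>2 \<le> (real n * \<bar>k\<bar>)\<^sup>2" by (intro power_mono) auto
    with \<open>k \<noteq> 0\<close> show ?thesis by (simp add: power_mult_distrib divide_le_eq)
  qed
  show "\<bar>slope_multiplier n k h\<bar> \<le> real n + real n ^ 3"
  proof (cases "k = 0 \<or> \<not> (\<bar>h\<bar> \<le> real n \<and> 1 \<le> real n * \<bar>k\<bar>)")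
    case True
    then show ?thesis by (auto simp: slope_multiplier_def abs_mult sgn_if)
  next
    case False
    then have "\<bar>slope_multiplier n k h\<bar> = \<bar>h\<bar> * (1 / k\<^sup>2) / 4" by (simp add: slope_multiplier_def)
    also have "\<dots> \<le> real n * (real n)\<^sup>2 / 4"
      using False * by (intro divide_right_mono mult_mono) auto
    also have "\<dots> \<le> real n + real n ^ 3" by (simp add: power3_eq_cube power2_eq_square field_simps add_increasing)
    finally show ?thesis .
  qed
  show "\<bar>4 * k\<^sup>2 * (slope_multiplier n k h)\<^sup>2\<bar> \<le> real n ^ 4"
  proof (cases "k = 0 \<or> \<not> (\<bar>h\<bar> \<le> real n \<and> 1 \<le> real n * \<bar>k\<bar>)")
    case True
    then show ?thesis by (auto simp: slope_multiplier_def)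
  next
    case False
    then have "\<bar>4 * k\<^sup>2 * (slope_multiplier n k h)\<^sup>2\<bar> = \<bar>h\<bar>\<^sup>2 * (1 / k\<^sup>2) / 4"
      by (simp add: slope_multiplier_def power2_eq_square field_simps)
    also have "\<dots> \<le> (real n)\<^sup>2 * (real n)\<^sup>2 / 4"
      using False * by (intro divide_right_mono mult_mono power_mono) auto
    also have "\<dots> \<le> real n ^ 4" by (simp add: power4_eq_xxxx power2_eq_square)
    finally show ?thesis .
  qed
qed

lemma slope_truncation_tendsto:
  "(\<lambda>n. ennreal (k\<^sup>2 + slope_truncation n k h)) \<longlonglongrightarrow> ennreal (k\<^sup>2) + slope_energy k h"
proof (cases "k = 0")
  case k: True
  show ?thesis
  proof (cases "h = 0")
    case False
    have "(\<lambda>n. ennreal (2 * real n * \<bar>h\<bar>)) \<longlonglongrightarrow> \<top>"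
      unfolding tendsto_top_iff_ennreal
    proof (intro allI impI)
      fix l :: real assume l: "0 \<le> l"
      obtain N where N: "l / (2 * \<bar>h\<bar>) < real N" using reals_Archimedean2 by blast
      show "\<forall>\<^sub>F n in sequentially. ennreal l < ennreal (2 * real n * \<bar>h\<bar>)"
        unfolding eventually_sequentially
      proof (intro exI allI impI)
        fix n assume "N \<le> n"
        with N have "l / (2 * \<bar>h\<bar>) < real n" by linarith
        then have "l < 2 * real n * \<bar>h\<bar>" using False by (simp add: divide_less_eq mult_ac)
        then show "ennreal l < ennreal (2 * real n * \<bar>h\<bar>)" using l by (simp add: ennreal_less_iff)
      qed
    qed
    then show ?thesis using k False by (simp add: slope_truncation_def slope_energy_def)
  qed (simp add: k slope_truncation_def slope_energy_def)
next
  case False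
  obtain N where N: "max \<bar>h\<bar> (1 / \<bar>k\<bar>) < real N" using reals_Archimedean2 by blast
  have "\<forall>\<^sub>F n in sequentially. ennreal (k\<^sup>2) + slope_energy k h = ennreal (k\<^sup>2 + slope_truncation n k h)"
    unfolding eventually_sequentially
  proof (intro exI allI impI)
    fix n assume "N \<le> n"
    with N have "\<bar>h\<bar> \<le> real n" "1 / \<bar>k\<bar> \<le> real n" by linarith+
    then have "\<bar>h\<bar> \<le> real n" "1 \<le> real n * \<bar>k\<bar>" using False by (simp_all add: divide_le_eq)
    then show "ennreal (k\<^sup>2) + slope_energy k h = ennreal (k\<^sup>2 + slope_truncation n k h)"
      using False by (simp add: slope_truncation_def slope_energy_def ennreal_plus)
  qed
  then show ?thesis by (rule Lim_transform_eventually[OF tendsto_const])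
qed

text \<open>
  Superposing all profiles gives the measure on the plane whose density at (t, k) averages the densities of
  the profiles with wave number k. Its slope a is the correspondingly weighted average of the logarithmic slopes.
  The energy does not increase, by convexity: integrate the linear minorants with a bounded multiplier that
  depends on the image point only, and pass to the limit with Fatou's lemma. Integration by parts on each fibre
  shows that a is the density of the x-derivative.
\<close>

lemma profile_family_imp_sheet:
  assumes F: "profile_family \<Omega> Y \<eta>" and fin: "profile_energy \<Omega> Y \<eta> < \<infinity>"
  obtains m a where "sheet m a" "sheet_energy m a \<le> profile_energy \<Omega> Y \<eta>"
proof -
  note pf = profile_familyD[OF F]
  note [measurable] = pf(2,4,5)
  interpret prob_space \<Omega> by (rule pf)
  interpret P: pair_sigma_finite \<Omega> U01 ..
  let ?Q = "\<Omega> \<Otimes>\<^sub>M U01"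
  define g where "g q = prim (\<eta> (fst q)) (snd q)" for q
  define e where "e q = \<eta> (fst q) (snd q)" for q
  define T :: "_ \<times> real \<Rightarrow> real \<times> real" where "T q = (snd q, Y (fst q))" for q
  define E where "E = profile_energy \<Omega> Y \<eta>"
  have [measurable]: "g \<in> borel_measurable ?Q" "e \<in> borel_measurable ?Q"
    using pf(4,5) by (simp_all add: g_def[abs_def] e_def[abs_def])
  have sndQ [measurable]: "snd \<in> borel_measurable ?Q"
    using measurable_snd[of \<Omega> U01] measurable_cong_sets[OF refl sets_U01, of ?Q] by (rule back_subst)
  have T [measurable]: "T \<in> measurable ?Q borel"
    unfolding T_def[abs_def] borel_prod[symmetric] by measurable
  have ge: "AE q in ?Q. 0 \<le> g q \<and> (g q = 0 \<longrightarrow> e q = 0)" using pf(9) by (simp add: g_def e_def)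
  then have g0: "AE q in ?Q. 0 \<le> g q" and e0: "AE q in ?Q. g q = 0 \<longrightarrow> e q = 0" by (auto elim: eventually_mono)
  have E: "E = (\<integral>\<^sup>+q. cell_energy (Y (fst q)) (g q) (e q) \<partial>?Q)"
    by (simp add: E_def profile_energy_pair[OF F] g_def e_def)
  have marg: "(\<integral>\<^sup>+q. ennreal (g q) * indicator A (snd q) \<partial>?Q) = (\<integral>\<^sup>+t. ennreal (2 * t) * indicator A t \<partial>U01)"
    if [measurable]: "A \<in> sets borel" for A
  proof -
    have "(\<lambda>q. ennreal (g q) * indicator A (snd q)) \<in> borel_measurable ?Q" by measurable
    from U.nn_integral_fst[OF this] pf(8)[OF that] show ?thesis by (simp add: g_def)
  qed
  have gi: "integrable ?Q g"
  proof (rule integrableI_nonneg)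
    show "(\<integral>\<^sup>+q. ennreal (g q) \<partial>?Q) < \<infinity>" using marg[of UNIV] by (simp add: integral_id_U01)
  qed (use g0 in auto)
  have abs_le: "AE q in ?Q. ennreal \<bar>e q\<bar> \<le> cell_energy (Y (fst q)) (g q) (e q)"
    using ge by eventually_elim (rule cell_energy_ge_abs, auto)
  have ei: "integrable ?Q e"
  proof (rule integrableI_bounded)
    have "(\<integral>\<^sup>+q. ennreal (norm (e q)) \<partial>?Q) \<le> E"
      unfolding E real_norm_def by (rule nn_integral_mono_AE[OF abs_le])
    then show "(\<integral>\<^sup>+q. ennreal (norm (e q)) \<partial>?Q) < \<infinity>" using fin by (simp add: E_def)
  qed simp
  define m where "m = distr (density ?Q (\<lambda>q. ennreal (g q))) borel T"
  obtain a where a [measurable]: "a \<in> borel_measurable borel" and ai: "integrable m a"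
    and push': "\<forall>f\<in>borel_measurable borel. (\<exists>K. \<forall>p\<in>space borel. \<bar>f p\<bar> \<le> K) \<longrightarrow>
       (LINT p|m. f p * a p) = (LINT q|?Q. f (T q) * e q)"
    by (rule push_forward_density[OF T gi g0 ei e0, folded m_def])
  have push: "(LINT p|m. f p * a p) = (LINT q|?Q. f (T q) * e q)"
    if "f \<in> borel_measurable borel" "\<And>x. \<bar>f x\<bar> \<le> K" for f :: "real \<times> real \<Rightarrow> real" and K
    using push' that by blast
  have [simp, measurable_cong]: "sets m = sets borel" and [simp]: "space m = UNIV" by (simp_all add: m_def)
  have nnm: "(\<integral>\<^sup>+p. f p \<partial>m) = (\<integral>\<^sup>+q. ennreal (g q) * f (T q) \<partial>?Q)"
    if [measurable]: "f \<in> borel_measurable borel" for f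
    unfolding m_def by (subst nn_integral_distr, measurable, subst nn_integral_density) auto
  have lint: "(LINT p|m. f p) = (LINT q|?Q. g q * f (T q))"
    and inteq: "integrable m f \<longleftrightarrow> integrable ?Q (\<lambda>q. g q * f (T q))"
    if [measurable]: "f \<in> borel_measurable borel" for f :: "_ \<Rightarrow> real"
  proof -
    show "(LINT p|m. f p) = (LINT q|?Q. g q * f (T q))"
      unfolding m_def by (subst integral_distr, measurable, subst integral_density) (auto simp: g0)
    show "integrable m f \<longleftrightarrow> integrable ?Q (\<lambda>q. g q * f (T q))"
      unfolding m_def by (subst integrable_distr_eq, measurable, subst integrable_density) (auto simp: g0)
  qed
  have finm: "finite_measure m"
  proof (rule finite_measureI)
    have "emeasure m UNIV = (\<integral>\<^sup>+p. 1 \<partial>m)" by simp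
    also have "\<dots> = 1" using marg[of UNIV] by (subst nnm) (simp_all add: integral_id_U01)
    finally show "emeasure m (space m) \<noteq> \<infinity>" by simp
  qed
  interpret m: finite_measure m by fact
  have sheet: "sheet m a"
    unfolding sheet_def
  proof (intro conjI ballI)
    have "emeasure m (- half_strip) = (\<integral>\<^sup>+p. indicator (- half_strip) p \<partial>m)" by simp
    also have "\<dots> = (\<integral>\<^sup>+q. ennreal (g q) * indicator (- half_strip) (T q) \<partial>?Q)"
      by (rule nnm) measurable
    also have "\<dots> = (\<integral>\<^sup>+q. ennreal (g q) * indicator (- {0<..<1}) (snd q) \<partial>?Q)"
      by (intro nn_integral_cong) (auto simp: T_def half_strip_def indicator_def)
    also have "\<dots> = (\<integral>\<^sup>+t. ennreal (2 * t) * indicator (- {0<..<1}) t \<partial>U01)" by (rule marg) auto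
    also have "\<dots> = (\<integral>\<^sup>+t. 0 \<partial>U01)"
      by (rule nn_integral_cong_AE) (use AE_U01 in \<open>eventually_elim, simp\<close>)
    finally show "emeasure m (- half_strip) = 0" by simp
    show "distr m borel fst = density U01 (\<lambda>x. ennreal (2 * x))"
    proof (rule measure_eqI)
      fix A assume "A \<in> sets (distr m borel fst)"
      then have A [measurable]: "A \<in> sets borel" by simp
      have "emeasure (distr m borel fst) A = (\<integral>\<^sup>+p. indicator A (fst p) \<partial>m)"
        by (subst nn_integral_indicator[symmetric], simp, subst nn_integral_distr) auto
      also have "\<dots> = (\<integral>\<^sup>+q. ennreal (g q) * indicator A (fst (T q)) \<partial>?Q)"
        by (rule nnm) measurable
      also have "\<dots> = (\<integral>\<^sup>+t. ennreal (2 * t) * indicator A t \<partial>U01)" using marg[OF A] by (simp add: T_def)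
      also have "\<dots> = emeasure (density U01 (\<lambda>x. ennreal (2 * x))) A" by (subst emeasure_density) auto
      finally show "emeasure (distr m borel fst) A = emeasure (density U01 (\<lambda>x. ennreal (2 * x))) A" .
    qed simp
    fix \<phi> assume \<phi>: "\<phi> \<in> test_fun strip"
    note \<phi>m [measurable] = test_fun_measurable[OF \<phi>]
    obtain D B where D: "continuous_on UNIV D" "\<And>p. \<bar>D p\<bar> \<le> B"
      "\<And>x k. ((\<lambda>t. \<phi> (t, k)) has_real_derivative D (x, k)) (at x)"
      "\<And>x k. deriv (\<lambda>t. \<phi> (t, k)) x = D (x, k)"
      using test_fun_strip_x_derivative[OF \<phi>] by metis
    have Dm [measurable]: "D \<in> borel_measurable borel" using D(1) by (rule borel_measurable_continuous_onI)
    obtain K where K: "\<And>p. \<bar>\<phi> p\<bar> \<le> K" using test_fun_props(4)[OF \<phi>] by metis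
    have i1: "integrable ?Q (\<lambda>q. \<phi> (T q) * e q)"
      by (rule integrable_bounded_mult(1)[OF ei, where K=K]) (auto simp: K)
    have i2: "integrable ?Q (\<lambda>q. D (T q) * g q)"
      by (rule integrable_bounded_mult(1)[OF gi, where K=B]) (auto simp: D)
    have "(LINT p|m. \<phi> p * a p) = (LINT q|?Q. \<phi> (T q) * e q)" by (rule push[OF \<phi>m K])
    also have "\<dots> = (LINT w|\<Omega>. LINT t|U01. \<phi> (T (w, t)) * e (w, t))"
      by (rule P.integral_fst'[OF i1, symmetric])
    also have "\<dots> = (LINT w|\<Omega>. - (LINT t|U01. D (T (w, t)) * g (w, t)))"
    proof (rule integral_cong_AE)
      show "AE w in \<Omega>. (LINT t|U01. \<phi> (T (w, t)) * e (w, t)) = - (LINT t|U01. D (T (w, t)) * g (w, t))"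
        using pf(6)
      proof eventually_elim
        case (elim w)
        have "(LINT t|U01. D (t, Y w) * prim (\<eta> w) t) = - (LINT x|U01. \<phi> (x, Y w) * \<eta> w x)"
        proof (rule fiber_integration_by_parts[OF elim])
          show "continuous_on UNIV (\<lambda>t. D (t, Y w))"
            by (rule continuous_on_compose2[OF D(1)]) (auto intro!: continuous_intros)
          show "\<phi> (1, Y w) = 0" by (rule test_fun_props(6)[OF \<phi>]) (simp add: strip_def)
        qed (use D in auto)
        then show ?case by (simp add: T_def e_def g_def)
      qed
      have "(\<lambda>(w, t). \<phi> (T (w, t)) * e (w, t)) \<in> borel_measurable ?Q" "(\<lambda>(w, t). D (T (w, t)) * g (w, t)) \<in> borel_measurable ?Q"
        using i1 i2 by (auto simp: split_beta')
      from this[THEN U.borel_measurable_lebesgue_integral]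
      show "(\<lambda>w. LINT t|U01. \<phi> (T (w, t)) * e (w, t)) \<in> borel_measurable \<Omega>"
        "(\<lambda>w. - (LINT t|U01. D (T (w, t)) * g (w, t))) \<in> borel_measurable \<Omega>" by auto
    qed
    also have "\<dots> = - (LINT q|?Q. D (T q) * g q)"
      using P.integral_fst'[OF i2] by simp
    also have "(LINT q|?Q. D (T q) * g q) = (LINT p|m. D p)"
      by (subst lint) (auto simp: mult.commute)
    finally show "(LINT p|m. \<phi> p * a p) = - (LINT p|m. deriv (\<lambda>t. \<phi> (t, snd p)) (fst p))"
      by (simp add: D(4))
  qed (auto intro: ai finm)
  have "sheet_energy m a \<le> E"
  proof -
    define c where "c n p = slope_multiplier n (snd p) (a p)" for n p
    define v where "v n p = slope_truncation n (snd p) (a p)" for n p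
    have [measurable]: "c n \<in> borel_measurable borel" "v n \<in> borel_measurable borel" for n
      unfolding c_def slope_multiplier_def v_def slope_truncation_def sgn_if by measurable
    have ki: "integrable ?Q (\<lambda>q. g q * (snd (T q))\<^sup>2)"
    proof (rule integrableI_nonneg)
      have "(\<integral>\<^sup>+q. ennreal (g q * (snd (T q))\<^sup>2) \<partial>?Q) \<le> E"
        unfolding E
      proof (rule nn_integral_mono_AE)
        show "AE q in ?Q. ennreal (g q * (snd (T q))\<^sup>2) \<le> cell_energy (Y (fst q)) (g q) (e q)"
          using ge
        proof eventually_elim
          case (elim q)
          with cell_energy_ge_dual[of "g q" "e q" "Y (fst q)" 0] show ?case by (simp add: T_def mult.commute)
        qed
      qed
      then show "(\<integral>\<^sup>+q. ennreal (g q * (snd (T q))\<^sup>2) \<partial>?Q) < \<infinity>" using fin by (simp add: E_def)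
    qed (use g0 in auto)
    have kim: "integrable m (\<lambda>p. (snd p)\<^sup>2)" using ki by (subst inteq) auto
    have bound: "(\<integral>\<^sup>+p. ennreal ((snd p)\<^sup>2 + v n p) \<partial>m) \<le> E" for n
    proof -
      define w where "w p = 4 * (snd p)\<^sup>2 * (c n p)\<^sup>2" for p
      have [measurable]: "w \<in> borel_measurable borel" unfolding w_def by measurable
      have cb: "\<bar>c n p\<bar> \<le> real n + real n ^ 3" "\<bar>w p\<bar> \<le> real n ^ 4" for p
        using slope_multiplier_bounds by (auto simp: c_def w_def)
      have i1: "integrable ?Q (\<lambda>q. c n (T q) * e q)"
        by (rule integrable_bounded_mult(1)[OF ei, where K="real n + real n ^ 3"]) (auto simp: cb)
      have i2: "integrable ?Q (\<lambda>q. g q * w (T q))"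
        by (rule integrable_bounded_mult(2)[OF gi, where K="real n ^ 4"]) (auto simp: cb)
      have j1: "integrable m (\<lambda>p. c n p * a p)"
        by (rule integrable_bounded_mult(1)[OF ai, where K="real n + real n ^ 3"]) (auto simp: cb)
      have j2: "integrable m w"
        by (rule m.integrable_const_bound[where B="real n ^ 4"]) (auto simp: cb)
      have veq: "(snd p)\<^sup>2 + v n p = (snd p)\<^sup>2 + 2 * (c n p * a p) - w p" for p
        using slope_truncation_eq[of n "snd p" "a p"] by (simp add: v_def c_def w_def mult.assoc)
      have iv: "integrable m (\<lambda>p. (snd p)\<^sup>2 + v n p)" unfolding veq using kim j1 j2 by simp
      have "(LINT p|m. (snd p)\<^sup>2 + v n p) = (LINT p|m. (snd p)\<^sup>2) + 2 * (LINT p|m. c n p * a p) - (LINT p|m. w p)"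
        unfolding veq using kim j1 j2 by simp
      also have "\<dots> = (LINT q|?Q. g q * (snd (T q))\<^sup>2) + 2 * (LINT q|?Q. c n (T q) * e q) - (LINT q|?Q. g q * w (T q))"
        using push[of "c n" "real n + real n ^ 3"] cb by (simp add: lint)
      also have "\<dots> = (LINT q|?Q. g q * (snd (T q))\<^sup>2 + 2 * (c n (T q) * e q) - g q * w (T q))"
        using ki i1 i2 by simp
      finally have eq: "(LINT p|m. (snd p)\<^sup>2 + v n p) = \<dots>" .
      have "(\<integral>\<^sup>+p. ennreal ((snd p)\<^sup>2 + v n p) \<partial>m) = ennreal (LINT p|m. (snd p)\<^sup>2 + v n p)"
        by (rule nn_integral_eq_integral[OF iv]) (auto simp: v_def slope_truncation_nonneg)
      also have "\<dots> \<le> (\<integral>\<^sup>+q. ennreal (g q * (snd (T q))\<^sup>2 + 2 * (c n (T q) * e q) - g q * w (T q)) \<partial>?Q)"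
        unfolding eq by (rule ennreal_integral_le_nn_integral) (use ki i1 i2 in simp)
      also have "\<dots> \<le> E"
        unfolding E
      proof (rule nn_integral_mono_AE)
        show "AE q in ?Q. ennreal (g q * (snd (T q))\<^sup>2 + 2 * (c n (T q) * e q) - g q * w (T q)) \<le>
            cell_energy (Y (fst q)) (g q) (e q)"
          using ge
        proof eventually_elim
          case (elim q)
          then show ?case
            using cell_energy_ge_dual[of "g q" "e q" "Y (fst q)" "c n (T q)"] by (simp add: T_def w_def ac_simps)
        qed
      qed
      finally show ?thesis .
    qed
    have "sheet_energy m a \<le> (\<integral>\<^sup>+p. liminf (\<lambda>n. ennreal ((snd p)\<^sup>2 + v n p)) \<partial>m)"
      unfolding sheet_energy_def
    proof (rule nn_integral_mono)
      fix p show "ennreal ((snd p)\<^sup>2) + slope_energy (snd p) (a p) \<le> liminf (\<lambda>n. ennreal ((snd p)\<^sup>2 + v n p))"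
        using lim_imp_Liminf[OF _ slope_truncation_tendsto[of "snd p" "a p"]] by (simp add: v_def)
    qed
    also have "\<dots> \<le> liminf (\<lambda>n. \<integral>\<^sup>+p. ennreal ((snd p)\<^sup>2 + v n p) \<partial>m)"
      by (rule nn_integral_liminf) measurable
    also have "\<dots> \<le> liminf (\<lambda>n. E)" by (intro Liminf_mono always_eventually allI bound)
    also have "\<dots> = E" by (simp add: Liminf_const)
    finally show ?thesis .
  qed
  with sheet that show thesis by (simp add: E_def)
qed

section \<open>A competitor of finite energy\<close>

text \<open>
  The derivative in t of 60 (r - r^2)^2, where r = w/t < 1. The profile with parameter w lives on (w,1) and
  depends on w/t only; since the integral of (r - r^2)^2 over (0,1) is 1/30, the profiles add up to the
  density 2t at t.
\<close>

definition wedge_slope :: "real \<Rightarrow> real \<Rightarrow> real" where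
  "wedge_slope w t = (if w < t then 120 * (w / t - w\<^sup>2 / t\<^sup>2) * (2 * w\<^sup>2 / t ^ 3 - w / t\<^sup>2) else 0)"

lemma wedge_slope_measurable [measurable]:
  "(\<lambda>(w, t). wedge_slope w t) \<in> borel_measurable (borel \<Otimes>\<^sub>M borel)"
  unfolding wedge_slope_def split_beta' by measurable

lemma wedge_slope_fiber [measurable]: "wedge_slope w \<in> borel_measurable borel"
  unfolding wedge_slope_def[abs_def] by measurable

lemma wedge_profile:
  assumes w: "0 < w" "w < 1" and t: "0 < t" "t < 1"
  shows "prim (wedge_slope w) t = (if w < t then 60 * (w / t - w\<^sup>2 / t\<^sup>2)\<^sup>2 else 0)"
proof (cases "w < t")
  case True
  have "prim (wedge_slope w) t = (LINT x|lborel. (120 * (w / x - w\<^sup>2 / x\<^sup>2) * (2 * w\<^sup>2 / x ^ 3 - w / x\<^sup>2)) * indicator {w..t} x)"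
    unfolding prim_def
  proof (subst integral_U01, measurable, unfold set_lebesgue_integral_def, rule integral_cong_AE)
    show "AE x in lborel. indicator {0<..<1} x *\<^sub>R (indicator {..<t} x * wedge_slope w x) =
        (120 * (w / x - w\<^sup>2 / x\<^sup>2) * (2 * w\<^sup>2 / x ^ 3 - w / x\<^sup>2)) * indicator {w..t} x"
      using AE_lborel_singleton[of w] AE_lborel_singleton[of t]
      by eventually_elim (use w t in \<open>auto simp: indicator_def wedge_slope_def\<close>)
  qed measurable
  also have "\<dots> = 60 * (w / t - w\<^sup>2 / t\<^sup>2)\<^sup>2 - 60 * (w / w - w\<^sup>2 / w\<^sup>2)\<^sup>2"
  proof (rule integral_FTC_Icc_real)
    fix x assume "w \<le> x" "x \<le> t"
    then have "x \<noteq> 0" using w by auto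
    then show "((\<lambda>x. 60 * (w / x - w\<^sup>2 / x\<^sup>2)\<^sup>2) has_real_derivative
        (120 * (w / x - w\<^sup>2 / x\<^sup>2) * (2 * w\<^sup>2 / x ^ 3 - w / x\<^sup>2))) (at x)"
      by (auto intro!: derivative_eq_intros simp: field_simps power2_eq_square power3_eq_cube)
    show "isCont (\<lambda>x. 120 * (w / x - w\<^sup>2 / x\<^sup>2) * (2 * w\<^sup>2 / x ^ 3 - w / x\<^sup>2)) x"
      using \<open>x \<noteq> 0\<close> by (auto intro!: continuous_intros)
  qed (use True in auto)
  finally show ?thesis using True w by simp
next
  case False
  have "prim (wedge_slope w) t = (LINT x|U01. 0)"
    unfolding prim_def by (rule Bochner_Integration.integral_cong) (use False in \<open>auto simp: wedge_slope_def indicator_def\<close>)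
  with False show ?thesis by simp
qed

lemma cell_energy_eq:
  assumes "0 \<le> g" "k \<noteq> 0"
  shows "cell_energy k g h = ennreal (k\<^sup>2 * g + 1 / (4 * k\<^sup>2) * (h / g)\<^sup>2 * g)"
proof -
  have "cell_energy k g h = ennreal ((k\<^sup>2 + 1 / (4 * k\<^sup>2) * (h / g)\<^sup>2) * g)"
    using assms by (simp add: cell_energy_def slope_energy_def ennreal_mult ennreal_plus)
  then show ?thesis by (simp only: distrib_right)
qed

text \<open>
  With r = w/t and k^2 = 1/w, both parts of the energy are 60 / t times a polynomial in r that is at most 1.
\<close>

lemma wedge_cell_energy:
  assumes w: "0 < w" and wt: "w < t"
  shows "cell_energy (1 / sqrt w) (60 * (w / t - w\<^sup>2 / t\<^sup>2)\<^sup>2) (wedge_slope w t) \<le> ennreal (120 / t)"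
proof -
  define r where "r = w / t"
  have t: "t > 0" using assms by simp
  have r: "0 < r" "r < 1" and we: "w = r * t" using assms t by (auto simp: r_def)
  define g where "g = 60 * (r - r\<^sup>2)\<^sup>2"
  define h where "h = 120 * (r - r\<^sup>2) * ((2 * r\<^sup>2 - r) / t)"
  have r2: "r - r\<^sup>2 > 0" using r by (simp add: power2_eq_square)
  have e1: "60 * (w / t - w\<^sup>2 / t\<^sup>2)\<^sup>2 = g" using t by (simp add: g_def we power_mult_distrib)
  have e2: "wedge_slope w t = h"
    using wt t by (simp add: wedge_slope_def h_def we power_mult_distrib field_simps power2_eq_square power3_eq_cube)
  have k2: "(1 / sqrt w)\<^sup>2 = 1 / w" using w by (simp add: power_divide)
  have "cell_energy (1 / sqrt w) g h = ennreal (1 / w * g + 1 / (4 * (1 / w)) * (h / g)\<^sup>2 * g)"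
    using w cell_energy_eq[of g "1 / sqrt w" h] by (simp add: k2 g_def)
  also have "1 / w * g + 1 / (4 * (1 / w)) * (h / g)\<^sup>2 * g = 60 * (r * (1 - r)\<^sup>2 / t) + 60 * (r * (2 * r\<^sup>2 - r)\<^sup>2 / t)"
  proof -
    have "(120 * u * q / (60 * u\<^sup>2))\<^sup>2 * (60 * u\<^sup>2) = 240 * q\<^sup>2" if "u \<noteq> 0" for u q :: real
      using that by (simp add: field_simps power2_eq_square)
    from this[of "r - r\<^sup>2" "(2 * r\<^sup>2 - r) / t"] have "(h / g)\<^sup>2 * g = 240 * ((2 * r\<^sup>2 - r) / t)\<^sup>2"
      using r2 unfolding h_def g_def by simp
    then have "1 / (4 * (1 / w)) * (h / g)\<^sup>2 * g = w * 60 * ((2 * r\<^sup>2 - r) / t)\<^sup>2"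
      by (simp add: mult.assoc)
    also have "\<dots> = 60 * (r * (2 * r\<^sup>2 - r)\<^sup>2 / t)" using t by (simp add: we power_divide power2_eq_square)
    finally have A: "1 / (4 * (1 / w)) * (h / g)\<^sup>2 * g = 60 * (r * (2 * r\<^sup>2 - r)\<^sup>2 / t)" .
    have "r - r\<^sup>2 = r * (1 - r)" by (simp add: power2_eq_square algebra_simps)
    then have B: "1 / w * g = 60 * (r * (1 - r)\<^sup>2 / t)"
      using r t by (simp add: g_def we power_mult_distrib power2_eq_square)
    show ?thesis unfolding A B ..
  qed
  also have "ennreal \<dots> \<le> ennreal (120 / t)"
  proof (rule ennreal_leI)
    have "r * (1 - r)\<^sup>2 \<le> 1" using r by (intro mult_le_one power_le_one) auto
    moreover have "(2 * r\<^sup>2 - r)\<^sup>2 \<le> 1"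
    proof -
      have "r\<^sup>2 \<le> r" "0 \<le> r\<^sup>2" using r by (auto simp: power2_eq_square mult_left_le)
      then have "\<bar>2 * r\<^sup>2 - r\<bar> \<le> 1" using r by linarith
      then show ?thesis by (simp add: abs_square_le_1)
    qed
    then have "r * (2 * r\<^sup>2 - r)\<^sup>2 \<le> 1" using r by (intro mult_le_one) auto
    ultimately have "60 * (r * (1 - r)\<^sup>2) + 60 * (r * (2 * r\<^sup>2 - r)\<^sup>2) \<le> 120" by linarith
    then have "(60 * (r * (1 - r)\<^sup>2) + 60 * (r * (2 * r\<^sup>2 - r)\<^sup>2)) / t \<le> 120 / t"
      using t by (intro divide_right_mono) auto
    then show "60 * (r * (1 - r)\<^sup>2 / t) + 60 * (r * (2 * r\<^sup>2 - r)\<^sup>2 / t) \<le> 120 / t"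
      by (simp add: add_divide_distrib)
  qed
  finally show ?thesis by (simp add: e1 e2)
qed

text \<open>
  At each t only the parameters w < t contribute, so the bound 120 / t integrates to 120.
\<close>

lemma finite_energy_profile_family:
  "profile_family U01 (\<lambda>w. 1 / sqrt w) wedge_slope" "profile_energy U01 (\<lambda>w. 1 / sqrt w) wedge_slope \<le> 120"
proof -
  interpret P: pair_sigma_finite U01 U01 ..
  have m: "(\<lambda>(w, t). wedge_slope w t) \<in> borel_measurable (U01 \<Otimes>\<^sub>M U01)" by measurable
  have pm: "(\<lambda>(w, t). prim (wedge_slope w) t) \<in> borel_measurable (U01 \<Otimes>\<^sub>M U01)"
    by (rule prim_measurable_pair[OF m])
  then have [measurable]: "(\<lambda>q. prim (wedge_slope (fst q)) (snd q)) \<in> borel_measurable (U01 \<Otimes>\<^sub>M U01)"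
    by (simp add: split_beta')
  show "profile_family U01 (\<lambda>w. 1 / sqrt w) wedge_slope"
    unfolding profile_family_def
  proof (intro conjI ballI m)
    show "AE w in U01. integrable U01 (wedge_slope w)"
      using AE_U01
    proof eventually_elim
      case (elim w)
      show ?case
      proof (rule U.integrable_const_bound[where B="120 * (3 / w)"])
        show "AE t in U01. norm (wedge_slope w t) \<le> 120 * (3 / w)"
          using AE_U01
        proof eventually_elim
          case (elim t)
          show ?case
          proof (cases "w < t")
            case True
            have w: "w > 0" using \<open>w \<in> {0<..<1}\<close> by simp
            define r where "r = w / t"
            have t: "t > 0" using True w by simp
            have r: "0 < r" "r < 1" and we: "w = r * t" using True w t by (auto simp: r_def)
            have r2: "r\<^sup>2 \<le> r" "0 \<le> r\<^sup>2" using r by (auto simp: power2_eq_square mult_left_le)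
            have e: "wedge_slope w t = 120 * (r - r\<^sup>2) * ((2 * r\<^sup>2 - r) / t)"
              using True t by (simp add: wedge_slope_def we power_mult_distrib field_simps power2_eq_square power3_eq_cube)
            have "norm (wedge_slope w t) = 120 * (\<bar>r - r\<^sup>2\<bar> * (\<bar>2 * r\<^sup>2 - r\<bar> / t))"
              unfolding e real_norm_def abs_mult abs_divide using t by simp
            also have "\<dots> \<le> 120 * (1 * (1 / t))"
            proof (intro mult_left_mono mult_mono divide_right_mono)
              show "\<bar>r - r\<^sup>2\<bar> \<le> 1" "\<bar>2 * r\<^sup>2 - r\<bar> \<le> 1" using r r2 by linarith+
            qed (use t in auto)
            also have "\<dots> \<le> 120 * (3 / w)" using True w t by (simp add: field_simps)
            finally show ?thesis .
          qed (use elim \<open>w \<in> {0<..<1}\<close> in \<open>simp add: wedge_slope_def\<close>)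
        qed
      qed measurable
    qed
    show "AE w in U01. AE t in U01. 0 \<le> prim (wedge_slope w) t \<and> (prim (wedge_slope w) t = 0 \<longrightarrow> wedge_slope w t = 0)"
      using AE_U01
    proof eventually_elim
      case (elim w)
      then have w: "0 < w" "w < 1" by auto
      show ?case
        using AE_U01
      proof eventually_elim
        case (elim t)
        then show ?case using wedge_profile[OF w, of t] by (auto simp: wedge_slope_def)
      qed
    qed
    fix A :: "real set" assume A [measurable]: "A \<in> sets borel"
    have "(\<integral>\<^sup>+w. \<integral>\<^sup>+t. ennreal (prim (wedge_slope w) t) * indicator A t \<partial>U01 \<partial>U01) =
        (\<integral>\<^sup>+t. \<integral>\<^sup>+w. ennreal (prim (wedge_slope w) t) * indicator A t \<partial>U01 \<partial>U01)"
      by (rule P.Fubini'[symmetric]) (simp add: split_beta')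
    also have "\<dots> = (\<integral>\<^sup>+t. ennreal (2 * t) * indicator A t \<partial>U01)"
    proof (rule nn_integral_cong_AE)
      show "AE t in U01. (\<integral>\<^sup>+w. ennreal (prim (wedge_slope w) t) * indicator A t \<partial>U01) = ennreal (2 * t) * indicator A t"
        using AE_U01
      proof eventually_elim
        case (elim t)
        then have t: "0 < t" "t < 1" by auto
        have "(\<integral>\<^sup>+w. ennreal (prim (wedge_slope w) t) \<partial>U01) = (\<integral>\<^sup>+w. ennreal (60 * (w / t - w\<^sup>2 / t\<^sup>2)\<^sup>2) * indicator {..<t} w \<partial>U01)"
        proof (rule nn_integral_cong_AE)
          show "AE w in U01. ennreal (prim (wedge_slope w) t) = ennreal (60 * (w / t - w\<^sup>2 / t\<^sup>2)\<^sup>2) * indicator {..<t} w"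
            using AE_U01 by eventually_elim (use t in \<open>auto simp: wedge_profile indicator_def\<close>)
        qed
        also have "\<dots> = (\<integral>\<^sup>+w. ennreal (60 * (w / t - w\<^sup>2 / t\<^sup>2)\<^sup>2) * indicator {0..t} w \<partial>lborel)"
        proof (subst nn_integral_U01, measurable, rule nn_integral_cong_AE)
          show "AE w in lborel. ennreal (60 * (w / t - w\<^sup>2 / t\<^sup>2)\<^sup>2) * indicator {..<t} w * indicator {0<..<1} w =
              ennreal (60 * (w / t - w\<^sup>2 / t\<^sup>2)\<^sup>2) * indicator {0..t} w"
            using AE_lborel_singleton[of 0] AE_lborel_singleton[of t]
            by eventually_elim (use t in \<open>auto simp: indicator_def\<close>)
        qed
        also have "\<dots> = ennreal (60 * (t ^ 3 / (3 * t\<^sup>2) - t ^ 4 / (2 * t ^ 3) + t ^ 5 / (5 * t ^ 4)) - 60 * (0 ^ 3 / (3 * t\<^sup>2) - 0 ^ 4 / (2 * t ^ 3) + 0 ^ 5 / (5 * t ^ 4)))"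
        proof (rule nn_integral_FTC_Icc)
          show "((\<lambda>w. 60 * (w ^ 3 / (3 * t\<^sup>2) - w ^ 4 / (2 * t ^ 3) + w ^ 5 / (5 * t ^ 4))) has_real_derivative
              60 * (w / t - w\<^sup>2 / t\<^sup>2)\<^sup>2) (at w)" for w
            using t by (auto intro!: derivative_eq_intros simp: field_simps power2_eq_square power3_eq_cube power4_eq_xxxx)
        qed (use t in auto)
        also have "60 * (t ^ 3 / (3 * t\<^sup>2) - t ^ 4 / (2 * t ^ 3) + t ^ 5 / (5 * t ^ 4)) - 60 * (0 ^ 3 / (3 * t\<^sup>2) - 0 ^ 4 / (2 * t ^ 3) + 0 ^ 5 / (5 * t ^ 4)) = 2 * t"
          using t by (simp add: field_simps eval_nat_numeral)
        finally have "(\<integral>\<^sup>+w. ennreal (prim (wedge_slope w) t) \<partial>U01) = ennreal (2 * t)" .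
        moreover have "(\<lambda>w. ennreal (prim (wedge_slope w) t)) \<in> borel_measurable U01"
          by (intro measurable_compose[OF _ measurable_ennreal] prim_measurable m borel_measurable_const)
        ultimately show ?case by (simp add: nn_integral_multc)
      qed
    qed
    finally show "(\<integral>\<^sup>+w. \<integral>\<^sup>+t. ennreal (prim (wedge_slope w) t) * indicator A t \<partial>U01 \<partial>U01) =
        (\<integral>\<^sup>+t. ennreal (2 * t) * indicator A t \<partial>U01)" .
  qed (auto intro: prob_space_U01)
  have "profile_energy U01 (\<lambda>w. 1 / sqrt w) wedge_slope \<le>
      (\<integral>\<^sup>+w. \<integral>\<^sup>+t. ennreal (120 / t) * indicator {..<t} w \<partial>U01 \<partial>U01)"
    unfolding profile_energy_def fiber_energy_def
  proof (rule nn_integral_mono_AE)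
    show "AE w in U01. (\<integral>\<^sup>+t. cell_energy (1 / sqrt w) (prim (wedge_slope w) t) (wedge_slope w t) \<partial>U01) \<le>
        (\<integral>\<^sup>+t. ennreal (120 / t) * indicator {..<t} w \<partial>U01)"
      using AE_U01
    proof eventually_elim
      case (elim w)
      then have w: "0 < w" "w < 1" by auto
      show ?case
      proof (rule nn_integral_mono_AE)
        show "AE t in U01. cell_energy (1 / sqrt w) (prim (wedge_slope w) t) (wedge_slope w t) \<le> ennreal (120 / t) * indicator {..<t} w"
          using AE_U01
        proof eventually_elim
          case (elim t)
          then show ?case
            using wedge_profile[OF w, of t] wedge_cell_energy[OF w(1), of t] by (auto simp: cell_energy_def)
        qed
      qed
    qed
  qed
  also have "\<dots> = (\<integral>\<^sup>+t. \<integral>\<^sup>+w. ennreal (120 / t) * indicator {..<t} w \<partial>U01 \<partial>U01)"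
  proof (rule P.Fubini'[symmetric])
    have "(\<lambda>q. ennreal (120 / snd q) * indicator {..<snd q} (fst q)) = (\<lambda>q. if fst q < snd q then ennreal (120 / snd q) else 0)"
      by (auto simp: indicator_def)
    also have "\<dots> \<in> borel_measurable (U01 \<Otimes>\<^sub>M U01)" by measurable
    finally show "(\<lambda>(w, t). ennreal (120 / t) * indicator {..<t} w) \<in> borel_measurable (U01 \<Otimes>\<^sub>M U01)"
      by (simp add: split_beta')
  qed
  also have "\<dots> = (\<integral>\<^sup>+t. 120 \<partial>U01)"
  proof (rule nn_integral_cong_AE)
    show "AE t in U01. (\<integral>\<^sup>+w. ennreal (120 / t) * indicator {..<t} w \<partial>U01) = 120"
      using AE_U01
    proof eventually_elim
      case (elim t)
      have "(\<integral>\<^sup>+w. indicator {..<t} w \<partial>U01) = (\<integral>\<^sup>+w. indicator {0<..<t} w \<partial>lborel)"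
        by (subst nn_integral_U01, measurable, rule nn_integral_cong) (use elim in \<open>auto simp: indicator_def\<close>)
      then have "(\<integral>\<^sup>+w. ennreal (120 / t) * indicator {..<t} w \<partial>U01) = ennreal (120 / t) * ennreal t"
        using elim by (simp add: nn_integral_cmult)
      also have "\<dots> = 120" using elim by (simp add: ennreal_mult[symmetric])
      finally show ?case .
    qed
  qed
  also have "\<dots> = 120" using U.emeasure_space_1 by simp
  finally show "profile_energy U01 (\<lambda>w. 1 / sqrt w) wedge_slope \<le> 120" .
qed

section \<open>Convergence of convex combinations\<close>

lemma integrable_square_product:
  fixes f g :: "'a \<Rightarrow> real"
  assumes [measurable]: "f \<in> borel_measurable M" "g \<in> borel_measurable M"
    and "integrable M (\<lambda>x. (f x)\<^sup>2)" "integrable M (\<lambda>x. (g x)\<^sup>2)"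
  shows "integrable M (\<lambda>x. f x * g x)"
proof (rule Bochner_Integration.integrable_bound)
  show "integrable M (\<lambda>x. (f x)\<^sup>2 + (g x)\<^sup>2)" using assms by simp
  show "AE x in M. norm (f x * g x) \<le> norm ((f x)\<^sup>2 + (g x)\<^sup>2)"
  proof (rule AE_I2)
    fix x
    have "0 \<le> (\<bar>f x\<bar> - \<bar>g x\<bar>)\<^sup>2" by simp
    then have "2 * (\<bar>f x\<bar> * \<bar>g x\<bar>) \<le> (f x)\<^sup>2 + (g x)\<^sup>2" by (simp add: power2_diff)
    moreover have "0 \<le> \<bar>f x\<bar> * \<bar>g x\<bar>" by simp
    ultimately have "\<bar>f x\<bar> * \<bar>g x\<bar> \<le> (f x)\<^sup>2 + (g x)\<^sup>2" by linarith
    then show "norm (f x * g x) \<le> norm ((f x)\<^sup>2 + (g x)\<^sup>2)" by (simp add: abs_mult)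
  qed
qed measurable

text \<open>
  A substitute for weak compactness in L^2. Consider the convex hulls of the tails of the sequence. Elements
  whose norms nearly attain the infimum over the hulls are close to each other by the parallelogram identity,
  because their midpoint cannot have a much smaller norm. If the distances decrease geometrically, the
  convergence is almost everywhere and the increments add up to an integrable majorant. The coefficients
  vanish for j < n, so limits of the original indices survive the averaging.
\<close>

lemma convex_combinations_converge:
  fixes f :: "nat \<Rightarrow> 'a \<Rightarrow> real"
  assumes fin: "finite_measure N" and f [measurable]: "\<And>n. f n \<in> borel_measurable N"
    and bd: "\<And>n. (\<integral>\<^sup>+x. ennreal ((f n x)\<^sup>2) \<partial>N) \<le> ennreal C"
  obtains c :: "nat \<Rightarrow> nat \<Rightarrow> real" and m :: "nat \<Rightarrow> nat" and D F
  where "\<And>n j. 0 \<le> c n j" "\<And>n j. j < n \<Longrightarrow> c n j = 0" "\<And>n. (\<Sum>j<m n. c n j) = 1"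
    "F \<in> borel_measurable N" "integrable N D"
    "AE x in N. (\<forall>n. \<bar>\<Sum>j<m n. c n j * f j x\<bar> \<le> D x) \<and> (\<lambda>n. \<Sum>j<m n. c n j * f j x) \<longlonglongrightarrow> F x"
proof -
  interpret finite_measure N by fact
  define K :: "nat \<Rightarrow> ((nat \<Rightarrow> real) \<times> nat) set" where
    "K n = {(c, m). (\<forall>j. 0 \<le> c j) \<and> (\<forall>j<n. c j = 0) \<and> (\<forall>j\<ge>m. c j = 0) \<and> (\<Sum>j<m. c j) = 1}" for n
  \<comment> \<open>K n encodes the finite convex combinations of the f j with j \<ge> n, G the function so obtained.\<close>
  define G :: "(nat \<Rightarrow> real) \<times> nat \<Rightarrow> 'a \<Rightarrow> real" where "G p x = (\<Sum>j<snd p. fst p j * f j x)" for p x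
  define q where "q p = (LINT x|N. (G p x)\<^sup>2)" for p
  define I where "I n = Inf (q ` K n)" for n
  have [measurable]: "G p \<in> borel_measurable N" for p unfolding G_def by measurable
  have f2: "integrable N (\<lambda>x. (f j x)\<^sup>2)" for j
  proof (rule integrableI_bounded)
    show "(\<integral>\<^sup>+x. ennreal (norm ((f j x)\<^sup>2)) \<partial>N) < \<infinity>"
      using bd[of j] by (simp add: le_less_trans[OF _ ennreal_less_top])
  qed measurable
  have G2: "integrable N (\<lambda>x. (G p x)\<^sup>2)" for p
  proof -
    have "(G p x)\<^sup>2 = (\<Sum>i<snd p. \<Sum>j<snd p. (fst p i * fst p j) * (f i x * f j x))" for x
      by (simp add: G_def power2_eq_square sum_product ac_simps)
    then show ?thesis
      using integrable_square_product[OF f f f2 f2] by simp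
  qed
  have Gprod: "integrable N (\<lambda>x. G p x * G p' x)" for p p'
    by (rule integrable_square_product) (auto intro: G2)
  have q0: "0 \<le> q p" for p by (simp add: q_def)
  have bdd: "bdd_below (q ` K n)" for n by (rule bdd_belowI[of _ 0]) (auto simp: q0)
  have unit: "((\<lambda>j. if j = n then 1 else 0), Suc n) \<in> K n" for n by (auto simp: K_def)
  have Kne: "K n \<noteq> {}" for n using unit by blast
  have Kmono: "K n' \<subseteq> K n" if "n \<le> n'" for n n' using that by (auto simp: K_def)
  have Imono: "I n \<le> I n'" if "n \<le> n'" for n n'
    unfolding I_def using Kmono[OF that] Kne bdd by (intro cInf_superset_mono) auto
  have Ile: "I n \<le> \<bar>C\<bar>" for n
  proof -
    have "I n \<le> q ((\<lambda>j. if j = n then 1 else 0), Suc n)" unfolding I_def by (rule cInf_lower[OF imageI[OF unit] bdd])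
    also have "\<dots> = (LINT x|N. (f n x)\<^sup>2)"
      by (simp add: q_def G_def if_distrib[where f="\<lambda>c. c * _"] cong: if_cong)
    also have "\<dots> \<le> \<bar>C\<bar>"
    proof -
      have "ennreal (LINT x|N. (f n x)\<^sup>2) = (\<integral>\<^sup>+x. ennreal ((f n x)\<^sup>2) \<partial>N)"
        by (rule nn_integral_eq_integral[OF f2, symmetric]) simp
      also have "\<dots> \<le> ennreal \<bar>C\<bar>" using bd[of n] by (rule order.trans) (simp add: ennreal_leI)
      finally show ?thesis by (simp add: ennreal_le_iff)
    qed
    finally show ?thesis .
  qed
  have mid: "\<exists>r\<in>K n. \<forall>x. G r x = (G p x + G p' x) / 2" if p: "p \<in> K n" and p': "p' \<in> K n" for n p p'
  proof -
    obtain c m c' m' where pe: "p = (c, m)" "p' = (c', m')" by (cases p, cases p')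
    define M where "M = max m m'"
    have cM: "(\<Sum>j<M. c j * h j) = (\<Sum>j<m. c j * h j)" "(\<Sum>j<M. c' j * h j) = (\<Sum>j<m'. c' j * h j)" for h
    proof -
      have z: "c j = 0" if "m \<le> j" for j using p that unfolding pe K_def by auto
      have z': "c' j = 0" if "m' \<le> j" for j using p' that unfolding pe K_def by auto
      show "(\<Sum>j<M. c j * h j) = (\<Sum>j<m. c j * h j)"
        unfolding M_def by (rule sum.mono_neutral_right) (auto intro: z)
      show "(\<Sum>j<M. c' j * h j) = (\<Sum>j<m'. c' j * h j)"
        unfolding M_def by (rule sum.mono_neutral_right) (auto intro: z')
    qed
    have "((\<lambda>j. (c j + c' j) / 2), M) \<in> K n"
      using p p' cM[of "\<lambda>_. 1"] unfolding pe K_def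
      by (auto simp: M_def sum_divide_distrib[symmetric] sum.distrib)
    moreover have "G ((\<lambda>j. (c j + c' j) / 2), M) x = (G p x + G p' x) / 2" for x
      using cM[of "\<lambda>j. f j x"]
      by (simp add: G_def pe sum_divide_distrib[symmetric] sum.distrib distrib_right)
    ultimately show ?thesis by blast
  qed
  define L where "L = (SUP n. I n)"
  have bddI: "bdd_above (range I)" by (rule bdd_aboveI[of _ "\<bar>C\<bar>"]) (auto simp: Ile)
  have IL: "I n \<le> L" for n unfolding L_def by (rule cSUP_upper[OF _ bddI]) simp
  \<comment> \<open>Squared norms below L + \<epsilon> n and midpoints above L - \<epsilon> n give squared distances at most 8 \<epsilon> n = (1/4)^n.\<close>
  define \<epsilon> :: "nat \<Rightarrow> real" where "\<epsilon> n = (1/4) ^ n / 8" for n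
  have eps: "\<epsilon> n > 0" for n by (simp add: \<epsilon>_def)
  have "\<exists>M. L - \<epsilon> n < I M" for n
  proof -
    have "L - \<epsilon> n < (SUP n. I n)" using eps[of n] by (simp add: L_def[symmetric])
    then show ?thesis using less_cSUP_iff[OF _ bddI] by auto
  qed
  then obtain M where M: "\<And>n. L - \<epsilon> n < I (M n)" by metis
  \<comment> \<open>An index beyond n and M n that is monotone in n, so that the hulls are nested.\<close>
  define N' where "N' n = n + (\<Sum>i\<le>n. M i)" for n
  have N'ge: "M n \<le> N' n" "n \<le> N' n" for n unfolding N'_def using member_le_sum[of n "{..n}" M] by auto
  have N'mono: "N' n \<le> N' (Suc n)" for n by (simp add: N'_def)
  have IN: "L - \<epsilon> n < I (N' n)" for n using M[of n] Imono[OF N'ge(1)[of n]] by linarith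
  have "\<exists>p\<in>K (N' n). q p < L + \<epsilon> n" for n
  proof -
    have "Inf (q ` K (N' n)) < L + \<epsilon> n" using IL[of "N' n"] eps[of n] by (simp add: I_def)
    then show ?thesis using cInf_lessD[of "q ` K (N' n)"] Kne by blast
  qed
  then obtain p where p: "\<And>n. p n \<in> K (N' n)" "\<And>n. q (p n) < L + \<epsilon> n" by metis
  define d where "d n x = G (p (Suc n)) x - G (p n) x" for n x
  have [measurable]: "d n \<in> borel_measurable N" for n unfolding d_def by measurable
  have d2i: "integrable N (\<lambda>x. (d n x)\<^sup>2)" for n
    unfolding d_def power2_diff using G2 Gprod by (simp add: mult.assoc)
  have d2: "(LINT x|N. (d n x)\<^sup>2) \<le> (1/4) ^ n" for n
  proof -
    have "p (Suc n) \<in> K (N' n)" using p(1)[of "Suc n"] Kmono[OF N'mono] by blast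
    from mid[OF p(1)[of n] this] obtain r where r: "r \<in> K (N' n)" "\<And>x. G r x = (G (p n) x + G (p (Suc n)) x) / 2" by blast
    have "I (N' n) \<le> q r" unfolding I_def using r by (intro cInf_lower bdd) auto
    then have ql: "L - \<epsilon> n < q r" using IN[of n] by linarith
    have "(LINT x|N. (d n x)\<^sup>2) = (LINT x|N. 2 * (G (p n) x)\<^sup>2 + 2 * (G (p (Suc n)) x)\<^sup>2 - 4 * (G r x)\<^sup>2)"
      by (rule Bochner_Integration.integral_cong) (auto simp: d_def r power2_eq_square field_simps)
    also have "\<dots> = 2 * q (p n) + 2 * q (p (Suc n)) - 4 * q r"
      using G2 by (simp add: q_def)
    also have "\<dots> \<le> 2 * (L + \<epsilon> n) + 2 * (L + \<epsilon> (Suc n)) - 4 * (L - \<epsilon> n)"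
    proof -
      have lin: "2 * a + 2 * b - 4 * c \<le> 2 * (l + e) + 2 * (l + e') - 4 * (l - e)"
        if "a < l + e" "b < l + e'" "l - e < c" for a b c l e e' :: real
        using that by argo
      show ?thesis by (rule lin[OF p(2)[of n] p(2)[of "Suc n"] ql])
    qed
    also have "\<dots> \<le> 8 * \<epsilon> n" using eps[of n] by (simp add: \<epsilon>_def)
    also have "\<dots> = (1/4) ^ n" by (simp add: \<epsilon>_def)
    finally show ?thesis .
  qed
  have d1: "(\<integral>\<^sup>+x. ennreal \<bar>d n x\<bar> \<partial>N) \<le> ennreal ((1/2) ^ n * (1 + measure N (space N)))" for n
  proof -
    have i: "integrable N (\<lambda>x. 2 ^ n * (d n x)\<^sup>2 + (1/2) ^ n)" using d2i by simp
    have "(\<integral>\<^sup>+x. ennreal \<bar>d n x\<bar> \<partial>N) \<le> (\<integral>\<^sup>+x. ennreal (2 ^ n * (d n x)\<^sup>2 + (1/2) ^ n) \<partial>N)"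
    proof (intro nn_integral_mono ennreal_leI)
      fix x
      \<comment> \<open>Young: |d| \<le> 2^n d^2 + 2^(-n), which turns the L^2 bound into a summable L^1 bound.\<close>
      have "0 \<le> (2 ^ n * \<bar>d n x\<bar> - 1)\<^sup>2" by simp
      then have "2 * (2 ^ n * \<bar>d n x\<bar>) \<le> (2 ^ n)\<^sup>2 * (d n x)\<^sup>2 + 1" by (simp add: power2_diff power_mult_distrib)
      moreover have "0 \<le> 2 ^ n * \<bar>d n x\<bar>" by simp
      ultimately have "2 ^ n * \<bar>d n x\<bar> \<le> (2 ^ n)\<^sup>2 * (d n x)\<^sup>2 + 1" by linarith
      then have "(1/2) ^ n * (2 ^ n * \<bar>d n x\<bar>) \<le> (1/2) ^ n * ((2 ^ n)\<^sup>2 * (d n x)\<^sup>2 + 1)" by (rule mult_left_mono) simp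
      then show "\<bar>d n x\<bar> \<le> 2 ^ n * (d n x)\<^sup>2 + (1/2) ^ n"
        by (simp add: power_one_over field_simps power2_eq_square)
    qed
    also have "\<dots> = ennreal (LINT x|N. 2 ^ n * (d n x)\<^sup>2 + (1/2) ^ n)"
      by (rule nn_integral_eq_integral[OF i]) simp
    also have "(LINT x|N. 2 ^ n * (d n x)\<^sup>2 + (1/2) ^ n) = 2 ^ n * (LINT x|N. (d n x)\<^sup>2) + (1/2) ^ n * measure N (space N)"
      using d2i by simp
    also have "ennreal \<dots> \<le> ennreal ((1/2) ^ n * (1 + measure N (space N)))"
    proof (rule ennreal_leI)
      have "2 ^ n * (LINT x|N. (d n x)\<^sup>2) \<le> 2 ^ n * (1/4) ^ n" using d2[of n] by (intro mult_left_mono) auto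
      also have "\<dots> = (1/2) ^ n" by (simp add: power_mult_distrib[symmetric])
      finally show "2 ^ n * (LINT x|N. (d n x)\<^sup>2) + (1/2) ^ n * measure N (space N) \<le> (1/2) ^ n * (1 + measure N (space N))"
        by (simp add: distrib_left)
    qed
    finally show ?thesis .
  qed
  define De where "De x = ennreal \<bar>G (p 0) x\<bar> + (\<Sum>n. ennreal \<bar>d n x\<bar>)" for x
  have [measurable]: "De \<in> borel_measurable N" unfolding De_def by measurable
  have Dfin: "(\<integral>\<^sup>+x. De x \<partial>N) < \<infinity>"
  proof -
    have "(\<integral>\<^sup>+x. De x \<partial>N) = (\<integral>\<^sup>+x. ennreal \<bar>G (p 0) x\<bar> \<partial>N) + (\<Sum>n. \<integral>\<^sup>+x. ennreal \<bar>d n x\<bar> \<partial>N)"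
      unfolding De_def by (simp add: nn_integral_add nn_integral_suminf)
    moreover have "(\<integral>\<^sup>+x. ennreal \<bar>G (p 0) x\<bar> \<partial>N) < \<infinity>"
    proof -
      have "integrable N (\<lambda>x. 1 * G (p 0) x)" by (rule integrable_square_product) (auto intro: G2)
      then show ?thesis unfolding integrable_iff_bounded by simp
    qed
    moreover have "(\<Sum>n. \<integral>\<^sup>+x. ennreal \<bar>d n x\<bar> \<partial>N) < \<infinity>"
    proof -
      have "(\<Sum>n. \<integral>\<^sup>+x. ennreal \<bar>d n x\<bar> \<partial>N) \<le> (\<Sum>n. ennreal ((1/2) ^ n * (1 + measure N (space N))))"
        by (intro suminf_le d1 summableI)
      also have "\<dots> = ennreal (\<Sum>n. (1/2) ^ n * (1 + measure N (space N)))"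
        by (intro suminf_ennreal2 summable_mult2 summable_geometric) auto
      also have "\<dots> < \<infinity>" by simp
      finally show ?thesis .
    qed
    ultimately show ?thesis by simp
  qed
  have Dae: "AE x in N. De x \<noteq> \<infinity>" by (rule nn_integral_PInf_AE) (use Dfin in auto)
  define D where "D x = enn2real (De x)" for x
  define F where "F x = lim (\<lambda>n. G (p n) x)" for x
  have tele: "G (p n) x = G (p 0) x + (\<Sum>i<n. d i x)" for n x
    by (induction n) (auto simp: d_def)
  have main: "(\<forall>n. \<bar>G (p n) x\<bar> \<le> D x) \<and> (\<lambda>n. G (p n) x) \<longlonglongrightarrow> F x" if x: "De x \<noteq> \<infinity>" for x
  proof
    have "(\<Sum>n. ennreal \<bar>d n x\<bar>) \<noteq> \<top>" using x by (auto simp: De_def)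
    then have sm: "summable (\<lambda>n. \<bar>d n x\<bar>)" by (intro summable_suminf_not_top) auto
    have De: "De x = ennreal (\<bar>G (p 0) x\<bar> + (\<Sum>n. \<bar>d n x\<bar>))"
      unfolding De_def using sm by (subst suminf_ennreal2) (auto simp: ennreal_plus suminf_nonneg)
    have Dx: "D x = \<bar>G (p 0) x\<bar> + (\<Sum>n. \<bar>d n x\<bar>)" unfolding D_def De
      by (rule enn2real_ennreal) (simp add: suminf_nonneg[OF sm])
    show "\<forall>n. \<bar>G (p n) x\<bar> \<le> D x"
    proof
      fix n
      have "\<bar>G (p n) x\<bar> \<le> \<bar>G (p 0) x\<bar> + \<bar>\<Sum>i<n. d i x\<bar>" unfolding tele[of n] by (rule abs_triangle_ineq)
      also have "\<bar>\<Sum>i<n. d i x\<bar> \<le> (\<Sum>i<n. \<bar>d i x\<bar>)" by (rule sum_abs)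
      also have "\<dots> \<le> (\<Sum>i. \<bar>d i x\<bar>)" by (rule sum_le_suminf[OF sm]) auto
      finally show "\<bar>G (p n) x\<bar> \<le> D x" unfolding Dx by simp
    qed
    have "summable (\<lambda>n. d n x)" using sm by (rule summable_rabs_cancel)
    then have "(\<lambda>n. G (p 0) x + (\<Sum>i<n. d i x)) \<longlonglongrightarrow> G (p 0) x + (\<Sum>i. d i x)"
      by (intro tendsto_intros summable_LIMSEQ)
    then have "convergent (\<lambda>n. G (p n) x)" unfolding tele[symmetric] convergent_def by blast
    then show "(\<lambda>n. G (p n) x) \<longlonglongrightarrow> F x" unfolding F_def by (simp add: convergent_LIMSEQ_iff)
  qed
  have Di: "integrable N D"
  proof (rule integrableI_nonneg)
    have "(\<integral>\<^sup>+x. ennreal (D x) \<partial>N) = (\<integral>\<^sup>+x. De x \<partial>N)"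
      by (rule nn_integral_cong_AE) (use Dae in \<open>eventually_elim, simp add: D_def ennreal_enn2real_if\<close>)
    with Dfin show "(\<integral>\<^sup>+x. ennreal (D x) \<partial>N) < \<infinity>" by simp
  qed (auto simp: D_def[abs_def])
  show thesis
  proof (rule that[of "\<lambda>n. fst (p n)" "\<lambda>n. snd (p n)" F D])
    have pK: "(fst (p n), snd (p n)) \<in> K (N' n)" for n using p(1)[of n] by simp
    show "0 \<le> fst (p n) j" for n j using pK[of n] by (auto simp: K_def)
    show "fst (p n) j = 0" if "j < n" for n j using pK[of n] that N'ge(2)[of n] by (auto simp: K_def)
    show "(\<Sum>j<snd (p n). fst (p n) j) = 1" for n using pK[of n] by (auto simp: K_def)
    show "F \<in> borel_measurable N" unfolding F_def by (rule borel_measurable_lim_metric) measurable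
    show "integrable N D" by (rule Di)
    show "AE x in N. (\<forall>n. \<bar>\<Sum>j<snd (p n). fst (p n) j * f j x\<bar> \<le> D x) \<and>
        (\<lambda>n. \<Sum>j<snd (p n). fst (p n) j * f j x) \<longlonglongrightarrow> F x"
      using Dae by eventually_elim (rule main[unfolded G_def])
  qed
qed

section \<open>Bounds on a single fibre\<close>

lemma square_le_cell_energy:
  assumes g: "0 \<le> g" "g = 0 \<longrightarrow> h = 0" and e: "cell_energy k g h = ennreal e" "0 \<le> e"
  shows "h\<^sup>2 \<le> 4 * k\<^sup>2 * e * g"
proof (cases "k = 0")
  case True
  have "h = 0"
  proof (rule ccontr)
    assume "h \<noteq> 0"
    then have "cell_energy k g h = \<top>" using True g
      by (simp add: cell_energy_def slope_energy_def ennreal_top_mult)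
    with e show False by simp
  qed
  then show ?thesis using g e by simp
next
  case False
  show ?thesis
  proof (cases "g = 0")
    case gp: False
    have "ennreal (k\<^sup>2 * g + 1 / (4 * k\<^sup>2) * (h / g)\<^sup>2 * g) = ennreal e"
      using cell_energy_eq[of g k h] g False e by simp
    then have "k\<^sup>2 * g + 1 / (4 * k\<^sup>2) * (h / g)\<^sup>2 * g = e" using e g by (subst (asm) ennreal_inj) auto
    moreover have "0 \<le> k\<^sup>2 * g" using g by simp
    ultimately have "1 / (4 * k\<^sup>2) * (h / g)\<^sup>2 * g \<le> e" by linarith
    then have "(4 * k\<^sup>2 * g) * (1 / (4 * k\<^sup>2) * (h / g)\<^sup>2 * g) \<le> (4 * k\<^sup>2 * g) * e"
      using g by (intro mult_left_mono) auto
    moreover have "(4 * k\<^sup>2 * g) * (1 / (4 * k\<^sup>2) * (h / g)\<^sup>2 * g) = h\<^sup>2"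
      using False gp by (simp add: field_simps power2_eq_square)
    ultimately show ?thesis by (simp add: ac_simps)
  qed (use g e in simp)
qed

lemma abs_le_half_sum:
  fixes h A g s :: real
  assumes "h\<^sup>2 \<le> A * g" "0 \<le> A" "0 \<le> g" "0 < s"
  shows "\<bar>h\<bar> \<le> (A * s + g / s) / 2"
proof (rule power2_le_imp_le)
  have "0 \<le> (A * s - g / s)\<^sup>2" by simp
  then have "A * g \<le> ((A * s + g / s) / 2)\<^sup>2"
    using assms by (simp add: power2_eq_square field_simps)
  then show "\<bar>h\<bar>\<^sup>2 \<le> ((A * s + g / s) / 2)\<^sup>2" using assms by simp
  show "0 \<le> (A * s + g / s) / 2" using assms by simp
qed

lemma ennreal_mult_add:
  "0 \<le> a \<Longrightarrow> 0 \<le> b \<Longrightarrow> 0 \<le> c \<Longrightarrow> 0 \<le> d \<Longrightarrow>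
    ennreal (a * b + c * d) = ennreal a * ennreal b + ennreal c * ennreal d"
  by (simp add: ennreal_plus ennreal_mult)

text \<open>
  If e is the pointwise energy on the fibre, then h^2 \<le> 4 k^2 e g, where g is the primitive of h. Young's
  inequality with parameter s bounds the integral of |h|, hence g, by \<phi> and the unit mass; inserting the
  bound for g into h^2 \<le> 4 k^2 e g gives the second claim.
\<close>

lemma fiber_bounds:
  assumes h [measurable]: "h \<in> borel_measurable borel"
    and ae: "AE t in U01. 0 \<le> prim h t \<and> (prim h t = 0 \<longrightarrow> h t = 0)"
    and mass: "(\<integral>\<^sup>+t. ennreal (prim h t) \<partial>U01) = 1"
    and en: "fiber_energy k h = ennreal \<phi>" "0 \<le> \<phi>" and s: "0 < s"
  shows "\<bar>prim h t\<bar> \<le> (4 * k\<^sup>2 * \<phi> * s + 1 / s) / 2"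
    and "(\<integral>\<^sup>+t. ennreal ((h t)\<^sup>2) \<partial>U01) \<le> ennreal (4 * k\<^sup>2 * \<phi> * ((4 * k\<^sup>2 * \<phi> * s + 1 / s) / 2))"
proof -
  define e where "e t = enn2real (cell_energy k (prim h t) (h t))" for t
  have [measurable]: "e \<in> borel_measurable borel" unfolding e_def by measurable
  have "(\<integral>\<^sup>+t. cell_energy k (prim h t) (h t) \<partial>U01) \<noteq> \<infinity>" using en by (simp add: fiber_energy_def)
  then have "AE t in U01. cell_energy k (prim h t) (h t) \<noteq> \<infinity>"
    by (intro nn_integral_PInf_AE) auto
  then have ee: "AE t in U01. cell_energy k (prim h t) (h t) = ennreal (e t)"
    by eventually_elim (simp add: e_def ennreal_enn2real_if)
  have ei: "(\<integral>\<^sup>+t. ennreal (e t) \<partial>U01) = ennreal \<phi>"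
    unfolding en(1)[symmetric] fiber_energy_def
    by (rule nn_integral_cong_AE) (use ee in \<open>eventually_elim, simp\<close>)
  have sq: "AE t in U01. (h t)\<^sup>2 \<le> 4 * k\<^sup>2 * e t * prim h t"
    using ae ee by eventually_elim (rule square_le_cell_energy, auto simp: e_def)
  have prim_le: "\<bar>prim h t\<bar> \<le> (4 * k\<^sup>2 * \<phi> * s + 1 / s) / 2" for t
  proof -
    have "ennreal \<bar>prim h t\<bar> \<le> (\<integral>\<^sup>+x. ennreal \<bar>h x\<bar> \<partial>U01)" by (rule prim_le_nn_integral)
    also have "\<dots> \<le> (\<integral>\<^sup>+x. ennreal (2 * k\<^sup>2 * s) * ennreal (e x) + ennreal (1 / (2 * s)) * ennreal (prim h x) \<partial>U01)"
    proof (rule nn_integral_mono_AE)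
      show "AE x in U01. ennreal \<bar>h x\<bar> \<le> ennreal (2 * k\<^sup>2 * s) * ennreal (e x) + ennreal (1 / (2 * s)) * ennreal (prim h x)"
        using sq ae
      proof eventually_elim
        case (elim x)
        have "\<bar>h x\<bar> \<le> (4 * k\<^sup>2 * e x * s + prim h x / s) / 2"
          by (rule abs_le_half_sum) (use elim s in \<open>auto simp: e_def\<close>)
        also have "\<dots> = 2 * k\<^sup>2 * s * e x + 1 / (2 * s) * prim h x" using s by (simp add: field_simps)
        finally have "ennreal \<bar>h x\<bar> \<le> ennreal (2 * k\<^sup>2 * s * e x + 1 / (2 * s) * prim h x)" by (rule ennreal_leI)
        also have "\<dots> = ennreal (2 * k\<^sup>2 * s) * ennreal (e x) + ennreal (1 / (2 * s)) * ennreal (prim h x)"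
          by (rule ennreal_mult_add) (use s elim in \<open>auto simp: e_def\<close>)
        finally show ?case .
      qed
    qed
    also have "\<dots> = ennreal (2 * k\<^sup>2 * s) * ennreal \<phi> + ennreal (1 / (2 * s))"
      by (subst nn_integral_add, measurable, simp add: nn_integral_cmult ei mass)
    also have "\<dots> = ennreal ((4 * k\<^sup>2 * \<phi> * s + 1 / s) / 2)"
      using s en(2) by (simp add: ennreal_mult[symmetric] ennreal_plus[symmetric] field_simps del: ennreal_plus)
    finally show ?thesis using s en(2) by (subst (asm) ennreal_le_iff) auto
  qed
  show "\<bar>prim h t\<bar> \<le> (4 * k\<^sup>2 * \<phi> * s + 1 / s) / 2" by (rule prim_le)
  define B where "B = (4 * k\<^sup>2 * \<phi> * s + 1 / s) / 2"
  have B: "0 \<le> B" using s en(2) by (simp add: B_def)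
  have "(\<integral>\<^sup>+t. ennreal ((h t)\<^sup>2) \<partial>U01) \<le> (\<integral>\<^sup>+t. ennreal (4 * k\<^sup>2 * B) * ennreal (e t) \<partial>U01)"
  proof (rule nn_integral_mono_AE)
    show "AE t in U01. ennreal ((h t)\<^sup>2) \<le> ennreal (4 * k\<^sup>2 * B) * ennreal (e t)"
      using sq
    proof eventually_elim
      case (elim t)
      have "prim h t \<le> B" using prim_le[of t] by (simp add: B_def)
      then have "4 * k\<^sup>2 * e t * prim h t \<le> 4 * k\<^sup>2 * e t * B" by (intro mult_left_mono) (auto simp: e_def)
      with elim have "(h t)\<^sup>2 \<le> 4 * k\<^sup>2 * B * e t" by (simp add: ac_simps)
      then have "ennreal ((h t)\<^sup>2) \<le> ennreal (4 * k\<^sup>2 * B * e t)" by (rule ennreal_leI)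
      also have "\<dots> = ennreal (4 * k\<^sup>2 * B) * ennreal (e t)" using B by (intro ennreal_mult) (auto simp: e_def)
      finally show ?case .
    qed
  qed
  also have "\<dots> = ennreal (4 * k\<^sup>2 * B) * ennreal \<phi>" by (simp add: nn_integral_cmult ei)
  also have "\<dots> = ennreal (4 * k\<^sup>2 * \<phi> * B)" using B en(2) by (simp add: ennreal_mult[symmetric] ac_simps)
  finally show "(\<integral>\<^sup>+t. ennreal ((h t)\<^sup>2) \<partial>U01) \<le> ennreal (4 * k\<^sup>2 * \<phi> * ((4 * k\<^sup>2 * \<phi> * s + 1 / s) / 2))"
    by (simp add: B_def)
qed

lemma prim_cmult: "prim (\<lambda>x. c * h x) t = c * prim h t"
  unfolding prim_def by (simp add: mult.left_commute flip: Bochner_Integration.integral_mult_right_zero)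

lemma cell_energy_scale:
  assumes "0 < c"
  shows "cell_energy k (c * g) (c * h) = ennreal c * cell_energy k g h"
proof -
  have "ennreal (c * g) = ennreal c * ennreal g" using assms by (cases "0 \<le> g") (auto simp: ennreal_mult ennreal_neg mult_nonneg_nonpos)
  then show ?thesis using assms by (simp add: cell_energy_def ac_simps)
qed

lemma fiber_energy_scale:
  assumes "0 < c" and [measurable]: "h \<in> borel_measurable borel"
  shows "fiber_energy k (\<lambda>x. c * h x) = ennreal c * fiber_energy k h"
  unfolding fiber_energy_def prim_cmult cell_energy_scale[OF assms(1)] by (rule nn_integral_cmult) measurable

lemma fiber_energy_ge:
  assumes [measurable]: "h \<in> borel_measurable borel" and mass: "(\<integral>\<^sup>+t. ennreal (prim h t) \<partial>U01) = 1"
  shows "ennreal (k\<^sup>2) \<le> fiber_energy k h"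
proof -
  have "ennreal (k\<^sup>2) = (\<integral>\<^sup>+t. ennreal (k\<^sup>2) * ennreal (prim h t) \<partial>U01)" by (simp add: nn_integral_cmult mass)
  also have "\<dots> \<le> fiber_energy k h"
    unfolding fiber_energy_def cell_energy_def by (intro nn_integral_mono mult_right_mono) auto
  finally show ?thesis .
qed

lemma fiber_energy_measurable:
  assumes m: "(\<lambda>(w, x). \<eta> w x) \<in> borel_measurable (\<Omega> \<Otimes>\<^sub>M U01)" and [measurable]: "Y \<in> borel_measurable \<Omega>"
  shows "(\<lambda>w. fiber_energy (Y w) (\<eta> w)) \<in> borel_measurable \<Omega>"
  unfolding fiber_energy_def
proof (rule U.borel_measurable_nn_integral)
  have 1: "(\<lambda>q. \<eta> (fst q) (snd q)) \<in> borel_measurable (\<Omega> \<Otimes>\<^sub>M U01)"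
    "(\<lambda>q. prim (\<eta> (fst q)) (snd q)) \<in> borel_measurable (\<Omega> \<Otimes>\<^sub>M U01)"
    using m prim_measurable_pair[OF m] by (simp_all add: split_beta')
  have 2: "(\<lambda>q. Y (fst q)) \<in> borel_measurable (\<Omega> \<Otimes>\<^sub>M U01)" by measurable
  show "(\<lambda>(w, t). cell_energy (Y w) (prim (\<eta> w) t) (\<eta> w t)) \<in> borel_measurable (\<Omega> \<Otimes>\<^sub>M U01)"
    using cell_energy_measurable[OF 2 1(2,1)] by (simp add: split_beta')
qed

text \<open>
  On fibres of unit mass the L^2 norm of the slope grows with the fibre energy \<phi>, which is only integrable. As
  the energy is homogeneous of degree one, the fibres can be divided by any weight w(k) > 0 if the measure
  of the wave numbers is multiplied by w. The weight 1 + sqrt \<phi> is large enough to make the slopes bounded in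
  L^2, up to a power of k, and small enough to keep the laws of the wave numbers tight: \<phi> is at least k^2,
  so \<phi> dominates K times the weight, up to a constant, where |k| > K.
\<close>

lemma normalized_profile_family:
  assumes s: "sheet m a" and E: "sheet_energy m a \<le> ennreal E" "0 \<le> E"
  obtains lam :: "real measure" and \<eta> where
    "sets lam = sets borel" "(\<lambda>(k, x). \<eta> k x) \<in> borel_measurable (borel \<Otimes>\<^sub>M borel)"
    "profile_family lam (\<lambda>k. k) \<eta>" "profile_energy lam (\<lambda>k. k) \<eta> = sheet_energy m a"
    "AE k in lam. (\<integral>\<^sup>+t. ennreal (prim (\<eta> k) t) \<partial>U01) \<le> ennreal (2 + E)"
    "(\<integral>\<^sup>+k. (\<integral>\<^sup>+t. ennreal ((\<eta> k t)\<^sup>2) \<partial>U01) * ennreal (1 / (1 + 4 * k\<^sup>2)\<^sup>2) \<partial>lam) \<le> ennreal ((2 + E) * E)"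
    "\<And>K. 1 \<le> K \<Longrightarrow> emeasure lam {k. K < \<bar>k\<bar>} \<le> ennreal (2 * E / K)"
proof -
  define l0 where "l0 = distr m borel snd"
  obtain \<eta>0 where m0: "(\<lambda>(k, x). \<eta>0 k x) \<in> borel_measurable (borel \<Otimes>\<^sub>M borel)"
    and f0: "profile_family l0 (\<lambda>k. k) \<eta>0" and e0: "profile_energy l0 (\<lambda>k. k) \<eta>0 = sheet_energy m a"
    and u0: "AE k in l0. (\<integral>\<^sup>+t. ennreal (prim (\<eta>0 k) t) \<partial>U01) = 1"
  proof (rule sheet_disintegration[OF s, folded l0_def], goal_cases)
    case (1 \<eta>)
    show ?case by (rule that[OF 1(2) 1(3) 1(4) 1(6)])
  qed
  have sl0 [simp, measurable_cong]: "sets l0 = sets borel" by (simp add: l0_def)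
  have spl0 [simp]: "space l0 = UNIV" by (simp add: l0_def)
  note pf = profile_familyD[OF f0]
  interpret l0: prob_space l0 by (rule pf)
  have fib [measurable]: "\<eta>0 k \<in> borel_measurable borel" for k
    using measurable_compose[OF measurable_Pair1'[of k borel borel] m0] by simp
  define \<phi> where "\<phi> k = enn2real (fiber_energy k (\<eta>0 k))" for k
  have fm [measurable]: "(\<lambda>k. fiber_energy k (\<eta>0 k)) \<in> borel_measurable borel"
    using fiber_energy_measurable[OF pf(3,2)] by simp
  have [measurable]: "\<phi> \<in> borel_measurable borel" unfolding \<phi>_def by measurable
  have \<phi>0: "0 \<le> \<phi> k" for k by (simp add: \<phi>_def)
  have tot: "(\<integral>\<^sup>+k. fiber_energy k (\<eta>0 k) \<partial>l0) \<le> ennreal E" using e0 E by (simp add: profile_energy_def)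
  then have "(\<integral>\<^sup>+k. fiber_energy k (\<eta>0 k) \<partial>l0) \<noteq> \<infinity>" by (auto simp: top_unique)
  then have "AE k in l0. fiber_energy k (\<eta>0 k) \<noteq> \<infinity>" by (intro nn_integral_PInf_AE) auto
  then have fe: "AE k in l0. fiber_energy k (\<eta>0 k) = ennreal (\<phi> k)"
    by eventually_elim (simp add: \<phi>_def ennreal_enn2real_if)
  have \<phi>E: "(\<integral>\<^sup>+k. ennreal (\<phi> k) \<partial>l0) \<le> ennreal E"
  proof -
    have "(\<integral>\<^sup>+k. ennreal (\<phi> k) \<partial>l0) = (\<integral>\<^sup>+k. fiber_energy k (\<eta>0 k) \<partial>l0)"
      by (rule nn_integral_cong_AE) (use fe in \<open>eventually_elim, simp\<close>)
    then show ?thesis using tot by simp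
  qed
  have k\<phi>: "AE k in l0. k\<^sup>2 \<le> \<phi> k"
    using fe u0
  proof eventually_elim
    case (elim k)
    then show ?case using fiber_energy_ge[OF fib, of k k] \<phi>0[of k] by (simp add: ennreal_le_iff)
  qed
  define w where "w k = 1 + sqrt (\<phi> k)" for k
  have [measurable]: "w \<in> borel_measurable borel" unfolding w_def by measurable
  have w1: "1 \<le> w k" and wp: "0 < w k" for k using \<phi>0[of k] by (auto simp: w_def add_pos_nonneg)
  have wle: "w k \<le> 2 + \<phi> k" for k
  proof -
    have "0 \<le> (sqrt (\<phi> k) - 1)\<^sup>2" by simp
    then have "2 * sqrt (\<phi> k) \<le> \<phi> k + 1" using \<phi>0[of k] by (simp add: power2_diff)
    then show ?thesis using \<phi>0[of k] by (simp add: w_def)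
  qed
  have \<phi>w: "\<phi> k / w k \<le> w k" "\<phi> k \<le> w k * w k" for k
  proof -
    have "\<phi> k = sqrt (\<phi> k) * sqrt (\<phi> k)" using \<phi>0[of k] by simp
    also have "\<dots> \<le> w k * w k" using \<phi>0[of k] by (intro mult_mono) (auto simp: w_def)
    finally show "\<phi> k \<le> w k * w k" .
    then show "\<phi> k / w k \<le> w k" using wp[of k] by (simp add: divide_le_eq)
  qed
  have wint: "(\<integral>\<^sup>+k. ennreal (w k) \<partial>l0) \<le> ennreal (2 + E)"
  proof -
    have "(\<integral>\<^sup>+k. ennreal (w k) \<partial>l0) \<le> (\<integral>\<^sup>+k. 2 + ennreal (\<phi> k) \<partial>l0)"
    proof (rule nn_integral_mono)
      fix k
      have "ennreal (w k) \<le> ennreal (2 + \<phi> k)" using wle by (rule ennreal_leI)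
      then show "ennreal (w k) \<le> 2 + ennreal (\<phi> k)" using \<phi>0[of k] by (simp add: ennreal_plus)
    qed
    also have "\<dots> = 2 + (\<integral>\<^sup>+k. ennreal (\<phi> k) \<partial>l0)"
      using l0.emeasure_space_1 by (simp add: nn_integral_add)
    also have "\<dots> \<le> 2 + ennreal E" using \<phi>E by (intro add_left_mono)
    finally show ?thesis using E by (simp add: ennreal_plus)
  qed
  define W where "W = enn2real (\<integral>\<^sup>+k. ennreal (w k) \<partial>l0)"
  have WE: "(\<integral>\<^sup>+k. ennreal (w k) \<partial>l0) = ennreal W"
    unfolding W_def using wint by (simp add: ennreal_enn2real_if top_unique) (metis ennreal_neq_top top.extremum_unique)
  have W0: "0 \<le> W" by (simp add: W_def)
  have Wle: "W \<le> 2 + E" using wint W0 E unfolding WE by (subst (asm) ennreal_le_iff) auto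
  have W1: "1 \<le> W"
  proof -
    have "1 = (\<integral>\<^sup>+k. 1 \<partial>l0)" using l0.emeasure_space_1 by simp
    also have "\<dots> \<le> (\<integral>\<^sup>+k. ennreal (w k) \<partial>l0)" using w1 by (intro nn_integral_mono) (simp add: ennreal_ge_1)
    finally show ?thesis unfolding WE by (simp add: ennreal_ge_1)
  qed
  define \<eta> where "\<eta> k x = W / w k * \<eta>0 k x" for k x
  define lam where "lam = density l0 (\<lambda>k. ennreal (w k / W))"
  have sl [simp, measurable_cong]: "sets lam = sets borel" and spl [simp]: "space lam = UNIV" by (simp_all add: lam_def)
  have cp: "0 < W / w k" for k using W1 wp[of k] by simp
  have nnl: "(\<integral>\<^sup>+k. f k \<partial>lam) = (\<integral>\<^sup>+k. ennreal (w k / W) * f k \<partial>l0)" if [measurable]: "f \<in> borel_measurable borel" for f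
    unfolding lam_def by (rule nn_integral_density) measurable
  have AEl: "(AE k in lam. P k) \<longleftrightarrow> (AE k in l0. P k)" for P
  proof -
    have "0 < ennreal (w k / W)" for k using W1 wp[of k] by simp
    then show ?thesis unfolding lam_def by (subst AE_density) auto
  qed
  have prob: "prob_space lam"
  proof (rule prob_spaceI)
    have "emeasure lam (space lam) = (\<integral>\<^sup>+k. 1 \<partial>lam)" by simp
    also have "\<dots> = (\<integral>\<^sup>+k. ennreal (1 / W) * ennreal (w k) \<partial>l0)"
      using W1 wp by (subst nnl) (auto simp: ennreal_mult[symmetric] less_imp_le)
    also have "\<dots> = ennreal (1 / W) * ennreal W" by (simp add: nn_integral_cmult WE)
    also have "\<dots> = 1" using W1 by (simp add: ennreal_mult[symmetric])
    finally show "emeasure lam (space lam) = 1" .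
  qed
  have m1: "(\<lambda>(k, x). \<eta> k x) \<in> borel_measurable (borel \<Otimes>\<^sub>M borel)"
  proof -
    have [measurable]: "(\<lambda>q. \<eta>0 (fst q) (snd q)) \<in> borel_measurable (borel \<Otimes>\<^sub>M borel)" using m0 by (simp add: split_beta')
    show ?thesis unfolding \<eta>_def split_beta' by measurable
  qed
  have fib1 [measurable]: "\<eta> k \<in> borel_measurable borel" for k unfolding \<eta>_def[abs_def] by measurable
  have prim\<eta>: "prim (\<eta> k) t = W / w k * prim (\<eta>0 k) t" for k t
    unfolding \<eta>_def[abs_def] by (rule prim_cmult)
  have canc: "ennreal (w k / W) * (ennreal (W / w k) * x) = x" for k x
    using W1 wp[of k] by (simp add: mult.assoc[symmetric] ennreal_mult[symmetric])
  have mP: "(\<lambda>(k, t). ennreal (prim (\<eta> k) t)) \<in> borel_measurable (borel \<Otimes>\<^sub>M U01)"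
    "(\<lambda>(k, t). \<eta> k t) \<in> borel_measurable (borel \<Otimes>\<^sub>M U01)"
  proof -
    show "(\<lambda>(k, t). \<eta> k t) \<in> borel_measurable (borel \<Otimes>\<^sub>M U01)" using m1 by simp
    from prim_measurable_pair[OF this] show "(\<lambda>(k, t). ennreal (prim (\<eta> k) t)) \<in> borel_measurable (borel \<Otimes>\<^sub>M U01)"
      by (auto simp: split_beta')
  qed
  have ennprim: "ennreal (prim (\<eta> k) t) = ennreal (W / w k) * ennreal (prim (\<eta>0 k) t)" for k t
    unfolding prim\<eta> using cp[of k]
    by (cases "0 \<le> prim (\<eta>0 k) t") (auto simp: ennreal_mult ennreal_neg mult_nonneg_nonpos simp del: times_divide_eq_left)
  have fam: "profile_family lam (\<lambda>k. k) \<eta>"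
    unfolding profile_family_def
  proof (intro conjI ballI prob)
    show "(\<lambda>(k, t). \<eta> k t) \<in> borel_measurable (lam \<Otimes>\<^sub>M U01)" using mP(2) by simp
    show "AE k in lam. integrable U01 (\<eta> k)"
      unfolding AEl using pf(6) by eventually_elim (simp add: \<eta>_def[abs_def])
    show "AE k in lam. AE t in U01. 0 \<le> prim (\<eta> k) t \<and> (prim (\<eta> k) t = 0 \<longrightarrow> \<eta> k t = 0)"
      unfolding AEl using pf(7)
    proof eventually_elim
      case (elim k)
      then show ?case
      proof eventually_elim
        case (elim t)
        then show ?case
          unfolding prim\<eta> using cp[of k] by (auto simp: \<eta>_def simp del: times_divide_eq_left)
      qed
    qed
    fix A :: "real set" assume A [measurable]: "A \<in> sets borel"
    have "(\<lambda>(k, t). ennreal (prim (\<eta> k) t) * indicator A t) \<in> borel_measurable (borel \<Otimes>\<^sub>M U01)"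
      using mP(1) by (simp add: split_beta')
    from U.borel_measurable_nn_integral[OF this]
    have "(\<integral>\<^sup>+k. \<integral>\<^sup>+t. ennreal (prim (\<eta> k) t) * indicator A t \<partial>U01 \<partial>lam) =
        (\<integral>\<^sup>+k. ennreal (w k / W) * (\<integral>\<^sup>+t. ennreal (prim (\<eta> k) t) * indicator A t \<partial>U01) \<partial>l0)" by (rule nnl)
    also have "\<dots> = (\<integral>\<^sup>+k. \<integral>\<^sup>+t. ennreal (prim (\<eta>0 k) t) * indicator A t \<partial>U01 \<partial>l0)"
      by (simp add: ennprim mult.assoc nn_integral_cmult canc)
    also have "\<dots> = (\<integral>\<^sup>+t. ennreal (2 * t) * indicator A t \<partial>U01)" by (rule pf(8)[OF A])
    finally show "(\<integral>\<^sup>+k. \<integral>\<^sup>+t. ennreal (prim (\<eta> k) t) * indicator A t \<partial>U01 \<partial>lam) = (\<integral>\<^sup>+t. ennreal (2 * t) * indicator A t \<partial>U01)" .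
  qed simp
  have fes: "fiber_energy k (\<eta> k) = ennreal (W / w k) * fiber_energy k (\<eta>0 k)" for k
    unfolding \<eta>_def[abs_def] by (rule fiber_energy_scale[OF cp fib])
  have en: "profile_energy lam (\<lambda>k. k) \<eta> = sheet_energy m a"
    unfolding e0[symmetric] profile_energy_def fes by (subst nnl) (auto simp: canc)
  have B1: "AE k in lam. (\<integral>\<^sup>+t. ennreal (prim (\<eta> k) t) \<partial>U01) \<le> ennreal (2 + E)"
    unfolding AEl using u0
  proof eventually_elim
    case (elim k)
    have "W / w k \<le> W" using w1[of k] W0 by (simp add: divide_le_eq mult_left_le mult_le_cancel_left1)
    then have "ennreal (W / w k) \<le> ennreal (2 + E)" using Wle by (intro ennreal_leI) linarith
    with elim show ?case by (simp add: ennprim nn_integral_cmult)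
  qed
  have B2: "(\<integral>\<^sup>+k. (\<integral>\<^sup>+t. ennreal ((\<eta> k t)\<^sup>2) \<partial>U01) * ennreal (1 / (1 + 4 * k\<^sup>2)\<^sup>2) \<partial>lam) \<le> ennreal ((2 + E) * E)"
  proof -
    have "(\<lambda>(k, t). ennreal ((\<eta> k t)\<^sup>2)) \<in> borel_measurable (borel \<Otimes>\<^sub>M U01)" using mP(2) by (simp add: split_beta')
    from U.borel_measurable_nn_integral[OF this]
    have "(\<integral>\<^sup>+k. (\<integral>\<^sup>+t. ennreal ((\<eta> k t)\<^sup>2) \<partial>U01) * ennreal (1 / (1 + 4 * k\<^sup>2)\<^sup>2) \<partial>lam) =
        (\<integral>\<^sup>+k. ennreal (w k / W) * ((\<integral>\<^sup>+t. ennreal ((\<eta> k t)\<^sup>2) \<partial>U01) * ennreal (1 / (1 + 4 * k\<^sup>2)\<^sup>2)) \<partial>l0)"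
      by (intro nnl borel_measurable_times) auto
    also have "\<dots> \<le> (\<integral>\<^sup>+k. ennreal W * ennreal (\<phi> k) \<partial>l0)"
    proof (rule nn_integral_mono_AE)
      show "AE k in l0. ennreal (w k / W) * ((\<integral>\<^sup>+t. ennreal ((\<eta> k t)\<^sup>2) \<partial>U01) * ennreal (1 / (1 + 4 * k\<^sup>2)\<^sup>2)) \<le> ennreal W * ennreal (\<phi> k)"
        using u0 fe pf(7)
      proof eventually_elim
        case (elim k)
        let ?R = "4 * k\<^sup>2 * \<phi> k * ((4 * k\<^sup>2 * \<phi> k * (1 / w k) + 1 / (1 / w k)) / 2)"
        have r: "(\<integral>\<^sup>+t. ennreal ((\<eta>0 k t)\<^sup>2) \<partial>U01) \<le> ennreal ?R"
          using fiber_bounds(2)[OF fib elim(3) elim(1) elim(2) \<phi>0, of "1 / w k"] wp[of k] by simp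
        have "(\<integral>\<^sup>+t. ennreal ((\<eta> k t)\<^sup>2) \<partial>U01) = ennreal ((W / w k)\<^sup>2) * (\<integral>\<^sup>+t. ennreal ((\<eta>0 k t)\<^sup>2) \<partial>U01)"
          by (subst nn_integral_cmult[symmetric], measurable, unfold \<eta>_def power_mult_distrib)
             (intro nn_integral_cong ennreal_mult, auto)
        also have "\<dots> \<le> ennreal ((W / w k)\<^sup>2) * ennreal ?R" by (intro mult_left_mono r) simp
        finally have r': "(\<integral>\<^sup>+t. ennreal ((\<eta> k t)\<^sup>2) \<partial>U01) \<le> ennreal ((W / w k)\<^sup>2) * ennreal ?R" .
        have R0: "0 \<le> ?R" using \<phi>0[of k] wp[of k] by simp
        have R1: "?R \<le> (1 + 4 * k\<^sup>2)\<^sup>2 * \<phi> k * w k"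
        proof -
          have "4 * k\<^sup>2 * \<phi> k * (1 / w k) + 1 / (1 / w k) = 4 * k\<^sup>2 * (\<phi> k / w k) + w k" by simp
          also have "\<dots> \<le> 4 * k\<^sup>2 * w k + w k" using \<phi>w(1)[of k] by (intro add_right_mono mult_left_mono) auto
          also have "\<dots> = (1 + 4 * k\<^sup>2) * w k" by (simp add: algebra_simps)
          finally have le: "4 * k\<^sup>2 * \<phi> k * (1 / w k) + 1 / (1 / w k) \<le> (1 + 4 * k\<^sup>2) * w k" .
          have half: "x / 2 \<le> y" if "x \<le> y" "0 \<le> y" for x y :: real using that by linarith
          have "(4 * k\<^sup>2 * \<phi> k * (1 / w k) + 1 / (1 / w k)) / 2 \<le> (1 + 4 * k\<^sup>2) * w k"
            by (rule half[OF le]) (use wp[of k] in simp)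
          then have "?R \<le> (1 + 4 * k\<^sup>2) * \<phi> k * ((1 + 4 * k\<^sup>2) * w k)"
            using \<phi>0[of k] wp[of k] by (intro mult_mono) auto
          then show ?thesis by (simp add: power2_eq_square ac_simps)
        qed
        have kp: "0 < 1 + 4 * k\<^sup>2" by (simp add: add_pos_nonneg)
        have "ennreal (w k / W) * ((\<integral>\<^sup>+t. ennreal ((\<eta> k t)\<^sup>2) \<partial>U01) * ennreal (1 / (1 + 4 * k\<^sup>2)\<^sup>2)) \<le>
           ennreal (w k / W) * ((ennreal ((W / w k)\<^sup>2) * ennreal ?R) * ennreal (1 / (1 + 4 * k\<^sup>2)\<^sup>2))"
          by (intro mult_left_mono mult_right_mono r') auto
        also have "\<dots> = ennreal (w k / W * (((W / w k)\<^sup>2 * ?R) * (1 / (1 + 4 * k\<^sup>2)\<^sup>2)))"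
          using R0 wp[of k] W0 by (simp add: ennreal_mult less_imp_le del: times_divide_eq_right times_divide_eq_left)
        also have "\<dots> \<le> ennreal (w k / W * (((W / w k)\<^sup>2 * ((1 + 4 * k\<^sup>2)\<^sup>2 * \<phi> k * w k)) * (1 / (1 + 4 * k\<^sup>2)\<^sup>2)))"
          using R1 wp[of k] W0 by (intro ennreal_leI mult_left_mono mult_right_mono) (auto simp: less_imp_le)
        also have "w k / W * (((W / w k)\<^sup>2 * ((1 + 4 * k\<^sup>2)\<^sup>2 * \<phi> k * w k)) * (1 / (1 + 4 * k\<^sup>2)\<^sup>2)) = W * \<phi> k"
        proof -
          have A: "w / W * (((W / w)\<^sup>2 * (q\<^sup>2 * p * w)) * (1 / q\<^sup>2)) = W * p" if "w \<noteq> 0" "W \<noteq> 0" "q \<noteq> 0" for w W q p :: real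
            using that by (simp add: field_simps power2_eq_square)
          show ?thesis by (rule A) (use wp[of k] W1 kp in auto)
        qed
        also have "ennreal (W * \<phi> k) = ennreal W * ennreal (\<phi> k)" using W0 \<phi>0 by (rule ennreal_mult)
        finally show ?case .
      qed
    qed
    also have "\<dots> = ennreal W * (\<integral>\<^sup>+k. ennreal (\<phi> k) \<partial>l0)" by (rule nn_integral_cmult) measurable
    also have "\<dots> \<le> ennreal (2 + E) * ennreal E" using Wle \<phi>E by (intro mult_mono ennreal_leI) auto
    finally show ?thesis using E by (simp add: ennreal_mult)
  qed
  have B3: "emeasure lam {k. K < \<bar>k\<bar>} \<le> ennreal (2 * E / K)" if K: "1 \<le> K" for K
  proof -
    have "emeasure lam {k. K < \<bar>k\<bar>} = (\<integral>\<^sup>+k. indicator {k. K < \<bar>k\<bar>} k \<partial>lam)" by simp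
    also have "\<dots> = (\<integral>\<^sup>+k. ennreal (w k / W) * indicator {k. K < \<bar>k\<bar>} k \<partial>l0)" by (rule nnl) measurable
    also have "\<dots> \<le> (\<integral>\<^sup>+k. ennreal (2 / K) * ennreal (\<phi> k) \<partial>l0)"
    proof (rule nn_integral_mono_AE)
      show "AE k in l0. ennreal (w k / W) * indicator {k. K < \<bar>k\<bar>} k \<le> ennreal (2 / K) * ennreal (\<phi> k)"
        using k\<phi>
      proof eventually_elim
        case (elim k)
        show ?case
        proof (cases "K < \<bar>k\<bar>")
          case True
          have "K \<le> sqrt (\<phi> k)"
          proof (rule real_le_rsqrt)
            have "K\<^sup>2 \<le> \<bar>k\<bar>\<^sup>2" using True K by (intro power_mono) auto
            with elim show "K\<^sup>2 \<le> \<phi> k" by simp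
          qed
          moreover have "K * r \<le> r * r" "K * 1 \<le> r * r" if "K \<le> r" for r
          proof -
            show "K * r \<le> r * r" by (rule mult_right_mono) (use K that in linarith)+
            show "K * 1 \<le> r * r" by (rule mult_mono) (use K that in linarith)+
          qed
          ultimately have "K * sqrt (\<phi> k) \<le> sqrt (\<phi> k) * sqrt (\<phi> k)" "K * 1 \<le> sqrt (\<phi> k) * sqrt (\<phi> k)"
            by blast+
          then have "K * w k \<le> 2 * \<phi> k" using \<phi>0[of k] by (simp add: w_def distrib_left)
          then have "w k \<le> 2 / K * \<phi> k" using K by (simp add: field_simps)
          moreover have "w k / W \<le> w k" using W1 wp[of k] by (simp add: divide_le_eq mult_le_cancel_left1)
          ultimately have "ennreal (w k / W) \<le> ennreal (2 / K * \<phi> k)" by (intro ennreal_leI) linarith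
          also have "\<dots> = ennreal (2 / K) * ennreal (\<phi> k)" using K \<phi>0[of k] by (intro ennreal_mult) auto
          finally show ?thesis using True by simp
        qed simp
      qed
    qed
    also have "\<dots> = ennreal (2 / K) * (\<integral>\<^sup>+k. ennreal (\<phi> k) \<partial>l0)" by (rule nn_integral_cmult) measurable
    also have "\<dots> \<le> ennreal (2 / K) * ennreal E" using \<phi>E by (intro mult_left_mono) auto
    also have "\<dots> = ennreal (2 * E / K)" using K E by (simp add: ennreal_mult[symmetric])
    finally show ?thesis .
  qed
  show thesis by (rule that[OF sl m1 fam en B1 B2 B3])
qed

section \<open>Lower semicontinuity and compactness\<close>

text \<open>
  The linear minorants determine the cell energy: c = h / (4 k^2 g) is optimal if k and g do not vanish;
  otherwise the minorants are unbounded in c unless h = 0.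
\<close>

lemma cell_energy_le_if_dual:
  assumes g: "0 \<le> g" and L: "0 \<le> L" and dual: "\<And>c. ennreal (k\<^sup>2 * g + 2 * c * h - 4 * k\<^sup>2 * c\<^sup>2 * g) \<le> ennreal L"
  shows "(g = 0 \<longrightarrow> h = 0) \<and> cell_energy k g h \<le> ennreal L"
proof -
  have h0: "h = 0" if "g = 0 \<or> k = 0"
  proof (rule ccontr)
    assume "h \<noteq> 0"
    then have e1: "2 * ((L + 1) / (2 * h)) * h = L + 1" by simp
    have e2: "k\<^sup>2 * g + 2 * c * h - 4 * k\<^sup>2 * c\<^sup>2 * g = 2 * c * h" for c using that by auto
    have "ennreal (L + 1) \<le> ennreal L" using dual[of "(L + 1) / (2 * h)", unfolded e2] unfolding e1 .
    then show False using L by (simp add: ennreal_le_iff)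
  qed
  moreover have "cell_energy k g h \<le> ennreal L"
  proof (cases "g = 0 \<or> k = 0")
    case True
    then show ?thesis using h0 by (auto simp: cell_energy_def slope_energy_def)
  next
    case False
    then have e: "k\<^sup>2 * g + 2 * (h / (4 * k\<^sup>2 * g)) * h - 4 * k\<^sup>2 * (h / (4 * k\<^sup>2 * g))\<^sup>2 * g =
        k\<^sup>2 * g + 1 / (4 * k\<^sup>2) * (h / g)\<^sup>2 * g"
      by (simp add: field_simps power2_eq_square)
    have "cell_energy k g h = ennreal (k\<^sup>2 * g + 1 / (4 * k\<^sup>2) * (h / g)\<^sup>2 * g)"
      by (rule cell_energy_eq) (use g False in auto)
    then show ?thesis using dual[of "h / (4 * k\<^sup>2 * g)", unfolded e] by (simp only:)
  qed
  ultimately show ?thesis by blast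
qed

lemma profile_family_transport:
  assumes sl: "sets lam = sets borel" and m: "(\<lambda>(k, x). \<eta> k x) \<in> borel_measurable (borel \<Otimes>\<^sub>M borel)"
    and F: "profile_family lam (\<lambda>k. k) \<eta>" and prob: "prob_space \<Omega>" and Y [measurable]: "Y \<in> borel_measurable \<Omega>"
    and d: "distr \<Omega> borel Y = lam"
  shows "profile_family \<Omega> Y (\<lambda>w. \<eta> (Y w))" "profile_energy \<Omega> Y (\<lambda>w. \<eta> (Y w)) = profile_energy lam (\<lambda>k. k) \<eta>"
proof -
  note pf = profile_familyD[OF F]
  have AEd: "AE w in \<Omega>. P (Y w)" if "AE k in lam. P k" for P
    using that unfolding d[symmetric] by (rule AE_distrD[OF Y])
  have nnd: "(\<integral>\<^sup>+k. f k \<partial>lam) = (\<integral>\<^sup>+w. f (Y w) \<partial>\<Omega>)" if "f \<in> borel_measurable borel" for f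
    unfolding d[symmetric] using that by (intro nn_integral_distr) auto
  have mU: "(\<lambda>(k, x). \<eta> k x) \<in> borel_measurable (borel \<Otimes>\<^sub>M U01)" using m by simp
  show "profile_energy \<Omega> Y (\<lambda>w. \<eta> (Y w)) = profile_energy lam (\<lambda>k. k) \<eta>"
    unfolding profile_energy_def by (rule nnd[symmetric]) (rule fiber_energy_measurable[OF mU], simp)
  show "profile_family \<Omega> Y (\<lambda>w. \<eta> (Y w))"
    unfolding profile_family_def
  proof (intro conjI ballI prob Y AEd pf(6,7))
    have "(\<lambda>q. (Y (fst q), snd q)) \<in> measurable (\<Omega> \<Otimes>\<^sub>M U01) (borel \<Otimes>\<^sub>M U01)" by measurable
    from measurable_compose[OF this mU]
    show "(\<lambda>(w, x). \<eta> (Y w) x) \<in> borel_measurable (\<Omega> \<Otimes>\<^sub>M U01)" by (simp add: split_beta')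
    fix A :: "real set" assume A [measurable]: "A \<in> sets borel"
    have "(\<lambda>(k, t). ennreal (prim (\<eta> k) t) * indicator A t) \<in> borel_measurable (borel \<Otimes>\<^sub>M U01)"
      using prim_measurable_pair[OF mU] by (simp add: split_beta')
    from nnd[OF U.borel_measurable_nn_integral[OF this]] pf(8)[OF A]
    show "(\<integral>\<^sup>+w. \<integral>\<^sup>+t. ennreal (prim (\<eta> (Y w)) t) * indicator A t \<partial>U01 \<partial>\<Omega>) =
        (\<integral>\<^sup>+t. ennreal (2 * t) * indicator A t \<partial>U01)" by simp
  qed
qed

lemma liminf_ge_if_tendsto:
  fixes u :: "nat \<Rightarrow> ennreal"
  assumes "a \<longlonglongrightarrow> l" "\<forall>\<^sub>F n in sequentially. a n \<le> u n"
  shows "l \<le> liminf u"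
  using lim_imp_Liminf[OF _ assms(1)] Liminf_mono[OF assms(2)] by simp

text \<open>
  The n-th average only involves indices j \<ge> n.
\<close>

lemma liminf_averages_le:
  fixes E :: "nat \<Rightarrow> ennreal" and c :: "nat \<Rightarrow> nat \<Rightarrow> real"
  assumes E: "E \<longlonglongrightarrow> I" and c: "\<And>n j. 0 \<le> c n j" "\<And>n j. j < n \<Longrightarrow> c n j = 0" "\<And>n. (\<Sum>j<m n. c n j) = 1"
  shows "liminf (\<lambda>n. \<Sum>j<m n. ennreal (c n j) * E j) \<le> I"
proof (rule dense_ge)
  fix y assume "I < y"
  with E have "\<forall>\<^sub>F n in sequentially. E n < y" by (rule order_tendstoD(2))
  then obtain M where M: "\<And>j. M \<le> j \<Longrightarrow> E j < y" by (auto simp: eventually_sequentially)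
  have "\<forall>\<^sub>F n in sequentially. (\<Sum>j<m n. ennreal (c n j) * E j) \<le> y"
    unfolding eventually_sequentially
  proof (intro exI allI impI)
    fix n assume n: "M \<le> n"
    have "(\<Sum>j<m n. ennreal (c n j) * E j) \<le> (\<Sum>j<m n. ennreal (c n j) * y)"
    proof (rule sum_mono)
      fix j
      show "ennreal (c n j) * E j \<le> ennreal (c n j) * y"
      proof (cases "j < n")
        case False
        then have "E j \<le> y" using M[of j] n by simp
        then show ?thesis by (intro mult_left_mono) auto
      qed (simp add: c)
    qed
    also have "\<dots> = ennreal (\<Sum>j<m n. c n j) * y"
      by (simp add: sum_distrib_right[symmetric] c(1))
    finally show "(\<Sum>j<m n. ennreal (c n j) * E j) \<le> y" by (simp add: c)
  qed
  then have "liminf (\<lambda>n. \<Sum>j<m n. ennreal (c n j) * E j) \<le> liminf (\<lambda>n. y)" by (rule Liminf_mono)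
  then show "liminf (\<lambda>n. \<Sum>j<m n. ennreal (c n j) * E j) \<le> y" by (simp add: Liminf_const)
qed

lemma ennreal_sum_le: "ennreal (\<Sum>j\<in>A. x j) \<le> (\<Sum>j\<in>A. ennreal (x j))"
proof (cases "finite A")
  case True
  have "ennreal (\<Sum>j\<in>A. x j) \<le> ennreal (\<Sum>j\<in>A. max 0 (x j))" by (intro ennreal_leI sum_mono) auto
  also have "\<dots> = (\<Sum>j\<in>A. ennreal (max 0 (x j)))" by (rule sum_ennreal[symmetric]) simp
  also have "\<dots> = (\<Sum>j\<in>A. ennreal (x j))" by (intro sum.cong refl) (simp add: max_def ennreal_neg)
  finally show ?thesis .
qed simp

text \<open>
  The cell energy is convex in (g,h) but not in the wave number. Averages are nevertheless lower semicontinuous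
  if the wave numbers converge: all indices in the n-th average are at least n, so their wave numbers
  are uniformly close to k, and the linear minorants for k change by at most \<delta>.
\<close>

lemma dual_bound_limit:
  fixes y g h :: "nat \<Rightarrow> real"
  assumes y: "y \<longlonglongrightarrow> k"
    and c: "\<And>n j. 0 \<le> c n j" "\<And>n j. j < n \<Longrightarrow> c n j = 0"
    and G: "(\<lambda>n. \<Sum>j<m n. c n j * g j) \<longlonglongrightarrow> G" and H: "(\<lambda>n. \<Sum>j<m n. c n j * h j) \<longlonglongrightarrow> H"
    and gh: "\<And>j. 0 \<le> g j \<and> (g j = 0 \<longrightarrow> h j = 0)"
  shows "ennreal (k\<^sup>2 * G + 2 * b * H - 4 * k\<^sup>2 * b\<^sup>2 * G) \<le>
    liminf (\<lambda>n. \<Sum>j<m n. ennreal (c n j) * cell_energy (y j) (g j) (h j))" (is "_ \<le> liminf ?u")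
proof -
  have step: "ennreal ((k\<^sup>2 - \<delta>) * G + 2 * b * H - 4 * (k\<^sup>2 + \<delta>) * b\<^sup>2 * G) \<le> liminf ?u" if \<delta>: "0 < \<delta>" for \<delta>
  proof (rule liminf_ge_if_tendsto)
    let ?g = "\<lambda>n. \<Sum>j<m n. c n j * g j" and ?h = "\<lambda>n. \<Sum>j<m n. c n j * h j"
    show "(\<lambda>n. ennreal ((k\<^sup>2 - \<delta>) * ?g n + 2 * b * ?h n - 4 * (k\<^sup>2 + \<delta>) * b\<^sup>2 * ?g n)) \<longlonglongrightarrow>
        ennreal ((k\<^sup>2 - \<delta>) * G + 2 * b * H - 4 * (k\<^sup>2 + \<delta>) * b\<^sup>2 * G)"
      by (intro tendsto_ennrealI tendsto_intros G H)
    have "(\<lambda>n. (y n)\<^sup>2) \<longlonglongrightarrow> k\<^sup>2" by (intro tendsto_intros y)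
    then have "\<forall>\<^sub>F n in sequentially. dist ((y n)\<^sup>2) (k\<^sup>2) < \<delta>" using \<delta> by (rule tendstoD)
    then obtain M where M: "\<And>j. M \<le> j \<Longrightarrow> \<bar>(y j)\<^sup>2 - k\<^sup>2\<bar> < \<delta>"
      by (auto simp: eventually_sequentially dist_real_def)
    show "\<forall>\<^sub>F n in sequentially. ennreal ((k\<^sup>2 - \<delta>) * ?g n + 2 * b * ?h n - 4 * (k\<^sup>2 + \<delta>) * b\<^sup>2 * ?g n) \<le> ?u n"
      unfolding eventually_sequentially
    proof (intro exI allI impI)
      fix n assume n: "M \<le> n"
      have lin: "(k\<^sup>2 - \<delta>) * ?g n + 2 * b * ?h n - 4 * (k\<^sup>2 + \<delta>) * b\<^sup>2 * ?g n =
          (\<Sum>j<m n. c n j * ((k\<^sup>2 - \<delta>) * g j + 2 * b * h j - 4 * (k\<^sup>2 + \<delta>) * b\<^sup>2 * g j))"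
      proof -
        have "p * ?g n + q * ?h n - r * ?g n = (\<Sum>j<m n. p * (c n j * g j) + q * (c n j * h j) - r * (c n j * g j))" for p q r
          by (simp add: sum_distrib_left sum.distrib sum_subtractf)
        moreover have "p * (c n j * g j) + q * (c n j * h j) - r * (c n j * g j) = c n j * (p * g j + q * h j - r * g j)" for p q r j
          by (simp add: algebra_simps)
        ultimately show ?thesis by (simp only:)
      qed
      have "ennreal ((k\<^sup>2 - \<delta>) * ?g n + 2 * b * ?h n - 4 * (k\<^sup>2 + \<delta>) * b\<^sup>2 * ?g n) \<le>
          (\<Sum>j<m n. ennreal (c n j * ((k\<^sup>2 - \<delta>) * g j + 2 * b * h j - 4 * (k\<^sup>2 + \<delta>) * b\<^sup>2 * g j)))"
        unfolding lin by (rule ennreal_sum_le)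
      also have "\<dots> \<le> ?u n"
      proof (rule sum_mono)
        fix j
        show "ennreal (c n j * ((k\<^sup>2 - \<delta>) * g j + 2 * b * h j - 4 * (k\<^sup>2 + \<delta>) * b\<^sup>2 * g j)) \<le>
            ennreal (c n j) * cell_energy (y j) (g j) (h j)"
        proof (cases "j < n")
          case False
          then have "k\<^sup>2 - \<delta> \<le> (y j)\<^sup>2" "(y j)\<^sup>2 \<le> k\<^sup>2 + \<delta>" using M[of j] n by auto
          then have "(k\<^sup>2 - \<delta>) * g j \<le> (y j)\<^sup>2 * g j" "(y j)\<^sup>2 * (4 * b\<^sup>2 * g j) \<le> (k\<^sup>2 + \<delta>) * (4 * b\<^sup>2 * g j)"
            using gh[of j] by (auto intro!: mult_right_mono)
          moreover have "4 * x * b\<^sup>2 * g j = x * (4 * b\<^sup>2 * g j)" for x by (simp only: ac_simps)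
          ultimately have "(k\<^sup>2 - \<delta>) * g j + 2 * b * h j - 4 * (k\<^sup>2 + \<delta>) * b\<^sup>2 * g j \<le>
              (y j)\<^sup>2 * g j + 2 * b * h j - 4 * (y j)\<^sup>2 * b\<^sup>2 * g j" by (metis add_mono_thms_linordered_semiring(2) add.commute diff_mono add_right_mono)
          then have "ennreal ((k\<^sup>2 - \<delta>) * g j + 2 * b * h j - 4 * (k\<^sup>2 + \<delta>) * b\<^sup>2 * g j) \<le>
              ennreal ((y j)\<^sup>2 * g j + 2 * b * h j - 4 * (y j)\<^sup>2 * b\<^sup>2 * g j)" by (rule ennreal_leI)
          also have "\<dots> \<le> cell_energy (y j) (g j) (h j)"
            using gh[of j] by (intro cell_energy_ge_dual) auto
          finally have le: "ennreal ((k\<^sup>2 - \<delta>) * g j + 2 * b * h j - 4 * (k\<^sup>2 + \<delta>) * b\<^sup>2 * g j) \<le> cell_energy (y j) (g j) (h j)" .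
          have "ennreal (c n j * x) = ennreal (c n j) * ennreal x" for x
            using c(1)[of n j] by (rule ennreal_mult')
          then show ?thesis using le by (simp add: mult_left_mono)
        qed (simp add: c)
      qed
      finally show "ennreal ((k\<^sup>2 - \<delta>) * ?g n + 2 * b * ?h n - 4 * (k\<^sup>2 + \<delta>) * b\<^sup>2 * ?g n) \<le> ?u n" .
    qed
  qed
  show ?thesis
  proof (rule LIMSEQ_le_const2)
    let ?d = "\<lambda>i. inverse (real (Suc i))"
    have "(\<lambda>i. ennreal ((k\<^sup>2 - ?d i) * G + 2 * b * H - 4 * (k\<^sup>2 + ?d i) * b\<^sup>2 * G)) \<longlonglongrightarrow>
        ennreal ((k\<^sup>2 - 0) * G + 2 * b * H - 4 * (k\<^sup>2 + 0) * b\<^sup>2 * G)"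
      by (intro tendsto_ennrealI tendsto_intros LIMSEQ_inverse_real_of_nat)
    then show "(\<lambda>i. ennreal ((k\<^sup>2 - ?d i) * G + 2 * b * H - 4 * (k\<^sup>2 + ?d i) * b\<^sup>2 * G)) \<longlonglongrightarrow>
        ennreal (k\<^sup>2 * G + 2 * b * H - 4 * k\<^sup>2 * b\<^sup>2 * G)" by simp
    show "\<exists>N. \<forall>i\<ge>N. ennreal ((k\<^sup>2 - ?d i) * G + 2 * b * H - 4 * (k\<^sup>2 + ?d i) * b\<^sup>2 * G) \<le> liminf ?u"
      by (intro exI allI impI step) simp
  qed
qed

text \<open>
  The wave numbers converge pointwise, so their supremum S is finite and a weight depending on S makes the slopes
  bounded in a weighted L^2 space. Suitable convex combinations of the slopes converge almost everywhere with an integrable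
  majorant on almost every fibre; hence their primitives converge, and the linear constraint on the marginal is
  inherited. Fatou's lemma and the previous lower bound compare the energies.
\<close>

lemma profile_family_limit:
  fixes Y :: "nat \<Rightarrow> 'w \<Rightarrow> real"
  assumes prob: "prob_space \<Omega>"
    and Yl [measurable]: "Yl \<in> borel_measurable \<Omega>" and Ylim: "\<And>w. w \<in> space \<Omega> \<Longrightarrow> (\<lambda>n. Y n w) \<longlonglongrightarrow> Yl w"
    and F: "\<And>n. profile_family \<Omega> (Y n) (\<eta> n)"
    and E: "(\<lambda>n. profile_energy \<Omega> (Y n) (\<eta> n)) \<longlonglongrightarrow> I" and I: "I < \<infinity>"
    and mass: "\<And>n. AE w in \<Omega>. (\<integral>\<^sup>+t. ennreal (prim (\<eta> n w) t) \<partial>U01) \<le> ennreal W"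
    and L2: "\<And>n. (\<integral>\<^sup>+w. (\<integral>\<^sup>+t. ennreal ((\<eta> n w t)\<^sup>2) \<partial>U01) * ennreal (1 / (1 + 4 * (Y n w)\<^sup>2)\<^sup>2) \<partial>\<Omega>) \<le> ennreal C"
  shows "\<exists>\<eta>'. profile_family \<Omega> Yl \<eta>' \<and> profile_energy \<Omega> Yl \<eta>' \<le> I"
proof -
  interpret prob_space \<Omega> by (rule prob)
  interpret P: pair_sigma_finite \<Omega> U01 ..
  let ?Q = "\<Omega> \<Otimes>\<^sub>M U01"
  note pf = profile_familyD[OF F]
  have Ym [measurable]: "Y n \<in> borel_measurable \<Omega>" for n by (rule pf)
  have em [measurable]: "(\<lambda>q. \<eta> n (fst q) (snd q)) \<in> borel_measurable ?Q" for n by (rule pf)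
  have gm [measurable]: "(\<lambda>q. prim (\<eta> n (fst q)) (snd q)) \<in> borel_measurable ?Q" for n by (rule pf)
  have sndQ [measurable]: "snd \<in> borel_measurable ?Q"
    using measurable_snd[of \<Omega> U01] measurable_cong_sets[OF refl sets_U01, of ?Q] by (rule back_subst)
  define S where "S w = (SUP n. \<bar>Y n w\<bar>)" for w
  have bdd: "bdd_above (range (\<lambda>n. \<bar>Y n w\<bar>))" if "w \<in> space \<Omega>" for w
  proof -
    have "Bseq (\<lambda>n. Y n w)" using Ylim[OF that] convergentI convergent_imp_Bseq by blast
    then obtain K where "\<And>n. \<bar>Y n w\<bar> \<le> K" unfolding Bseq_def real_norm_def by metis
    then show ?thesis by (intro bdd_aboveI[of _ K]) auto
  qed
  have [measurable]: "S \<in> borel_measurable \<Omega>" unfolding S_def using bdd by (intro borel_measurable_cSUP) auto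
  have YS: "\<bar>Y n w\<bar> \<le> S w" if "w \<in> space \<Omega>" for n w
    unfolding S_def by (rule cSUP_upper[OF _ bdd[OF that]]) simp
  \<comment> \<open>A weight below all the weights in the L^2 bounds, independent of n and positive everywhere.\<close>
  define v where "v w = 1 / (1 + 4 * (S w)\<^sup>2)\<^sup>2" for w
  have [measurable]: "v \<in> borel_measurable \<Omega>" unfolding v_def by measurable
  have v0: "0 < v w" for w
  proof -
    have "0 < 1 + 4 * (S w)\<^sup>2" by (simp add: add_pos_nonneg)
    then show ?thesis by (simp add: v_def)
  qed
  have v1: "v w \<le> 1" for w
    using power_mono[of 1 "1 + 4 * (S w)\<^sup>2" 2] by (simp add: v_def divide_le_eq)
  have vY: "v w \<le> 1 / (1 + 4 * (Y n w)\<^sup>2)\<^sup>2" if "w \<in> space \<Omega>" for n w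
  proof -
    have "(Y n w)\<^sup>2 \<le> (S w)\<^sup>2" using power_mono[OF YS[OF that, of n], of 2] by simp
    then have "(1 + 4 * (Y n w)\<^sup>2)\<^sup>2 \<le> (1 + 4 * (S w)\<^sup>2)\<^sup>2" by (intro power_mono) auto
    moreover have "0 < (1 + 4 * x\<^sup>2)\<^sup>2" for x :: real
    proof -
      have "0 < 1 + 4 * x\<^sup>2" by (simp add: add_pos_nonneg)
      then show ?thesis by simp
    qed
    ultimately show ?thesis unfolding v_def by (intro divide_left_mono mult_pos_pos) auto
  qed
  define N where "N = density ?Q (\<lambda>q. ennreal (v (fst q)))"
  have [simp, measurable_cong]: "sets N = sets ?Q" by (simp add: N_def)
  have AEN: "(AE q in N. R q) \<longleftrightarrow> (AE q in ?Q. R q)" for R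
    unfolding N_def using v0 by (subst AE_density) auto
  have finN: "finite_measure N"
  proof (rule finite_measureI)
    have "emeasure N (space N) = (\<integral>\<^sup>+q. 1 \<partial>N)" by simp
    also have "\<dots> = (\<integral>\<^sup>+q. ennreal (v (fst q)) \<partial>?Q)"
      unfolding N_def by (subst nn_integral_density) auto
    also have "\<dots> \<le> (\<integral>\<^sup>+q. 1 \<partial>?Q)" using v1 by (intro nn_integral_mono) simp
    also have "\<dots> = 1"
      using U.emeasure_space_1 emeasure_space_1
      by (subst U.nn_integral_fst[symmetric]) auto
    finally show "emeasure N (space N) \<noteq> \<infinity>" by (auto simp: top_unique)
  qed
  define f where "f n q = \<eta> n (fst q) (snd q)" for n q
  have fm [measurable]: "f n \<in> borel_measurable ?Q" for n unfolding f_def by measurable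
  have fN: "f n \<in> borel_measurable N" for n by measurable
  have f2: "(\<integral>\<^sup>+q. ennreal ((f n q)\<^sup>2) \<partial>N) \<le> ennreal C" for n
  proof -
    have "(\<lambda>q. ennreal (v (fst q)) * ennreal ((f n q)\<^sup>2)) \<in> borel_measurable ?Q" by measurable
    from U.nn_integral_fst[OF this]
    have "(\<integral>\<^sup>+q. ennreal ((f n q)\<^sup>2) \<partial>N) = (\<integral>\<^sup>+w. \<integral>\<^sup>+t. ennreal (v w) * ennreal ((\<eta> n w t)\<^sup>2) \<partial>U01 \<partial>\<Omega>)"
      unfolding N_def by (subst nn_integral_density) (auto simp: f_def)
    also have "\<dots> \<le> (\<integral>\<^sup>+w. (\<integral>\<^sup>+t. ennreal ((\<eta> n w t)\<^sup>2) \<partial>U01) * ennreal (1 / (1 + 4 * (Y n w)\<^sup>2)\<^sup>2) \<partial>\<Omega>)"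
    proof (rule nn_integral_mono)
      fix w assume w: "w \<in> space \<Omega>"
      have [measurable]: "\<eta> n w \<in> borel_measurable U01"
        using measurable_compose[OF measurable_Pair1'[OF w] em[of n]] by simp
      have "(\<integral>\<^sup>+t. ennreal (v w) * ennreal ((\<eta> n w t)\<^sup>2) \<partial>U01) = ennreal (v w) * (\<integral>\<^sup>+t. ennreal ((\<eta> n w t)\<^sup>2) \<partial>U01)"
        by (intro nn_integral_cmult) measurable
      also have "\<dots> \<le> ennreal (1 / (1 + 4 * (Y n w)\<^sup>2)\<^sup>2) * (\<integral>\<^sup>+t. ennreal ((\<eta> n w t)\<^sup>2) \<partial>U01)"
        by (intro mult_right_mono ennreal_leI vY[OF w]) simp
      finally show "(\<integral>\<^sup>+t. ennreal (v w) * ennreal ((\<eta> n w t)\<^sup>2) \<partial>U01) \<le>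
          (\<integral>\<^sup>+t. ennreal ((\<eta> n w t)\<^sup>2) \<partial>U01) * ennreal (1 / (1 + 4 * (Y n w)\<^sup>2)\<^sup>2)" by (simp only: mult.commute)
    qed
    also have "\<dots> \<le> ennreal C" by (rule L2)
    finally show ?thesis .
  qed
  obtain c :: "nat \<Rightarrow> nat \<Rightarrow> real" and m :: "nat \<Rightarrow> nat" and D Fl where c: "\<And>n j. 0 \<le> c n j" "\<And>n j. j < n \<Longrightarrow> c n j = 0" "\<And>n. (\<Sum>j<m n. c n j) = 1"
    and FlN: "Fl \<in> borel_measurable N" and DN: "integrable N D"
    and conv: "AE q in N. (\<forall>n. \<bar>\<Sum>j<m n. c n j * f j q\<bar> \<le> D q) \<and> (\<lambda>n. \<Sum>j<m n. c n j * f j q) \<longlonglongrightarrow> Fl q"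
  proof (rule convex_combinations_converge[where f=f and N=N and C=C, OF finN fN f2], goal_cases)
    case (1 c m F D)
    show ?case by (rule that[OF 1(2) 1(3) 1(4) 1(5) 1(6) 1(7)])
  qed
  have Flm [measurable]: "Fl \<in> borel_measurable ?Q" using FlN by simp
  have Dm [measurable]: "D \<in> borel_measurable ?Q" using DN by auto
  define h where "h n w t = (\<Sum>j<m n. c n j * \<eta> j w t)" for n w t
  define \<eta>' where "\<eta>' w t = Fl (w, t)" for w t
  have \<eta>'m: "(\<lambda>(w, t). \<eta>' w t) \<in> borel_measurable ?Q" by (simp add: \<eta>'_def)
  have hm: "(\<lambda>(w, t). h n w t) \<in> borel_measurable ?Q" for n
    unfolding h_def split_beta' by measurable
  have conv': "AE w in \<Omega>. AE t in U01. (\<forall>n. \<bar>h n w t\<bar> \<le> D (w, t)) \<and> (\<lambda>n. h n w t) \<longlonglongrightarrow> \<eta>' w t"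
    using P.AE_pair[OF conv[unfolded AEN]] by (simp add: f_def h_def \<eta>'_def)
  have Dint: "AE w in \<Omega>. integrable U01 (\<lambda>t. D (w, t))"
  proof -
    have mm: "(\<lambda>q. ennreal (v (fst q)) * ennreal \<bar>D q\<bar>) \<in> borel_measurable ?Q" by measurable
    have "(\<integral>\<^sup>+q. ennreal (norm (D q)) \<partial>N) < \<infinity>" using DN unfolding integrable_iff_bounded by blast
    then have "(\<integral>\<^sup>+q. ennreal (v (fst q)) * ennreal \<bar>D q\<bar> \<partial>?Q) < \<infinity>"
      unfolding N_def by (subst (asm) nn_integral_density) auto
    then have "(\<integral>\<^sup>+w. \<integral>\<^sup>+t. ennreal (v w) * ennreal \<bar>D (w, t)\<bar> \<partial>U01 \<partial>\<Omega>) \<noteq> \<infinity>"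
      using U.nn_integral_fst[OF mm] by simp
    moreover have "(\<lambda>w. \<integral>\<^sup>+t. ennreal (v w) * ennreal \<bar>D (w, t)\<bar> \<partial>U01) \<in> borel_measurable \<Omega>"
      using U.borel_measurable_nn_integral_fst[OF mm] by simp
    ultimately have "AE w in \<Omega>. (\<integral>\<^sup>+t. ennreal (v w) * ennreal \<bar>D (w, t)\<bar> \<partial>U01) \<noteq> \<infinity>"
      by (intro nn_integral_PInf_AE)
    then show ?thesis
      using AE_space
    proof eventually_elim
      case (elim w)
      have dm [measurable]: "(\<lambda>t. D (w, t)) \<in> borel_measurable U01"
        using measurable_compose[OF measurable_Pair1'[OF elim(2)] Dm] by simp
      have "(\<integral>\<^sup>+t. ennreal (v w) * ennreal \<bar>D (w, t)\<bar> \<partial>U01) = ennreal (v w) * (\<integral>\<^sup>+t. ennreal \<bar>D (w, t)\<bar> \<partial>U01)"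
        by (intro nn_integral_cmult) measurable
      with elim(1) v0[of w] have "(\<integral>\<^sup>+t. ennreal \<bar>D (w, t)\<bar> \<partial>U01) < \<infinity>"
        by (auto simp: ennreal_mult_eq_top_iff less_top)
      with dm show ?case by (simp add: integrable_iff_bounded)
    qed
  qed
  \<comment> \<open>The fibres on which all almost-everywhere properties hold simultaneously.\<close>
  define good where "good w \<longleftrightarrow> w \<in> space \<Omega> \<and> integrable U01 (\<lambda>t. D (w, t)) \<and> (\<forall>j. integrable U01 (\<eta> j w)) \<and>
     (AE t in U01. \<forall>j. 0 \<le> prim (\<eta> j w) t \<and> (prim (\<eta> j w) t = 0 \<longrightarrow> \<eta> j w t = 0)) \<and>
     (\<forall>j. (\<integral>\<^sup>+t. ennreal (prim (\<eta> j w) t) \<partial>U01) \<le> ennreal W) \<and>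
     (AE t in U01. (\<forall>n. \<bar>h n w t\<bar> \<le> D (w, t)) \<and> (\<lambda>n. h n w t) \<longlonglongrightarrow> \<eta>' w t)" for w
  have good: "AE w in \<Omega>. good w"
  proof -
    have 1: "AE w in \<Omega>. \<forall>j. integrable U01 (\<eta> j w)" by (simp add: AE_all_countable pf(6))
    have 2: "AE w in \<Omega>. \<forall>j. AE t in U01. 0 \<le> prim (\<eta> j w) t \<and> (prim (\<eta> j w) t = 0 \<longrightarrow> \<eta> j w t = 0)"
      unfolding AE_all_countable using pf(7) by blast
    have 3: "AE w in \<Omega>. \<forall>j. (\<integral>\<^sup>+t. ennreal (prim (\<eta> j w) t) \<partial>U01) \<le> ennreal W" by (simp add: AE_all_countable mass)
    show ?thesis
      using 1 2 3 conv' Dint AE_space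
    proof eventually_elim
      case (elim w)
      have "AE t in U01. \<forall>j. 0 \<le> prim (\<eta> j w) t \<and> (prim (\<eta> j w) t = 0 \<longrightarrow> \<eta> j w t = 0)"
        unfolding AE_all_countable by (rule elim(2))
      with elim show ?case unfolding good_def by blast
    qed
  qed
  have hfib: "h n w \<in> borel_measurable U01" "\<eta>' w \<in> borel_measurable U01" if "w \<in> space \<Omega>" for n w
    using measurable_compose[OF measurable_Pair1'[OF that] hm[of n]] measurable_compose[OF measurable_Pair1'[OF that] \<eta>'m] by simp_all
  have primh: "prim (h n w) t = (\<Sum>j<m n. c n j * prim (\<eta> j w) t)" if g: "good w" for n w t
  proof -
    have i: "integrable U01 (\<lambda>x. c n j * (indicator {..<t} x * \<eta> j w x))" for j
      using g by (intro integrable_mult_right integrable_bounded_mult(1)[where K=1]) (auto simp: good_def indicator_def)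
    have "prim (h n w) t = (LINT x|U01. (\<Sum>j<m n. c n j * (indicator {..<t} x * \<eta> j w x)))"
      unfolding prim_def h_def by (simp add: sum_distrib_left mult.left_commute)
    also have "\<dots> = (\<Sum>j<m n. c n j * prim (\<eta> j w) t)"
      unfolding prim_def using i by (subst Bochner_Integration.integral_sum) auto
    finally show ?thesis .
  qed
  have dom: "integrable U01 (\<eta>' w)" "(\<lambda>n. prim (h n w) t) \<longlonglongrightarrow> prim (\<eta>' w) t" "\<bar>prim (h n w) t\<bar> \<le> (LINT t|U01. D (w, t))"
    if g: "good w" for w t n
  proof -
    have w: "w \<in> space \<Omega>" and Di: "integrable U01 (\<lambda>t. D (w, t))"
      and cv: "AE t in U01. (\<forall>n. \<bar>h n w t\<bar> \<le> D (w, t)) \<and> (\<lambda>n. h n w t) \<longlonglongrightarrow> \<eta>' w t" using g by (auto simp: good_def)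
    note [measurable] = hfib[OF w]
    show "integrable U01 (\<eta>' w)"
    proof (rule integrable_dominated_convergence[where s="\<lambda>n. h n w", OF _ _ Di])
      show "AE x in U01. (\<lambda>i. h i w x) \<longlonglongrightarrow> \<eta>' w x" using cv by eventually_elim auto
      show "AE x in U01. norm (h i w x) \<le> D (w, x)" for i using cv by eventually_elim auto
    qed measurable
    show "(\<lambda>n. prim (h n w) t) \<longlonglongrightarrow> prim (\<eta>' w) t"
      unfolding prim_def
    proof (rule integral_dominated_convergence[OF _ _ Di])
      show "AE x in U01. (\<lambda>i. indicator {..<t} x * h i w x) \<longlonglongrightarrow> indicator {..<t} x * \<eta>' w x"
        using cv by eventually_elim (intro tendsto_mult tendsto_const, auto)
      show "AE x in U01. norm (indicator {..<t} x * h i w x) \<le> D (w, x)" for i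
        using cv
      proof eventually_elim
        case (elim x)
        then have "\<bar>h i w x\<bar> \<le> D (w, x)" by blast
        then show ?case by (auto simp: indicator_def intro: order.trans[OF abs_ge_zero])
      qed
    qed measurable
    have "\<bar>prim (h n w) t\<bar> \<le> (LINT x|U01. \<bar>indicator {..<t} x * h n w x\<bar>)" unfolding prim_def by (rule integral_abs_bound)
    also have "\<dots> \<le> (LINT x|U01. D (w, x))"
    proof (rule integral_mono_AE')
      show "AE x in U01. \<bar>indicator {..<t} x * h n w x\<bar> \<le> D (w, x)"
        using cv
      proof eventually_elim
        case (elim x)
        then have "\<bar>h n w x\<bar> \<le> D (w, x)" by blast
        then show ?case by (auto simp: indicator_def intro: order.trans[OF abs_ge_zero])
      qed
      show "AE x in U01. 0 \<le> D (w, x)"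
        using cv
      proof eventually_elim
        case (elim x)
        then have "\<bar>h n w x\<bar> \<le> D (w, x)" by blast
        then show ?case by (rule order.trans[OF abs_ge_zero])
      qed
    qed (use Di in auto)
    finally show "\<bar>prim (h n w) t\<bar> \<le> (LINT t|U01. D (w, t))" .
  qed
  have pos: "AE t in U01. 0 \<le> prim (\<eta>' w) t" if g: "good w" for w
  proof -
    have "AE t in U01. \<forall>j. 0 \<le> prim (\<eta> j w) t \<and> (prim (\<eta> j w) t = 0 \<longrightarrow> \<eta> j w t = 0)" using g by (simp add: good_def)
    then show ?thesis
    proof eventually_elim
      case (elim t)
      have "0 \<le> prim (h n w) t" for n unfolding primh[OF g] using elim c(1) by (intro sum_nonneg mult_nonneg_nonneg) auto
      then show ?case using dom(2)[OF g, of t] by (intro LIMSEQ_le_const) auto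
    qed
  qed
  have prim'm: "(\<lambda>(w, t). prim (\<eta>' w) t) \<in> borel_measurable ?Q" by (rule prim_measurable_pair[OF \<eta>'m])
  have primhm: "(\<lambda>(w, t). prim (h n w) t) \<in> borel_measurable ?Q" for n by (rule prim_measurable_pair[OF hm])
  have marg: "(\<integral>\<^sup>+w. \<integral>\<^sup>+t. ennreal (prim (\<eta>' w) t) * indicator A t \<partial>U01 \<partial>\<Omega>) = (\<integral>\<^sup>+t. ennreal (2 * t) * indicator A t \<partial>U01)"
    if A [measurable]: "A \<in> sets borel" for A
  proof -
    let ?M = "\<integral>\<^sup>+t. ennreal (2 * t) * indicator A t \<partial>U01"
    let ?P = "\<lambda>n w. \<integral>\<^sup>+t. ennreal (prim (h n w) t) * indicator A t \<partial>U01"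
    let ?P' = "\<lambda>w. \<integral>\<^sup>+t. ennreal (prim (\<eta>' w) t) * indicator A t \<partial>U01"
    have fibp: "prim (h n w) \<in> borel_measurable U01" "prim (\<eta>' w) \<in> borel_measurable U01" "prim (\<eta> n w) \<in> borel_measurable U01"
      if "w \<in> space \<Omega>" for n w
      using measurable_compose[OF measurable_Pair1'[OF that] primhm[of n]] measurable_compose[OF measurable_Pair1'[OF that] prim'm]
        measurable_compose[OF measurable_Pair1'[OF that] gm[of n]] by simp_all
    have Psum: "?P n w = (\<Sum>j<m n. ennreal (c n j) * (\<integral>\<^sup>+t. ennreal (prim (\<eta> j w) t) * indicator A t \<partial>U01))" if g: "good w" for n w
    proof -
      have w: "w \<in> space \<Omega>" using g by (simp add: good_def)
      note [measurable] = fibp[OF w]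
      have ae: "AE t in U01. \<forall>j. 0 \<le> prim (\<eta> j w) t \<and> (prim (\<eta> j w) t = 0 \<longrightarrow> \<eta> j w t = 0)" using g by (simp add: good_def)
      have "?P n w = (\<integral>\<^sup>+t. (\<Sum>j<m n. ennreal (c n j) * (ennreal (prim (\<eta> j w) t) * indicator A t)) \<partial>U01)"
      proof (rule nn_integral_cong_AE)
        show "AE t in U01. ennreal (prim (h n w) t) * indicator A t = (\<Sum>j<m n. ennreal (c n j) * (ennreal (prim (\<eta> j w) t) * indicator A t))"
          using ae
        proof eventually_elim
          case (elim t)
          have "ennreal (prim (h n w) t) = (\<Sum>j<m n. ennreal (c n j * prim (\<eta> j w) t))"
            unfolding primh[OF g] by (rule sum_ennreal[symmetric]) (use elim c in auto)
          also have "\<dots> = (\<Sum>j<m n. ennreal (c n j) * ennreal (prim (\<eta> j w) t))"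
            by (intro sum.cong refl ennreal_mult') (rule c)
          finally show ?case by (simp add: sum_distrib_right mult.assoc)
        qed
      qed
      also have "\<dots> = (\<Sum>j<m n. \<integral>\<^sup>+t. ennreal (c n j) * (ennreal (prim (\<eta> j w) t) * indicator A t) \<partial>U01)"
        by (rule nn_integral_sum) measurable
      also have "\<dots> = (\<Sum>j<m n. ennreal (c n j) * (\<integral>\<^sup>+t. ennreal (prim (\<eta> j w) t) * indicator A t \<partial>U01))"
        by (intro sum.cong refl nn_integral_cmult) measurable
      finally show ?thesis .
    qed
    have Pm: "(\<lambda>w. ?P n w) \<in> borel_measurable \<Omega>" "?P' \<in> borel_measurable \<Omega>"
      "(\<lambda>w. \<integral>\<^sup>+t. ennreal (prim (\<eta> n w) t) * indicator A t \<partial>U01) \<in> borel_measurable \<Omega>" for n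
    proof -
      have "(\<lambda>(w, t). ennreal (prim (h n w) t) * indicator A t) \<in> borel_measurable ?Q" using primhm by (simp add: split_beta')
      from U.borel_measurable_nn_integral[OF this] show "(\<lambda>w. ?P n w) \<in> borel_measurable \<Omega>" .
      have "(\<lambda>(w, t). ennreal (prim (\<eta>' w) t) * indicator A t) \<in> borel_measurable ?Q" using prim'm by (simp add: split_beta')
      from U.borel_measurable_nn_integral[OF this] show "?P' \<in> borel_measurable \<Omega>" .
      have "(\<lambda>(w, t). ennreal (prim (\<eta> n w) t) * indicator A t) \<in> borel_measurable ?Q" using gm[of n] by (simp add: split_beta')
      from U.borel_measurable_nn_integral[OF this]
      show "(\<lambda>w. \<integral>\<^sup>+t. ennreal (prim (\<eta> n w) t) * indicator A t \<partial>U01) \<in> borel_measurable \<Omega>" .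
    qed
    have PM: "(\<integral>\<^sup>+w. ?P n w \<partial>\<Omega>) = ?M" for n
    proof -
      have "(\<integral>\<^sup>+w. ?P n w \<partial>\<Omega>) = (\<integral>\<^sup>+w. (\<Sum>j<m n. ennreal (c n j) * (\<integral>\<^sup>+t. ennreal (prim (\<eta> j w) t) * indicator A t \<partial>U01)) \<partial>\<Omega>)"
      proof (rule nn_integral_cong_AE)
        show "AE w in \<Omega>. ?P n w = (\<Sum>j<m n. ennreal (c n j) * (\<integral>\<^sup>+t. ennreal (prim (\<eta> j w) t) * indicator A t \<partial>U01))"
          using good by eventually_elim (rule Psum)
      qed
      also have "\<dots> = (\<Sum>j<m n. ennreal (c n j) * (\<integral>\<^sup>+w. \<integral>\<^sup>+t. ennreal (prim (\<eta> j w) t) * indicator A t \<partial>U01 \<partial>\<Omega>))"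
        using Pm(3) by (subst nn_integral_sum) (auto intro!: sum.cong nn_integral_cmult)
      also have "\<dots> = (\<Sum>j<m n. ennreal (c n j)) * ?M" by (simp add: pf(8)[OF A] sum_distrib_right)
      also have "(\<Sum>j<m n. ennreal (c n j)) = 1" using c by simp
      finally show ?thesis by simp
    qed
    have "(\<lambda>n. \<integral>\<^sup>+w. ?P n w \<partial>\<Omega>) \<longlonglongrightarrow> (\<integral>\<^sup>+w. ?P' w \<partial>\<Omega>)"
    proof (rule nn_integral_dominated_convergence[where w="\<lambda>_. ennreal W"])
      show "AE w in \<Omega>. ?P n w \<le> ennreal W" for n
        using good
      proof eventually_elim
        case (elim w)
        have "?P n w \<le> (\<Sum>j<m n. ennreal (c n j) * ennreal W)"
          unfolding Psum[OF elim]
        proof (intro sum_mono mult_left_mono)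
          fix j
          have "(\<integral>\<^sup>+t. ennreal (prim (\<eta> j w) t) * indicator A t \<partial>U01) \<le> (\<integral>\<^sup>+t. ennreal (prim (\<eta> j w) t) \<partial>U01)"
            by (intro nn_integral_mono) (auto simp: indicator_def)
          also have "\<dots> \<le> ennreal W" using elim by (simp add: good_def)
          finally show "(\<integral>\<^sup>+t. ennreal (prim (\<eta> j w) t) * indicator A t \<partial>U01) \<le> ennreal W" .
        qed auto
        also have "\<dots> = (\<Sum>j<m n. ennreal (c n j)) * ennreal W" by (simp only: sum_distrib_right)
        also have "(\<Sum>j<m n. ennreal (c n j)) = 1" using c by simp
        finally show ?case by simp
      qed
      show "(\<integral>\<^sup>+w. ennreal W \<partial>\<Omega>) < \<infinity>" using emeasure_space_1 by simp
      show "AE w in \<Omega>. (\<lambda>n. ?P n w) \<longlonglongrightarrow> ?P' w"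
        using good
      proof eventually_elim
        case (elim w)
        then have w: "w \<in> space \<Omega>" by (simp add: good_def)
        note [measurable] = fibp[OF w]
        show ?case
        proof (rule nn_integral_dominated_convergence[where w="\<lambda>_. ennreal (LINT t|U01. D (w, t))"])
          show "AE t in U01. ennreal (prim (h n w) t) * indicator A t \<le> ennreal (LINT t|U01. D (w, t))" for n
          proof (rule AE_I2)
            fix t
            have "prim (h n w) t \<le> (LINT t|U01. D (w, t))" using dom(3)[OF elim, of n t] by linarith
            then show "ennreal (prim (h n w) t) * indicator A t \<le> ennreal (LINT t|U01. D (w, t))"
              by (auto simp: indicator_def intro: ennreal_leI)
          qed
          show "AE t in U01. (\<lambda>n. ennreal (prim (h n w) t) * indicator A t) \<longlonglongrightarrow> ennreal (prim (\<eta>' w) t) * indicator A t"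
          proof (rule AE_I2)
            fix t show "(\<lambda>n. ennreal (prim (h n w) t) * indicator A t) \<longlonglongrightarrow> ennreal (prim (\<eta>' w) t) * indicator A t"
              using tendsto_ennrealI[OF dom(2)[OF elim, of t]] by (cases "t \<in> A") auto
          qed
          show "(\<integral>\<^sup>+t. ennreal (LINT t|U01. D (w, t)) \<partial>U01) < \<infinity>" using U.emeasure_space_1 by simp
        qed measurable
      qed
    qed (use Pm in auto)
    then show ?thesis unfolding PM by (simp add: LIMSEQ_const_iff)
  qed
  define u where "u n q = (\<Sum>j<m n. ennreal (c n j) * cell_energy (Y j (fst q)) (prim (\<eta> j (fst q)) (snd q)) (\<eta> j (fst q) (snd q)))" for n q
  have cm: "(\<lambda>q. cell_energy (Y j (fst q)) (prim (\<eta> j (fst q)) (snd q)) (\<eta> j (fst q) (snd q))) \<in> borel_measurable ?Q" for j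
    by (rule cell_energy_measurable) (use em gm in auto)
  have um [measurable]: "u n \<in> borel_measurable ?Q" for n unfolding u_def using cm by (intro borel_measurable_sum borel_measurable_times) auto
  have uI: "(\<integral>\<^sup>+q. u n q \<partial>?Q) = (\<Sum>j<m n. ennreal (c n j) * profile_energy \<Omega> (Y j) (\<eta> j))" for n
  proof -
    have "(\<integral>\<^sup>+q. u n q \<partial>?Q) = (\<Sum>j<m n. \<integral>\<^sup>+q. ennreal (c n j) * cell_energy (Y j (fst q)) (prim (\<eta> j (fst q)) (snd q)) (\<eta> j (fst q) (snd q)) \<partial>?Q)"
      unfolding u_def using cm by (intro nn_integral_sum borel_measurable_times) auto
    then show ?thesis using cm by (simp add: nn_integral_cmult profile_energy_pair[OF F])
  qed
  have Lint: "(\<integral>\<^sup>+q. liminf (\<lambda>n. u n q) \<partial>?Q) \<le> I"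
  proof -
    have "(\<integral>\<^sup>+q. liminf (\<lambda>n. u n q) \<partial>?Q) \<le> liminf (\<lambda>n. \<integral>\<^sup>+q. u n q \<partial>?Q)" by (rule nn_integral_liminf) measurable
    also have "\<dots> \<le> I" unfolding uI by (rule liminf_averages_le[OF E c])
    finally show ?thesis .
  qed
  have Lm: "(\<lambda>q. liminf (\<lambda>n. u n q)) \<in> borel_measurable ?Q" by measurable
  have "AE q in ?Q. liminf (\<lambda>n. u n q) \<noteq> \<infinity>"
    by (rule nn_integral_PInf_AE[OF Lm]) (use Lint I in auto)
  from P.AE_pair[OF this] good
  have key: "AE w in \<Omega>. AE t in U01. 0 \<le> prim (\<eta>' w) t \<and> (prim (\<eta>' w) t = 0 \<longrightarrow> \<eta>' w t = 0) \<and>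
      cell_energy (Yl w) (prim (\<eta>' w) t) (\<eta>' w t) \<le> liminf (\<lambda>n. u n (w, t))"
  proof eventually_elim
    case (elim w)
    note g = elim(2)
    have w: "w \<in> space \<Omega>" and 1: "AE t in U01. \<forall>j. 0 \<le> prim (\<eta> j w) t \<and> (prim (\<eta> j w) t = 0 \<longrightarrow> \<eta> j w t = 0)"
      and 2: "AE t in U01. (\<forall>n. \<bar>h n w t\<bar> \<le> D (w, t)) \<and> (\<lambda>n. h n w t) \<longlonglongrightarrow> \<eta>' w t" using g by (auto simp: good_def)
    show ?case
      using elim(1) 1 2 pos[OF g]
    proof eventually_elim
      case (elim t)
      obtain L where L: "liminf (\<lambda>n. u n (w, t)) = ennreal L" "0 \<le> L" using elim(1) by (cases "liminf (\<lambda>n. u n (w, t))") auto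
      have gl: "(\<lambda>n. \<Sum>j<m n. c n j * prim (\<eta> j w) t) \<longlonglongrightarrow> prim (\<eta>' w) t"
        using dom(2)[OF g, of t] by (simp add: primh[OF g])
      have hl: "(\<lambda>n. \<Sum>j<m n. c n j * \<eta> j w t) \<longlonglongrightarrow> \<eta>' w t" using elim(3) by (simp add: h_def)
      have gh: "0 \<le> prim (\<eta> j w) t \<and> (prim (\<eta> j w) t = 0 \<longrightarrow> \<eta> j w t = 0)" for j using elim(2) by blast
      have "ennreal ((Yl w)\<^sup>2 * prim (\<eta>' w) t + 2 * b * \<eta>' w t - 4 * (Yl w)\<^sup>2 * b\<^sup>2 * prim (\<eta>' w) t) \<le> ennreal L" for b
        using dual_bound_limit[OF Ylim[OF w] c(1,2) gl hl gh, of b] unfolding L(1)[symmetric] u_def by simp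
      from cell_energy_le_if_dual[OF elim(4) L(2) this] elim(4) L show ?case by simp
    qed
  qed
  have fam: "profile_family \<Omega> Yl \<eta>'"
    unfolding profile_family_def
  proof (intro conjI ballI prob Yl \<eta>'m marg)
    show "AE w in \<Omega>. integrable U01 (\<eta>' w)" using good by eventually_elim (rule dom(1))
    show "AE w in \<Omega>. AE t in U01. 0 \<le> prim (\<eta>' w) t \<and> (prim (\<eta>' w) t = 0 \<longrightarrow> \<eta>' w t = 0)"
      using key
    proof eventually_elim
      case (elim w)
      then show ?case by eventually_elim blast
    qed
  qed
  have "profile_energy \<Omega> Yl \<eta>' \<le> (\<integral>\<^sup>+w. \<integral>\<^sup>+t. liminf (\<lambda>n. u n (w, t)) \<partial>U01 \<partial>\<Omega>)"
    unfolding profile_energy_def fiber_energy_def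
  proof (rule nn_integral_mono_AE)
    show "AE w in \<Omega>. (\<integral>\<^sup>+t. cell_energy (Yl w) (prim (\<eta>' w) t) (\<eta>' w t) \<partial>U01) \<le> (\<integral>\<^sup>+t. liminf (\<lambda>n. u n (w, t)) \<partial>U01)"
      using key
    proof eventually_elim
      case (elim w)
      show ?case by (rule nn_integral_mono_AE) (use elim in \<open>eventually_elim, blast\<close>)
    qed
  qed
  also have "\<dots> = (\<integral>\<^sup>+q. liminf (\<lambda>n. u n q) \<partial>?Q)" by (rule U.nn_integral_fst[OF Lm])
  also note Lint
  finally show ?thesis using fam by blast
qed

section \<open>Existence of minimizers\<close>

text \<open>
  The direct method. The laws of the wave numbers of a minimizing sequence of normalized families are tight;
  along a subsequence they converge weakly, and Skorohod's theorem realizes them as pointwise convergent random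
  wave numbers on one probability space. The limit family has at most the infimal energy and can be
  superposed to an admissible measure.
\<close>

lemma F_infty_attained: "\<exists>\<mu>\<in>M_infty. F_infty \<mu> = (INF \<nu>\<in>M_infty. F_infty \<nu>)"
  and F_infty_Inf_finite: "(INF \<nu>\<in>M_infty. F_infty \<nu>) \<le> 120"
proof -
  let ?I = "INF \<nu>\<in>M_infty. F_infty \<nu>"
  have "profile_energy U01 (\<lambda>w. 1 / sqrt w) wedge_slope < \<infinity>"
    using finite_energy_profile_family(2) by (rule le_less_trans) simp
  from profile_family_imp_sheet[OF finite_energy_profile_family(1) this]
  obtain m0 a0 where s0: "sheet m0 a0" "sheet_energy m0 a0 \<le> 120"
    using finite_energy_profile_family(2) order.trans by metis
  have in0: "restrict_space m0 strip \<in> M_infty" and "F_infty (restrict_space m0 strip) \<le> 120"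
    using sheet_imp_M_infty[OF s0(1)] s0(2) by auto
  then show I120: "?I \<le> 120" by (rule INF_lower2)
  have "\<exists>u. (\<forall>n. u n \<in> F_infty ` M_infty) \<and> u \<longlonglongrightarrow> ?I"
    by (rule Inf_as_limit) (use in0 in blast)
  then obtain u where u: "\<And>n. u n \<in> F_infty ` M_infty" "u \<longlonglongrightarrow> ?I" by blast
  have "?I < 121" using I120 by (rule le_less_trans) simp
  with u(2) have "\<forall>\<^sub>F n in sequentially. u n < 121" by (rule order_tendstoD(2))
  then obtain N0 where N0: "\<And>n. N0 \<le> n \<Longrightarrow> u n < 121" by (auto simp: eventually_sequentially)
  \<comment> \<open>The tail with energies below 121 of a minimizing sequence.\<close>
  define e where "e n = u (n + N0)" for n
  have e: "e \<longlonglongrightarrow> ?I" unfolding e_def by (rule LIMSEQ_ignore_initial_segment[OF u(2)])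
  have e121: "e n \<le> ennreal 121" for n using N0[of "n + N0"] by (simp add: e_def less_imp_le)
  have "\<exists>m a. sheet m a \<and> sheet_energy m a = e n" for n
  proof -
    obtain \<mu> where \<mu>: "\<mu> \<in> M_infty" "F_infty \<mu> = e n" using u(1)[of "n + N0"] by (auto simp: e_def)
    then show ?thesis using M_infty_imp_sheet[OF \<mu>(1)] by metis
  qed
  then obtain mm aa where sh: "\<And>n. sheet (mm n) (aa n)" "\<And>n. sheet_energy (mm n) (aa n) = e n" by metis
  define good where "good n lam \<eta> \<longleftrightarrow> sets lam = sets (borel :: real measure) \<and>
     (\<lambda>(k, x). \<eta> k x) \<in> borel_measurable (borel \<Otimes>\<^sub>M borel) \<and>
     profile_family lam (\<lambda>k. k) \<eta> \<and> profile_energy lam (\<lambda>k. k) \<eta> = e n \<and>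
     (AE k in lam. (\<integral>\<^sup>+t. ennreal (prim (\<eta> k) t) \<partial>U01) \<le> ennreal (2 + 121)) \<and>
     (\<integral>\<^sup>+k. (\<integral>\<^sup>+t. ennreal ((\<eta> k t)\<^sup>2) \<partial>U01) * ennreal (1 / (1 + 4 * k\<^sup>2)\<^sup>2) \<partial>lam) \<le> ennreal ((2 + 121) * 121) \<and>
     (\<forall>K\<ge>1. emeasure lam {k. K < \<bar>k\<bar>} \<le> ennreal (2 * 121 / K))" for n lam \<eta>
  have "\<exists>lam \<eta>. good n lam \<eta>" for n
  proof -
    have le: "sheet_energy (mm n) (aa n) \<le> ennreal 121" using sh(2) e121 by simp
    show ?thesis
    proof (rule normalized_profile_family[OF sh(1)[of n] le], goal_cases)
      case (2 lam \<eta>)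
      show ?case
        unfolding good_def using 2 sh(2) by (intro exI[of _ lam] exI[of _ \<eta>] conjI) auto
    qed simp
  qed
  then obtain lam \<eta> where g: "\<And>n. good n (lam n) (\<eta> n)" by metis
  have sl: "sets (lam n) = sets borel" and em: "(\<lambda>(k, x). \<eta> n k x) \<in> borel_measurable (borel \<Otimes>\<^sub>M borel)"
    and pfam: "profile_family (lam n) (\<lambda>k. k) (\<eta> n)" and pe: "profile_energy (lam n) (\<lambda>k. k) (\<eta> n) = e n"
    and mass: "AE k in lam n. (\<integral>\<^sup>+t. ennreal (prim (\<eta> n k) t) \<partial>U01) \<le> ennreal (2 + 121)"
    and L2: "(\<integral>\<^sup>+k. (\<integral>\<^sup>+t. ennreal ((\<eta> n k t)\<^sup>2) \<partial>U01) * ennreal (1 / (1 + 4 * k\<^sup>2)\<^sup>2) \<partial>lam n) \<le> ennreal ((2 + 121) * 121)"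
    and tail: "\<And>K. 1 \<le> K \<Longrightarrow> emeasure (lam n) {k. K < \<bar>k\<bar>} \<le> ennreal (2 * 121 / K)" for n
    using g[of n] unfolding good_def by blast+
  have rd: "real_distribution (lam n)" for n
    unfolding real_distribution_def real_distribution_axioms_def using profile_familyD(1)[OF pfam] sl by blast
  have tight: "tight lam"
    unfolding tight_def
  proof (intro conjI allI impI rd)
    fix \<epsilon> :: real assume \<epsilon>: "0 < \<epsilon>"
    \<comment> \<open>The tail bound 2 * 121 / K then drops below \<epsilon>.\<close>
    define K where "K = 1 + 242 / \<epsilon>"
    have K: "1 \<le> K" "242 / K < \<epsilon>" using \<epsilon> by (auto simp: K_def field_simps add_pos_pos)
    show "\<exists>a b. a < b \<and> (\<forall>n. 1 - \<epsilon> < measure (lam n) {a<..b})"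
    proof (intro exI conjI allI)
      show "- K - 1 < K" using K by simp
      fix n
      interpret real_distribution "lam n" by (rule rd)
      have B: "{k. K < \<bar>k\<bar>} \<in> events" by (simp add: sl)
      have "ennreal (prob {k. K < \<bar>k\<bar>}) \<le> ennreal (242 / K)" using tail[OF K(1), of n] by (simp add: emeasure_eq_measure)
      then have "prob {k. K < \<bar>k\<bar>} < \<epsilon>" using K by (simp add: ennreal_le_iff)
      moreover have "prob (space (lam n) - {k. K < \<bar>k\<bar>}) = 1 - prob {k. K < \<bar>k\<bar>}" by (rule prob_compl[OF B])
      moreover have "prob (space (lam n) - {k. K < \<bar>k\<bar>}) \<le> prob {- K - 1<..K}"
        by (rule finite_measure_mono) (auto simp: sl)
      ultimately show "1 - \<epsilon> < prob {- K - 1<..K}" by linarith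
    qed
  qed
  obtain r M where r: "strict_mono (r :: nat \<Rightarrow> nat)" and M: "real_distribution M" and wc: "weak_conv_m (lam \<circ> id \<circ> r) M"
    using tight_imp_convergent_subsubsequence[OF tight strict_mono_id] by blast
  have rd': "real_distribution ((lam \<circ> id \<circ> r) n)" for n using rd by simp
  obtain \<Omega> :: "real measure" and Ys :: "nat \<Rightarrow> real \<Rightarrow> real" and Yl :: "real \<Rightarrow> real" where
    sk: "prob_space \<Omega> \<and> (\<forall>n. Ys n \<in> borel_measurable \<Omega>) \<and> (\<forall>n. distr \<Omega> borel (Ys n) = (lam \<circ> id \<circ> r) n) \<and>
      Yl \<in> measurable \<Omega> lborel \<and> distr \<Omega> borel Yl = M \<and> (\<forall>w\<in>space \<Omega>. (\<lambda>n. Ys n w) \<longlonglongrightarrow> Yl w)"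
    using Skorohod[OF rd' M wc] by (elim exE)
  have prob: "prob_space \<Omega>" and Ym: "\<And>n. Ys n \<in> borel_measurable \<Omega>" and Yd: "\<And>n. distr \<Omega> borel (Ys n) = lam (r n)"
    and Ylm: "Yl \<in> borel_measurable \<Omega>" and Ylim: "\<And>w. w \<in> space \<Omega> \<Longrightarrow> (\<lambda>n. Ys n w) \<longlonglongrightarrow> Yl w"
    using sk by simp_all
  note tr = profile_family_transport[OF sl em pfam prob Ym Yd]
  have mU: "(\<lambda>(k, x). \<eta> n k x) \<in> borel_measurable (borel \<Otimes>\<^sub>M U01)" for n using em[of n] by simp
  have "\<exists>\<eta>'. profile_family \<Omega> Yl \<eta>' \<and> profile_energy \<Omega> Yl \<eta>' \<le> ?I"
  proof (rule profile_family_limit[OF prob Ylm Ylim])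
    show "profile_family \<Omega> (Ys n) (\<lambda>w. \<eta> (r n) (Ys n w))" for n by (rule tr(1))
    have "profile_energy \<Omega> (Ys n) (\<lambda>w. \<eta> (r n) (Ys n w)) = (e \<circ> r) n" for n using tr(2)[of n] pe by simp
    then show "(\<lambda>n. profile_energy \<Omega> (Ys n) (\<lambda>w. \<eta> (r n) (Ys n w))) \<longlonglongrightarrow> ?I"
      using LIMSEQ_subseq_LIMSEQ[OF e r] by (simp add: comp_def)
    show "?I < \<infinity>" using I120 by (rule le_less_trans) simp
    show "AE w in \<Omega>. (\<integral>\<^sup>+t. ennreal (prim (\<eta> (r n) (Ys n w)) t) \<partial>U01) \<le> ennreal (2 + 121)" for n
      using mass[of "r n"] unfolding Yd[symmetric] by (rule AE_distrD[OF Ym])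
    show "(\<integral>\<^sup>+w. (\<integral>\<^sup>+t. ennreal ((\<eta> (r n) (Ys n w) t)\<^sup>2) \<partial>U01) * ennreal (1 / (1 + 4 * (Ys n w)\<^sup>2)\<^sup>2) \<partial>\<Omega>) \<le> ennreal ((2 + 121) * 121)" for n
    proof -
      have "(\<lambda>(k, t). ennreal ((\<eta> (r n) k t)\<^sup>2)) \<in> borel_measurable (borel \<Otimes>\<^sub>M U01)" using mU[of "r n"] by (simp add: split_beta')
      from U.borel_measurable_nn_integral[OF this]
      have "(\<lambda>k. (\<integral>\<^sup>+t. ennreal ((\<eta> (r n) k t)\<^sup>2) \<partial>U01) * ennreal (1 / (1 + 4 * k\<^sup>2)\<^sup>2)) \<in> borel_measurable borel"
        by (intro borel_measurable_times_ennreal) auto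
      then have "(\<lambda>k. (\<integral>\<^sup>+t. ennreal ((\<eta> (r n) k t)\<^sup>2) \<partial>U01) * ennreal (1 / (1 + 4 * k\<^sup>2)\<^sup>2)) \<in> borel_measurable (distr \<Omega> borel (Ys n))"
        by simp
      from nn_integral_distr[OF Ym[of n] this] L2[of "r n"] show ?thesis unfolding Yd by simp
    qed
  qed
  then obtain \<eta>' where \<eta>': "profile_family \<Omega> Yl \<eta>'" "profile_energy \<Omega> Yl \<eta>' \<le> ?I" by blast
  have "profile_energy \<Omega> Yl \<eta>' < \<infinity>" using order.trans[OF \<eta>'(2) I120] by (rule le_less_trans) simp
  from profile_family_imp_sheet[OF \<eta>'(1) this] obtain m a where s: "sheet m a" "sheet_energy m a \<le> ?I"
    using \<eta>'(2) order.trans by metis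
  from sheet_imp_M_infty[OF s(1)] s(2) have "restrict_space m strip \<in> M_infty" "F_infty (restrict_space m strip) \<le> ?I" by auto
  then show "\<exists>\<mu>\<in>M_infty. F_infty \<mu> = ?I" by (meson INF_lower antisym)
qed

section \<open>Equipartition of the energy\<close>

text \<open>
  For a fixed profile the slope energy is proportional to 1/K^2. If it is b at the wave number k, the energy
  at K is K^2 + k^2 b / K^2, which is minimal for K^4 = k^2 b, with the value 2 |k| sqrt b.
\<close>

lemma optimal_wavenumber:
  assumes h [measurable]: "h \<in> borel_measurable borel"
    and ae: "AE t in U01. 0 \<le> prim h t \<and> (prim h t = 0 \<longrightarrow> h t = 0)"
    and mass: "(\<integral>\<^sup>+t. ennreal (prim h t) \<partial>U01) = 1" and fin: "fiber_energy k h \<noteq> \<infinity>"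
  obtains b where "0 \<le> b" "(\<integral>\<^sup>+t. slope_energy k (h t / prim h t) * ennreal (prim h t) \<partial>U01) = ennreal b"
    "fiber_energy k h = ennreal (k\<^sup>2 + b)" "fiber_energy (sqrt (sqrt (k\<^sup>2 * b))) h = ennreal (2 * (\<bar>k\<bar> * sqrt b))"
proof -
  let ?S = "\<lambda>k. \<integral>\<^sup>+t. slope_energy k (h t / prim h t) * ennreal (prim h t) \<partial>U01"
  have split: "fiber_energy k h = ennreal (k\<^sup>2) + ?S k" for k
  proof -
    have "fiber_energy k h = (\<integral>\<^sup>+t. ennreal (k\<^sup>2) * ennreal (prim h t) + slope_energy k (h t / prim h t) * ennreal (prim h t) \<partial>U01)"
      by (simp add: fiber_energy_def cell_energy_def distrib_right)
    also have "\<dots> = ennreal (k\<^sup>2) + ?S k" by (subst nn_integral_add) (auto simp: nn_integral_cmult mass)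
    finally show ?thesis .
  qed
  define b where "b = enn2real (?S k)"
  have Sfin: "?S k \<noteq> \<infinity>" using fin split[of k] by auto
  then have Sb: "?S k = ennreal b" by (simp add: b_def ennreal_enn2real_if)
  have b: "0 \<le> b" by (simp add: b_def)
  \<comment> \<open>The slope energy at a wave number K \<noteq> 0 is the integral of q divided by K^2.\<close>
  define q where "q t = (h t / prim h t)\<^sup>2 * prim h t / 4" for t
  have [measurable]: "q \<in> borel_measurable borel" unfolding q_def by measurable
  have Sq: "?S K = ennreal (1 / K\<^sup>2) * (\<integral>\<^sup>+t. ennreal (q t) \<partial>U01)" if "K \<noteq> 0" for K
  proof -
    have "?S K = (\<integral>\<^sup>+t. ennreal (1 / K\<^sup>2) * ennreal (q t) \<partial>U01)"
    proof (rule nn_integral_cong_AE)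
      show "AE t in U01. slope_energy K (h t / prim h t) * ennreal (prim h t) = ennreal (1 / K\<^sup>2) * ennreal (q t)"
        using ae
      proof eventually_elim
        case (elim t)
        have "slope_energy K (h t / prim h t) * ennreal (prim h t) = ennreal (1 / (4 * K\<^sup>2) * (h t / prim h t)\<^sup>2 * prim h t)"
          using that elim unfolding slope_energy_def by (subst ennreal_mult) auto
        also have "1 / (4 * K\<^sup>2) * (h t / prim h t)\<^sup>2 * prim h t = 1 / K\<^sup>2 * q t" by (simp add: q_def)
        also have "ennreal \<dots> = ennreal (1 / K\<^sup>2) * ennreal (q t)" using elim by (intro ennreal_mult) (auto simp: q_def)
        finally show ?case .
      qed
    qed
    then show ?thesis by (simp add: nn_integral_cmult)
  qed
  have q0: "(\<integral>\<^sup>+t. ennreal (q t) \<partial>U01) = ennreal (k\<^sup>2 * b)"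
  proof (cases "k = 0")
    case True
    have "AE t in U01. slope_energy k (h t / prim h t) * ennreal (prim h t) \<noteq> \<infinity>"
      by (rule nn_integral_PInf_AE) (use Sfin in auto)
    then have "AE t in U01. ennreal (q t) = 0"
      using ae
    proof eventually_elim
      case (elim t)
      show ?case
      proof (cases "h t / prim h t = 0")
        case False
        then have "0 < prim h t" using elim(2) by (cases "prim h t = 0") auto
        then have "slope_energy k (h t / prim h t) * ennreal (prim h t) = \<infinity>"
          using True False by (simp add: slope_energy_def ennreal_top_mult)
        with elim(1) show ?thesis by simp
      qed (auto simp: q_def)
    qed
    then have "(\<integral>\<^sup>+t. ennreal (q t) \<partial>U01) = 0" by (subst nn_integral_0_iff_AE) auto
    then show ?thesis using True by simp
  next
    case False
    have "ennreal (k\<^sup>2) * ennreal b = ennreal (k\<^sup>2) * (ennreal (1 / k\<^sup>2) * (\<integral>\<^sup>+t. ennreal (q t) \<partial>U01))"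
      using Sq[OF False] Sb by simp
    also have "\<dots> = (\<integral>\<^sup>+t. ennreal (q t) \<partial>U01)"
      using False by (simp add: mult.assoc[symmetric] ennreal_mult[symmetric])
    finally show ?thesis using b by (simp add: ennreal_mult)
  qed
  define K where "K = sqrt (sqrt (k\<^sup>2 * b))"
  have B0: "0 \<le> k\<^sup>2 * b" using b by simp
  have K2: "K\<^sup>2 = sqrt (k\<^sup>2 * b)" using B0 by (simp add: K_def)
  have K2': "K\<^sup>2 = \<bar>k\<bar> * sqrt b" unfolding K2 by (simp add: real_sqrt_mult)
  have "?S K = ennreal (K\<^sup>2)"
  proof (cases "K = 0")
    case True
    then have z: "k\<^sup>2 * b = 0" using K2 B0 by simp
    have "(\<integral>\<^sup>+t. ennreal (q t) \<partial>U01) = 0" unfolding q0 z by simp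
    then have "AE t in U01. ennreal (q t) = 0" by (subst (asm) nn_integral_0_iff_AE) auto
    then have "AE t in U01. slope_energy K (h t / prim h t) * ennreal (prim h t) = 0"
      using ae
    proof eventually_elim
      case (elim t)
      show ?case
      proof (cases "prim h t = 0")
        case False
        then have "0 < prim h t" using elim(2) by simp
        then have "0 < q t \<or> h t = 0" by (cases "h t = 0") (auto simp: q_def)
        then have "h t = 0" using elim(1) by (auto simp: ennreal_eq_0_iff)
        then show ?thesis using True by (simp add: slope_energy_def)
      qed simp
    qed
    then have "?S K = 0" by (subst nn_integral_0_iff_AE) auto
    then show ?thesis using True by simp
  next
    case False
    have "k\<^sup>2 * b = K\<^sup>2 * K\<^sup>2" unfolding K2 using B0 by simp
    then have "?S K = ennreal (1 / K\<^sup>2) * ennreal (K\<^sup>2 * K\<^sup>2)" using Sq[OF False] q0 by simp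
    also have "\<dots> = ennreal (1 / K\<^sup>2 * (K\<^sup>2 * K\<^sup>2))" by (rule ennreal_mult[symmetric]) auto
    also have "1 / K\<^sup>2 * (K\<^sup>2 * K\<^sup>2) = K\<^sup>2"
    proof -
      have "1 / X * (X * X) = X" if "X \<noteq> 0" for X :: real using that by simp
      from this[of "K\<^sup>2"] False show ?thesis by simp
    qed
    finally show ?thesis .
  qed
  then have "fiber_energy K h = ennreal (K\<^sup>2 + K\<^sup>2)" by (subst ennreal_plus) (auto simp: split)
  then have "fiber_energy K h = ennreal (2 * (\<bar>k\<bar> * sqrt b))" by (simp only: K2' mult_2)
  moreover have "fiber_energy k h = ennreal (k\<^sup>2 + b)" using b by (simp add: split Sb ennreal_plus)
  ultimately show thesis using that[OF b Sb] by (simp add: K_def)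
qed

text \<open>
  Giving every profile its optimal wave number lowers the energy by the integral of (|k| - sqrt b)^2, where k^2
  and b are the two parts of the fibre energy. For an optimal family this integral vanishes.
\<close>

lemma optimal_family_equipartition:
  assumes F: "profile_family \<Omega> Y \<eta>" and mass: "AE w in \<Omega>. (\<integral>\<^sup>+t. ennreal (prim (\<eta> w) t) \<partial>U01) = 1"
    and fin: "profile_energy \<Omega> Y \<eta> < \<infinity>"
    and opt: "\<And>Y'. profile_family \<Omega> Y' \<eta> \<Longrightarrow> profile_energy \<Omega> Y \<eta> \<le> profile_energy \<Omega> Y' \<eta>"
  shows "AE w in \<Omega>. fiber_energy (Y w) (\<eta> w) = ennreal (2 * (Y w)\<^sup>2) \<and>
    (\<integral>\<^sup>+t. slope_energy (Y w) (\<eta> w t / prim (\<eta> w) t) * ennreal (prim (\<eta> w) t) \<partial>U01) = ennreal ((Y w)\<^sup>2)"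
proof -
  note pf = profile_familyD[OF F]
  note [measurable] = pf(2) fiber_energy_measurable[OF pf(3) pf(2)]
  \<comment> \<open>The slope part of the fibre energy, and the wave number that is optimal for it.\<close>
  define br where "br w = enn2real (fiber_energy (Y w) (\<eta> w)) - (Y w)\<^sup>2" for w
  define K where "K w = sqrt (sqrt ((Y w)\<^sup>2 * br w))" for w
  let ?S = "\<lambda>w. \<integral>\<^sup>+t. slope_energy (Y w) (\<eta> w t / prim (\<eta> w) t) * ennreal (prim (\<eta> w) t) \<partial>U01"
  have [measurable]: "br \<in> borel_measurable \<Omega>" unfolding br_def by measurable
  have [measurable]: "K \<in> borel_measurable \<Omega>" unfolding K_def by measurable
  have "AE w in \<Omega>. fiber_energy (Y w) (\<eta> w) \<noteq> \<infinity>"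
    by (rule nn_integral_PInf_AE) (use fin in \<open>auto simp: profile_energy_def\<close>)
  with pf(7) mass AE_space
  have key: "AE w in \<Omega>. 0 \<le> br w \<and> ?S w = ennreal (br w) \<and> fiber_energy (Y w) (\<eta> w) = ennreal ((Y w)\<^sup>2 + br w) \<and>
      fiber_energy (K w) (\<eta> w) = ennreal (2 * (\<bar>Y w\<bar> * sqrt (br w)))"
  proof eventually_elim
    case (elim w)
    have h: "\<eta> w \<in> borel_measurable borel" using measurable_Pair2[OF pf(3) elim(3)] by simp
    show ?case
    proof (rule optimal_wavenumber[OF h elim(1,2,4)], goal_cases)
      case (1 b)
      have "enn2real (fiber_energy (Y w) (\<eta> w)) = (Y w)\<^sup>2 + b" unfolding 1(3) using 1(1) by (intro enn2real_ennreal) simp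
      then have "br w = b" by (simp add: br_def)
      with 1 show ?case by (simp add: K_def)
    qed
  qed
  have FK: "profile_family \<Omega> K \<eta>" using F unfolding profile_family_def by simp
  let ?A = "\<integral>\<^sup>+w. ennreal (2 * (\<bar>Y w\<bar> * sqrt (br w))) \<partial>\<Omega>" and ?D = "\<integral>\<^sup>+w. ennreal ((\<bar>Y w\<bar> - sqrt (br w))\<^sup>2) \<partial>\<Omega>"
  have "profile_energy \<Omega> K \<eta> = ?A"
    unfolding profile_energy_def by (rule nn_integral_cong_AE) (use key in eventually_elim, simp)
  moreover have "profile_energy \<Omega> Y \<eta> = (\<integral>\<^sup>+w. ennreal (2 * (\<bar>Y w\<bar> * sqrt (br w))) + ennreal ((\<bar>Y w\<bar> - sqrt (br w))\<^sup>2) \<partial>\<Omega>)"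
    unfolding profile_energy_def
  proof (rule nn_integral_cong_AE, use key in eventually_elim)
    fix w assume *: "0 \<le> br w \<and> ?S w = ennreal (br w) \<and> fiber_energy (Y w) (\<eta> w) = ennreal ((Y w)\<^sup>2 + br w) \<and>
      fiber_energy (K w) (\<eta> w) = ennreal (2 * (\<bar>Y w\<bar> * sqrt (br w)))"
    then have "(Y w)\<^sup>2 + br w = 2 * (\<bar>Y w\<bar> * sqrt (br w)) + (\<bar>Y w\<bar> - sqrt (br w))\<^sup>2"
      by (simp add: power2_diff)
    moreover have "ennreal (2 * (\<bar>Y w\<bar> * sqrt (br w)) + (\<bar>Y w\<bar> - sqrt (br w))\<^sup>2) =
        ennreal (2 * (\<bar>Y w\<bar> * sqrt (br w))) + ennreal ((\<bar>Y w\<bar> - sqrt (br w))\<^sup>2)"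
      using * by (intro ennreal_plus) auto
    ultimately show "fiber_energy (Y w) (\<eta> w) = ennreal (2 * (\<bar>Y w\<bar> * sqrt (br w))) + ennreal ((\<bar>Y w\<bar> - sqrt (br w))\<^sup>2)"
      using * by simp
  qed
  then have "profile_energy \<Omega> Y \<eta> = ?A + ?D" by (simp add: nn_integral_add)
  ultimately have "?A + ?D \<le> ?A" "?A + ?D < \<infinity>" using opt[OF FK] fin by simp_all
  moreover have "y = 0" if "x + y \<le> x" "x + y < \<infinity>" for x y :: ennreal
  proof -
    have "x \<noteq> \<infinity>" "x + y \<le> x + 0" using that by auto
    then have "y \<le> 0" by (simp only: ennreal_add_left_cancel_le) auto
    then show ?thesis by simp
  qed
  ultimately have "?D = 0" by blast
  then have "AE w in \<Omega>. ennreal ((\<bar>Y w\<bar> - sqrt (br w))\<^sup>2) = 0" by (subst (asm) nn_integral_0_iff_AE) auto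
  with key show ?thesis
  proof eventually_elim
    case (elim w)
    have "(\<bar>Y w\<bar> - sqrt (br w))\<^sup>2 \<le> 0" using elim(2) by (simp only: ennreal_eq_0_iff)
    then have "\<bar>Y w\<bar> = sqrt (br w)" by simp
    then have "br w = (Y w)\<^sup>2" using elim(1) by (metis power2_abs real_sqrt_pow2)
    with elim(1) show ?case by simp
  qed
qed

text \<open>
  A profile of unit mass on an interval of length one exceeds every number below 1 somewhere, whereas with the fibre energy
  2 k^2 it is bounded by (8 k^4 + 1) / 2. This is impossible if |k| < 1/2.
\<close>

lemma equipartition_imp_wavenumber_ge:
  assumes h [measurable]: "h \<in> borel_measurable borel"
    and ae: "AE t in U01. 0 \<le> prim h t \<and> (prim h t = 0 \<longrightarrow> h t = 0)"
    and mass: "(\<integral>\<^sup>+t. ennreal (prim h t) \<partial>U01) = 1" and en: "fiber_energy k h = ennreal (2 * k\<^sup>2)"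
  shows "1 / 2 \<le> \<bar>k\<bar>"
proof (rule ccontr)
  \<comment> \<open>The bound of the fibre for the energy 2 k^2 and the parameter s = 1.\<close>
  define c where "c = (4 * k\<^sup>2 * (2 * k\<^sup>2) * 1 + 1 / 1) / (2::real)"
  have "\<bar>prim h t\<bar> \<le> c" for t unfolding c_def by (rule fiber_bounds(1)[OF h ae mass en]) auto
  then have "(\<integral>\<^sup>+t. ennreal (prim h t) \<partial>U01) \<le> (\<integral>\<^sup>+t. ennreal c \<partial>U01)"
    by (intro nn_integral_mono ennreal_leI) (metis abs_le_D1)
  then have "ennreal 1 \<le> ennreal c" using mass U.emeasure_space_1 by simp
  then have c: "1 \<le> c" by (subst (asm) ennreal_le_iff2) auto
  assume "\<not> 1 / 2 \<le> \<bar>k\<bar>"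
  then have "\<bar>k\<bar> * \<bar>k\<bar> \<le> 1 / 2 * (1 / 2)" by (intro mult_mono) auto
  then have k: "k\<^sup>2 \<le> 1 / 4" by (simp add: power2_eq_square)
  then have "k\<^sup>2 * k\<^sup>2 \<le> 1 / 4 * (1 / 4)" by (intro mult_mono) auto
  then show False using c unfolding c_def by simp
qed

section \<open>Disintegration and bounded variation of minimizers\<close>

lemma AE_equal_imp_completion:
  fixes f g :: "'a \<Rightarrow> real"
  assumes f [measurable]: "f \<in> borel_measurable M" and ae: "AE x in M. g x = f x"
  shows "g \<in> borel_measurable (completion M)" "integrable M f \<Longrightarrow> integrable (completion M) g"
    "integral\<^sup>L (completion M) g = integral\<^sup>L M f"
proof -
  have fc: "f \<in> borel_measurable (completion M)" using f by (rule measurable_completion)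
  have aec: "AE x in completion M. g x = f x" using ae by (rule AE_completion)
  show gm: "g \<in> borel_measurable (completion M)"
  proof (rule measurableI)
    fix A :: "real set" assume A: "A \<in> sets borel"
    have n1: "AE x in M. \<not> (g x \<noteq> f x)" using ae by eventually_elim simp
    have n2: "AE x in M. \<not> (g x \<in> A \<and> g x \<noteq> f x)" using ae by eventually_elim simp
    have p1: "Measurable.pred (completion M) (\<lambda>x. g x \<noteq> f x)" by (rule sets_completion_AE[OF n1])
    have p2: "Measurable.pred (completion M) (\<lambda>x. g x \<in> A \<and> g x \<noteq> f x)" by (rule sets_completion_AE[OF n2])
    have p3: "Measurable.pred (completion M) (\<lambda>x. f x \<in> A)"
      using measurable_sets[OF fc A] by (simp add: pred_def vimage_def Int_def conj_commute)
    have "Measurable.pred (completion M) (\<lambda>x. (f x \<in> A \<and> \<not> (g x \<noteq> f x)) \<or> (g x \<in> A \<and> g x \<noteq> f x))"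
      by (rule pred_intros_logic(5)[OF pred_intros_logic(3)[OF p3 pred_intros_logic(2)[OF p1]] p2])
    moreover have "((f x \<in> A \<and> \<not> (g x \<noteq> f x)) \<or> (g x \<in> A \<and> g x \<noteq> f x)) = (g x \<in> A)" for x by auto
    ultimately have "Measurable.pred (completion M) (\<lambda>x. g x \<in> A)" by simp
    then show "g -` A \<inter> space (completion M) \<in> sets (completion M)"
      by (simp add: pred_def vimage_def Int_def conj_commute)
  qed simp
  show "integrable M f \<Longrightarrow> integrable (completion M) g"
    using integrable_cong_AE[OF gm fc aec] integrable_completion[OF f] by blast
  show "integral\<^sup>L (completion M) g = integral\<^sup>L M f"
    using integral_cong_AE[OF gm fc aec] integral_completion[OF f] by simp
qed

lemma lebesgue_fiber:
  fixes f h :: "real \<Rightarrow> real"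
  assumes f [measurable]: "f \<in> borel_measurable borel" and ae: "AE t in U01. h t = f t"
  shows "integrable U01 f \<Longrightarrow> set_integrable lebesgue {0<..<1} h" "(LINT t:{0<..<1}|lebesgue. h t) = (LINT t|U01. f t)"
proof -
  have m: "(\<lambda>t. indicator {0<..<1} t *\<^sub>R f t) \<in> borel_measurable lborel" by measurable
  have "AE t in lborel. indicator {0<..<1} t *\<^sub>R h t = indicator {0<..<1} t *\<^sub>R f t"
    using ae unfolding AE_U01_iff by eventually_elim (auto simp: indicator_def)
  note c = AE_equal_imp_completion[OF m this]
  show "integrable U01 f \<Longrightarrow> set_integrable lebesgue {0<..<1} h"
    unfolding integrable_U01[OF f] set_integrable_def by (rule c(2))
  show "(LINT t:{0<..<1}|lebesgue. h t) = (LINT t|U01. f t)"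
    unfolding integral_U01[OF f] set_lebesgue_integral_def by (rule c(3))
qed

lemma integrable_prim:
  assumes h: "integrable U01 h"
  shows "integrable U01 (prim h)"
proof (rule U.integrable_const_bound)
  have [measurable]: "h \<in> borel_measurable borel" using h by auto
  show "prim h \<in> borel_measurable U01" by measurable
  have "\<bar>prim h t\<bar> \<le> (LINT x|U01. \<bar>h x\<bar>)" for t
  proof -
    have "ennreal \<bar>prim h t\<bar> \<le> (\<integral>\<^sup>+x. ennreal \<bar>h x\<bar> \<partial>U01)" by (rule prim_le_nn_integral)
    also have "\<dots> = ennreal (LINT x|U01. \<bar>h x\<bar>)" using h by (intro nn_integral_eq_integral) auto
    finally show ?thesis by (simp add: ennreal_le_iff)
  qed
  then show "AE t in U01. norm (prim h t) \<le> (LINT x|U01. \<bar>h x\<bar>)" by simp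
qed

text \<open>
  The distributional derivative of the primitive is the measure with density h.
\<close>

lemma prim_BV01:
  assumes h: "integrable U01 h"
  shows "prim h \<in> BV01"
proof -
  have [measurable]: "h \<in> borel_measurable borel" using h by auto
  have [measurable]: "prim h \<in> borel_measurable borel" by measurable
  let ?R = "restrict_space borel {0<..<1::real}" and ?L = "restrict_space lborel {0<..<1::real}"
  have "sets ?R = sets ?L" by (rule sets_restrict_space_cong) simp
  moreover have "space ?R = space ?L" by (simp add: space_restrict_space)
  ultimately have pv: "pos_variation ?R = pos_variation ?L" and nv: "neg_variation ?R = neg_variation ?L"
    by (auto simp: fun_eq_iff pos_variation_def neg_variation_def)
  have hi: "integrable ?L h"
    using h unfolding integrable_U01[OF \<open>h \<in> borel_measurable borel\<close>] set_integrable_def by (subst integrable_restrict_space) auto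
  define \<nu> where "\<nu> A = (LINT x:A|?L. h x)" for A
  have sm: "signed_measure_on ?L \<nu>" by (rule signed_measure_on_density[OF hi]) (simp add: \<nu>_def)
  show ?thesis
    unfolding BV01_def
  proof (intro CollectI conjI exI[of _ \<nu>] ballI)
    show "set_integrable lebesgue {0<..<1} (prim h)"
      by (rule lebesgue_fiber(1)[OF _ _ integrable_prim[OF h]]) auto
    show "signed_measure_on ?R \<nu>" using sm \<open>sets ?R = sets ?L\<close> by (simp add: signed_measure_on_def)
    fix \<phi> :: "real \<Rightarrow> real" assume \<phi>: "\<phi> \<in> test_fun {0<..<1}"
    note [measurable] = test_fun_measurable[OF \<phi>]
    obtain B where B: "\<And>x. \<bar>\<phi> x\<bar> \<le> B" using test_fun_props(4)[OF \<phi>] by metis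
    obtain B' where D: "continuous_on UNIV (deriv \<phi>)" "\<And>x. \<bar>deriv \<phi> x\<bar> \<le> B'" "\<And>x. (\<phi> has_real_derivative deriv \<phi> x) (at x)"
      using test_fun_real_derivative[OF \<phi>] by metis
    have [measurable]: "deriv \<phi> \<in> borel_measurable borel" using D(1) by (rule borel_measurable_continuous_onI)
    have "signed_integral ?R \<nu> \<phi> = signed_integral ?L \<nu> \<phi>" by (simp add: signed_integral_def pv nv)
    also have "\<dots> = (LINT x|?L. \<phi> x * h x)"
    proof (rule signed_integral_density[OF hi, where K = B])
      show "\<phi> \<in> borel_measurable ?L" by (rule measurable_restrict_space1) measurable
    qed (auto simp: \<nu>_def B)
    also have "\<dots> = (LINT x|U01. \<phi> x * h x)"
      by (subst integral_restrict_space) (auto simp: integral_U01 set_lebesgue_integral_def)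
    also have "\<dots> = - (LINT t|U01. deriv \<phi> t * prim h t)"
      using fiber_integration_by_parts[OF h D] test_fun_props(6)[OF \<phi>, of 1] by simp
    also have "(LINT t|U01. deriv \<phi> t * prim h t) = (LINT x:{0<..<1}|lebesgue. prim h x * deriv \<phi> x)"
      by (subst lebesgue_integral_eq_U01) (auto simp: mult.commute)
    finally show "signed_integral ?R \<nu> \<phi> = - (LINT x:{0<..<1}|lebesgue. prim h x * deriv \<phi> x)" .
  qed
qed

text \<open>
  A function measurable for the completion is replaced by a Borel function. The two may differ on a set that m does not
  charge; on almost every fibre such a set is Lebesgue null up to points where the fibre density
  vanishes, which suffices because f only enters through its product with that density. For the Borel
  function, m is the image of a density on the product space, and Fubini's theorem applies.
\<close>

lemma sheet_is_disintegration:
  assumes s: "sheet m a"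
  defines "lam \<equiv> distr m borel snd"
  assumes em: "(\<lambda>(k, x). \<eta> k x) \<in> borel_measurable (borel \<Otimes>\<^sub>M borel)"
    and F: "profile_family lam (\<lambda>k. k) \<eta>"
    and fub: "\<And>f. f \<in> borel_measurable borel \<Longrightarrow>
       (\<integral>\<^sup>+p. f p \<partial>m) = (\<integral>\<^sup>+k. \<integral>\<^sup>+t. f (t, k) * ennreal (prim (\<eta> k) t) \<partial>U01 \<partial>lam)"
    and unit: "AE k in lam. (\<integral>\<^sup>+t. ennreal (prim (\<eta> k) t) \<partial>U01) = 1"
  shows "is_disintegration (restrict_space m half_strip) lam (\<lambda>k. prim (\<eta> k))"
    and "measurable_family lam (\<lambda>k. prim (\<eta> k))"
proof -
  note sh = sheetD[OF s]
  note pf = profile_familyD[OF F]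
  let ?g = "\<lambda>k. prim (\<eta> k)" and ?R = "restrict_space m half_strip"
  interpret prob_space lam by (rule pf)
  interpret P: pair_sigma_finite lam U01 ..
  have sl [measurable_cong]: "sets lam = sets borel" by (simp add: lam_def)
  have h [measurable]: "\<eta> k \<in> borel_measurable borel" for k using measurable_Pair2[OF em] by simp
  have H: "half_strip \<inter> space m \<in> sets m" by (simp add: sh(1,2))
  have gm [measurable]: "(\<lambda>q. prim (\<eta> (fst q)) (snd q)) \<in> borel_measurable (lam \<Otimes>\<^sub>M U01)" by (rule pf)
  show mf: "measurable_family lam ?g"
    unfolding measurable_family_def
  proof (intro ballI impI)
    fix B :: "real set" assume B [measurable]: "B \<in> sets borel" and sub: "B \<subseteq> {0<..<1}"
    have "(LINT x:B|lebesgue. ?g k x) = (LINT x|U01. indicator B x * ?g k x)" for k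
    proof -
      have "(LINT x:B|lebesgue. ?g k x) = (LINT x:{0<..<1}|lebesgue. indicator B x * ?g k x)"
        unfolding set_lebesgue_integral_def using sub by (intro Bochner_Integration.integral_cong) (auto simp: indicator_def)
      also have "\<dots> = (LINT x|U01. indicator B x * ?g k x)" by (rule lebesgue_integral_eq_U01) measurable
      finally show ?thesis .
    qed
    moreover have "(\<lambda>k. LINT x|U01. indicator B x * ?g k x) \<in> borel_measurable lam"
    proof (rule U.borel_measurable_lebesgue_integral)
      have "(\<lambda>q. indicator B (snd q) * prim (\<eta> (fst q)) (snd q)) \<in> borel_measurable (lam \<Otimes>\<^sub>M U01)" by measurable
      then show "(\<lambda>(k, x). indicator B x * ?g k x) \<in> borel_measurable (lam \<Otimes>\<^sub>M U01)" by (simp add: split_beta')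
    qed
    ultimately show "(\<lambda>k. LINT x:B|lebesgue. ?g k x) \<in> borel_measurable (completion lam)"
      by (simp add: measurable_completion)
  qed
  have null: "AE k in lam. AE t in U01. Q (t, k) \<or> ?g k t = 0" if Q: "AE p in m. Q p" for Q
  proof -
    from Q obtain N where N: "{p \<in> space m. \<not> Q p} \<subseteq> N" "N \<in> sets m" "emeasure m N = 0" by (elim AE_E) auto
    have [measurable]: "N \<in> sets borel" using N sh(1) by simp
    have [measurable]: "N \<in> sets (borel \<Otimes>\<^sub>M borel)" unfolding borel_prod using N sh(1) by simp
    have "(\<integral>\<^sup>+k. \<integral>\<^sup>+t. indicator N (t, k) * ennreal (?g k t) \<partial>U01 \<partial>lam) = 0"
      using fub[of "indicator N"] N by (simp add: sh(1))
    moreover have inm: "(\<lambda>(k, t). indicator N (t, k) * ennreal (?g k t)) \<in> borel_measurable (lam \<Otimes>\<^sub>M U01)"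
      unfolding split_beta' by measurable
    ultimately have "AE k in lam. (\<integral>\<^sup>+t. indicator N (t, k) * ennreal (?g k t) \<partial>U01) = 0"
      by (subst (asm) nn_integral_0_iff_AE) (auto intro: U.borel_measurable_nn_integral)
    with pf(7) show ?thesis
    proof eventually_elim
      case (elim k)
      have "(\<lambda>t. indicator N (t, k) * ennreal (?g k t)) \<in> borel_measurable U01"
        using measurable_Pair2[OF inm, of k] by (simp add: lam_def)
      with elim(2) have "AE t in U01. indicator N (t, k) * ennreal (?g k t) = 0"
        by (subst (asm) nn_integral_0_iff_AE) auto
      with elim(1) show ?case
      proof eventually_elim
        case (elim t)
        show ?case
        proof (cases "(t, k) \<in> N")
          case True
          then show ?thesis using elim by (auto simp: ennreal_eq_0_iff)
        next
          case False
          then show ?thesis using N(1) sh(2) by auto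
        qed
      qed
    qed
  qed
  have mdist: "m = distr (density (lam \<Otimes>\<^sub>M U01) (\<lambda>q. ennreal (prim (\<eta> (fst q)) (snd q)))) borel (\<lambda>q. (snd q, fst q))"
  proof (rule measure_eqI)
    fix A assume "A \<in> sets m"
    then have [measurable]: "A \<in> sets borel" using sh(1) by simp
    then have [measurable]: "A \<in> sets (borel \<Otimes>\<^sub>M borel)" unfolding borel_prod .
    have sw: "(\<lambda>q. (snd q, fst q)) \<in> measurable (lam \<Otimes>\<^sub>M U01) borel" unfolding borel_prod[symmetric] by measurable
    have "(\<lambda>q. indicator A (snd q, fst q) * ennreal (prim (\<eta> (fst q)) (snd q))) \<in> borel_measurable (lam \<Otimes>\<^sub>M U01)" by measurable
    from U.nn_integral_fst[OF this]
    have "emeasure m A = (\<integral>\<^sup>+q. indicator A (snd q, fst q) * ennreal (prim (\<eta> (fst q)) (snd q)) \<partial>(lam \<Otimes>\<^sub>M U01))"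
      using fub[of "indicator A"] \<open>A \<in> sets m\<close> by simp
    also have "\<dots> = (\<integral>\<^sup>+q. ennreal (prim (\<eta> (fst q)) (snd q)) * indicator ((\<lambda>q. (snd q, fst q)) -` A \<inter> space (lam \<Otimes>\<^sub>M U01)) q \<partial>(lam \<Otimes>\<^sub>M U01))"
      by (rule nn_integral_cong) (auto simp: indicator_def)
    also have "\<dots> = emeasure (density (lam \<Otimes>\<^sub>M U01) (\<lambda>q. ennreal (prim (\<eta> (fst q)) (snd q)))) ((\<lambda>q. (snd q, fst q)) -` A \<inter> space (lam \<Otimes>\<^sub>M U01))"
    proof (rule emeasure_density[symmetric])
      show "(\<lambda>q. ennreal (prim (\<eta> (fst q)) (snd q))) \<in> borel_measurable (lam \<Otimes>\<^sub>M U01)" using gm by simp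
      show "(\<lambda>q. (snd q, fst q)) -` A \<inter> space (lam \<Otimes>\<^sub>M U01) \<in> sets (lam \<Otimes>\<^sub>M U01)"
        using sw \<open>A \<in> sets borel\<close> by (rule measurable_sets)
    qed
    finally show "emeasure m A = emeasure (distr (density (lam \<Otimes>\<^sub>M U01) (\<lambda>q. ennreal (prim (\<eta> (fst q)) (snd q)))) borel (\<lambda>q. (snd q, fst q))) A"
      using sw by (subst emeasure_distr) auto
  qed (simp add: sh(1))
  have "AE k in lam. set_integrable lebesgue {0<..<1} (?g k) \<and> (LINT x:{0<..<1}|lebesgue. ?g k x) = 1"
    using pf(6,7) unit
  proof eventually_elim
    case (elim k)
    have gi: "integrable U01 (?g k)" by (rule integrable_prim[OF elim(1)])
    have "AE t in U01. 0 \<le> ?g k t" using elim(2) by eventually_elim simp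
    with gi have "(\<integral>\<^sup>+t. ennreal (?g k t) \<partial>U01) = ennreal (LINT t|U01. ?g k t)" by (intro nn_integral_eq_integral)
    with elim(3) have "(LINT t|U01. ?g k t) = 1" by (metis ennreal_eq_1)
    then show ?case using lebesgue_fiber[of "?g k" "?g k"] gi by simp
  qed
  moreover have "(AE k in lam. set_integrable lebesgue {0<..<1} (\<lambda>x. f (x, k) * ?g k x)) \<and>
      integrable (completion lam) (\<lambda>k. LINT x:{0<..<1}|lebesgue. f (x, k) * ?g k x) \<and>
      (LINT p|completion ?R. f p) = (LINT k|completion lam. (LINT x:{0<..<1}|lebesgue. f (x, k) * ?g k x))"
    if f: "integrable (completion ?R) f" for f :: "real \<times> real \<Rightarrow> real"
  proof -
    obtain f1 where f1: "f1 \<in> borel_measurable ?R" "AE p in ?R. f p = f1 p"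
      using completion_ex_borel_measurable_real[of f ?R] f by blast
    \<comment> \<open>The Borel representative, extended by 0 to the plane.\<close>
    define f2 :: "real \<times> real \<Rightarrow> real" where "f2 p = indicator half_strip p *\<^sub>R f1 p" for p
    have f1c: "f1 \<in> borel_measurable (completion ?R)" using f1(1) by (rule measurable_completion)
    have fc: "f \<in> borel_measurable (completion ?R)" using f by auto
    have f1i: "integrable ?R f1"
      using integrable_cong_AE[OF fc f1c AE_completion[OF f1(2)]] f integrable_completion[OF f1(1)] by blast
    have f2m: "f2 \<in> borel_measurable m"
      using f1(1) unfolding borel_measurable_restrict_space_iff[OF H] f2_def[abs_def] .
    then have [measurable]: "f2 \<in> borel_measurable borel" by (simp add: measurable_cong_sets[OF sh(1) refl])
    then have [measurable]: "f2 \<in> borel_measurable (borel \<Otimes>\<^sub>M borel)" by (simp add: borel_prod)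
    have f2i: "integrable m f2" using f1i unfolding integrable_restrict_space[OF H] f2_def[abs_def] .
    have "(LINT p|completion ?R. f p) = (LINT p|?R. f1 p)"
      using integral_cong_AE[OF fc f1c AE_completion[OF f1(2)]] integral_completion[OF f1(1)] by simp
    then have int: "(LINT p|completion ?R. f p) = (LINT p|m. f2 p)"
      unfolding integral_restrict_space[OF H] f2_def by simp
    have "AE p in m. f p = f2 p"
      using f1(2)[unfolded AE_restrict_space_iff[OF H]] sh(4) by eventually_elim (simp add: f2_def)
    from null[OF this] have eq: "AE k in lam. AE t in U01. f (t, k) * ?g k t = f2 (t, k) * ?g k t"
      by (rule eventually_mono) (auto elim!: eventually_mono)
    have sw: "(\<lambda>q. (snd q, fst q)) \<in> measurable (density (lam \<Otimes>\<^sub>M U01) (\<lambda>q. ennreal (prim (\<eta> (fst q)) (snd q)))) borel"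
      unfolding borel_prod[symmetric] by measurable
    have nn: "AE q in lam \<Otimes>\<^sub>M U01. 0 \<le> prim (\<eta> (fst q)) (snd q)" using pf(9) by eventually_elim simp
    let ?G = "\<lambda>q. prim (\<eta> (fst q)) (snd q) *\<^sub>R f2 (snd q, fst q)"
    have f2s: "(\<lambda>q. f2 (snd q, fst q)) \<in> borel_measurable (lam \<Otimes>\<^sub>M U01)" by measurable
    have "integrable (density (lam \<Otimes>\<^sub>M U01) (\<lambda>q. ennreal (prim (\<eta> (fst q)) (snd q)))) (\<lambda>q. f2 (snd q, fst q))"
      using f2i unfolding mdist by (subst (asm) integrable_distr_eq[OF sw]) auto
    then have Gi: "integrable (lam \<Otimes>\<^sub>M U01) ?G" by (subst (asm) integrable_density[OF f2s gm nn])
    have "(LINT p|m. f2 p) = (LINT q|density (lam \<Otimes>\<^sub>M U01) (\<lambda>q. ennreal (prim (\<eta> (fst q)) (snd q))). f2 (snd q, fst q))"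
      unfolding mdist by (rule integral_distr[OF sw]) measurable
    also have "\<dots> = integral\<^sup>L (lam \<Otimes>\<^sub>M U01) ?G" by (rule integral_density[OF f2s gm nn])
    finally have int2: "(LINT p|m. f2 p) = integral\<^sup>L (lam \<Otimes>\<^sub>M U01) ?G" .
    define J where "J k = (LINT t|U01. f2 (t, k) * ?g k t)" for k
    have J: "J = (\<lambda>k. LINT t|U01. ?G (k, t))" by (simp add: J_def fun_eq_iff mult.commute)
    have Ji: "integrable lam J" unfolding J by (rule P.integrable_fst'[OF Gi])
    have JI: "(LINT k|lam. J k) = (LINT p|m. f2 p)" unfolding J int2 by (rule P.integral_fst'[OF Gi])
    have bm: "(\<lambda>t. f2 (t, k) * ?g k t) \<in> borel_measurable borel" for k by measurable
    have "AE k in lam. integrable U01 (\<lambda>t. f2 (t, k) * ?g k t)"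
      using P.AE_integrable_fst'[OF Gi] by (simp add: mult.commute)
    with eq have fib: "AE k in lam. set_integrable lebesgue {0<..<1} (\<lambda>x. f (x, k) * ?g k x) \<and>
        (LINT x:{0<..<1}|lebesgue. f (x, k) * ?g k x) = J k"
    proof eventually_elim
      case (elim k)
      from lebesgue_fiber(1)[OF bm elim] lebesgue_fiber(2)[OF bm elim(1)] show ?case unfolding J_def by (rule conjI)
    qed
    then have 1: "AE k in lam. set_integrable lebesgue {0<..<1} (\<lambda>x. f (x, k) * ?g k x)"
      and 2: "AE k in lam. (LINT x:{0<..<1}|lebesgue. f (x, k) * ?g k x) = J k"
      by (eventually_elim, simp)+
    have Jm: "J \<in> borel_measurable lam" using Ji by auto
    from 1 AE_equal_imp_completion(2)[OF Jm 2 Ji] AE_equal_imp_completion(3)[OF Jm 2] int JI show ?thesis by simp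
  qed
  moreover have "?g k \<in> borel_measurable (lebesgue_on {0<..<1})" for k
    by (intro measurable_restrict_space1 measurable_completion) simp
  ultimately show "is_disintegration ?R lam ?g"
    unfolding is_disintegration_def using mf sl finite_measure_axioms by blast
qed

section \<open>Minimizers of the functional\<close>

theorem theorem6p2:
  shows "(\<exists>\<mu>\<in>M_infty. F_infty \<mu> = (INF \<nu>\<in>M_infty. F_infty \<nu>)) \<and>
    (\<forall>\<mu>. is_minimizer \<mu> \<longrightarrow>
      (\<exists>C::real. C > 0 \<and> (\<exists>g :: real \<Rightarrow> real \<Rightarrow> real.
        measurable_family (k_marginal \<mu>) g \<and>
        (AE k in k_marginal \<mu>. g k \<in> BV01) \<and>
        is_disintegration (restr \<mu>) (k_marginal \<mu>) g \<and>
        (AE k in k_marginal \<mu>.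
          (\<integral>\<^sup>+x\<in>{0<..<1}. ennreal (k\<^sup>2 * g k x) \<partial>lebesgue) =
          (\<integral>\<^sup>+x\<in>{0<..<1}. slope_energy k (dx_density \<mu> (x, k)) * ennreal (g k x) \<partial>lebesgue)) \<and>
        emeasure (k_marginal \<mu>) {k. \<bar>k\<bar> < C} = 0)))"
proof (intro conjI allI impI)
  show "\<exists>\<mu>\<in>M_infty. F_infty \<mu> = (INF \<nu>\<in>M_infty. F_infty \<nu>)" by (rule F_infty_attained)
next
  fix \<mu> assume min: "is_minimizer \<mu>"
  then have \<mu>: "\<mu> \<in> M_infty" and opt: "F_infty \<mu> = (INF \<nu>\<in>M_infty. F_infty \<nu>)" by (simp_all add: is_minimizer_def)
  have sp: "space \<mu> = strip" and se: "sets \<mu> = sets (restrict_space borel strip)" using \<mu> by (simp_all add: M_infty_def)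
  define m where "m = distr \<mu> borel (\<lambda>p. p)"
  define a where "a p = indicator strip p *\<^sub>R dx_density \<mu> p" for p
  define lam where "lam = distr m borel snd"
  have s: "sheet m a" and en: "F_infty \<mu> = sheet_energy m a"
    using M_infty_imp_sheet[OF \<mu>] by (simp_all add: m_def a_def[abs_def])
  note sh = sheetD[OF s]
  note idm = identity_measurable_strip[OF se]
  have restr: "restr \<mu> = restrict_space m half_strip"
  proof (rule measure_eqI)
    have "sets (restr \<mu>) = sets (restrict_space (restrict_space borel strip) half_strip)"
      unfolding restr_def by (rule sets_restrict_space_cong[OF se])
    also have "\<dots> = sets (restrict_space borel half_strip)"
      using half_strip_subset by (simp add: restrict_restrict_space Int_absorb1)
    also have "\<dots> = sets (restrict_space m half_strip)" by (rule sets_restrict_space_cong) (simp add: sh(1))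
    finally show sR: "sets (restr \<mu>) = sets (restrict_space m half_strip)" .
    fix A assume A: "A \<in> sets (restr \<mu>)"
    have Hm: "half_strip \<inter> space m \<in> sets m" by (simp add: sh(1,2))
    have "half_strip \<inter> space \<mu> \<in> sets \<mu>"
      using measurable_sets[OF idm, of half_strip] by (simp add: Int_commute)
    moreover have Ab: "A \<in> sets m" "A \<subseteq> half_strip"
      using A unfolding sR sets_restrict_space_iff[OF Hm] by auto
    ultimately have "emeasure (restr \<mu>) A = emeasure \<mu> A" unfolding restr_def by (intro emeasure_restrict_space)
    moreover have "emeasure m A = emeasure \<mu> (A \<inter> space \<mu>)"
      unfolding m_def using Ab sh(1) by (subst emeasure_distr[OF idm]) simp_all
    moreover have "A \<inter> space \<mu> = A" using Ab half_strip_subset sp by blast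
    moreover have "emeasure (restrict_space m half_strip) A = emeasure m A" using Hm Ab by (intro emeasure_restrict_space)
    ultimately show "emeasure (restr \<mu>) A = emeasure (restrict_space m half_strip) A" by simp
  qed
  have sndm: "snd \<in> borel_measurable m" by (simp add: measurable_cong_sets[OF sh(1) refl])
  have marg: "k_marginal \<mu> = lam"
    unfolding k_marginal_def restr lam_def
  proof (rule measure_eqI)
    fix A :: "real set" assume "A \<in> sets (distr (restrict_space m half_strip) borel snd)"
    then have A: "A \<in> sets borel" by simp
    have Hm: "half_strip \<inter> space m \<in> sets m" by (simp add: sh(1,2))
    have sA: "snd -` A \<in> sets m" using measurable_sets[OF sndm A] sh(2) by simp
    have "emeasure (distr (restrict_space m half_strip) borel snd) A = emeasure m (snd -` A \<inter> half_strip)"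
      using A sh(2) sndm Hm
      by (subst emeasure_distr) (auto simp: space_restrict_space measurable_restrict_space1 intro!: emeasure_restrict_space)
    also have "\<dots> = emeasure m (snd -` A)"
      by (rule emeasure_eq_AE) (use sh(4) in eventually_elim, auto simp: sA sets.Int Hm[unfolded sh(2), simplified])
    finally show "emeasure (distr (restrict_space m half_strip) borel snd) A = emeasure (distr m borel snd) A"
      using A sndm sh(2) by (simp add: emeasure_distr)
  qed simp
  show "\<exists>C::real. C > 0 \<and> (\<exists>g :: real \<Rightarrow> real \<Rightarrow> real.
        measurable_family (k_marginal \<mu>) g \<and>
        (AE k in k_marginal \<mu>. g k \<in> BV01) \<and>
        is_disintegration (restr \<mu>) (k_marginal \<mu>) g \<and>
        (AE k in k_marginal \<mu>.
          (\<integral>\<^sup>+x\<in>{0<..<1}. ennreal (k\<^sup>2 * g k x) \<partial>lebesgue) =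
          (\<integral>\<^sup>+x\<in>{0<..<1}. slope_energy k (dx_density \<mu> (x, k)) * ennreal (g k x) \<partial>lebesgue)) \<and>
        emeasure (k_marginal \<mu>) {k. \<bar>k\<bar> < C} = 0)"
    unfolding marg restr
  proof (rule sheet_disintegration[OF s, folded lam_def], goal_cases)
    case (1 \<eta>)
    note em = 1(1) and F = 1(2) and E = 1(3) and fub = 1(4) and unit = 1(5) and slope = 1(6)
    note pf = profile_familyD[OF F]
    have h [measurable]: "\<eta> k \<in> borel_measurable borel" for k using measurable_Pair2[OF em] by simp
    have PE: "profile_energy lam (\<lambda>k. k) \<eta> = F_infty \<mu>" by (simp only: E en)
    have fin: "profile_energy lam (\<lambda>k. k) \<eta> < \<infinity>"
      unfolding PE opt using F_infty_Inf_finite by (rule le_less_trans) simp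
    have best: "profile_energy lam (\<lambda>k. k) \<eta> \<le> profile_energy lam Y \<eta>" if Y: "profile_family lam Y \<eta>" for Y
    proof (cases "profile_energy lam Y \<eta> < \<infinity>")
      case True
      show ?thesis
      proof (rule profile_family_imp_sheet[OF Y True])
        fix m' a' assume s': "sheet m' a'" "sheet_energy m' a' \<le> profile_energy lam Y \<eta>"
        have "F_infty \<mu> \<le> F_infty (restrict_space m' strip)"
          unfolding opt by (rule INF_lower[OF sheet_imp_M_infty(1)[OF s'(1)]])
        also have "\<dots> \<le> profile_energy lam Y \<eta>" using sheet_imp_M_infty(2)[OF s'(1)] s'(2) by simp
        finally show ?thesis unfolding PE .
      qed
    qed (simp add: less_top[symmetric])
    have eqp: "AE k in lam. fiber_energy k (\<eta> k) = ennreal (2 * k\<^sup>2) \<and>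
        (\<integral>\<^sup>+t. slope_energy k (\<eta> k t / prim (\<eta> k) t) * ennreal (prim (\<eta> k) t) \<partial>U01) = ennreal (k\<^sup>2)"
      by (rule optimal_family_equipartition[OF F unit fin]) (rule best)
    have eq: "AE k in lam. (\<integral>\<^sup>+x\<in>{0<..<1}. ennreal (k\<^sup>2 * prim (\<eta> k) x) \<partial>lebesgue) =
          (\<integral>\<^sup>+x\<in>{0<..<1}. slope_energy k (dx_density \<mu> (x, k)) * ennreal (prim (\<eta> k) x) \<partial>lebesgue)"
      using eqp unit slope
    proof eventually_elim
      case (elim k)
      have "(\<lambda>x. a (x, k)) \<in> borel_measurable borel"
        by (rule measurable_compose[OF _ sh(5)]) (simp add: borel_prod[symmetric])
      note [measurable] = this
      have "(\<integral>\<^sup>+x\<in>{0<..<1}. ennreal (k\<^sup>2 * prim (\<eta> k) x) \<partial>lebesgue) = (\<integral>\<^sup>+x. ennreal (k\<^sup>2 * prim (\<eta> k) x) \<partial>U01)"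
        by (rule lebesgue_nn_integral_eq_U01) measurable
      also have "\<dots> = ennreal (k\<^sup>2)" by (simp add: ennreal_mult' nn_integral_cmult elim(2))
      finally have L: "(\<integral>\<^sup>+x\<in>{0<..<1}. ennreal (k\<^sup>2 * prim (\<eta> k) x) \<partial>lebesgue) = ennreal (k\<^sup>2)" .
      have "(\<integral>\<^sup>+x\<in>{0<..<1}. slope_energy k (dx_density \<mu> (x, k)) * ennreal (prim (\<eta> k) x) \<partial>lebesgue) =
          (\<integral>\<^sup>+x\<in>{0<..<1}. slope_energy k (a (x, k)) * ennreal (prim (\<eta> k) x) \<partial>lebesgue)"
        by (rule nn_integral_cong) (auto simp: a_def strip_def indicator_def)
      also have "\<dots> = (\<integral>\<^sup>+x. slope_energy k (a (x, k)) * ennreal (prim (\<eta> k) x) \<partial>U01)"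
        by (rule lebesgue_nn_integral_eq_U01) measurable
      also have "\<dots> = (\<integral>\<^sup>+x. slope_energy k (\<eta> k x / prim (\<eta> k) x) * ennreal (prim (\<eta> k) x) \<partial>U01)"
      proof (rule nn_integral_cong_AE)
        show "AE x in U01. slope_energy k (a (x, k)) * ennreal (prim (\<eta> k) x) =
            slope_energy k (\<eta> k x / prim (\<eta> k) x) * ennreal (prim (\<eta> k) x)"
          using elim(3)
        proof eventually_elim
          case (elim x)
          then show ?case by (cases "prim (\<eta> k) x = 0") simp_all
        qed
      qed
      also have "\<dots> = ennreal (k\<^sup>2)" using elim(1) by simp
      finally show ?case using L by simp
    qed
    have bv: "AE k in lam. prim (\<eta> k) \<in> BV01" using pf(6) by eventually_elim (rule prim_BV01)
    have "AE k in lam. 1 / 2 \<le> \<bar>k\<bar>"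
      using eqp unit pf(7) by eventually_elim (rule equipartition_imp_wavenumber_ge[OF h], auto)
    then have "AE k in lam. \<not> \<bar>k\<bar> < 1 / 2" by eventually_elim simp
    moreover have "{k. \<bar>k\<bar> < 1 / 2} \<in> sets lam" by (simp add: lam_def)
    ultimately have low: "emeasure lam {k. \<bar>k\<bar> < 1 / 2} = 0"
      by (subst (asm) AE_iff_measurable[of "{k. \<bar>k\<bar> < 1 / 2}"]) (auto simp: lam_def)
    note dis = sheet_is_disintegration[OF s em[folded lam_def] F[unfolded lam_def] fub[unfolded lam_def] unit[unfolded lam_def], folded lam_def]
    show ?case
      by (intro exI[of _ "1 / 2"] exI[of _ "\<lambda>k. prim (\<eta> k)"] conjI dis bv eq low) simp_all
  qed
qed

end
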